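(* Let $p$ be an odd prime and let $G$ be a group of order $p^5$ in the isoclinism family $\Phi_2$. For $\mu\in \mathrm{Irr}(Z(G)|G')$ let $\chi_\mu\in \mathrm{nl}(G)$ be the character with $\chi_\mu(g)=p\mu(g)$ for $g\in Z(G)$ and $\chi_\mu(g)=0$ otherwise. In every case below, $\psi_\mu$ denotes the linear character of $H$ with the indicated values on the indicated generators of $H$. (1) Let $G\in\Phi_2\setminus\{\Phi_2(32)a_2,\Phi_2(221)d\}$. The following list determines all inequivalent irreducible rational matrix representations of $G$ whose kernels do not contain $G'$: for each group $G$ it gives $Z(G)$, $G'$ and a required pair $(H,\psi_\mu)$ to construct an irreducible rational matrix representation of $G$ that affords the character $\Omega(\chi_\mu)$, where $\chi_\mu\in\mathrm{nl}(G)$. - $\Phi_2(311)a=\langle\alpha,\alpha_1,\alpha_2,\gamma:[\alpha_1,\alpha]=\alpha^{p^2}=\alpha_2,\ \alpha_1^p=\alpha_2^p=\gamma^p=1\rangle$; $Z(G)=\langle\alpha^p,\gamma\rangle$, $G'=\langle\alpha^{p^2}\rangle$; $H=\langle\alpha^p,\alpha_1,\gamma\rangle$; $\psi_\mu(\alpha^p)=\mu(\alpha^p)$, $\psi_\mu(\alpha_1)=1$, $\psi_\mu(\gamma)=\mu(\gamma)$. - $\Phi_2(221)a=\langle\alpha,\alpha_1,\alpha_2,\gamma:[\alpha_1,\alpha]=\alpha^p=\alpha_2,\ \alpha_1^{p^2}=\alpha_2^p=\gamma^p=1\rangle$; $Z(G)=\langle\alpha^p,\alpha_1^p,\gamma\rangle$,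 $G'=\langle\alpha^p\rangle$; $H=\langle\alpha^{-i}\alpha_1,\alpha^p,\gamma\rangle$ ($0\le i\le p-1$); $\psi_\mu(\alpha^{-i}\alpha_1)=1$, $\psi_\mu(\alpha^p)=\mu(\alpha^p)$, $\psi_\mu(\gamma)=\mu(\gamma)$. - $\Phi_2(221)b=\langle\alpha,\alpha_1,\alpha_2,\gamma:[\alpha_1,\alpha]=\alpha^p=\alpha_2,\ \alpha_1^p=\alpha_2^p=\gamma^{p^2}=1\rangle$; $Z(G)=\langle\alpha^p,\gamma\rangle$, $G'=\langle\alpha^p\rangle$; $H=\langle\alpha^p,\alpha_1,\gamma\rangle$; $\psi_\mu(\alpha^p)=\mu(\alpha^p)$, $\psi_\mu(\alpha_1)=1$, $\psi_\mu(\gamma)=\mu(\gamma)$. - $\Phi_2(2111)a=\langle\alpha,\alpha_1,\alpha_2,\gamma,\delta:[\alpha_1,\alpha]=\alpha^p=\alpha_2,\ \alpha_1^p=\alpha_2^p=\gamma^p=\delta^p=1\rangle$; $Z(G)=\langle\alpha^p,\gamma,\delta\rangle$, $G'=\langle\alpha^p\rangle$; $H=\langle\alpha^p,\alpha_1,\gamma,\delta\rangle$; $\psi_\mu(\alpha^p)=\mu(\alpha^p)$, $\psi_\mu(\alpha_1)=1$, $\psi_\mu(\gamma)=\mu(\gamma)$, $\psi_\mu(\delta)=\mu(\delta)$. - $\Phi_2(2111)b=\langle\alpha,\alpha_1,\alpha_2,\gamma,\delta:[\alpha_1,\alpha]=\gamma^p=\alpha_2,\ \alpha^p=\alpha_1^p=\alpha_2^p=\delta^p=1\rangle$;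 $Z(G)=\langle\gamma,\delta\rangle$, $G'=\langle\gamma^p\rangle$; $H=\langle\alpha,\gamma,\delta\rangle$; $\psi_\mu(\alpha)=1$, $\psi_\mu(\gamma)=\mu(\gamma)$, $\psi_\mu(\delta)=\mu(\delta)$. - $\Phi_2(2111)c=\langle\alpha,\alpha_1,\alpha_2,\gamma:[\alpha_1,\alpha]=\alpha_2,\ \alpha^{p^2}=\alpha_1^p=\alpha_2^p=\gamma^p=1\rangle$; $Z(G)=\langle\alpha^p,\alpha_2,\gamma\rangle$, $G'=\langle\alpha_2\rangle$; $H=\langle\alpha^p,\alpha_1,\alpha_2,\gamma\rangle$; $\psi_\mu(\alpha^p)=\mu(\alpha^p)$, $\psi_\mu(\alpha_1)=1$, $\psi_\mu(\alpha_2)=\mu(\alpha_2)$, $\psi_\mu(\gamma)=\mu(\gamma)$. - $\Phi_2(2111)d=\langle\alpha,\alpha_1,\alpha_2,\gamma:[\alpha_1,\alpha]=\alpha_2,\ \alpha^p=\alpha_1^p=\alpha_2^p=\gamma^{p^2}=1\rangle$; $Z(G)=\langle\alpha_2,\gamma\rangle$, $G'=\langle\alpha_2\rangle$; $H=\langle\alpha_1,\alpha_2,\gamma\rangle$; $\psi_\mu(\alpha_1)=1$, $\psi_\mu(\alpha_2)=\mu(\alpha_2)$, $\psi_\mu(\gamma)=\mu(\gamma)$. - $\Phi_2(1^5)=\langle\alpha,\alpha_1,\alpha_2,\gamma,\delta:[\alpha_1,\alpha]=\alpha_2,\ \alpha^p=\alpha_1^p=\alpha_2^p=\gamma^p=\delta^p=1\rangle$;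 $Z(G)=\langle\alpha_2,\gamma,\delta\rangle$, $G'=\langle\alpha_2\rangle$; $H=\langle\alpha_1,\alpha_2,\gamma,\delta\rangle$; $\psi_\mu(\alpha_1)=1$, $\psi_\mu(\alpha_2)=\mu(\alpha_2)$, $\psi_\mu(\gamma)=\mu(\gamma)$, $\psi_\mu(\delta)=\mu(\delta)$. - $\Phi_2(41)=\langle\alpha,\alpha_1,\alpha_2:[\alpha_1,\alpha]=\alpha^{p^3}=\alpha_2,\ \alpha_1^p=\alpha_2^p=1\rangle$; $Z(G)=\langle\alpha^p\rangle$, $G'=\langle\alpha^{p^3}\rangle$; $H=\langle\alpha^p,\alpha_1\rangle$; $\psi_\mu(\alpha^p)=\mu(\alpha^p)$, $\psi_\mu(\alpha_1)=1$. - $\Phi_2(32)a_1=\langle\alpha,\alpha_1,\alpha_2:[\alpha_1,\alpha]=\alpha^{p^2}=\alpha_2,\ \alpha_1^{p^2}=\alpha_2^p=1\rangle$; $Z(G)=\langle\alpha^p,\alpha_1^p\rangle$, $G'=\langle\alpha^{p^2}\rangle$; $H=\langle\alpha^p,\alpha_1\rangle$; $\psi_\mu(\alpha^p)=\mu(\alpha^p)$, $\psi_\mu(\alpha_1)=(\mu(\alpha_1^p))^{1/p}$. - $\Phi_2(311)b=\langle\alpha,\alpha_1,\alpha_2,\gamma:[\alpha_1,\alpha]=\gamma^{p^2}=\alpha_2,\ \alpha^p=\alpha_1^p=\alpha_2^p=1\rangle$; $Z(G)=\langle\gamma\rangle$, $G'=\langle\gamma^{p^2}\rangle$; $H=\langle\alpha,\gamma\rangle$;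 $\psi_\mu(\alpha)=1$, $\psi_\mu(\gamma)=\mu(\gamma)$. - $\Phi_2(311)c=\langle\alpha,\alpha_1,\alpha_2:[\alpha_1,\alpha]=\alpha_2,\ \alpha^{p^3}=\alpha_1^p=\alpha_2^p=1\rangle$; $Z(G)=\langle\alpha^p,\alpha_2\rangle$, $G'=\langle\alpha_2\rangle$; $H=\langle\alpha^p,\alpha_1,\alpha_2\rangle$; $\psi_\mu(\alpha^p)=\mu(\alpha^p)$, $\psi_\mu(\alpha_1)=1$, $\psi_\mu(\alpha_2)=\mu(\alpha_2)$. - $\Phi_2(221)c=\langle\alpha,\alpha_1,\alpha_2,\gamma:[\alpha_1,\alpha]=\gamma^p=\alpha_2,\ \alpha^{p^2}=\alpha_1^p=\alpha_2^p=1\rangle$; $Z(G)=\langle\alpha^p,\gamma\rangle$, $G'=\langle\gamma^p\rangle$; $H=\langle\alpha^p,\alpha_1,\gamma\rangle$; $\psi_\mu(\alpha^p)=\mu(\alpha^p)$, $\psi_\mu(\alpha_1)=1$, $\psi_\mu(\gamma)=\mu(\gamma)$. (2) For $G=\Phi_2(32)a_2=\langle\alpha,\alpha_1,\alpha_2:[\alpha_1,\alpha]=\alpha_1^p=\alpha_2,\ \alpha^{p^3}=\alpha_2^p=1\rangle$, we have $Z(G)=\langle\alpha^p,\alpha_1^p\rangle$ and $G'=\langle\alpha_1^p\rangle$. Suppose $\mu\in\mathrm{Irr}(Z(G)|G')$ is given by $\mu(\alpha_1^p)=\zeta_p$ and $\mu(\alpha^p)=\zeta_{p^2}^i$, where $0\le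 i\le p^2-1$. (a) If $\mu(\alpha^p)$ is a primitive $p^2$-th root of unity, then a required pair to construct an irreducible rational matrix representation of $G$ affording $\Omega(\chi_\mu)$ is $(H,\psi_\mu)$ with $H=\langle\alpha^p,\alpha_1\rangle$, $\psi_\mu(\alpha^p)=\mu(\alpha^p)$, $\psi_\mu(\alpha_1)=(\mu(\alpha_1^p))^{1/p}$. (b) If $\mu(\alpha^p)$ is not a primitive $p^2$-th root of unity, then $\mu$ can be defined by $\mu(\alpha_1^p)=\zeta_p$ and $\mu(\alpha^p)=\zeta_p^i$, where $0\le i\le p-1$. Hence a required pair to construct an irreducible rational matrix representation of $G$ affording $\Omega(\chi_\mu)$ is $(H,\psi_\mu)$ with $H=\langle\alpha\alpha_1^{-i},\alpha_1^p\rangle$, $\psi_\mu(\alpha\alpha_1^{-i})=1$, $\psi_\mu(\alpha_1^p)=\mu(\alpha_1^p)$. (3) For $G=\Phi_2(221)d=\langle\alpha,\alpha_1,\alpha_2:[\alpha_1,\alpha]=\alpha_2,\ \alpha^{p^2}=\alpha_1^{p^2}=\alpha_2^p=1\rangle$, we have $Z(G)=\langle\alpha^p,\alpha_1^p,\alpha_2\rangle$ and $G'=\langle\alpha_2\rangle$. Let $\mu\in\mathrm{Irr}(Z(G)|G')$. (a) If $\mu(\alpha_1^p)=1$, then a required pair to construct an irreducible rational matrix representation of $G$ affording $\Omega(\chi_\mu)$ is $(H,\psi_\mu)$ with $H=\langle\alpha^p,\alpha_1,\alpha_2\rangle$, $\psi_\mu(\alpha^p)=\mu(\alpha^p)$,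 $\psi_\mu(\alpha_1)=1$, $\psi_\mu(\alpha_2)=\mu(\alpha_2)$. (b) If $\mu(\alpha_1^p)\ne1$, then $\mu(\alpha^p)=(\mu(\alpha_1^p))^i$ for some $0\le i\le p-1$, and hence a required pair to construct an irreducible rational matrix representation of $G$ affording $\Omega(\chi_\mu)$ is $(H,\psi_\mu)$ with $H=\langle\alpha\alpha_1^{-i},\alpha_1^p,\alpha_2\rangle$, $\psi_\mu(\alpha\alpha_1^{-i})=1$, $\psi_\mu(\alpha_1^p)=\mu(\alpha_1^p)$, $\psi_\mu(\alpha_2)=\mu(\alpha_2)$.
   Context: For a finite group $G$: $\mathrm{Irr}(G)$ is the set of irreducible complex characters, $\mathrm{lin}(G)$ (resp. $\mathrm{nl}(G)$) the subset of linear (resp. non-linear) ones; for $N\trianglelefteq G$, $\mathrm{Irr}(G|N)=\{\chi\in\mathrm{Irr}(G): N\nsubseteq\ker\chi\}$; $Z(G)$ is the center and $G'$ the commutator subgroup; $\mathbb{Q}(\chi)$ is the field generated over $\mathbb{Q}$ by the values of $\chi$; $\psi^G$ denotes the induced character. $\Omega(\chi)=m_{\mathbb{Q}}(\chi)\sum_{\sigma\in\mathrm{Gal}(\mathbb{Q}(\chi)/\mathbb{Q})}\chi^\sigma$, where $m_{\mathbb{Q}}(\chi)$ is the Schur index over $\mathbb{Q}$; it is the character of an irreducible $\mathbb{Q}$-representation. Required pair: for a finite $p$-group $G$ ($p$ odd) and $\chi\in\mathrm{Irr}(G)$, a required pair to construct an irreducible rational matrix representation of $G$ affording $\Omega(\chi)$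 is a pair $(H,\psi)$ with $H\le G$, $\psi\in\mathrm{lin}(H)$, $\psi^G=\chi$ and $\mathbb{Q}(\psi)=\mathbb{Q}(\chi)$. Given such a pair, inducing to $G$ an irreducible $\mathbb{Q}$-representation of $H$ affording $\Omega(\psi)$ gives an irreducible $\mathbb{Q}$-representation of $G$ affording $\Omega(\chi)$. Two groups $G,H$ are isoclinic if there are isomorphisms $G/Z(G)\to H/Z(H)$ and $G'\to H'$ compatible with the commutator maps. $\Phi_2$ is the isoclinism family of the non-abelian groups of order $p^3$; its members of order $p^5$ (R. James' classification) are the 15 groups listed in the statement. For $G\in\Phi_2$ of order $p^5$, $|G'|=p$, $G'\subset Z(G)$, $|Z(G)|=p^3$, and the non-linear irreducible complex characters of $G$ are exactly the $\chi_\mu$, $\mu\in\mathrm{Irr}(Z(G)|G')$. Presentations are of groups of order $p^5$; $[x,y]=x^{-1}y^{-1}xy$; all relations $[x,y]=1$ between generators whose commutator is not listed are omitted. $\zeta_m$ is a primitive $m$-th root of unity; $z^{1/p}$ denotes a $p$-th root of the complex number $z$. *)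

theory Defs
  imports Complex_Main "HOL-Computational_Algebra.Primes" "HOL-Algebra.Generated_Groups"
    "Jordan_Normal_Form.Matrix"
begin

section \<open>Groups\<close>

definition center_of :: "('a, 'b) monoid_scheme \<Rightarrow> 'a set" where
  "center_of G = {z \<in> carrier G. \<forall>g \<in> carrier G. z \<otimes>\<^bsub>G\<^esub> g = g \<otimes>\<^bsub>G\<^esub> z}"

abbreviation commutator_subgroup :: "('a, 'b) monoid_scheme \<Rightarrow> 'a set" where
  "commutator_subgroup G \<equiv> derived G (carrier G)"

abbreviation subgrp :: "('a, 'b) monoid_scheme \<Rightarrow> 'a set \<Rightarrow> ('a, 'b) monoid_scheme" where
  "subgrp G H \<equiv> G\<lparr>carrier := H\<rparr>"

definition commutator :: "('a, 'b) monoid_scheme \<Rightarrow> 'a \<Rightarrow> 'a \<Rightarrow> 'a" where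
  "commutator G x y = inv\<^bsub>G\<^esub> x \<otimes>\<^bsub>G\<^esub> inv\<^bsub>G\<^esub> y \<otimes>\<^bsub>G\<^esub> x \<otimes>\<^bsub>G\<^esub> y"

definition isoclinic :: "('a, 'b) monoid_scheme \<Rightarrow> ('c, 'd) monoid_scheme \<Rightarrow> bool" where
  "isoclinic G H \<longleftrightarrow>
     (\<exists>\<theta> \<phi>. \<theta> \<in> iso (G Mod center_of G) (H Mod center_of H) \<and>
            \<phi> \<in> iso (subgrp G (commutator_subgroup G)) (subgrp H (commutator_subgroup H)) \<and>
            (\<forall>x \<in> carrier G. \<forall>y \<in> carrier G. \<forall>x' \<in> carrier H. \<forall>y' \<in> carrier H.
               \<theta> (center_of G #>\<^bsub>G\<^esub> x) = center_of H #>\<^bsub>H\<^esub> x' \<longrightarrow>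
               \<theta> (center_of G #>\<^bsub>G\<^esub> y) = center_of H #>\<^bsub>H\<^esub> y' \<longrightarrow>
               \<phi> (commutator G x y) = commutator H x' y'))"

text \<open>The isoclinism family of the non-abelian groups of order \<open>p\<^sup>3\<close>. Finite groups have
  isomorphic copies on \<open>nat\<close>, so nothing is lost by fixing that type.\<close>

definition in_Phi2 :: "nat \<Rightarrow> ('a, 'b) monoid_scheme \<Rightarrow> bool" where
  "in_Phi2 p G \<longleftrightarrow>
     (\<exists>E :: nat monoid. group E \<and> order E = p ^ 3 \<and> \<not> comm_group E \<and> isoclinic G E)"

subsection \<open>Presentations\<close>

datatype gword = One | Gen nat | Pow gword nat | Comm gword gword

primrec word_val :: "('a, 'b) monoid_scheme \<Rightarrow> 'a list \<Rightarrow> gword \<Rightarrow> 'a" where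
  "word_val G xs One = \<one>\<^bsub>G\<^esub>"
| "word_val G xs (Gen i) = xs ! i"
| "word_val G xs (Pow w n) = word_val G xs w [^]\<^bsub>G\<^esub> n"
| "word_val G xs (Comm u v) = commutator G (word_val G xs u) (word_val G xs v)"

text \<open>A relation is a list of words, read as a chain of equations \<open>w\<^sub>1 = w\<^sub>2 = \<dots> = w\<^sub>k\<close>.\<close>

definition satisfies_rels :: "('a, 'b) monoid_scheme \<Rightarrow> 'a list \<Rightarrow> gword list set \<Rightarrow> bool" where
  "satisfies_rels G xs R \<longleftrightarrow>
     (\<forall>c \<in> R. \<forall>u \<in> set c. \<forall>v \<in> set c. word_val G xs u = word_val G xs v)"

text \<open>The universal property is tested against groups on \<open>nat\<close> only; this suffices because the
  image of a homomorphism from a finitely generated group is countable.\<close>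

definition presented_by :: "('a, 'b) monoid_scheme \<Rightarrow> 'a list \<Rightarrow> gword list set \<Rightarrow> bool" where
  "presented_by G xs R \<longleftrightarrow>
     group G \<and> set xs \<subseteq> carrier G \<and> generate G (set xs) = carrier G \<and> satisfies_rels G xs R \<and>
     (\<forall>(K :: nat monoid) ys.
        group K \<and> length ys = length xs \<and> set ys \<subseteq> carrier K \<and> satisfies_rels K ys R \<longrightarrow>
        (\<exists>f \<in> hom G K. map f xs = ys))"

text \<open>Convention: commutators of two generators are trivial unless listed. In all presentations
  below the only listed commutator is that of the generators 0 and 1.\<close>

definition omitted_rels :: "nat \<Rightarrow> gword list set" where
  "omitted_rels n = {[Comm (Gen i) (Gen j), One] | i j. i < j \<and> j < n \<and> (i, j) \<noteq> (0, 1)}"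

definition Phi2_pres :: "('a, 'b) monoid_scheme \<Rightarrow> 'a list \<Rightarrow> gword list list \<Rightarrow> bool" where
  "Phi2_pres G xs R \<longleftrightarrow> presented_by G xs (set R \<union> omitted_rels (length xs))"

abbreviation (input) "wa \<equiv> Gen 0"    \<comment> \<open>\<open>\<alpha>\<close>\<close>
abbreviation (input) "wa1 \<equiv> Gen 1"   \<comment> \<open>\<open>\<alpha>\<^sub>1\<close>\<close>
abbreviation (input) "wa2 \<equiv> Gen 2"   \<comment> \<open>\<open>\<alpha>\<^sub>2\<close>\<close>
abbreviation (input) "wc \<equiv> Gen 3"    \<comment> \<open>\<open>\<gamma>\<close>\<close>
abbreviation (input) "wd \<equiv> Gen 4"    \<comment> \<open>\<open>\<delta>\<close>\<close>

definition rels_311a :: "nat \<Rightarrow> gword list list" where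
  "rels_311a p = [[Comm wa1 wa, Pow wa (p^2), wa2], [Pow wa1 p, Pow wa2 p, Pow wc p, One]]"

definition rels_221a :: "nat \<Rightarrow> gword list list" where
  "rels_221a p = [[Comm wa1 wa, Pow wa p, wa2], [Pow wa1 (p^2), Pow wa2 p, Pow wc p, One]]"

definition rels_221b :: "nat \<Rightarrow> gword list list" where
  "rels_221b p = [[Comm wa1 wa, Pow wa p, wa2], [Pow wa1 p, Pow wa2 p, Pow wc (p^2), One]]"

definition rels_2111a :: "nat \<Rightarrow> gword list list" where
  "rels_2111a p =
     [[Comm wa1 wa, Pow wa p, wa2], [Pow wa1 p, Pow wa2 p, Pow wc p, Pow wd p, One]]"

definition rels_2111b :: "nat \<Rightarrow> gword list list" where
  "rels_2111b p =
     [[Comm wa1 wa, Pow wc p, wa2], [Pow wa p, Pow wa1 p, Pow wa2 p, Pow wd p, One]]"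

definition rels_2111c :: "nat \<Rightarrow> gword list list" where
  "rels_2111c p =
     [[Comm wa1 wa, wa2], [Pow wa (p^2), Pow wa1 p, Pow wa2 p, Pow wc p, One]]"

definition rels_2111d :: "nat \<Rightarrow> gword list list" where
  "rels_2111d p =
     [[Comm wa1 wa, wa2], [Pow wa p, Pow wa1 p, Pow wa2 p, Pow wc (p^2), One]]"

definition rels_11111 :: "nat \<Rightarrow> gword list list" where
  "rels_11111 p =
     [[Comm wa1 wa, wa2], [Pow wa p, Pow wa1 p, Pow wa2 p, Pow wc p, Pow wd p, One]]"

definition rels_41 :: "nat \<Rightarrow> gword list list" where
  "rels_41 p = [[Comm wa1 wa, Pow wa (p^3), wa2], [Pow wa1 p, Pow wa2 p, One]]"

definition rels_32a1 :: "nat \<Rightarrow> gword list list" where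
  "rels_32a1 p = [[Comm wa1 wa, Pow wa (p^2), wa2], [Pow wa1 (p^2), Pow wa2 p, One]]"

definition rels_311b :: "nat \<Rightarrow> gword list list" where
  "rels_311b p = [[Comm wa1 wa, Pow wc (p^2), wa2], [Pow wa p, Pow wa1 p, Pow wa2 p, One]]"

definition rels_311c :: "nat \<Rightarrow> gword list list" where
  "rels_311c p = [[Comm wa1 wa, wa2], [Pow wa (p^3), Pow wa1 p, Pow wa2 p, One]]"

definition rels_221c :: "nat \<Rightarrow> gword list list" where
  "rels_221c p = [[Comm wa1 wa, Pow wc p, wa2], [Pow wa (p^2), Pow wa1 p, Pow wa2 p, One]]"

definition rels_32a2 :: "nat \<Rightarrow> gword list list" where
  "rels_32a2 p = [[Comm wa1 wa, Pow wa1 p, wa2], [Pow wa (p^3), Pow wa2 p, One]]"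

definition rels_221d :: "nat \<Rightarrow> gword list list" where
  "rels_221d p = [[Comm wa1 wa, wa2], [Pow wa (p^2), Pow wa1 (p^2), Pow wa2 p, One]]"

section \<open>Matrix representations over subfields of the complex numbers\<close>

definition complex_subfield :: "complex set \<Rightarrow> bool" where
  "complex_subfield K \<longleftrightarrow> 0 \<in> K \<and> 1 \<in> K \<and>
     (\<forall>x \<in> K. \<forall>y \<in> K. x + y \<in> K \<and> x * y \<in> K) \<and> (\<forall>x \<in> K. - x \<in> K \<and> inverse x \<in> K)"

definition mats_over :: "complex set \<Rightarrow> nat \<Rightarrow> complex mat set" where
  "mats_over K n = {A \<in> carrier_mat n n. \<forall>i < n. \<forall>j < n. A $$ (i, j) \<in> K}"

definition vecs_over :: "complex set \<Rightarrow> nat \<Rightarrow> complex vec set" where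
  "vecs_over K n = {v \<in> carrier_vec n. \<forall>i < n. v $ i \<in> K}"

definition matrix_rep ::
  "complex set \<Rightarrow> ('a, 'b) monoid_scheme \<Rightarrow> nat \<Rightarrow> ('a \<Rightarrow> complex mat) \<Rightarrow> bool" where
  "matrix_rep K G n \<rho> \<longleftrightarrow>
     (\<forall>g \<in> carrier G. \<rho> g \<in> mats_over K n) \<and> \<rho> \<one>\<^bsub>G\<^esub> = 1\<^sub>m n \<and>
     (\<forall>g \<in> carrier G. \<forall>h \<in> carrier G. \<rho> (g \<otimes>\<^bsub>G\<^esub> h) = \<rho> g * \<rho> h)"

definition invariant_subspace ::
  "complex set \<Rightarrow> ('a, 'b) monoid_scheme \<Rightarrow> nat \<Rightarrow> ('a \<Rightarrow> complex mat) \<Rightarrow> complex vec set \<Rightarrow> bool" where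
  "invariant_subspace K G n \<rho> W \<longleftrightarrow>
     W \<subseteq> vecs_over K n \<and> 0\<^sub>v n \<in> W \<and> (\<forall>v \<in> W. \<forall>w \<in> W. v + w \<in> W) \<and>
     (\<forall>c \<in> K. \<forall>v \<in> W. c \<cdot>\<^sub>v v \<in> W) \<and> (\<forall>g \<in> carrier G. \<forall>v \<in> W. \<rho> g *\<^sub>v v \<in> W)"

definition irreducible_rep ::
  "complex set \<Rightarrow> ('a, 'b) monoid_scheme \<Rightarrow> nat \<Rightarrow> ('a \<Rightarrow> complex mat) \<Rightarrow> bool" where
  "irreducible_rep K G n \<rho> \<longleftrightarrow> matrix_rep K G n \<rho> \<and> 0 < n \<and>
     (\<forall>W. invariant_subspace K G n \<rho> W \<longrightarrow> W = {0\<^sub>v n} \<or> W = vecs_over K n)"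

definition equivalent_reps ::
  "complex set \<Rightarrow> ('a, 'b) monoid_scheme \<Rightarrow> nat \<Rightarrow> ('a \<Rightarrow> complex mat)
     \<Rightarrow> nat \<Rightarrow> ('a \<Rightarrow> complex mat) \<Rightarrow> bool" where
  "equivalent_reps K G n \<rho> n' \<rho>' \<longleftrightarrow> n = n' \<and>
     (\<exists>T \<in> mats_over K n. \<exists>S \<in> mats_over K n. T * S = 1\<^sub>m n \<and> S * T = 1\<^sub>m n \<and>
        (\<forall>g \<in> carrier G. \<rho>' g = T * \<rho> g * S))"

definition rep_kernel :: "('a, 'b) monoid_scheme \<Rightarrow> nat \<Rightarrow> ('a \<Rightarrow> complex mat) \<Rightarrow> 'a set" where
  "rep_kernel G n \<rho> = {g \<in> carrier G. \<rho> g = 1\<^sub>m n}"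

text \<open>Characters, and class functions generally, are extended by 0 outside the carrier.\<close>

definition afforded_character ::
  "('a, 'b) monoid_scheme \<Rightarrow> nat \<Rightarrow> ('a \<Rightarrow> complex mat) \<Rightarrow> 'a \<Rightarrow> complex" where
  "afforded_character G n \<rho> = (\<lambda>g. if g \<in> carrier G then (\<Sum>i<n. \<rho> g $$ (i, i)) else 0)"

definition affords ::
  "('a, 'b) monoid_scheme \<Rightarrow> nat \<Rightarrow> ('a \<Rightarrow> complex mat) \<Rightarrow> ('a \<Rightarrow> complex) \<Rightarrow> bool" where
  "affords G n \<rho> \<chi> \<longleftrightarrow> afforded_character G n \<rho> = \<chi>"

section \<open>Characters\<close>

definition Irr :: "('a, 'b) monoid_scheme \<Rightarrow> ('a \<Rightarrow> complex) set" where
  "Irr G = {\<chi>. \<exists>n \<rho>. irreducible_rep UNIV G n \<rho> \<and> affords G n \<rho> \<chi>}"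

definition lin :: "('a, 'b) monoid_scheme \<Rightarrow> ('a \<Rightarrow> complex) set" where
  "lin G = {\<chi> \<in> Irr G. \<chi> \<one>\<^bsub>G\<^esub> = 1}"

definition nl :: "('a, 'b) monoid_scheme \<Rightarrow> ('a \<Rightarrow> complex) set" where
  "nl G = {\<chi> \<in> Irr G. \<chi> \<one>\<^bsub>G\<^esub> \<noteq> 1}"

definition char_kernel :: "('a, 'b) monoid_scheme \<Rightarrow> ('a \<Rightarrow> complex) \<Rightarrow> 'a set" where
  "char_kernel G \<chi> = {g \<in> carrier G. \<chi> g = \<chi> \<one>\<^bsub>G\<^esub>}"

definition Irr_over :: "('a, 'b) monoid_scheme \<Rightarrow> 'a set \<Rightarrow> ('a \<Rightarrow> complex) set" where
  "Irr_over G N = {\<chi> \<in> Irr G. \<not> N \<subseteq> char_kernel G \<chi>}"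

definition char_field :: "('a, 'b) monoid_scheme \<Rightarrow> ('a \<Rightarrow> complex) \<Rightarrow> complex set" where
  "char_field G \<chi> = complex_subfield hull (\<chi> ` carrier G)"

definition Gal_Q :: "complex set \<Rightarrow> (complex \<Rightarrow> complex) set" where
  "Gal_Q K = {\<sigma> \<in> extensional K. bij_betw \<sigma> K K \<and>
     (\<forall>x \<in> K. \<forall>y \<in> K. \<sigma> (x + y) = \<sigma> x + \<sigma> y \<and> \<sigma> (x * y) = \<sigma> x * \<sigma> y) \<and> (\<forall>x \<in> \<rat>. \<sigma> x = x)}"

text \<open>The Schur index of \<open>\<chi>\<close> over \<open>\<rat>\<close>: the least \<open>m \<ge> 1\<close> for which \<open>m \<chi>\<close> is afforded by a
  representation over \<open>\<rat>(\<chi>)\<close>.\<close>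

definition schur_index_Q :: "('a, 'b) monoid_scheme \<Rightarrow> ('a \<Rightarrow> complex) \<Rightarrow> nat" where
  "schur_index_Q G \<chi> = (LEAST m. 0 < m \<and>
     (\<exists>n \<rho>. matrix_rep (char_field G \<chi>) G n \<rho> \<and> affords G n \<rho> (\<lambda>g. of_nat m * \<chi> g)))"

definition Omega :: "('a, 'b) monoid_scheme \<Rightarrow> ('a \<Rightarrow> complex) \<Rightarrow> 'a \<Rightarrow> complex" where
  "Omega G \<chi> = (\<lambda>g. of_nat (schur_index_Q G \<chi>) * (\<Sum>\<sigma> \<in> Gal_Q (char_field G \<chi>). \<sigma> (\<chi> g)))"

definition induced_char ::
  "('a, 'b) monoid_scheme \<Rightarrow> 'a set \<Rightarrow> ('a \<Rightarrow> complex) \<Rightarrow> 'a \<Rightarrow> complex" where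
  "induced_char G H \<psi> = (\<lambda>g. if g \<in> carrier G
     then (\<Sum>x \<in> {x \<in> carrier G. inv\<^bsub>G\<^esub> x \<otimes>\<^bsub>G\<^esub> g \<otimes>\<^bsub>G\<^esub> x \<in> H}. \<psi> (inv\<^bsub>G\<^esub> x \<otimes>\<^bsub>G\<^esub> g \<otimes>\<^bsub>G\<^esub> x)) / of_nat (card H)
     else 0)"

definition required_pair ::
  "('a, 'b) monoid_scheme \<Rightarrow> ('a \<Rightarrow> complex) \<Rightarrow> 'a set \<Rightarrow> ('a \<Rightarrow> complex) \<Rightarrow> bool" where
  "required_pair G \<chi> H \<psi> \<longleftrightarrow>
     \<chi> \<in> Irr G \<and> subgroup H G \<and> \<psi> \<in> lin (subgrp G H) \<and> induced_char G H \<psi> = \<chi> \<and>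
     char_field (subgrp G H) \<psi> = char_field G \<chi>"

definition left_transversal :: "('a, 'b) monoid_scheme \<Rightarrow> 'a set \<Rightarrow> 'a list \<Rightarrow> bool" where
  "left_transversal G H ts \<longleftrightarrow> distinct ts \<and> set ts \<subseteq> carrier G \<and>
     (\<forall>g \<in> carrier G. \<exists>!t. t \<in> set ts \<and> inv\<^bsub>G\<^esub> t \<otimes>\<^bsub>G\<^esub> g \<in> H)"

text \<open>The induced matrix representation: a block matrix with \<open>d \<times> d\<close> blocks, whose block at
  \<open>(k, l)\<close> is \<open>\<sigma> (t\<^sub>k\<inverse> g t\<^sub>l)\<close>, read as 0 when the argument is outside \<open>H\<close>.\<close>

definition induced_rep :: "('a, 'b) monoid_scheme \<Rightarrow> 'a set \<Rightarrow> 'a list \<Rightarrow> nat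
    \<Rightarrow> ('a \<Rightarrow> complex mat) \<Rightarrow> 'a \<Rightarrow> complex mat" where
  "induced_rep G H ts d \<sigma> g = mat (length ts * d) (length ts * d)
     (\<lambda>(i, j). let h = inv\<^bsub>G\<^esub> (ts ! (i div d)) \<otimes>\<^bsub>G\<^esub> g \<otimes>\<^bsub>G\<^esub> (ts ! (j div d))
               in if h \<in> H then \<sigma> h $$ (i mod d, j mod d) else 0)"

definition primitive_root_of_unity :: "nat \<Rightarrow> complex \<Rightarrow> bool" where
  "primitive_root_of_unity m z \<longleftrightarrow> 0 < m \<and> z ^ m = 1 \<and> (\<forall>k. 0 < k \<and> k < m \<longrightarrow> z ^ k \<noteq> 1)"

section \<open>The required pairs of a group in the family\<close>

text \<open>\<open>Irr(Z(G)|G')\<close> and the characters \<open>\<chi>\<^sub>\<mu>\<close>\<close>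

definition central_chars :: "('a, 'b) monoid_scheme \<Rightarrow> ('a \<Rightarrow> complex) set" where
  "central_chars G = Irr_over (subgrp G (center_of G)) (commutator_subgroup G)"

definition chi_mu ::
  "nat \<Rightarrow> ('a, 'b) monoid_scheme \<Rightarrow> ('a \<Rightarrow> complex) \<Rightarrow> 'a \<Rightarrow> complex" where
  "chi_mu p G \<mu> = (\<lambda>g. if g \<in> center_of G then of_nat p * \<mu> g else 0)"

text \<open>A list \<open>v\<close> of pairs (group element, complex number) encodes a pair \<open>(H, \<psi>)\<close>: \<open>H\<close> is generated
  by the group elements, and \<open>\<psi>\<close> is the linear character of \<open>H\<close> taking the given values on them.\<close>

definition gen_subgroup :: "('a, 'b) monoid_scheme \<Rightarrow> ('a \<times> complex) list \<Rightarrow> 'a set" where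
  "gen_subgroup G v = generate G (fst ` set v)"

definition lin_with_values ::
  "('a, 'b) monoid_scheme \<Rightarrow> ('a \<times> complex) list \<Rightarrow> ('a \<Rightarrow> complex) \<Rightarrow> bool" where
  "lin_with_values G v \<psi> \<longleftrightarrow>
     \<psi> \<in> lin (subgrp G (gen_subgroup G v)) \<and> (\<forall>(h, z) \<in> set v. \<psi> h = z)"

definition gives_required_pair ::
  "nat \<Rightarrow> ('a, 'b) monoid_scheme \<Rightarrow> ('a \<Rightarrow> complex) \<Rightarrow> ('a \<times> complex) list \<Rightarrow> bool" where
  "gives_required_pair p G \<mu> v \<longleftrightarrow> chi_mu p G \<mu> \<in> nl G \<and> (\<exists>!\<psi>. lin_with_values G v \<psi>) \<and>
     (\<forall>\<psi>. lin_with_values G v \<psi> \<longrightarrow> required_pair G (chi_mu p G \<mu>) (gen_subgroup G v) \<psi>)"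

text \<open>\<open>\<rho>\<close>, of degree \<open>n\<close>, is induced from an irreducible rational representation of \<open>H\<close> affording
  \<open>\<Omega>(\<psi>)\<close>, where \<open>(H, \<psi>)\<close> is the pair encoded by \<open>v\<close>.\<close>

definition constructed_rep :: "('a, 'b) monoid_scheme \<Rightarrow> ('a \<times> complex) list
    \<Rightarrow> nat \<Rightarrow> ('a \<Rightarrow> complex mat) \<Rightarrow> bool" where
  "constructed_rep G v n \<rho> \<longleftrightarrow>
     (\<exists>\<psi> d \<sigma> ts. lin_with_values G v \<psi> \<and>
        irreducible_rep \<rat> (subgrp G (gen_subgroup G v)) d \<sigma> \<and>
        affords (subgrp G (gen_subgroup G v)) d \<sigma> (Omega (subgrp G (gen_subgroup G v)) \<psi>) \<and>
        left_transversal G (gen_subgroup G v) ts \<and>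
        n = length ts * d \<and> \<rho> = induced_rep G (gen_subgroup G v) ts d \<sigma>)"

text \<open>\<open>A \<mu>\<close> is the set of pairs (in the above encoding) listed for \<open>\<mu>\<close>; it has several elements when
  the list leaves a choice, such as that of a \<open>p\<close>-th root. The listed pairs are required pairs, the
  representations constructed from them are irreducible and afford \<open>\<Omega>(\<chi>\<^sub>\<mu>)\<close>, they exhaust the
  irreducible rational representations with kernel not containing \<open>G'\<close> up to equivalence, and the
  only coincidences up to equivalence are between Galois conjugate \<open>\<chi>\<^sub>\<mu>\<close>.\<close>

definition determines_rational_reps :: "nat \<Rightarrow> ('a, 'b) monoid_scheme
    \<Rightarrow> (('a \<Rightarrow> complex) \<Rightarrow> ('a \<times> complex) list set) \<Rightarrow> bool" where
  "determines_rational_reps p G A \<longleftrightarrow>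
     (\<forall>\<mu> \<in> central_chars G. A \<mu> \<noteq> {} \<and>
        (\<forall>v \<in> A \<mu>. gives_required_pair p G \<mu> v \<and>
           (\<exists>n \<rho>. constructed_rep G v n \<rho>) \<and>
           (\<forall>n \<rho>. constructed_rep G v n \<rho> \<longrightarrow>
              irreducible_rep \<rat> G n \<rho> \<and> affords G n \<rho> (Omega G (chi_mu p G \<mu>)) \<and>
              \<not> commutator_subgroup G \<subseteq> rep_kernel G n \<rho>))) \<and>
     (\<forall>n \<rho>. irreducible_rep \<rat> G n \<rho> \<and> \<not> commutator_subgroup G \<subseteq> rep_kernel G n \<rho> \<longrightarrow>
        (\<exists>\<mu> \<in> central_chars G. \<exists>v \<in> A \<mu>. \<exists>n' \<rho>'.
           constructed_rep G v n' \<rho>' \<and> equivalent_reps \<rat> G n \<rho> n' \<rho>')) \<and>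
     (\<forall>\<mu> \<in> central_chars G. \<forall>\<mu>' \<in> central_chars G. \<forall>v \<in> A \<mu>. \<forall>v' \<in> A \<mu>'. \<forall>n \<rho> n' \<rho>'.
        constructed_rep G v n \<rho> \<and> constructed_rep G v' n' \<rho>' \<longrightarrow>
        (equivalent_reps \<rat> G n \<rho> n' \<rho>' \<longleftrightarrow>
           (\<exists>\<sigma> \<in> Gal_Q (char_field G (chi_mu p G \<mu>)).
              chi_mu p G \<mu>' = (\<lambda>g. \<sigma> (chi_mu p G \<mu> g)))))"

end

theory Submission
  imports Defs "Berlekamp_Zassenhaus.Factor_Bound" "Jordan_Normal_Form.Spectral_Radius"
    "HOL-Algebra.Multiplicative_Group"
begin

text \<open>Let \<open>\<mu>\<close> be a central character that is nontrivial on \<open>G'\<close>, let \<open>u\<close> be a non-central element with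
  \<open>\<mu>(u\<^sup>p) = 1\<close>, and let \<open>H\<close> be the centralizer of \<open>u\<close>. Since \<open>G'\<close> is central of order \<open>p\<close> and \<open>Z(G)\<close> has
  index at most \<open>p\<^sup>2\<close>, the group \<open>H\<close> is the abelian group \<open>\<langle>u\<rangle>Z(G)\<close> of index \<open>p\<close>, and \<open>\<mu>\<close> extends to the
  character \<open>\<psi>\<close> of \<open>H\<close> with \<open>\<psi>(u) = 1\<close>, which has the same values as \<open>\<mu>\<close> and induces \<open>\<chi>\<^sub>\<mu>\<close>. Every listed pair
  is of this form, with a generator \<open>h = uz\<close> for some central \<open>z\<close>.

  The rational representation of \<open>H\<close> affording \<open>\<Omega>(\<psi>)\<close> acts by multiplication on a cyclotomic field of prime
  power order, so it is irreducible because the cyclotomic polynomial is. An invariant subspace of the representation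
  induced to \<open>G\<close> is cut into its blocks by averaging over the conjugates of \<open>u\<close>, which gives
  irreducibility. Conversely, a central element acts on an irreducible rational representation \<open>\<rho>\<close> either
  trivially or with vanishing averages. Hence \<open>Z(G)\<close> acts through a cyclic group, that is, with the same kernel as
  some \<open>\<mu>\<close>; if this kernel does not contain \<open>G'\<close>, then \<open>u\<close> has a fixed vector,
  whose translates give a nonzero homomorphism from the induced representation to \<open>\<rho>\<close>. So \<open>\<rho>\<close>
  is determined by the kernel of \<open>\<mu>\<close>, which determines \<open>\<mu>\<close> up to Galois conjugacy.\<close>

text \<open>The obstacle is that no matrices are at hand: \<open>\<sigma>\<close> is any rational
  representation affording \<open>\<Omega>(\<psi>)\<close>, and \<open>\<rho>\<close> is any
  irreducible one. One principle stands in for them: if \<open>x\<close> is central and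
  \<open>\<rho> x\<close> is not the identity, the sum of \<open>\<rho> (x ^ j)\<close> over a
  period vanishes, since its image is an invariant subspace on which \<open>x\<close> acts
  trivially. It serves four times: to read kernels off characters, to show that \<open>Z(G)\<close>
  acts through a cyclic group, to produce a fixed vector of \<open>u\<close>, and to cut out blocks.
  Passing from the listed generator \<open>h\<close> to \<open>u\<close> with \<psi>(u) = 1 makes
  the cases uniform: a prescribed p-th root turns out to be a value of \<mu>, so a central factor
  removes it. The condition on \<open>u ^ p\<close> is exactly what makes \<open>u ^ i z\<close> |->
  \<mu>(z) well defined, and no new values arise, so the character fields agree. Both \<psi> and its
  induced character are realised over the cyclotomic field, so the Schur indices are 1 and \<Omega>
  is a plain Galois sum. Oddness of \<open>p\<close> enters through (xy)^p = x^p y^p, which lets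
  mixed generators such as \<alpha> times a power of the inverse of \<open>\<alpha>\<^sub>1\<close>
  have a p-th power in the kernel of \<mu>.\<close>

hide_const (open) Polynomial.order

section \<open>The cyclotomic polynomial of prime power order\<close>

text \<open>If \<open>f = g * h\<close> with \<open>P\<close> dividing the constant term of
  \<open>h\<close>, then \<open>P\<close> does not divide that of \<open>g\<close>, by the condition
  on \<open>P ^ 2\<close>. At the first coefficient of \<open>h\<close> prime to \<open>P\<close>
  the coefficient of \<open>f\<close> is prime to \<open>P\<close> too, so this index is already
  \<open>degree f\<close>. The conclusion speaks of degrees only and thus ignores constant
  factors.\<close>

lemma eisenstein:
  fixes f :: "int poly" and P :: int
  assumes P: "prime P" and deg: "degree f > 0"
    and low: "\<And>i. i < degree f \<Longrightarrow> P dvd coeff f i"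
    and lead: "\<not> P dvd coeff f (degree f)" and c0: "\<not> P ^ 2 dvd coeff f 0"
  shows "irreducible\<^sub>d f"
proof -
  have key: "degree h = degree f"
    if f: "f = g * h" and dh: "P dvd coeff h 0" for g h
  proof -
    have f0: "f \<noteq> 0" using deg by auto
    have g0: "\<not> P dvd coeff g 0"
    proof
      assume "P dvd coeff g 0"
      hence "P * P dvd coeff g 0 * coeff h 0" using dh by (rule mult_dvd_mono)
      thus False using c0 by (simp add: f coeff_mult power2_eq_square)
    qed
    have "\<exists>i. \<not> P dvd coeff h i"
    proof (rule ccontr)
      assume "\<not> ?thesis"
      hence "\<And>n. P dvd coeff f n" unfolding f coeff_mult by (auto intro!: dvd_sum)
      thus False using lead by auto
    qed
    then obtain i where i: "\<not> P dvd coeff h i" "\<And>j. j < i \<Longrightarrow> P dvd coeff h j"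
      using exists_least_iff[of "\<lambda>i. \<not> P dvd coeff h i"] by auto
    have "\<not> P dvd coeff f i"
    proof
      assume *: "P dvd coeff f i"
      have "coeff f i = (\<Sum>j\<le>i. coeff h j * coeff g (i - j))"
        unfolding f by (subst mult.commute, rule coeff_mult)
      also have "\<dots> = coeff h i * coeff g 0 + (\<Sum>j<i. coeff h j * coeff g (i - j))"
        by (simp add: lessThan_Suc_atMost[symmetric])
      finally have e: "coeff h i * coeff g 0 = coeff f i - (\<Sum>j<i. coeff h j * coeff g (i - j))"
        by simp
      have "P dvd (\<Sum>j<i. coeff h j * coeff g (i - j))" using i(2) by (intro dvd_sum) auto
      hence "P dvd coeff h i * coeff g 0" unfolding e using * by (rule dvd_diff[rotated])
      thus False using i(1) g0 P by (simp add: prime_dvd_mult_iff)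
    qed
    hence "i \<ge> degree f" using low by (meson not_le)
    moreover have "i \<le> degree h" using i(1) by (metis dvd_0_right le_degree)
    moreover have "degree f = degree g + degree h" using f0 f by (metis degree_mult_eq mult_eq_0_iff)
    ultimately show ?thesis by simp
  qed
  show ?thesis
  proof (rule irreducible\<^sub>dI)
    show "degree f > 0" by fact
    fix q r assume d: "degree q < degree f" "degree r < degree f" and f: "f = q * r"
    have "P dvd coeff f 0" using low deg by simp
    hence "P dvd coeff q 0 * coeff r 0" by (simp add: f coeff_mult)
    hence "P dvd coeff q 0 \<or> P dvd coeff r 0" using P by (simp add: prime_dvd_mult_iff)
    thus False using key[of q r] key[of r q] f d by (auto simp: mult.commute)
  qed
qed

text \<open>For \<open>q = p ^ k\<close> this is the cyclotomic polynomial of order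
  \<open>p ^ (k + 1)\<close>. The coefficient ring is left open because irreducibility is proved
  over the integers and used over the rationals.\<close>

definition cyc_poly :: "nat \<Rightarrow> nat \<Rightarrow> 'a :: comm_ring_1 poly" where
  "cyc_poly p q = (\<Sum>j<p. monom 1 (q * j))"

lemma poly_cyc_poly: "poly (cyc_poly p q) x = (\<Sum>j<p. x ^ (q * j))"
  by (simp add: cyc_poly_def poly_sum poly_monom)

text \<open>Multiplication by a binomial yields a binomial, so the degree and the behaviour under a
  shift of the variable can be found without handling coefficients.\<close>

lemma cyc_poly_geometric:
  "(monom 1 q - 1) * cyc_poly p q = (monom 1 (p * q) - 1 :: 'a :: comm_ring_1 poly)"
proof -
  have "(monom 1 q - 1) * cyc_poly p q = (monom 1 q - 1 :: 'a poly) * (\<Sum>j<p. monom 1 q ^ j)"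
    by (simp add: cyc_poly_def monom_power mult.commute)
  also have "\<dots> = monom 1 q ^ p - 1"
    by (rule power_diff_1_eq[symmetric])
  also have "\<dots> = monom 1 (p * q) - 1"
    by (simp only: monom_power power_one mult.commute)
  finally show ?thesis .
qed

lemma degree_cyc_poly:
  assumes "p > 0" "q > 0"
  shows "degree (cyc_poly p q :: 'a :: idom poly) = (p - 1) * q"
proof -
  have d: "degree (monom 1 n - 1 :: 'a poly) = n" if "n > 0" for n
  proof -
    have "degree (monom 1 n + (- 1) :: 'a poly) = degree (monom 1 n :: 'a poly)"
      by (rule degree_add_eq_left) (use that in \<open>simp add: degree_monom_eq\<close>)
    thus ?thesis by (simp add: degree_monom_eq)
  qed
  have nz: "(monom 1 n - 1 :: 'a poly) \<noteq> 0" if "n > 0" for n using d[OF that] that by auto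
  have "cyc_poly p q \<noteq> (0 :: 'a poly)"
    using cyc_poly_geometric[of q p, where ?'a = 'a] nz[of "p * q"] assms by auto
  hence "degree ((monom 1 q - 1) * cyc_poly p q :: 'a poly) = q + degree (cyc_poly p q :: 'a poly)"
    using nz[OF assms(2)] d[OF assms(2)] by (simp add: degree_mult_eq)
  also have "degree ((monom 1 q - 1) * cyc_poly p q :: 'a poly) = p * q"
    unfolding cyc_poly_geometric using assms by (intro d) simp
  finally show ?thesis by (simp add: algebra_simps)
qed

text \<open>Iterated Frobenius: the inner binomial coefficients of a prime exponent are divisible by
  \<open>p\<close>. Divisibility by a constant polynomial expresses congruence modulo
  \<open>p\<close> without leaving the integer polynomials.\<close>

lemma frobenius_shift:
  assumes p: "prime (p :: nat)"
  shows "[:int p:] dvd [:1, 1:] ^ (p ^ k) - (monom 1 (p ^ k) + 1)"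
proof (induction k)
  case 0
  have "[:1, 1:] = (monom 1 1 + 1 :: int poly)"
    by (rule poly_eqI) (auto simp: coeff_pCons split: nat.splits)
  then show ?case by simp
next
  case (Suc k)
  define Y where "Y = ([:1, 1:] :: int poly) ^ (p ^ k)"
  define X where "X = (monom 1 (p ^ k) :: int poly)"
  have pp: "p > 0" using p prime_gt_0_nat by blast
  have 1: "[:int p:] dvd Y ^ p - (X + 1) ^ p"
  proof -
    have "Y - (X + 1) dvd Y ^ p - (X + 1) ^ p" by (simp add: power_diff_sumr2)
    thus ?thesis using Suc.IH by (auto simp: X_def Y_def intro: dvd_trans)
  qed
  have 2: "[:int p:] dvd (X + 1) ^ p - (X ^ p + 1)"
  proof -
    obtain r where r: "p = Suc r" using pp by (cases p) auto
    have "(X + 1) ^ p = (\<Sum>j\<le>p. of_nat (p choose j) * X ^ j)"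
      by (simp add: binomial_ring)
    also have "\<dots> = (\<Sum>j<p. of_nat (p choose j) * X ^ j) + X ^ p"
      by (simp add: lessThan_Suc_atMost[symmetric])
    also have "(\<Sum>j<p. of_nat (p choose j) * X ^ j)
        = 1 + (\<Sum>j<r. of_nat (p choose Suc j) * X ^ Suc j)"
      unfolding r by (subst sum.lessThan_Suc_shift) simp
    finally have e: "(X + 1) ^ p - (X ^ p + 1) = (\<Sum>j<r. of_nat (p choose Suc j) * X ^ Suc j)"
      by simp
    show ?thesis unfolding e
    proof (intro dvd_sum dvd_mult2)
      fix j assume "j \<in> {..<r}"
      hence "p dvd (p choose Suc j)" using p r by (intro dvd_choose_prime) auto
      then obtain c where "p choose Suc j = p * c" by (elim dvdE)
      hence "(of_nat (p choose Suc j) :: int poly) = [:int p:] * [:int c:]"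
        by (simp add: of_nat_poly)
      thus "[:int p:] dvd of_nat (p choose Suc j)" by simp
    qed
  qed
  have "[:1, 1:] ^ (p ^ Suc k) - (monom 1 (p ^ Suc k) + 1) = (Y ^ p - (X + 1) ^ p) + ((X + 1) ^ p - (X ^ p + 1))"
    by (simp add: X_def Y_def monom_power power_mult[symmetric] mult.commute)
  thus ?case using dvd_add[OF 1 2] by metis
qed

text \<open>The coefficients are 0 and 1, so Eisenstein does not apply directly; it applies after
  replacing X by X + 1.\<close>

lemma irreducible_d_cyc_poly_int:
  assumes p: "prime p"
  shows "irreducible\<^sub>d (cyc_poly p (p ^ k) :: int poly)"
proof -
  define q where "q = p ^ k"
  define F where "F = (cyc_poly p q :: int poly)"
  define s where "s = ([:1, 1:] :: int poly)"
  define S where "S = F \<circ>\<^sub>p s"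
  have pp: "p > 1" using p prime_gt_1_nat by blast
  have q0: "q > 0" using pp by (simp add: q_def)
  have ds: "degree s = 1" by (simp add: s_def)
  have dF: "degree F = (p - 1) * q" unfolding F_def using pp q0 by (intro degree_cyc_poly) auto
  have dS: "degree S = (p - 1) * q" by (simp add: S_def degree_pcompose dF ds)
  have comp: "monom 1 n \<circ>\<^sub>p s = s ^ n" for n
    by (induction n) (simp_all add: monom_Suc pcompose_pCons pcompose_1 del: pcompose_hom.hom_mult)
  have "(s ^ q - 1) * S = s ^ (p * q) - 1"
    using arg_cong[OF cyc_poly_geometric[of q p, where ?'a = int], of "\<lambda>f. f \<circ>\<^sub>p s"]
    by (simp add: pcompose_mult pcompose_diff comp S_def F_def pcompose_1)
  moreover obtain a where a: "s ^ q - (monom 1 q + 1) = [:int p:] * a"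
    using frobenius_shift[OF p, of k] unfolding q_def s_def by (elim dvdE)
  moreover obtain b where b: "s ^ (p * q) - (monom 1 (p * q) + 1) = [:int p:] * b"
    using frobenius_shift[OF p, of "Suc k"] unfolding q_def s_def power_Suc by (elim dvdE)
  ultimately have "(monom 1 q + [:int p:] * a) * S = monom 1 (p * q) + [:int p:] * b"
    by (metis (no_types, lifting) add.commute add_diff_cancel_left' diff_add_cancel diff_diff_eq2 add_diff_eq)
  \<comment> \<open>Modulo \<open>p\<close> the shifted polynomial \<open>S\<close> times X^q is
    X^(pq), so \<open>S\<close> is congruent to a single monomial of degree (p - 1) q.\<close>
  hence E: "monom 1 q * S = monom 1 (p * q) + [:int p:] * (b - a * S)"
    by (simp add: algebra_simps)
  have cS: "int p dvd coeff S i - (if i + q = p * q then 1 else 0)" for i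
  proof -
    have "coeff S i = coeff (monom 1 q * S) (i + q)" by (simp add: coeff_monom_mult)
    also have "\<dots> = (if i + q = p * q then 1 else 0) + int p * coeff (b - a * S) (i + q)"
      unfolding E by (simp add: eq_commute)
    finally have "coeff S i = (if i + q = p * q then 1 else 0) + int p * coeff (b - a * S) (i + q)" .
    thus ?thesis by (metis add_diff_cancel_left' dvd_triv_left)
  qed
  have Pp: "prime (int p)" using p by simp
  have pq: "(p - 1) * q + q = p * q" using pp by (simp add: algebra_simps)
  have "irreducible\<^sub>d S"
  proof (rule eisenstein[OF Pp])
    show "degree S > 0" using dS pp q0 by simp
    fix i assume "i < degree S"
    hence "i + q \<noteq> p * q" using pq unfolding dS by linarith
    thus "int p dvd coeff S i" using cS[of i] by simp
  next
    show "\<not> int p dvd coeff S (degree S)"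
    proof
      assume "int p dvd coeff S (degree S)"
      moreover have "int p dvd coeff S (degree S) - 1"
        using cS[of "degree S"] pq by (simp add: dS)
      ultimately have "int p dvd coeff S (degree S) - (coeff S (degree S) - 1)"
        by (rule dvd_diff)
      thus False using pp by simp
    qed
  next
    \<comment> \<open>The constant term after the shift is the value at 1, where each of the
      \<open>p\<close> summands is 1.\<close>
    have "coeff S 0 = poly F 1" by (simp add: S_def s_def pcompose_coeff_0 poly_0_coeff_0[symmetric] poly_pcompose)
    also have "\<dots> = int p" by (simp add: F_def poly_cyc_poly)
    finally have c: "coeff S 0 = int p" .
    show "\<not> (int p)\<^sup>2 dvd coeff S 0"
    proof
      assume "(int p)\<^sup>2 dvd coeff S 0"
      hence "p * p dvd p" by (simp add: c power2_eq_square flip: of_nat_mult)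
      thus False using pp by (auto dest: dvd_imp_le)
    qed
  qed
  \<comment> \<open>The shift is multiplicative and preserves degrees, so a factorisation of
    \<open>F\<close> would give one of \<open>S\<close>.\<close>
  hence "irreducible\<^sub>d F"
    unfolding irreducible\<^sub>d_def S_def degree_pcompose ds mult_1_right
    by (metis (no_types, lifting) degree_pcompose ds mult_1_right pcompose_mult)
  thus ?thesis by (simp add: F_def q_def)
qed

text \<open>Gauss's lemma carries irreducibility to the rationals, where it yields Bezout
  relations.\<close>

lemma irreducible_cyc_poly:
  assumes p: "prime p"
  shows "irreducible (cyc_poly p (p ^ k) :: rat poly)"
proof -
  have "map_poly rat_of_int (cyc_poly p (p ^ k)) = cyc_poly p (p ^ k)"
    by (intro poly_eqI) (simp add: cyc_poly_def coeff_sum coeff_map_poly if_distrib[of rat_of_int] cong: if_cong)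
  thus ?thesis using irreducible\<^sub>d_int_rat[OF irreducible_d_cyc_poly_int[OF p, of k]] by simp
qed

section \<open>The field generated by a root of unity of prime power order\<close>

interpretation of_rat_poly: map_poly_comm_ring_hom "of_rat :: rat \<Rightarrow> complex" ..

definition evq :: "rat poly \<Rightarrow> complex \<Rightarrow> complex" where
  "evq f x = poly (map_poly of_rat f) x"

lemma evq_simps [simp]:
  "evq (f + g) x = evq f x + evq g x" "evq (f * g) x = evq f x * evq g x"
  "evq (f - g) x = evq f x - evq g x" "evq (- f) x = - evq f x"
  "evq 0 x = 0" "evq 1 x = 1" "evq (monom c n) x = of_rat c * x ^ n"
  by (simp_all add: evq_def of_rat_poly.hom_add of_rat_poly.hom_mult of_rat_poly.hom_minus
      of_rat_poly.hom_uminus map_poly_monom poly_monom)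

lemma evq_sum [simp]: "evq (\<Sum>i\<in>I. f i) x = (\<Sum>i\<in>I. evq (f i) x)"
  by (induction I rule: infinite_finite_induct) auto

lemma evq_as_sum: "evq f x = (\<Sum>i\<le>degree f. of_rat (coeff f i) * x ^ i)"
  by (simp add: evq_def poly_altdef)

lemma evq_cyc_poly: "evq (cyc_poly p q) x = (\<Sum>j<p. x ^ (q * j))"
  by (simp add: cyc_poly_def)

lemma power_eq_1_gcd:
  fixes x :: "'a :: idom"
  assumes "x ^ a = 1" "x ^ b = 1" "a \<noteq> 0"
  shows "x ^ gcd a b = 1"
proof -
  obtain u v where uv: "a * u = b * v + gcd a b" using bezout_nat[OF assms(3)] by blast
  have "x ^ (a * u) = 1" "x ^ (b * v) = 1" by (simp_all add: power_mult assms)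
  thus ?thesis unfolding uv power_add by simp
qed

lemma geometric_sum_zero:
  fixes x :: "'a :: idom"
  assumes "x ^ n = 1" "x \<noteq> 1"
  shows "(\<Sum>j<n. x ^ j) = 0"
  using power_diff_1_eq[of x n] assms by auto

lemma subfield_Rats:
  assumes K: "complex_subfield K"
  shows "\<rat> \<subseteq> K"
proof
  fix x :: complex assume "x \<in> \<rat>"
  then obtain a b :: int where x: "x = of_int a / of_int b" by (elim Rats_cases') auto
  have n: "of_nat n \<in> K" for n using K by (induction n) (auto simp: complex_subfield_def)
  have z: "of_int i \<in> K" for i
  proof (cases "i \<ge> 0")
    case True
    thus ?thesis using n[of "nat i"] by simp
  next
    case False
    hence "- of_nat (nat (- i)) = (of_int i :: complex)" by simp
    moreover have "- of_nat (nat (- i)) \<in> K" using n K by (auto simp: complex_subfield_def)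
    ultimately show ?thesis by simp
  qed
  show "x \<in> K" using z[of a] z[of b] K unfolding x divide_inverse complex_subfield_def by blast
qed

lemma subfield_closed:
  assumes K: "complex_subfield K"
  shows "0 \<in> K" "1 \<in> K" "x \<in> K \<Longrightarrow> y \<in> K \<Longrightarrow> x + y \<in> K" "x \<in> K \<Longrightarrow> y \<in> K \<Longrightarrow> x * y \<in> K"
    "x \<in> K \<Longrightarrow> - x \<in> K" "x \<in> K \<Longrightarrow> inverse x \<in> K" "x \<in> K \<Longrightarrow> x ^ n \<in> K"
    "(\<And>i. i \<in> I \<Longrightarrow> f i \<in> K) \<Longrightarrow> sum f I \<in> K"
proof -
  show "x \<in> K \<Longrightarrow> x ^ n \<in> K" using K by (induction n) (auto simp: complex_subfield_def)
  show "(\<And>i. i \<in> I \<Longrightarrow> f i \<in> K) \<Longrightarrow> sum f I \<in> K"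
    using K by (induction I rule: infinite_finite_induct) (auto simp: complex_subfield_def)
qed (use K in \<open>auto simp: complex_subfield_def\<close>)

lemma complex_subfield_Rats: "complex_subfield \<rat>"
  by (auto simp: complex_subfield_def)

lemma complex_subfield_UNIV: "complex_subfield UNIV"
  by (auto simp: complex_subfield_def)

section \<open>Roots of unity of order p^(k+1) and the Galois group of the field they
  generate\<close>

locale prime_power =
  fixes p q k :: nat
  assumes prime_p: "prime p" and q_def: "q = p ^ k"
begin

text \<open>\<open>m\<close> is p^(k+1) and \<open>d\<close> is Euler's totient of \<open>m\<close>,
  the degree of the cyclotomic field. The order of a central character that is nontrivial on
  \<open>G'\<close> is a nontrivial power of \<open>p\<close>, so it has this form.\<close>

abbreviation "m \<equiv> p * q"
abbreviation "d \<equiv> (p - 1) * q"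

text \<open>These are the primitive \<open>m\<close>-th roots of unity: every proper divisor of the
  prime power \<open>m\<close> divides \<open>q\<close>, so a single exponent has to be
  tested.\<close>

definition proot :: "complex \<Rightarrow> bool" where
  "proot x \<longleftrightarrow> x ^ m = 1 \<and> x ^ q \<noteq> 1"

lemma p_gt1: "p > 1" using prime_p prime_gt_1_nat by blast
lemma q_pos: "q > 0" using p_gt1 by (simp add: q_def)
lemma m_pos: "m > 0" using p_gt1 q_pos by simp
lemma d_pos: "d > 0" using p_gt1 q_pos by simp
lemma m_eq: "m = d + q" using p_gt1 by (simp add: algebra_simps)

lemma proot_cyc: assumes "proot x" shows "(\<Sum>j<p. x ^ (q * j)) = 0"
  using geometric_sum_zero[of "x ^ q" p] assms by (simp add: proot_def power_mult[symmetric] mult.commute)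

lemma proot_nonzero: "proot x \<Longrightarrow> x \<noteq> 0"
  using m_pos by (auto simp: proot_def zero_power)

text \<open>The gcd of \<open>m\<close> and \<open>j\<close> is a power of \<open>p\<close>; if it
  were smaller than \<open>m\<close> it would divide \<open>q\<close> and force
  \<open>x ^ q = 1\<close>.\<close>

lemma proot_power_eq_1:
  assumes "proot x"
  shows "x ^ j = 1 \<longleftrightarrow> m dvd j"
proof
  assume j: "x ^ j = 1"
  have g: "x ^ gcd m j = 1" using assms j m_pos by (intro power_eq_1_gcd) (auto simp: proot_def)
  have "gcd m j dvd p ^ Suc k" by (simp add: q_def)
  then obtain i where i: "i \<le> Suc k" "gcd m j = p ^ i"
    using prime_p divides_primepow_nat by blast
  have "i = Suc k"
  proof (rule ccontr)
    assume "i \<noteq> Suc k"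
    hence "p ^ i dvd q" using i by (simp add: q_def le_imp_power_dvd)
    then obtain c where "q = p ^ i * c" by (elim dvdE)
    hence "x ^ q = 1" using g i by (simp add: power_mult)
    thus False using assms by (simp add: proot_def)
  qed
  hence "gcd m j = m" using i by (simp add: q_def)
  thus "m dvd j" by (metis gcd_dvd2)
next
  assume "m dvd j"
  thus "x ^ j = 1" using assms by (auto simp: proot_def power_mult elim!: dvdE)
qed

lemma proot_power_mod: "proot x \<Longrightarrow> x ^ (n mod m) = x ^ n"
proof -
  assume x: "proot x"
  have "x ^ n = x ^ (m * (n div m) + n mod m)" by (simp only: mult_div_mod_eq)
  also have "\<dots> = (x ^ m) ^ (n div m) * x ^ (n mod m)" by (simp only: power_add power_mult)
  also have "\<dots> = x ^ (n mod m)" using x by (simp only: proot_def power_one mult_1_left)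
  finally show ?thesis by simp
qed

lemma proot_power:
  assumes x: "proot x" and a: "\<not> p dvd a"
  shows "proot (x ^ a)"
proof -
  have "\<not> m dvd a * q"
  proof
    assume "m dvd a * q"
    hence "p dvd a" using q_pos by (simp add: dvd_mult_cancel2 mult.commute)
    thus False using a by simp
  qed
  hence "x ^ (a * q) \<noteq> 1" using proot_power_eq_1[OF x] by simp
  moreover have "x ^ (a * m) = 1" using proot_power_eq_1[OF x] by simp
  ultimately show ?thesis by (simp add: proot_def power_mult[symmetric])
qed

lemma proot_power_inj:
  assumes x: "proot x" and "a < m" "b < m" "x ^ a = x ^ b"
  shows "a = b"
proof -
  have *: "a = b" if "a < m" "b < m" "x ^ a = x ^ b" "a \<le> b" for a b
  proof -
    have "x ^ a * x ^ (b - a) = x ^ a"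
      using that(3,4) by (metis power_add le_add_diff_inverse)
    hence "x ^ (b - a) = 1" using proot_nonzero[OF x] by simp
    hence "m dvd b - a" using proot_power_eq_1[OF x] by simp
    thus ?thesis using that m_pos by (auto dest!: dvd_imp_le)
  qed
  show ?thesis using *[of a b] *[of b a] assms by (cases "a \<le> b") auto
qed

text \<open>Counting: the \<open>m\<close> distinct powers of \<open>x\<close> fill the set of
  \<open>m\<close>-th roots of unity.\<close>

lemma root_is_power:
  assumes x: "proot x" and y: "y ^ m = 1"
  shows "\<exists>j<m. y = x ^ j"
proof -
  have "inj_on (\<lambda>j. x ^ j) {..<m}" using proot_power_inj[OF x] by (auto intro!: inj_onI)
  hence "card ((\<lambda>j. x ^ j) ` {..<m}) = m" by (simp add: card_image)
  moreover have "(\<lambda>j. x ^ j) ` {..<m} \<subseteq> {z. z ^ m = 1}"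
    using x by (auto simp: proot_def) (metis mult.commute power_mult power_one)
  moreover have "card {z :: complex. z ^ m = 1} = m" "finite {z :: complex. z ^ m = 1}"
    using m_pos card_roots_unity_eq[of m] finite_roots_unity[of m] by simp_all
  ultimately have "(\<lambda>j. x ^ j) ` {..<m} = {z. z ^ m = 1}" by (intro card_subset_eq) auto
  thus ?thesis using y by blast
qed

lemma proot_power_iff:
  assumes x: "proot x"
  shows "proot (x ^ a) \<longleftrightarrow> \<not> p dvd a"
proof
  assume *: "proot (x ^ a)"
  show "\<not> p dvd a"
  proof
    assume "p dvd a"
    then obtain c where "a = p * c" by (elim dvdE)
    hence "(x ^ a) ^ q = (x ^ m) ^ c" by (simp add: power_mult[symmetric] ac_simps)
    thus False using * x by (simp add: proot_def)
  qed
qed (rule proot_power[OF x])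

text \<open>The cyclotomic polynomial is the minimal polynomial of every primitive root at once: a
  polynomial that it does not divide is coprime to it, and a Bezout relation evaluated at
  \<open>x\<close> excludes a zero there.\<close>

lemma evq_eq_0_iff:
  assumes x: "proot x"
  shows "evq f x = 0 \<longleftrightarrow> cyc_poly p q dvd f"
proof
  assume f: "evq f x = 0"
  show "cyc_poly p q dvd f"
  proof (rule ccontr)
    assume n: "\<not> cyc_poly p q dvd f"
    have "prime_elem (cyc_poly p q :: rat poly)"
      using irreducible_cyc_poly[OF prime_p, of k] by (simp add: q_def irreducible_imp_prime_elem)
    hence "gcd (cyc_poly p q) f = 1"
      using prime_elem_imp_coprime[OF _ n] coprime_imp_gcd_eq_1 by blast
    then obtain u v where "u * cyc_poly p q + v * f = 1"
      using bezout_coefficients_fst_snd[of "cyc_poly p q" f] by metis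
    hence "evq (u * cyc_poly p q + v * f) x = evq 1 x" by simp
    thus False using f proot_cyc[OF x] by (simp add: evq_cyc_poly)
  qed
next
  assume "cyc_poly p q dvd f"
  thus "evq f x = 0" using proot_cyc[OF x] by (auto simp: evq_cyc_poly elim!: dvdE)
qed

lemma proot_independent:
  assumes x: "proot x" and a: "\<And>i. i < d \<Longrightarrow> a i \<in> \<rat>" and s: "(\<Sum>i<d. a i * x ^ i) = 0" and i: "i < d"
  shows "a i = 0"
proof -
  have "\<forall>i. \<exists>r. i < d \<longrightarrow> a i = of_rat r" using a by (auto simp: Rats_def)
  from choice[OF this] obtain b where b: "\<And>i. i < d \<Longrightarrow> a i = of_rat (b i)" by blast
  define f where "f = (\<Sum>i<d. monom (b i) i)"
  have cf: "coeff f i = (if i < d then b i else 0)" for i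
    by (simp add: f_def coeff_sum if_distrib cong: if_cong)
  have "evq f x = 0" using s b by (simp add: f_def)
  hence dv: "cyc_poly p q dvd f" by (simp add: evq_eq_0_iff[OF x])
  have "f = 0"
  proof (rule ccontr)
    assume "f \<noteq> 0"
    hence "degree (cyc_poly p q :: rat poly) \<le> degree f" using dv by (rule dvd_imp_degree_le[rotated])
    moreover have "degree f < d" using d_pos by (intro degree_lessI) (auto simp: cf)
    ultimately show False using degree_cyc_poly[of p q, where ?'a = rat] p_gt1 q_pos by simp
  qed
  thus ?thesis using cf[of i] i b by simp
qed

definition Qx :: "complex \<Rightarrow> complex set" where
  "Qx x = range (\<lambda>f. evq f x)"

lemma Qx_I [simp]: "evq f x \<in> Qx x" by (simp add: Qx_def)

lemma Qx_inverse:
  assumes x: "proot x" and y: "y \<in> Qx x"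
  shows "inverse y \<in> Qx x"
proof (cases "y = 0")
  case True
  thus ?thesis by (metis Qx_I evq_simps(5) inverse_zero)
next
  case False
  obtain f where f: "y = evq f x" using y by (auto simp: Qx_def)
  hence n: "\<not> cyc_poly p q dvd f" using False evq_eq_0_iff[OF x] by simp
  have "prime_elem (cyc_poly p q :: rat poly)"
    using irreducible_cyc_poly[OF prime_p, of k] by (simp add: q_def irreducible_imp_prime_elem)
  hence "gcd (cyc_poly p q) f = 1"
    using prime_elem_imp_coprime[OF _ n] coprime_imp_gcd_eq_1 by blast
  then obtain u v where "u * cyc_poly p q + v * f = 1"
    using bezout_coefficients_fst_snd[of "cyc_poly p q" f] by metis
  hence "evq (u * cyc_poly p q + v * f) x = evq 1 x" by simp
  hence "evq v x * y = 1" using proot_cyc[OF x] by (simp add: f evq_cyc_poly)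
  hence "inverse y = evq v x" using inverse_unique[of y "evq v x"] by (simp add: mult.commute)
  thus ?thesis by simp
qed

lemma Qx_subfield: assumes x: "proot x" shows "complex_subfield (Qx x)"
  unfolding complex_subfield_def
proof (intro conjI ballI)
  show "0 \<in> Qx x" by (metis Qx_I evq_simps(5))
  show "1 \<in> Qx x" by (metis Qx_I evq_simps(6))
  fix y z assume "y \<in> Qx x" "z \<in> Qx x"
  then obtain f g where "y = evq f x" "z = evq g x" by (auto simp: Qx_def)
  thus "y + z \<in> Qx x" "y * z \<in> Qx x" "- y \<in> Qx x"
    by (metis Qx_I evq_simps(1), metis Qx_I evq_simps(2), metis Qx_I evq_simps(4))
qed (rule Qx_inverse[OF x])

lemma Qx_power: "x ^ n \<in> Qx x"
  using Qx_I[of "monom 1 n" x] by simp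

text \<open>Serves the fields of \<psi> and of its induced character alike. It remains to see that
  the values lie in the cyclotomic field and that one of them recovers \<open>x\<close>.\<close>

lemma hull_eq_Qx:
  assumes x: "proot x" and S: "S \<subseteq> Qx x"
    and min: "\<And>L. complex_subfield L \<Longrightarrow> S \<subseteq> L \<Longrightarrow> x \<in> L"
  shows "complex_subfield hull S = Qx x"
proof (rule hull_unique)
  show "S \<subseteq> Qx x" "complex_subfield (Qx x)" by (fact S, rule Qx_subfield[OF x])
  fix L assume L: "S \<subseteq> L" "complex_subfield L"
  have "x \<in> L" using min L by blast
  have "of_rat r \<in> L" for r using subfield_Rats[OF L(2)] by auto
  thus "Qx x \<subseteq> L" using \<open>x \<in> L\<close> L(2)
    by (auto simp: Qx_def evq_as_sum intro!: subfield_closed)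
qed

text \<open>Primitive roots share their minimal polynomial, so relations over the rationals pass
  from one to another. This makes the automorphism \<open>x\<close> |-> \<open>x ^ a\<close> well
  defined.\<close>

lemma evq_transfer:
  assumes "proot x" "proot y" "evq f x = evq g x"
  shows "evq f y = evq g y"
  using evq_eq_0_iff[OF assms(1), of "f - g"] evq_eq_0_iff[OF assms(2), of "f - g"] assms(3) by simp

text \<open>The automorphism sending \<open>x\<close> to \<open>x ^ a\<close>, computed on an
  arbitrarily chosen polynomial expression. It is undefined outside the field because elements of
  \<open>Gal_Q\<close> are extensional.\<close>

definition gal :: "complex \<Rightarrow> nat \<Rightarrow> complex \<Rightarrow> complex" where
  "gal x a = restrict (\<lambda>y. evq (SOME f. evq f x = y) (x ^ a)) (Qx x)"

lemma gal_evq: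
  assumes x: "proot x" and a: "\<not> p dvd a"
  shows "gal x a (evq f x) = evq f (x ^ a)"
proof -
  have "evq (SOME g. evq g x = evq f x) x = evq f x" by (rule someI[of _ f]) simp
  hence "evq (SOME g. evq g x = evq f x) (x ^ a) = evq f (x ^ a)"
    by (rule evq_transfer[OF x proot_power[OF x a]])
  thus ?thesis by (simp add: gal_def)
qed

lemma gal_power:
  assumes x: "proot x" and a: "\<not> p dvd a"
  shows "gal x a (x ^ n) = (x ^ n) ^ a"
  using gal_evq[OF x a, of "monom 1 n"] by (simp add: power_mult[symmetric] mult.commute)

lemma gal_in_Gal:
  assumes x: "proot x" and a: "\<not> p dvd a"
  shows "gal x a \<in> Gal_Q (Qx x)"
proof -
  note g = gal_evq[OF x a]
  have sub: "evq f (x ^ a) \<in> Qx x" for f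
    unfolding evq_as_sum
    using Qx_subfield[OF x] subfield_Rats[OF Qx_subfield[OF x]] Qx_power[of x 1]
    by (intro subfield_closed) auto
  have inj: "inj_on (gal x a) (Qx x)"
    by (auto simp: Qx_def g intro!: inj_onI evq_transfer[OF proot_power[OF x a] x])
  have "algebraic_semidom_class.coprime a (p ^ Suc k)"
    using prime_imp_coprime[OF prime_p a] by (simp add: algebraic_semidom_class.coprime_commute)
  then obtain b where b: "[a * b = 1] (mod m)"
    using cong_solve_coprime_nat[of a m] by (auto simp: q_def)
  have xb: "x ^ (a * b) = x"
    using proot_power_mod[OF x, of "a * b"] proot_power_mod[OF x, of 1] b by (simp add: cong_def)
  have surj: "Qx x \<subseteq> gal x a ` Qx x"
  proof
    fix y assume "y \<in> Qx x"
    then obtain f where f: "y = evq f x" by (auto simp: Qx_def)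
    \<comment> \<open>With \<open>b\<close> inverse to \<open>a\<close> modulo \<open>m\<close>,
      multiplying all exponents by \<open>b\<close> undoes the substitution of \<open>x ^ a\<close>
      for \<open>x\<close>.\<close>
    define h where "h = (\<Sum>i\<le>degree f. monom (coeff f i) (b * i))"
    have "(x ^ a) ^ (b * i) = x ^ i" for i
      using xb by (metis power_mult mult.assoc)
    hence "evq h (x ^ a) = y"
      by (simp add: h_def f evq_as_sum[of f])
    hence "gal x a (evq h x) = y" by (simp add: g)
    thus "y \<in> gal x a ` Qx x" by (metis Qx_I image_eqI)
  qed
  have "bij_betw (gal x a) (Qx x) (Qx x)"
    using inj surj g sub by (auto simp: bij_betw_def Qx_def)
  moreover have "gal x a y = y" if y: "y \<in> \<rat>" for y
  proof -
    obtain r where "y = of_rat r" using y by (auto simp: Rats_def)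
    thus ?thesis using g[of "monom r 0"] by simp
  qed
  moreover have "gal x a (y + z) = gal x a y + gal x a z \<and> gal x a (y * z) = gal x a y * gal x a z"
    if yz: "y \<in> Qx x" "z \<in> Qx x" for y z
  proof -
    obtain f h where f: "y = evq f x" "z = evq h x" using yz by (auto simp: Qx_def)
    have "gal x a (evq (f + h) x) = evq (f + h) (x ^ a)" "gal x a (evq (f * h) x) = evq (f * h) (x ^ a)"
      by (rule g)+
    thus ?thesis by (simp add: f g)
  qed
  ultimately show ?thesis by (auto simp: Gal_Q_def gal_def)
qed

lemma Gal_is_gal:
  assumes x: "proot x" and s: "\<sigma> \<in> Gal_Q (Qx x)"
  shows "\<exists>a<m. \<not> p dvd a \<and> \<sigma> = gal x a"
proof -
  let ?K = "Qx x"
  have add: "\<And>y z. y \<in> ?K \<Longrightarrow> z \<in> ?K \<Longrightarrow> \<sigma> (y + z) = \<sigma> y + \<sigma> z"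
    and mul: "\<And>y z. y \<in> ?K \<Longrightarrow> z \<in> ?K \<Longrightarrow> \<sigma> (y * z) = \<sigma> y * \<sigma> z"
    and rat: "\<And>r. r \<in> \<rat> \<Longrightarrow> \<sigma> r = r" and ext: "\<sigma> \<in> extensional ?K" and inj: "inj_on \<sigma> ?K"
    using s by (auto simp: Gal_Q_def bij_betw_def)
  have xK: "x \<in> ?K" using Qx_power[of x 1] by simp
  note F = subfield_closed[OF Qx_subfield[OF x]]
  have pow: "\<sigma> (x ^ n) = \<sigma> x ^ n" for n
    by (induction n) (auto simp: rat mul xK Qx_power)
  have "\<sigma> x ^ m = 1" using pow[of m] x rat by (simp add: proot_def)
  then obtain a where a: "a < m" "\<sigma> x = x ^ a" using root_is_power[OF x] by blast
  \<comment> \<open>Injectivity of the automorphism keeps the order of \<open>x\<close>, so the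
    exponent \<open>a\<close> is prime to \<open>p\<close>.\<close>
  have "\<sigma> x ^ q \<noteq> 1"
  proof
    assume "\<sigma> x ^ q = 1"
    hence "\<sigma> (x ^ q) = \<sigma> 1" using pow[of q] rat by simp
    hence "x ^ q = 1" using inj Qx_power[of x q] F(2) by (auto dest: inj_onD)
    thus False using x by (simp add: proot_def)
  qed
  hence "proot (x ^ a)" using \<open>\<sigma> x ^ m = 1\<close> a by (simp add: proot_def)
  hence pa: "\<not> p dvd a" using proot_power_iff[OF x] by simp
  have sm: "\<sigma> (sum f I) = (\<Sum>i\<in>I. \<sigma> (f i))" if "\<And>i. i \<in> I \<Longrightarrow> f i \<in> ?K" for f and I :: "nat set"
    using that by (induction I rule: infinite_finite_induct) (auto simp: rat add F)
  have rK: "of_rat r \<in> ?K" for r using subfield_Rats[OF Qx_subfield[OF x]] by auto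
  have "\<sigma> (evq f x) = evq f (x ^ a)" for f
    by (simp add: evq_as_sum sm F rK Qx_power mul rat pow a)
  hence "\<sigma> y = gal x a y" if "y \<in> ?K" for y
    using that gal_evq[OF x pa] by (auto simp: Qx_def)
  hence "\<sigma> = gal x a" using ext by (intro extensionalityI[of _ ?K]) (auto simp: gal_def)
  thus ?thesis using a pa by blast
qed

section \<open>Traces and coordinates in the cyclotomic field\<close>

abbreviation "units \<equiv> {a. a < m \<and> \<not> p dvd a}"

lemma sum_Gal:
  assumes x: "proot x"
  shows "(\<Sum>\<sigma>\<in>Gal_Q (Qx x). F \<sigma>) = (\<Sum>a\<in>units. F (gal x a))"
proof -
  have "inj_on (gal x) units"
  proof (rule inj_onI)
    fix a b assume a: "a \<in> units" and b: "b \<in> units" and "gal x a = gal x b"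
    hence "gal x a (x ^ 1) = gal x b (x ^ 1)" by simp
    hence "x ^ a = x ^ b" using gal_power[OF x, of a 1] gal_power[OF x, of b 1] a b by simp
    thus "a = b" using proot_power_inj[OF x] a b by blast
  qed
  moreover have "Gal_Q (Qx x) = gal x ` units"
    using gal_in_Gal[OF x] Gal_is_gal[OF x] by auto
  ultimately show ?thesis by (simp add: sum.reindex)
qed

text \<open>The trace, from the cyclotomic field down to the rationals, of an \<open>m\<close>-th
  root of unity: it depends only on whether the order is 1, \<open>p\<close>, or larger.\<close>

definition trace_val :: "complex \<Rightarrow> complex" where
  "trace_val x = (if x = 1 then of_nat d else if x ^ p = 1 then - of_nat q else 0)"

text \<open>The exponents prime to \<open>p\<close> are all exponents minus the multiples of
  \<open>p\<close>, and both of these give geometric sums.\<close>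

lemma sum_units_power:
  assumes x: "x ^ m = 1"
  shows "(\<Sum>a\<in>units. x ^ a) = trace_val x"
proof -
  have "{..<m} = units \<union> (\<lambda>b. p * b) ` {..<q}"
    using p_gt1 by (auto elim!: dvdE)
  moreover have "sum ((^) x) (units \<union> (\<lambda>b. p * b) ` {..<q})
      = (\<Sum>a\<in>units. x ^ a) + (\<Sum>a\<in>(\<lambda>b. p * b) ` {..<q}. x ^ a)"
    by (rule sum.union_disjoint) auto
  ultimately have "(\<Sum>a<m. x ^ a) = (\<Sum>a\<in>units. x ^ a) + (\<Sum>a\<in>(\<lambda>b. p * b) ` {..<q}. x ^ a)"
    by metis
  also have "(\<Sum>a\<in>(\<lambda>b. p * b) ` {..<q}. x ^ a) = (\<Sum>b<q. (x ^ p) ^ b)"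
    using p_gt1 by (subst sum.reindex) (auto simp: inj_on_def power_mult)
  finally have e: "(\<Sum>a\<in>units. x ^ a) = (\<Sum>a<m. x ^ a) - (\<Sum>b<q. (x ^ p) ^ b)" by simp
  show ?thesis
  proof (cases "x = 1")
    case True
    thus ?thesis unfolding e trace_val_def using m_eq
      by (simp add: of_nat_diff flip: of_nat_mult)
  next
    case False
    have "(\<Sum>a<m. x ^ a) = 0" using geometric_sum_zero[OF x False] .
    moreover have "(\<Sum>b<q. (x ^ p) ^ b) = 0" if "x ^ p \<noteq> 1"
      using geometric_sum_zero[of "x ^ p" q] that x by (simp add: power_mult)
    ultimately show ?thesis unfolding e trace_val_def using False by auto
  qed
qed

text \<open>The coordinate of \<open>x\<^sup>n\<close> at \<open>x\<^sup>a\<close>, with respect to the basis \<open>1, x, \<dots>, x\<^bsup>d-1\<^esup>\<close>.\<close>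

definition cf :: "nat \<Rightarrow> nat \<Rightarrow> complex" where
  "cf a n = (let r = n mod m in if r < d then (if a = r then 1 else 0)
     else if a mod q = r mod q then -1 else 0)"

lemma cf_Rats: "cf a n \<in> \<rat>" by (auto simp: cf_def Let_def)

text \<open>Only two relations of the powers of a root are used, periodicity and the vanishing
  cyclotomic sums. Stating them for an arbitrary \<open>f\<close> covers both the powers of
  \<open>x\<close> and the vector entries met when an intertwiner is built.\<close>

lemma cf_expand:
  fixes f :: "nat \<Rightarrow> complex"
  assumes per: "\<And>n. f (n mod m) = f n" and cyc: "\<And>s. (\<Sum>l<p. f (q * l + s)) = 0"
  shows "f n = (\<Sum>a<d. cf a n * f a)"
proof -
  define r where "r = n mod m"
  have rm: "r < m" using m_pos by (simp add: r_def)
  have fn: "f n = f r" by (simp add: r_def per)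
  show ?thesis
  proof (cases "r < d")
    case True
    have "(\<Sum>a<d. cf a n * f a) = (\<Sum>a<d. if a = r then f a else 0)"
      using True by (intro sum.cong) (auto simp: cf_def r_def[symmetric] Let_def)
    thus ?thesis using True fn by simp
  next
    case False
    \<comment> \<open>An index \<open>r\<close> beyond the basis is \<open>d + s\<close>, the last
      term of the cyclotomic relation with offset \<open>s\<close>; solving for it produces the
      coefficients -1.\<close>
    define s where "s = r - d"
    have r: "r = q * (p - 1) + s" using False by (simp add: s_def mult.commute)
    have s: "s < q" using rm m_eq False by (simp add: s_def)
    have rs: "r mod q = s" using s by (simp add: r)
    have "{a. a < d \<and> a mod q = s} = (\<lambda>l. q * l + s) ` {..<p - 1}"
    proof (rule Set.set_eqI, rule iffI)
      fix a assume "a \<in> {a. a < d \<and> a mod q = s}"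
      hence "a = q * (a div q) + s" "a div q < p - 1" using q_pos
        by (auto simp: div_less_iff_less_mult)
      thus "a \<in> (\<lambda>l. q * l + s) ` {..<p - 1}" by auto
    next
      fix a assume "a \<in> (\<lambda>l. q * l + s) ` {..<p - 1}"
      then obtain l where l: "l < p - 1" "a = q * l + s" by auto
      have "q * l + s < q * l + q" using s by simp
      also have "\<dots> = q * Suc l" by simp
      also have "\<dots> \<le> q * (p - 1)" using l by (intro mult_le_mono2) simp
      finally show "a \<in> {a. a < d \<and> a mod q = s}" using l s by (simp add: mult.commute)
    qed
    moreover have "inj_on (\<lambda>l. q * l + s) {..<p - 1}" using q_pos by (auto simp: inj_on_def)
    ultimately have "(\<Sum>a | a < d \<and> a mod q = s. f a) = (\<Sum>l<p - 1. f (q * l + s))"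
      by (simp add: sum.reindex)
    moreover have "(\<Sum>l<p. f (q * l + s)) = (\<Sum>l<p - 1. f (q * l + s)) + f r"
      using p_gt1 unfolding r by (cases p) auto
    ultimately have "f r = - (\<Sum>a | a < d \<and> a mod q = s. f a)"
      using cyc[of s] by (simp add: add_eq_0_iff)
    also have "\<dots> = (\<Sum>a | a < d \<and> a mod q = s. cf a n * f a)"
      unfolding sum_negf[symmetric]
      using False rs by (intro sum.cong) (auto simp: cf_def r_def[symmetric] Let_def)
    also have "\<dots> = (\<Sum>a<d. cf a n * f a)"
      using False rs by (intro sum.mono_neutral_left) (auto simp: cf_def r_def[symmetric] Let_def)
    finally show ?thesis by (simp add: fn)
  qed
qed

lemma cf_proot:
  assumes x: "proot x"
  shows "x ^ n = (\<Sum>a<d. cf a n * x ^ a)"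
proof (rule cf_expand)
  fix s
  have "(\<Sum>l<p. x ^ (q * l + s)) = (\<Sum>l<p. x ^ (q * l)) * x ^ s"
    by (simp add: power_add sum_distrib_right)
  thus "(\<Sum>l<p. x ^ (q * l + s)) = 0" by (simp add: proot_cyc[OF x])
qed (rule proot_power_mod[OF x])

text \<open>The trace of multiplication by \<open>x ^ j\<close>, obtained by counting diagonal
  entries. With \<open>i\<close> the residue of \<open>j\<close>, the entry at \<open>a\<close> is 1
  only for \<open>i = 0\<close>, and it is -1 only if \<open>q\<close> divides \<open>i\<close> and
  \<open>i + a\<close> is reduced to an index beyond the basis.\<close>

lemma cf_trace:
  assumes x: "proot x"
  shows "(\<Sum>a<d. cf a (j + a)) = trace_val (x ^ j)"
proof -
  define i where "i = j mod m"
  have im: "i < m" using m_pos by (simp add: i_def)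
  have r: "(j + a) mod m = (i + a) mod m" for a by (simp add: i_def mod_add_left_eq)
  have xj: "x ^ j = x ^ i" using proot_power_mod[OF x] by (simp add: i_def)
  have x1: "x ^ i = 1 \<longleftrightarrow> i = 0" using proot_power_inj[OF x im, of 0] m_pos by auto
  have "(x ^ i) ^ p = 1 \<longleftrightarrow> p * q dvd p * i"
    using proot_power_eq_1[OF x, of "i * p"] by (simp add: power_mult mult.commute)
  hence xp: "(x ^ i) ^ p = 1 \<longleftrightarrow> q dvd i" using p_gt1 by simp
  have cfe: "cf a (j + a) = (let r = (i + a) mod m in if r < d then (if a = r then 1 else 0)
     else if a mod q = r mod q then -1 else 0)" for a by (simp only: cf_def r)
  have modq: "(i + a) mod m mod q = (i + a) mod q" for a by (simp add: mod_mod_cancel)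
  have dm: "d < m" using m_eq q_pos by simp
  show ?thesis
  proof (cases "i = 0")
    case True
    have "(\<Sum>a<d. cf a (j + a)) = (\<Sum>a<d. 1)"
    proof (intro sum.cong refl)
      fix a assume "a \<in> {..<d}"
      hence a: "a < d" by simp
      hence "a mod m = a" using dm by (intro mod_less) linarith
      thus "cf a (j + a) = 1" using a by (simp add: cfe True Let_def)
    qed
    thus ?thesis unfolding xj trace_val_def using x1 True by simp
  next
    case False
    have ne: "a \<noteq> (i + a) mod m" if "a < d" for a
    proof
      assume *: "a = (i + a) mod m"
      have "a < m" using that dm by linarith
      hence "(0 + a) mod m = (i + a) mod m" using * by simp
      hence "0 mod m = i mod m" using cong_add_rcancel_nat[of 0 a i m] by (simp add: cong_def)
      thus False using False im by simp
    qed
    show ?thesis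
    proof (cases "q dvd i")
      case dq: False
      have "a mod q \<noteq> (i + a) mod m mod q" for a
      proof
        assume "a mod q = (i + a) mod m mod q"
        hence "(0 + a) mod q = (i + a) mod q" by (simp only: modq add_0)
        hence "0 mod q = i mod q" using cong_add_rcancel_nat[of 0 a i q] by (simp add: cong_def)
        thus False using dq by (simp add: dvd_eq_mod_eq_0)
      qed
      hence "(\<Sum>a<d. cf a (j + a)) = 0"
        using ne by (intro sum.neutral) (auto simp: cfe Let_def)
      thus ?thesis unfolding xj trace_val_def using x1 xp False dq by simp
    next
      case dq: True
      have qi: "q \<le> i" using dq False by (simp add: dvd_imp_le)
      have "q dvd m - i" using dq by (intro dvd_diff_nat) auto
      hence "q \<le> m - i" using im by (intro dvd_imp_le) auto
      hence id: "i \<le> d" using m_eq im by linarith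
      have me: "a mod q = (i + a) mod m mod q" for a
        unfolding modq using dq by (auto elim!: dvdE)
      \<comment> \<open>The indices that leave the basis form the interval from \<open>d - i\<close>
        to \<open>m - i\<close>; it has length \<open>q\<close> and, since
        \<open>q \<le> i \<le> d\<close>, lies within the basis.\<close>
      have "(\<Sum>a<d. cf a (j + a)) = (\<Sum>a<d. if d - i \<le> a \<and> a < m - i then -1 else 0)"
      proof (intro sum.cong refl)
        fix a assume "a \<in> {..<d}"
        hence a: "a < d" by simp
        have "(i + a) mod m < d \<longleftrightarrow> \<not> (d - i \<le> a \<and> a < m - i)"
        proof (cases "a < m - i")
          case True
          hence "(i + a) mod m = i + a" using im by simp
          thus ?thesis using True id by auto
        next
          case False
          hence "m \<le> i + a" by linarith
          hence "(i + a) mod m = (i + a - m) mod m" by (rule le_mod_geq)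
          moreover have d': "i + a - m < d" using a im id dm by linarith
          moreover have "(i + a - m) mod m = i + a - m" using d' dm by (intro mod_less) linarith
          ultimately have "(i + a) mod m < d" by metis
          thus ?thesis using False by blast
        qed
        thus "cf a (j + a) = (if d - i \<le> a \<and> a < m - i then -1 else 0)"
          using ne[OF a] me[of a] by (simp add: cfe Let_def)
      qed
      also have "\<dots> = (\<Sum>a\<in>{a \<in> {..<d}. d - i \<le> a \<and> a < m - i}. -1)"
        by (rule sum.inter_filter[symmetric]) simp
      also have "\<dots> = (\<Sum>a\<in>{d - i..<m - i}. -1)"
      proof (rule sum.cong)
        have "m - i \<le> d" using qi m_eq by linarith
        thus "{a \<in> {..<d}. d - i \<le> a \<and> a < m - i} = {d - i..<m - i}" by auto
      qed simp
      also have "\<dots> = - of_nat q" using id m_eq by simp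
      finally show ?thesis unfolding xj trace_val_def using x1 xp False dq by simp
    qed
  qed
qed

end

section \<open>Matrix representations over a subfield\<close>

lemma mats_overD: "A \<in> mats_over K n \<Longrightarrow> A \<in> carrier_mat n n"
  by (simp add: mats_over_def)

lemma vecs_overD: "v \<in> vecs_over K n \<Longrightarrow> v \<in> carrier_vec n"
  by (simp add: vecs_over_def)

lemma mult_mat_vec_index:
  assumes "A \<in> carrier_mat n k" "v \<in> carrier_vec k" "i < n"
  shows "(A *\<^sub>v v) $ i = (\<Sum>j<k. A $$ (i, j) * v $ j)"
  using assms by (auto simp: scalar_prod_def row_def atLeast0LessThan intro!: sum.cong)

lemma mult_mat_index:
  assumes "A \<in> carrier_mat n k" "B \<in> carrier_mat k l" "i < n" "j < l"
  shows "(A * B) $$ (i, j) = (\<Sum>a<k. A $$ (i, a) * B $$ (a, j))"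
  using assms by (auto simp: scalar_prod_def row_def col_def atLeast0LessThan intro!: sum.cong)

declare index_mult_mat_vec [simp del] index_mult_mat(1) [simp del]

lemma mult_mat_zero_vec:
  "A \<in> carrier_mat n k \<Longrightarrow> A *\<^sub>v 0\<^sub>v k = (0\<^sub>v n :: complex vec)"
  by (rule eq_vecI) (auto simp: mult_mat_vec_index[of _ n k])

lemma smult_zero_vec' [simp]: "c \<cdot>\<^sub>v 0\<^sub>v n = (0\<^sub>v n :: complex vec)"
  by (rule eq_vecI) auto

lemma mult_mat_vec_over:
  assumes K: "complex_subfield K" and A: "A \<in> carrier_mat n k" "\<And>i j. i < n \<Longrightarrow> j < k \<Longrightarrow> A $$ (i, j) \<in> K"
    and v: "v \<in> vecs_over K k"
  shows "A *\<^sub>v v \<in> vecs_over K n"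
  using assms by (auto simp: vecs_over_def mult_mat_vec_index intro!: subfield_closed[OF K])

lemma mats_over_mult_vec:
  "complex_subfield K \<Longrightarrow> A \<in> mats_over K n \<Longrightarrow> v \<in> vecs_over K n \<Longrightarrow> A *\<^sub>v v \<in> vecs_over K n"
  by (rule mult_mat_vec_over) (auto simp: mats_over_def)

lemma mats_over_mult:
  assumes K: "complex_subfield K" and "A \<in> mats_over K n" "B \<in> mats_over K n"
  shows "A * B \<in> mats_over K n"
  using assms by (auto simp: mats_over_def mult_mat_index intro!: subfield_closed[OF K])

lemma vecs_over_zero: "complex_subfield K \<Longrightarrow> 0\<^sub>v n \<in> vecs_over K n"
  by (auto simp: vecs_over_def subfield_closed)

lemma vecs_over_add:
  "complex_subfield K \<Longrightarrow> v \<in> vecs_over K n \<Longrightarrow> w \<in> vecs_over K n \<Longrightarrow> v + w \<in> vecs_over K n"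
  by (auto simp: vecs_over_def subfield_closed)

lemma vecs_over_smult:
  "complex_subfield K \<Longrightarrow> v \<in> vecs_over K n \<Longrightarrow> c \<in> K \<Longrightarrow> c \<cdot>\<^sub>v v \<in> vecs_over K n"
  by (auto simp: vecs_over_def subfield_closed)

lemma vecs_over_unit: "complex_subfield K \<Longrightarrow> unit_vec n i \<in> vecs_over K n"
  by (auto simp: vecs_over_def unit_vec_def subfield_closed)

lemma mult_unit_vec:
  assumes "A \<in> carrier_mat n k" "j < k" "i < n"
  shows "((A :: complex mat) *\<^sub>v unit_vec k j) $ i = A $$ (i, j)"
  using assms by (simp add: mult_mat_vec_index[of _ n k] unit_vec_def if_distrib cong: if_cong)

text \<open>Unit vectors have entries in every subfield, so even complex matrices can be compared on
  rational vectors. This matters where evaluation at a root is injective on rational vectors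
  only.\<close>

lemma mat_eq_by_action:
  assumes A: "A \<in> carrier_mat n k" and B: "B \<in> carrier_mat n k" and K: "complex_subfield K"
    and e: "\<And>v. v \<in> vecs_over K k \<Longrightarrow> A *\<^sub>v v = B *\<^sub>v v"
  shows "A = B"
proof (rule eq_matI)
  fix i j assume "i < dim_row B" "j < dim_col B"
  hence ij: "i < n" "j < k" using B by auto
  show "A $$ (i, j) = B $$ (i, j)"
    using e[OF vecs_over_unit[OF K]] mult_unit_vec[OF A ij(2,1)] mult_unit_vec[OF B ij(2,1)] by metis
qed (use A B in auto)

text \<open>The dimension is an argument so that an empty sum is the zero vector of the intended
  length.\<close>

definition vsum :: "nat \<Rightarrow> 'i set \<Rightarrow> ('i \<Rightarrow> complex vec) \<Rightarrow> complex vec" where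
  "vsum n I f = vec n (\<lambda>i. \<Sum>k\<in>I. f k $ i)"

lemma vsum_carrier [simp]: "vsum n I f \<in> carrier_vec n"
  by (simp add: vsum_def)

lemma vsum_index [simp]: "i < n \<Longrightarrow> vsum n I f $ i = (\<Sum>k\<in>I. f k $ i)"
  by (simp add: vsum_def)

lemma dim_vsum [simp]: "dim_vec (vsum n I f) = n"
  by (simp add: vsum_def)

lemma mult_mat_vsum:
  assumes A: "A \<in> carrier_mat n k" and f: "\<And>i. i \<in> I \<Longrightarrow> f i \<in> carrier_vec k"
  shows "A *\<^sub>v vsum k I f = vsum n I (\<lambda>i. A *\<^sub>v f i)"
proof (rule eq_vecI)
  fix i assume "i < dim_vec (vsum n I (\<lambda>i. A *\<^sub>v f i))"
  hence i: "i < n" by simp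
  have "(A *\<^sub>v vsum k I f) $ i = (\<Sum>j<k. \<Sum>l\<in>I. A $$ (i, j) * f l $ j)"
    using A i by (simp add: mult_mat_vec_index[of _ n k] sum_distrib_left)
  also have "\<dots> = (\<Sum>l\<in>I. \<Sum>j<k. A $$ (i, j) * f l $ j)" by (rule sum.swap)
  also have "\<dots> = (\<Sum>l\<in>I. (A *\<^sub>v f l) $ i)"
    by (rule sum.cong) (use A f i in \<open>simp_all add: mult_mat_vec_index[of _ n k]\<close>)
  finally show "(A *\<^sub>v vsum k I f) $ i = vsum n I (\<lambda>i. A *\<^sub>v f i) $ i" using i by simp
qed (use A in auto)

lemma vsum_in_invariant:
  assumes W: "invariant_subspace K G n \<rho> W" and f: "\<And>i. i \<in> I \<Longrightarrow> f i \<in> W"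
  shows "vsum n I f \<in> W"
  using f
proof (induction I rule: infinite_finite_induct)
  case (insert i I)
  have car: "f i \<in> carrier_vec n" using insert.prems W by (auto simp: invariant_subspace_def dest: vecs_overD)
  have "vsum n (insert i I) f = f i + vsum n I f"
    by (rule eq_vecI) (use insert car in auto)
  thus ?case using insert W by (auto simp: invariant_subspace_def)
qed (use W in \<open>auto simp: invariant_subspace_def vsum_def zero_vec_def[symmetric]\<close>)

lemma matrix_repD:
  assumes "matrix_rep K G n \<rho>"
  shows "\<And>g. g \<in> carrier G \<Longrightarrow> \<rho> g \<in> mats_over K n" "\<And>g. g \<in> carrier G \<Longrightarrow> \<rho> g \<in> carrier_mat n n"
    "\<rho> \<one>\<^bsub>G\<^esub> = 1\<^sub>m n"
    "\<And>g h. g \<in> carrier G \<Longrightarrow> h \<in> carrier G \<Longrightarrow> \<rho> (g \<otimes>\<^bsub>G\<^esub> h) = \<rho> g * \<rho> h"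
    "\<And>g h v. g \<in> carrier G \<Longrightarrow> h \<in> carrier G \<Longrightarrow> v \<in> carrier_vec n \<Longrightarrow>
      \<rho> (g \<otimes>\<^bsub>G\<^esub> h) *\<^sub>v v = \<rho> g *\<^sub>v (\<rho> h *\<^sub>v v)"
proof -
  show c: "\<And>g. g \<in> carrier G \<Longrightarrow> \<rho> g \<in> mats_over K n"
    and "\<rho> \<one>\<^bsub>G\<^esub> = 1\<^sub>m n"
    and m: "\<And>g h. g \<in> carrier G \<Longrightarrow> h \<in> carrier G \<Longrightarrow> \<rho> (g \<otimes>\<^bsub>G\<^esub> h) = \<rho> g * \<rho> h"
    using assms by (auto simp: matrix_rep_def)
  show c': "\<And>g. g \<in> carrier G \<Longrightarrow> \<rho> g \<in> carrier_mat n n" using c by (auto dest: mats_overD)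
  fix g h v assume "g \<in> carrier G" "h \<in> carrier G" "(v :: complex vec) \<in> carrier_vec n"
  thus "\<rho> (g \<otimes>\<^bsub>G\<^esub> h) *\<^sub>v v = \<rho> g *\<^sub>v (\<rho> h *\<^sub>v v)"
    using m c' by (simp add: assoc_mult_mat_vec[of _ n n _ n])
qed

lemma irreducible_repD:
  assumes "irreducible_rep K G n \<rho>"
  shows "matrix_rep K G n \<rho>" "0 < n"
    "\<And>W. invariant_subspace K G n \<rho> W \<Longrightarrow> w \<in> W \<Longrightarrow> w \<noteq> 0\<^sub>v n \<Longrightarrow> W = vecs_over K n"
  using assms by (auto simp: irreducible_rep_def)

lemma sum_entries_zero_vsum:
  assumes A: "\<And>j. j \<in> J \<Longrightarrow> A j \<in> carrier_mat n n"
    and z: "\<And>a b. a < n \<Longrightarrow> b < n \<Longrightarrow> (\<Sum>j\<in>J. A j $$ (a, b)) = 0" and v: "v \<in> carrier_vec n"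
  shows "vsum n J (\<lambda>j. A j *\<^sub>v v) = 0\<^sub>v n"
proof (rule eq_vecI)
  fix i assume "i < dim_vec (0\<^sub>v n)"
  hence i: "i < n" by simp
  have "vsum n J (\<lambda>j. A j *\<^sub>v v) $ i = (\<Sum>j\<in>J. \<Sum>b<n. A j $$ (i, b) * v $ b)"
    using i by (simp, intro sum.cong refl mult_mat_vec_index) (use A v i in auto)
  also have "\<dots> = (\<Sum>b<n. (\<Sum>j\<in>J. A j $$ (i, b)) * v $ b)"
    by (subst sum.swap) (simp add: sum_distrib_right)
  also have "\<dots> = 0" using z i by (intro sum.neutral) auto
  finally show "vsum n J (\<lambda>j. A j *\<^sub>v v) $ i = 0\<^sub>v n $ i" using i by simp
qed simp

text \<open>The image of the averaging operator over a central cyclic subgroup is an invariant subspace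
  on which that subgroup acts trivially.\<close>

lemma central_sum_dichotomy:
  assumes G: "group G" and K: "complex_subfield K" and irr: "irreducible_rep K G n \<rho>"
    and x: "x \<in> carrier G" and comm: "\<And>g. g \<in> carrier G \<Longrightarrow> x \<otimes>\<^bsub>G\<^esub> g = g \<otimes>\<^bsub>G\<^esub> x"
    and N: "\<rho> (x [^]\<^bsub>G\<^esub> (N :: nat)) = 1\<^sub>m n" and nt: "\<rho> x \<noteq> 1\<^sub>m n" and ab: "a < n" "b < n"
  shows "(\<Sum>j<N. \<rho> (x [^]\<^bsub>G\<^esub> j) $$ (a, b)) = 0"
proof -
  interpret group G by fact
  note R = matrix_repD[OF irreducible_repD(1)[OF irr]]
  have xp: "x [^]\<^bsub>G\<^esub> j \<in> carrier G" for j :: nat using x by simp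
  define P where "P v = vsum n {..<N} (\<lambda>j. \<rho> (x [^]\<^bsub>G\<^esub> j) *\<^sub>v v)" for v
  define W where "W = P ` vecs_over K n"
  have PW: "P v \<in> vecs_over K n" if "v \<in> vecs_over K n" for v
    using mats_over_mult_vec[OF K R(1)[OF xp] that]
    by (auto simp: vecs_over_def P_def intro!: subfield_closed[OF K])
  have com: "x [^]\<^bsub>G\<^esub> j \<otimes>\<^bsub>G\<^esub> g = g \<otimes>\<^bsub>G\<^esub> x [^]\<^bsub>G\<^esub> j" if "g \<in> carrier G" for j :: nat and g
  proof (induction j)
    case (Suc j)
    thus ?case using x that comm xp by (metis m_assoc nat_pow_Suc)
  qed (use that in simp)
  have lin: "A *\<^sub>v P v = vsum n {..<N} (\<lambda>j. A *\<^sub>v (\<rho> (x [^]\<^bsub>G\<^esub> j) *\<^sub>v v))"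
    if "A \<in> carrier_mat n n" "v \<in> carrier_vec n" for A v
    unfolding P_def using that R(2)[OF xp] by (intro mult_mat_vsum) (auto intro: mult_mat_vec_carrier)
  have inv: "invariant_subspace K G n \<rho> W"
    unfolding invariant_subspace_def
  proof (intro conjI ballI)
    show "W \<subseteq> vecs_over K n" using PW by (auto simp: W_def)
    have "P (0\<^sub>v n) = 0\<^sub>v n"
      by (rule eq_vecI) (auto simp: P_def mult_mat_zero_vec[OF R(2)[OF xp]])
    thus "0\<^sub>v n \<in> W" unfolding W_def using vecs_over_zero[OF K] by (metis image_eqI)
  next
    fix v w assume "v \<in> W" "w \<in> W"
    then obtain v' w' where vw: "v = P v'" "w = P w'" "v' \<in> vecs_over K n" "w' \<in> vecs_over K n"
      by (auto simp: W_def)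
    have c: "v' \<in> carrier_vec n" "w' \<in> carrier_vec n" using vw by (auto dest: vecs_overD)
    have "P v' + P w' = P (v' + w')"
      by (rule eq_vecI) (use c carrier_matD[OF R(2)[OF xp]] in \<open>simp_all add: P_def sum.distrib
          mult_add_distrib_mat_vec[OF R(2)[OF xp]]\<close>)
    thus "v + w \<in> W" using vw vecs_over_add[OF K] by (auto simp: W_def)
  next
    fix s v assume s: "s \<in> K" "v \<in> W"
    then obtain v' where v: "v = P v'" "v' \<in> vecs_over K n" by (auto simp: W_def)
    have c: "v' \<in> carrier_vec n" using v by (auto dest: vecs_overD)
    have "s \<cdot>\<^sub>v P v' = P (s \<cdot>\<^sub>v v')"
      by (rule eq_vecI) (use R(2)[OF xp] c carrier_matD[OF R(2)[OF xp]] in \<open>auto simp: P_def sum_distrib_left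
          mult_mat_vec[of _ n n] intro!: sum.cong\<close>)
    thus "s \<cdot>\<^sub>v v \<in> W" using v s vecs_over_smult[OF K] by (auto simp: W_def)
  next
    fix g v assume g: "g \<in> carrier G" and "v \<in> W"
    then obtain v' where v: "v = P v'" "v' \<in> vecs_over K n" by (auto simp: W_def)
    have c: "v' \<in> carrier_vec n" using v by (auto dest: vecs_overD)
    have "\<rho> g *\<^sub>v (\<rho> (x [^]\<^bsub>G\<^esub> j) *\<^sub>v v') = \<rho> (x [^]\<^bsub>G\<^esub> j) *\<^sub>v (\<rho> g *\<^sub>v v')" for j :: nat
      using R(5)[OF g xp c] R(5)[OF xp g c] com[OF g] by metis
    hence "\<rho> g *\<^sub>v P v' = P (\<rho> g *\<^sub>v v')"
      using lin[OF R(2)[OF g] c] by (simp add: P_def)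
    thus "\<rho> g *\<^sub>v v \<in> W" using v mats_over_mult_vec[OF K R(1)[OF g]] by (auto simp: W_def)
  qed
  \<comment> \<open>Applying \<open>\<rho> x\<close> to \<open>P v\<close> shifts the summation
    index by one, and the two ends agree because \<open>N\<close> is a period. So \<open>x\<close>
    fixes the image of \<open>P\<close> pointwise, and the image cannot be the whole space.\<close>
  have "W \<noteq> vecs_over K n"
  proof
    assume all: "W = vecs_over K n"
    have "\<rho> x *\<^sub>v w = 1\<^sub>m n *\<^sub>v w" if w: "w \<in> vecs_over K n" for w
    proof -
      obtain v where v: "w = P v" "v \<in> vecs_over K n" using all w by (auto simp: W_def)
      have c: "v \<in> carrier_vec n" using v by (auto dest: vecs_overD)
      define F where "F j = \<rho> (x [^]\<^bsub>G\<^esub> j) *\<^sub>v v" for j :: nat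
      have s: "\<rho> x *\<^sub>v F j = F (Suc j)" for j
        using R(5)[OF x xp c, of j] com[OF x, of j] by (simp add: F_def)
      have F0: "F N = F 0" using c by (simp add: F_def N R)
      have "\<rho> x *\<^sub>v w = vsum n {..<N} (\<lambda>j. F (Suc j))"
        using lin[OF R(2)[OF x] c] s by (simp add: v F_def)
      also have "\<dots> = vsum n {..<N} F"
      proof (rule eq_vecI)
        fix i assume "i < dim_vec (vsum n {..<N} F)"
        moreover have "(\<Sum>j<N. F (Suc j) $ i) + F 0 $ i = (\<Sum>j<N. F j $ i) + F N $ i"
          using sum.lessThan_Suc_shift[of "\<lambda>j. F j $ i" N] by (simp add: add.commute)
        ultimately show "vsum n {..<N} (\<lambda>j. F (Suc j)) $ i = vsum n {..<N} F $ i"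
          using F0 by simp
      qed simp
      also have "\<dots> = w" by (simp add: v P_def F_def[abs_def])
      finally show ?thesis using that by (auto dest!: vecs_overD)
    qed
    hence "\<rho> x = 1\<^sub>m n" by (intro mat_eq_by_action[OF R(2)[OF x] _ K]) auto
    thus False using nt by simp
  qed
  \<comment> \<open>Irreducibility forces \<open>P = 0\<close>; entry \<open>a\<close> of
    \<open>P\<close> at the \<open>b\<close>-th unit vector is the sum in question.\<close>
  moreover have "P (unit_vec n b) \<in> W" unfolding W_def using vecs_over_unit[OF K] by (rule imageI)
  ultimately have "P (unit_vec n b) = 0\<^sub>v n"
    using irreducible_repD(3)[OF irr inv] by blast
  hence "P (unit_vec n b) $ a = 0" using ab by simp
  thus ?thesis using ab by (simp add: P_def mult_unit_vec[OF R(2)[OF xp]])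
qed

text \<open>A bijective intertwiner has a two-sided inverse matrix; comparing the traces of the two
  products shows that it is square.\<close>

lemma schur_equivalent:
  assumes K: "complex_subfield K" and G: "group G"
    and irr: "irreducible_rep K G n \<rho>" and irr': "irreducible_rep K G n' \<rho>'"
    and T: "T \<in> carrier_mat n n'" and TK: "\<And>i j. i < n \<Longrightarrow> j < n' \<Longrightarrow> T $$ (i, j) \<in> K"
    and T0: "T \<noteq> 0\<^sub>m n n'"
    and int: "\<And>g. g \<in> carrier G \<Longrightarrow> \<rho> g * T = T * \<rho>' g"
  shows "equivalent_reps K G n \<rho> n' \<rho>'"
proof -
  note R = matrix_repD[OF irreducible_repD(1)[OF irr]]
  note R' = matrix_repD[OF irreducible_repD(1)[OF irr']]
  have intv: "\<rho> g *\<^sub>v (T *\<^sub>v v) = T *\<^sub>v (\<rho>' g *\<^sub>v v)" if "g \<in> carrier G" "v \<in> carrier_vec n'" for g v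
    using int[OF that(1)] assoc_mult_mat_vec[OF R(2)[OF that(1)] T that(2)]
      assoc_mult_mat_vec[OF T R'(2)[OF that(1)] that(2)] by metis
  have Tv: "T *\<^sub>v v \<in> vecs_over K n" if "v \<in> vecs_over K n'" for v
    using mult_mat_vec_over[OF K T TK that] .
  define ker where "ker = {v \<in> vecs_over K n'. T *\<^sub>v v = 0\<^sub>v n}"
  define im where "im = (\<lambda>v. T *\<^sub>v v) ` vecs_over K n'"
  have iker: "invariant_subspace K G n' \<rho>' ker"
    unfolding invariant_subspace_def
  proof (intro conjI ballI)
    show "ker \<subseteq> vecs_over K n'" by (auto simp: ker_def)
    show "0\<^sub>v n' \<in> ker" using vecs_over_zero[OF K] mult_mat_zero_vec[OF T] by (simp add: ker_def)
  next
    fix v w assume *: "v \<in> ker" "w \<in> ker"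
    hence "v \<in> carrier_vec n'" "w \<in> carrier_vec n'" by (auto simp: ker_def vecs_over_def)
    with * show "v + w \<in> ker"
      using vecs_over_add[OF K, of v n' w] mult_add_distrib_mat_vec[OF T, of v w]
      by (simp add: ker_def)
  next
    fix c v assume *: "c \<in> K" "v \<in> ker"
    hence "v \<in> carrier_vec n'" by (auto simp: ker_def vecs_over_def)
    with * show "c \<cdot>\<^sub>v v \<in> ker"
      using vecs_over_smult[OF K, of v n' c] mult_mat_vec[OF T, of v c]
      by (simp add: ker_def)
  next
    fix g v assume *: "g \<in> carrier G" "v \<in> ker"
    hence "v \<in> carrier_vec n'" by (auto simp: ker_def vecs_over_def)
    with * show "\<rho>' g *\<^sub>v v \<in> ker"
      using mats_over_mult_vec[OF K R'(1), of g v] intv[of g v] mult_mat_zero_vec[OF R(2), of g]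
      by (simp add: ker_def)
  qed
  have iim: "invariant_subspace K G n \<rho> im"
    unfolding invariant_subspace_def im_def
  proof (intro conjI ballI; (elim imageE)?)
    show "(\<lambda>v. T *\<^sub>v v) ` vecs_over K n' \<subseteq> vecs_over K n" using Tv by auto
    have "T *\<^sub>v 0\<^sub>v n' = 0\<^sub>v n" using T by (rule mult_mat_zero_vec)
    thus "0\<^sub>v n \<in> (\<lambda>v. T *\<^sub>v v) ` vecs_over K n'" using vecs_over_zero[OF K] by (metis image_eqI)
  next
    fix v w a b assume "v = T *\<^sub>v a" "w = T *\<^sub>v b" "a \<in> vecs_over K n'" "b \<in> vecs_over K n'"
    thus "v + w \<in> (\<lambda>v. T *\<^sub>v v) ` vecs_over K n'"
      using mult_add_distrib_mat_vec[OF T, of a b] vecs_over_add[OF K, of a n' b]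
      by (metis image_eqI vecs_overD)
  next
    fix c v a assume "c \<in> K" "v = T *\<^sub>v a" "a \<in> vecs_over K n'"
    thus "c \<cdot>\<^sub>v v \<in> (\<lambda>v. T *\<^sub>v v) ` vecs_over K n'"
      using mult_mat_vec[OF T, of a c] vecs_over_smult[OF K, of a n' c]
      by (metis image_eqI vecs_overD)
  next
    fix g v a assume "g \<in> carrier G" "v = T *\<^sub>v a" "a \<in> vecs_over K n'"
    thus "\<rho> g *\<^sub>v v \<in> (\<lambda>v. T *\<^sub>v v) ` vecs_over K n'"
      using intv[of g a] mats_over_mult_vec[OF K R'(1), of g a]
      by (metis image_eqI vecs_overD)
  qed
  have "\<not> (\<forall>j<n'. T *\<^sub>v unit_vec n' j = 0\<^sub>v n)"
  proof
    assume z: "\<forall>j<n'. T *\<^sub>v unit_vec n' j = 0\<^sub>v n"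
    have "T = 0\<^sub>m n n'"
    proof (rule eq_matI)
      fix i j assume "i < dim_row (0\<^sub>m n n')" "j < dim_col (0\<^sub>m n n')"
      thus "T $$ (i, j) = 0\<^sub>m n n' $$ (i, j)" using z mult_unit_vec[OF T, of j i] by simp
    qed (use T in auto)
    thus False using T0 by simp
  qed
  then obtain j where j: "j < n'" "T *\<^sub>v unit_vec n' j \<noteq> 0\<^sub>v n" by blast
  have imall: "im = vecs_over K n"
    using j vecs_over_unit[OF K] by (intro irreducible_repD(3)[OF irr iim, of "T *\<^sub>v unit_vec n' j"])
      (auto simp: im_def)
  have ker0: "v = 0\<^sub>v n'" if "v \<in> ker" for v
  proof (rule ccontr)
    assume "v \<noteq> 0\<^sub>v n'"
    hence "ker = vecs_over K n'" using irreducible_repD(3)[OF irr' iker that] by blast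
    hence "unit_vec n' j \<in> ker" using vecs_over_unit[OF K] by simp
    thus False using j by (simp add: ker_def)
  qed
  have "\<forall>i. \<exists>s. s \<in> vecs_over K n' \<and> T *\<^sub>v s = unit_vec n i"
  proof
    fix i
    have "unit_vec n i \<in> im" using vecs_over_unit[OF K] by (simp add: imall)
    thus "\<exists>s. s \<in> vecs_over K n' \<and> T *\<^sub>v s = unit_vec n i" by (auto simp: im_def)
  qed
  then obtain s where s: "\<And>i. s i \<in> vecs_over K n'" "\<And>i. T *\<^sub>v s i = unit_vec n i" by metis
  \<comment> \<open>The columns of the right inverse are chosen preimages of the unit
    vectors.\<close>
  define S where "S = mat n' n (\<lambda>(a, i). s i $ a)"
  have S: "S \<in> carrier_mat n' n" by (simp add: S_def)
  have SK: "S $$ (a, i) \<in> K" if "a < n'" "i < n" for a i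
    using s(1)[of i] that by (auto simp: S_def vecs_over_def)
  have TS: "T * S = 1\<^sub>m n"
  proof (rule eq_matI)
    fix i l assume "i < dim_row (1\<^sub>m n)" "l < dim_col (1\<^sub>m n)"
    hence il: "i < n" "l < n" by auto
    have "(T * S) $$ (i, l) = (T *\<^sub>v s l) $ i"
      unfolding mult_mat_index[OF T S il] mult_mat_vec_index[OF T vecs_overD[OF s(1)] il(1)]
      using il by (intro sum.cong) (auto simp: S_def)
    thus "(T * S) $$ (i, l) = 1\<^sub>m n $$ (i, l)" using il by (simp add: s unit_vec_def)
  qed (use T S in auto)
  have ST: "S * T = 1\<^sub>m n'"
  proof (rule mat_eq_by_action[OF _ _ K])
    fix v assume v: "v \<in> vecs_over K n'"
    hence c: "v \<in> carrier_vec n'" by (rule vecs_overD)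
    define w where "w = S *\<^sub>v (T *\<^sub>v v)"
    have w: "w \<in> vecs_over K n'" unfolding w_def using mult_mat_vec_over[OF K S SK Tv[OF v]] .
    hence wc: "w \<in> carrier_vec n'" by (rule vecs_overD)
    have "T *\<^sub>v w = (T * S) *\<^sub>v (T *\<^sub>v v)"
      unfolding w_def using assoc_mult_mat_vec[OF T S, of "T *\<^sub>v v"] T c by simp
    hence Tw: "T *\<^sub>v w = T *\<^sub>v v" using TS T c by simp
    \<comment> \<open>The difference of \<open>S T v\<close> and \<open>v\<close> lies in the kernel
      of \<open>T\<close>, which is zero.\<close>
    define y where "y = w + (-1) \<cdot>\<^sub>v v"
    have "-1 \<in> K" using subfield_closed(2,5)[OF K] by blast
    hence "y \<in> vecs_over K n'"
      unfolding y_def by (intro vecs_over_add[OF K w] vecs_over_smult[OF K v])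
    moreover have "T *\<^sub>v y = T *\<^sub>v w + (-1) \<cdot>\<^sub>v (T *\<^sub>v v)"
      using c wc by (simp only: y_def mult_add_distrib_mat_vec[OF T wc] smult_carrier_vec mult_mat_vec[OF T c])
    hence "T *\<^sub>v y = 0\<^sub>v n" unfolding Tw using T by (intro eq_vecI) auto
    ultimately have y0: "y = 0\<^sub>v n'" by (intro ker0) (simp add: ker_def)
    have "w = v"
    proof (rule eq_vecI)
      fix i assume "i < dim_vec v"
      moreover have "y $ i = 0\<^sub>v n' $ i" by (simp only: y0)
      ultimately show "w $ i = v $ i" using c wc by (simp add: y_def)
    qed (use c wc in auto)
    thus "(S * T) *\<^sub>v v = 1\<^sub>m n' *\<^sub>v v" using assoc_mult_mat_vec[OF S T c] c by (simp add: w_def)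
  qed (use S T in auto)
  have "(of_nat n :: complex) = (\<Sum>i<n. (T * S) $$ (i, i))" by (simp add: TS)
  also have "\<dots> = (\<Sum>i<n. \<Sum>a<n'. T $$ (i, a) * S $$ (a, i))"
    by (intro sum.cong refl mult_mat_index[OF T S]) auto
  also have "\<dots> = (\<Sum>a<n'. \<Sum>i<n. S $$ (a, i) * T $$ (i, a))"
    by (subst sum.swap) (simp add: mult.commute)
  also have "\<dots> = (\<Sum>a<n'. (S * T) $$ (a, a))"
    by (intro sum.cong refl mult_mat_index[OF S T, symmetric]) auto
  also have "\<dots> = of_nat n'" by (simp add: ST)
  finally have nn: "n = n'" by simp
  \<comment> \<open>\<open>T\<close> leads from the space of \<open>\<rho>'\<close> to that of
    \<open>\<rho>\<close>, so it is \<open>S\<close> that conjugates \<open>\<rho>\<close> into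
    \<open>\<rho>'\<close>.\<close>
  have "\<rho>' g = S * \<rho> g * T" if "g \<in> carrier G" for g
  proof -
    have "S * \<rho> g * T = S * (T * \<rho>' g)"
      using int[OF that] assoc_mult_mat[OF S R(2)[OF that] T] by simp
    also have "\<dots> = (S * T) * \<rho>' g" using assoc_mult_mat[OF S T R'(2)[OF that]] by simp
    finally show ?thesis using ST R'(2)[OF that] by simp
  qed
  thus ?thesis
    unfolding equivalent_reps_def using nn T S TK SK TS ST
    by (intro conjI bexI[of _ S] bexI[of _ T]) (auto simp: mats_over_def)
qed

lemma equivalent_reps_sym:
  assumes G: "\<And>g. g \<in> carrier G \<Longrightarrow> \<rho> g \<in> carrier_mat n n" and e: "equivalent_reps K G n \<rho> n' \<rho>'"
  shows "equivalent_reps K G n' \<rho>' n \<rho>"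
proof -
  obtain T S where nn: "n' = n" and T: "T \<in> mats_over K n" "S \<in> mats_over K n" "T * S = 1\<^sub>m n" "S * T = 1\<^sub>m n"
    and r: "\<And>g. g \<in> carrier G \<Longrightarrow> \<rho>' g = T * \<rho> g * S"
    using e by (auto simp: equivalent_reps_def)
  have c: "T \<in> carrier_mat n n" "S \<in> carrier_mat n n" using T by (auto dest: mats_overD)
  have "\<rho> g = S * \<rho>' g * T" if g: "g \<in> carrier G" for g
  proof -
    have "S * (T * \<rho> g * S) * T = S * T * \<rho> g * (S * T)"
      using c G[OF g] by (simp add: assoc_mult_mat[of _ n n _ n _ n])
    thus ?thesis using r[OF g] T G[OF g] by simp
  qed
  thus ?thesis unfolding equivalent_reps_def nn using T by blast
qed

lemma equivalent_reps_trans: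
  assumes K: "complex_subfield K" and G: "\<And>g. g \<in> carrier G \<Longrightarrow> \<rho> g \<in> carrier_mat n n"
    and e: "equivalent_reps K G n \<rho> n' \<rho>'" "equivalent_reps K G n' \<rho>' n'' \<rho>''"
  shows "equivalent_reps K G n \<rho> n'' \<rho>''"
proof -
  obtain T S where nn: "n' = n" and T: "T \<in> mats_over K n" "S \<in> mats_over K n" "T * S = 1\<^sub>m n" "S * T = 1\<^sub>m n"
    and r: "\<And>g. g \<in> carrier G \<Longrightarrow> \<rho>' g = T * \<rho> g * S"
    using e(1) by (auto simp: equivalent_reps_def)
  obtain T' S' where nn': "n'' = n" and T': "T' \<in> mats_over K n" "S' \<in> mats_over K n" "T' * S' = 1\<^sub>m n" "S' * T' = 1\<^sub>m n"
    and r': "\<And>g. g \<in> carrier G \<Longrightarrow> \<rho>'' g = T' * \<rho>' g * S'"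
    using e(2) by (auto simp: equivalent_reps_def nn)
  have c: "T \<in> carrier_mat n n" "S \<in> carrier_mat n n" "T' \<in> carrier_mat n n" "S' \<in> carrier_mat n n"
    using T T' by (auto dest: mats_overD)
  note a = assoc_mult_mat[of _ n n _ n _ n]
  have "(T' * T) * (S * S') = T' * (T * S) * S'" "(S * S') * (T' * T) = S * (S' * T') * T"
    using c by (simp_all add: a)
  hence "(T' * T) * (S * S') = 1\<^sub>m n" "(S * S') * (T' * T) = 1\<^sub>m n" using T T' c by simp_all
  moreover have "\<rho>'' g = (T' * T) * \<rho> g * (S * S')" if g: "g \<in> carrier G" for g
    using r[OF g] r'[OF g] c G[OF g] by (simp add: a)
  ultimately show ?thesis
    unfolding equivalent_reps_def nn' using mats_over_mult[OF K] T T' by blast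
qed

lemma equivalent_reps_kernel:
  assumes G: "\<And>g. g \<in> carrier G \<Longrightarrow> \<rho> g \<in> carrier_mat n n" and e: "equivalent_reps K G n \<rho> n' \<rho>'"
  shows "rep_kernel G n \<rho> \<subseteq> rep_kernel G n' \<rho>'"
  using e by (auto simp: equivalent_reps_def rep_kernel_def dest: mats_overD)

section \<open>Vectors cut into blocks of equal length\<close>

lemma sum_blocks:
  fixes f :: "nat \<Rightarrow> 'a :: comm_monoid_add"
  assumes "d > 0"
  shows "(\<Sum>i<n * d. f i) = (\<Sum>k<n. \<Sum>s<d. f (k * d + s))"
proof -
  have "(\<Sum>i<n * d. f i) = (\<Sum>k<n. sum f {k * d..<k * d + d})"
    by (rule sum.nat_group[symmetric])
  also have "\<dots> = (\<Sum>k<n. \<Sum>s<d. f (k * d + s))"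
  proof (rule sum.cong[OF refl])
    fix k
    show "sum f {k * d..<k * d + d} = (\<Sum>s<d. f (k * d + s))"
      using sum.shift_bounds_nat_ivl[of f 0 "k * d" d] by (simp add: atLeast0LessThan add.commute)
  qed
  finally show ?thesis .
qed

lemma block_bound: "k < L \<Longrightarrow> s < d \<Longrightarrow> k * d + s < L * (d :: nat)"
  by (metis (no_types, opaque_lifting) add.commute add_less_cancel_left less_le_trans mult_Suc mult_le_mono1 Suc_leI)

definition block :: "nat \<Rightarrow> nat \<Rightarrow> complex vec \<Rightarrow> complex vec" where
  "block d r v = vec d (\<lambda>s. v $ (r * d + s))"

text \<open>The inclusion of the \<open>l\<close>-th of \<open>L\<close> summands of dimension
  \<open>d\<close>; \<open>block\<close> is the projection.\<close>

definition blk :: "nat \<Rightarrow> nat \<Rightarrow> nat \<Rightarrow> complex vec \<Rightarrow> complex vec" where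
  "blk L d l x = vec (L * d) (\<lambda>i. if i div d = l then x $ (i mod d) else 0)"

lemma comp_carrier [simp]: "block d r v \<in> carrier_vec d" by (simp add: block_def)
lemma blk_carrier [simp]: "blk L d l x \<in> carrier_vec (L * d)" by (simp add: blk_def)

lemma comp_index: "s < d \<Longrightarrow> block d r v $ s = v $ (r * d + s)" by (simp add: block_def)

lemma vec_eq_by_comp:
  assumes "v \<in> carrier_vec (L * d)" "w \<in> carrier_vec (L * d)"
    and "\<And>r. r < L \<Longrightarrow> block d r v = block d r w"
  shows "v = w"
proof (rule eq_vecI)
  fix i assume "i < dim_vec w"
  hence i: "i < L * d" using assms by simp
  hence "d > 0" by (cases d) auto
  hence r: "i div d < L" "i mod d < d" using i by (auto simp: div_less_iff_less_mult)
  have "block d (i div d) v $ (i mod d) = block d (i div d) w $ (i mod d)" using assms(3)[OF r(1)] by simp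
  thus "v $ i = w $ i" using r by (simp add: comp_index)
qed (use assms in auto)

lemma comp_blk:
  assumes "x \<in> carrier_vec d" "r < L"
  shows "block d r (blk L d l x) = (if r = l then x else 0\<^sub>v d)"
  by (rule eq_vecI) (use assms block_bound[of r L _ d] in \<open>auto simp: block_def blk_def\<close>)

lemma comp_vsum:
  "r < L \<Longrightarrow> block d r (vsum (L * d) I f) = vsum d I (\<lambda>i. block d r (f i))"
  by (rule eq_vecI) (auto simp: block_def block_bound)

lemma comp_smult: "r < L \<Longrightarrow> v \<in> carrier_vec (L * d) \<Longrightarrow> block d r (c \<cdot>\<^sub>v v) = c \<cdot>\<^sub>v block d r v"
  by (rule eq_vecI) (auto simp: block_def block_bound)

lemma comp_zero: "r < L \<Longrightarrow> block d r (0\<^sub>v (L * d)) = 0\<^sub>v d"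
  by (rule eq_vecI) (auto simp: block_def block_bound)

lemma comp_over: "r < L \<Longrightarrow> v \<in> vecs_over K (L * d) \<Longrightarrow> block d r v \<in> vecs_over K d"
  by (auto simp: vecs_over_def comp_index block_bound)

section \<open>Induced representations\<close>

locale transversal = group G for G (structure) +
  fixes H :: "'a set" and ts :: "'a list"
  assumes H: "subgroup H G" and ts: "left_transversal G H ts"
begin

abbreviation "L \<equiv> length ts"

lemma ts_carrier [simp]: "k < L \<Longrightarrow> ts ! k \<in> carrier G"
  using ts by (auto simp: left_transversal_def)

lemma inv_cancel [simp]:
  assumes "x \<in> carrier G" "y \<in> carrier G"
  shows "inv x \<otimes> (x \<otimes> y) = y" "x \<otimes> (inv x \<otimes> y) = y"
  using assms by (simp_all add: m_assoc[symmetric])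

lemma H_carrier [simp]: "h \<in> H \<Longrightarrow> h \<in> carrier G"
  using H by (rule subgroup.mem_carrier)

lemma ex_index:
  assumes "g \<in> carrier G"
  obtains k where "k < L" "inv (ts ! k) \<otimes> g \<in> H"
  using ts assms unfolding left_transversal_def by (metis in_set_conv_nth)

lemma index_unique:
  assumes "g \<in> carrier G" "k < L" "l < L" "inv (ts ! k) \<otimes> g \<in> H" "inv (ts ! l) \<otimes> g \<in> H"
  shows "k = l"
proof -
  have "ts ! k = ts ! l" using ts assms unfolding left_transversal_def by (metis nth_mem)
  thus ?thesis using ts assms by (simp add: left_transversal_def nth_eq_iff_index_eq)
qed

lemma same_coset:
  assumes "k < L" "l < L" "inv (ts ! k) \<otimes> ts ! l \<in> H"
  shows "k = l"
  using assms subgroup.one_closed[OF H] by (intro index_unique[of "ts ! l"]) simp_all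

text \<open>Together with \<open>row_unique\<close> this says that each block row of an induced
  matrix has exactly one nonzero block. Existence comes from the coset of
  \<open>inv g \<otimes> ts ! r\<close>, by inverting.\<close>

lemma ex_row:
  assumes g: "g \<in> carrier G" and r: "r < L"
  obtains l where "l < L" "inv (ts ! r) \<otimes> g \<otimes> ts ! l \<in> H"
proof -
  obtain l where l: "l < L" "inv (ts ! l) \<otimes> (inv g \<otimes> ts ! r) \<in> H"
    using ex_index[of "inv g \<otimes> ts ! r"] g r by auto
  have "inv (inv (ts ! l) \<otimes> (inv g \<otimes> ts ! r)) \<in> H"
    by (rule subgroup.m_inv_closed[OF H l(2)])
  hence "inv (ts ! r) \<otimes> g \<otimes> ts ! l \<in> H" using g r l by (simp add: inv_mult_group m_assoc)
  thus ?thesis using that l by blast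
qed

lemma row_unique:
  assumes g: "g \<in> carrier G" and r: "r < L" and kl: "k < L" "l < L"
    and h: "inv (ts ! r) \<otimes> g \<otimes> ts ! k \<in> H" "inv (ts ! r) \<otimes> g \<otimes> ts ! l \<in> H"
  shows "k = l"
proof -
  have "inv (inv (ts ! r) \<otimes> g \<otimes> ts ! k) \<otimes> (inv (ts ! r) \<otimes> g \<otimes> ts ! l) \<in> H"
    by (rule subgroup.m_closed[OF H subgroup.m_inv_closed[OF H h(1)] h(2)])
  also have "inv (inv (ts ! r) \<otimes> g \<otimes> ts ! k) \<otimes> (inv (ts ! r) \<otimes> g \<otimes> ts ! l) = inv (ts ! k) \<otimes> ts ! l"
    using g r kl by (simp add: inv_mult_group m_assoc)
  finally show ?thesis using same_coset kl by blast
qed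

lemma L_pos: "L > 0"
  using ex_index[of \<one>] by (metis gr_zeroI not_less0 one_closed)

lemma transversal_bij: "bij_betw (\<lambda>(k, h). ts ! k \<otimes> h) ({..<L} \<times> H) (carrier G)"
  unfolding bij_betw_def
proof
  show "inj_on (\<lambda>(k, h). ts ! k \<otimes> h) ({..<L} \<times> H)"
  proof (rule inj_onI)
    fix x y assume xy: "x \<in> {..<L} \<times> H" "y \<in> {..<L} \<times> H"
      "(case x of (k, h) \<Rightarrow> ts ! k \<otimes> h) = (case y of (k, h) \<Rightarrow> ts ! k \<otimes> h)"
    obtain k h k' h' where e: "x = (k, h)" "y = (k', h')" by (cases x, cases y)
    have *: "k \<in> {..<L}" "h \<in> H" "k' \<in> {..<L}" "h' \<in> H" "ts ! k \<otimes> h = ts ! k' \<otimes> h'"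
      using xy by (auto simp: e)
    have "inv (ts ! k') \<otimes> (ts ! k \<otimes> h) = h'" "inv (ts ! k) \<otimes> (ts ! k \<otimes> h) = h"
      using *(1-4) by (simp_all add: *(5)) (simp flip: *(5))
    hence "k = k'" using * by (intro index_unique[of "ts ! k \<otimes> h"]) simp_all
    thus "x = y" using * by (simp add: e)
  qed
  show "(\<lambda>(k, h). ts ! k \<otimes> h) ` ({..<L} \<times> H) = carrier G"
  proof (intro subset_antisym subsetI)
    fix g assume g: "g \<in> carrier G"
    then obtain k where k: "k < L" "inv (ts ! k) \<otimes> g \<in> H" using ex_index by blast
    have "g = ts ! k \<otimes> (inv (ts ! k) \<otimes> g)" using g k by simp
    thus "g \<in> (\<lambda>(k, h). ts ! k \<otimes> h) ` ({..<L} \<times> H)" using k by (auto intro!: rev_image_eqI)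
  qed auto
qed

lemma sum_over_transversal:
  "(\<Sum>x\<in>carrier G. f x) = (\<Sum>k<L. \<Sum>h\<in>H. (f (ts ! k \<otimes> h) :: complex))"
  using sum.reindex_bij_betw[OF transversal_bij, of f]
  by (simp add: sum.cartesian_product case_prod_unfold)

end

locale induction = transversal G H ts for G (structure) and H ts +
  fixes K :: "complex set" and d :: nat and \<sigma> :: "'a \<Rightarrow> complex mat"
  assumes K: "complex_subfield K" and rep: "matrix_rep K (subgrp G H) d \<sigma>" and d_pos: "d > 0"
begin

abbreviation "ind \<equiv> induced_rep G H ts d \<sigma>"

lemma rep_H:
  shows "\<And>h. h \<in> H \<Longrightarrow> \<sigma> h \<in> mats_over K d" "\<And>h. h \<in> H \<Longrightarrow> \<sigma> h \<in> carrier_mat d d"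
    "\<sigma> \<one> = 1\<^sub>m d"
    "\<And>g h v. g \<in> H \<Longrightarrow> h \<in> H \<Longrightarrow> v \<in> carrier_vec d \<Longrightarrow> \<sigma> (g \<otimes> h) *\<^sub>v v = \<sigma> g *\<^sub>v (\<sigma> h *\<^sub>v v)"
  using matrix_repD[OF rep] by auto

lemma ind_carrier [simp]: "ind g \<in> carrier_mat (L * d) (L * d)"
  by (simp add: induced_rep_def)

lemma ind_index:
  assumes "r < L" "l < L" "a < d" "b < d"
  shows "ind g $$ (r * d + a, l * d + b) =
    (if inv (ts ! r) \<otimes> g \<otimes> ts ! l \<in> H then \<sigma> (inv (ts ! r) \<otimes> g \<otimes> ts ! l) $$ (a, b) else 0)"
  using assms block_bound[of r L a d] block_bound[of l L b d] by (simp add: induced_rep_def Let_def)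

lemma ind_over: "g \<in> carrier G \<Longrightarrow> ind g \<in> mats_over K (L * d)"
  unfolding mats_over_def
proof safe
  fix i j assume g: "g \<in> carrier G" and ij: "i < L * d" "j < L * d"
  let ?h = "inv (ts ! (i div d)) \<otimes> g \<otimes> ts ! (j div d)"
  have "ind g $$ (i, j) = (if ?h \<in> H then \<sigma> ?h $$ (i mod d, j mod d) else 0)"
    using ij by (simp add: induced_rep_def Let_def)
  moreover have "\<sigma> ?h $$ (i mod d, j mod d) \<in> K" if "?h \<in> H"
    using rep_H(1)[OF that] d_pos by (simp add: mats_over_def)
  ultimately show "ind g $$ (i, j) \<in> K" using subfield_closed(1)[OF K] by simp
qed simp

text \<open>A block row has a single nonzero block, so the double sum of the matrix product
  collapses. All later work with the induced representation goes through this formula.\<close>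

lemma comp_ind:
  assumes g: "g \<in> carrier G" and rl: "r < L" "l < L" and h: "inv (ts ! r) \<otimes> g \<otimes> ts ! l \<in> H"
    and v: "v \<in> carrier_vec (L * d)"
  shows "block d r (ind g *\<^sub>v v) = \<sigma> (inv (ts ! r) \<otimes> g \<otimes> ts ! l) *\<^sub>v block d l v"
proof (rule eq_vecI)
  let ?h = "inv (ts ! r) \<otimes> g \<otimes> ts ! l"
  fix a assume "a < dim_vec (\<sigma> ?h *\<^sub>v block d l v)"
  hence a: "a < d" using rep_H(2)[OF h] by simp
  have "block d r (ind g *\<^sub>v v) $ a = (\<Sum>j<L * d. ind g $$ (r * d + a, j) * v $ j)"
    using a block_bound[OF rl(1) a] by (simp add: comp_index mult_mat_vec_index[OF ind_carrier v])
  also have "\<dots> = (\<Sum>k<L. \<Sum>b<d. ind g $$ (r * d + a, k * d + b) * v $ (k * d + b))"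
    by (rule sum_blocks[OF d_pos])
  also have "\<dots> = (\<Sum>k<L. if k = l then (\<Sum>b<d. \<sigma> ?h $$ (a, b) * v $ (l * d + b)) else 0)"
  proof (rule sum.cong[OF refl])
    fix k assume "k \<in> {..<L}"
    hence k: "k < L" by simp
    show "(\<Sum>b<d. ind g $$ (r * d + a, k * d + b) * v $ (k * d + b))
        = (if k = l then \<Sum>b<d. \<sigma> ?h $$ (a, b) * v $ (l * d + b) else 0)"
    proof (cases "k = l")
      case True
      have "ind g $$ (r * d + a, l * d + b) = \<sigma> ?h $$ (a, b)" if "b < d" for b
        using ind_index[OF rl a that] h by simp
      thus ?thesis using True by simp
    next
      case False
      hence "inv (ts ! r) \<otimes> g \<otimes> ts ! k \<notin> H" using row_unique[OF g rl(1) k rl(2) _ h] by blast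
      hence "ind g $$ (r * d + a, k * d + b) = 0" if "b < d" for b
        using ind_index[OF rl(1) k a that] by simp
      thus ?thesis using False by simp
    qed
  qed
  also have "\<dots> = (\<Sum>b<d. \<sigma> ?h $$ (a, b) * v $ (l * d + b))" using rl by simp
  also have "\<dots> = (\<sigma> ?h *\<^sub>v block d l v) $ a"
    using a by (simp add: mult_mat_vec_index[OF rep_H(2)[OF h]] comp_index)
  finally show "block d r (ind g *\<^sub>v v) $ a = (\<sigma> ?h *\<^sub>v block d l v) $ a" .
qed (use rep_H(2)[OF h] in \<open>simp add: block_def\<close>)

lemma matrix_rep_ind: "matrix_rep K G (L * d) ind"
  unfolding matrix_rep_def
proof (intro conjI ballI)
  show "\<And>g. g \<in> carrier G \<Longrightarrow> ind g \<in> mats_over K (L * d)" by (rule ind_over)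
  show "ind \<one> = 1\<^sub>m (L * d)"
  proof (rule mat_eq_by_action[OF _ _ K])
    fix v assume "v \<in> vecs_over K (L * d)"
    hence v: "v \<in> carrier_vec (L * d)" by (rule vecs_overD)
    show "ind \<one> *\<^sub>v v = 1\<^sub>m (L * d) *\<^sub>v v"
    proof (rule vec_eq_by_comp)
      fix r assume r: "r < L"
      have "inv (ts ! r) \<otimes> \<one> \<otimes> ts ! r = \<one>" using r by simp
      thus "block d r (ind \<one> *\<^sub>v v) = block d r (1\<^sub>m (L * d) *\<^sub>v v)"
        using comp_ind[of \<one> r r v] r v subgroup.one_closed[OF H] by (simp add: rep_H(3))
    qed (use mult_mat_vec_carrier[OF ind_carrier v] v in simp_all)
  qed auto
next
  fix g h assume gh: "g \<in> carrier G" "h \<in> carrier G"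
  show "ind (g \<otimes> h) = ind g * ind h"
  proof (rule mat_eq_by_action[OF ind_carrier mult_carrier_mat[OF ind_carrier ind_carrier] K])
    fix v assume "v \<in> vecs_over K (L * d)"
    hence v: "v \<in> carrier_vec (L * d)" by (rule vecs_overD)
    have hv: "ind h *\<^sub>v v \<in> carrier_vec (L * d)" by (rule mult_mat_vec_carrier[OF ind_carrier v])
    have "ind (g \<otimes> h) *\<^sub>v v = ind g *\<^sub>v (ind h *\<^sub>v v)"
    proof (rule vec_eq_by_comp)
      fix r assume r: "r < L"
      obtain k where k: "k < L" "inv (ts ! r) \<otimes> g \<otimes> ts ! k \<in> H" using ex_row[OF gh(1) r] by blast
      obtain l where l: "l < L" "inv (ts ! k) \<otimes> h \<otimes> ts ! l \<in> H" using ex_row[OF gh(2) k(1)] by blast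
      \<comment> \<open>The intermediate representative cancels, so the blocks of the two factors
        multiply to the block of the product.\<close>
      have e: "(inv (ts ! r) \<otimes> g \<otimes> ts ! k) \<otimes> (inv (ts ! k) \<otimes> h \<otimes> ts ! l) = inv (ts ! r) \<otimes> (g \<otimes> h) \<otimes> ts ! l"
        using gh r k l by (simp add: m_assoc)
      have c: "inv (ts ! r) \<otimes> (g \<otimes> h) \<otimes> ts ! l \<in> H"
        unfolding e[symmetric] by (rule subgroup.m_closed[OF H k(2) l(2)])
      have "block d r (ind (g \<otimes> h) *\<^sub>v v) = \<sigma> (inv (ts ! r) \<otimes> (g \<otimes> h) \<otimes> ts ! l) *\<^sub>v block d l v"
        using comp_ind[OF _ r l(1) c v] gh by simp
      also have "\<dots> = \<sigma> (inv (ts ! r) \<otimes> g \<otimes> ts ! k) *\<^sub>v (\<sigma> (inv (ts ! k) \<otimes> h \<otimes> ts ! l) *\<^sub>v block d l v)"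
        unfolding e[symmetric] by (rule rep_H(4)[OF k(2) l(2)]) simp
      also have "\<dots> = block d r (ind g *\<^sub>v (ind h *\<^sub>v v))"
        using comp_ind[OF gh(1) r k hv] comp_ind[OF gh(2) k(1) l v] by simp
      finally show "block d r (ind (g \<otimes> h) *\<^sub>v v) = block d r (ind g *\<^sub>v (ind h *\<^sub>v v))" .
    qed (use mult_mat_vec_carrier[OF ind_carrier v] mult_mat_vec_carrier[OF ind_carrier hv] in simp_all)
    thus "ind (g \<otimes> h) *\<^sub>v v = (ind g * ind h) *\<^sub>v v"
      using assoc_mult_mat_vec[OF ind_carrier ind_carrier v] by simp
  qed
qed

text \<open>The trace is a sum over the transversal, the induced character one over the whole group.
  For abelian \<open>H\<close> the summand is constant on each coset, because conjugation by
  \<open>H\<close> fixes \<open>H\<close> pointwise and preserves its complement.\<close>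

lemma afforded_ind:
  assumes fin: "finite (carrier G)" and comm: "\<And>x y. x \<in> H \<Longrightarrow> y \<in> H \<Longrightarrow> x \<otimes> y = y \<otimes> x"
    and aff: "affords (subgrp G H) d \<sigma> \<theta>"
  shows "affords G (L * d) ind (induced_char G H \<theta>)"
  unfolding affords_def
proof (rule ext)
  fix g
  have \<theta>: "\<theta> x = (if x \<in> H then \<Sum>s<d. \<sigma> x $$ (s, s) else 0)" for x
    using aff by (auto simp: affords_def afforded_character_def)
  show "afforded_character G (L * d) ind g = induced_char G H \<theta> g"
  proof (cases "g \<in> carrier G")
    case True
    note g = this
    have fH: "finite H" using fin H_carrier by (meson finite_subset subsetI)
    have cH: "card H > 0" using fH subgroup.one_closed[OF H] by (auto simp: card_gt_0_iff)
    have "afforded_character G (L * d) ind g = (\<Sum>k<L. \<Sum>s<d. ind g $$ (k * d + s, k * d + s))"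
      using g by (simp add: afforded_character_def sum_blocks[OF d_pos])
    also have "\<dots> = (\<Sum>k<L. \<theta> (inv (ts ! k) \<otimes> g \<otimes> ts ! k))"
      by (intro sum.cong refl) (auto simp: \<theta> ind_index)
    finally have 1: "afforded_character G (L * d) ind g = (\<Sum>k<L. \<theta> (inv (ts ! k) \<otimes> g \<otimes> ts ! k))" .
    have conj: "\<theta> (inv h \<otimes> y \<otimes> h) = \<theta> y" if h: "h \<in> H" and y: "y \<in> carrier G" for h y
    proof (cases "y \<in> H")
      case True
      have "inv h \<otimes> y \<otimes> h = inv h \<otimes> (h \<otimes> y)" using comm[OF h True] h y by (simp add: m_assoc)
      thus ?thesis using h y by simp
    next
      case False
      have "inv h \<otimes> y \<otimes> h \<notin> H"
      proof
        assume *: "inv h \<otimes> y \<otimes> h \<in> H"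
        have "h \<otimes> (inv h \<otimes> y \<otimes> h) \<otimes> inv h \<in> H"
          by (rule subgroup.m_closed[OF H subgroup.m_closed[OF H h *] subgroup.m_inv_closed[OF H h]])
        also have "h \<otimes> (inv h \<otimes> y \<otimes> h) \<otimes> inv h = y"
          using h y by (simp add: m_assoc)
        finally show False using False by simp
      qed
      thus ?thesis using False \<theta> by simp
    qed
    have "(\<Sum>x\<in>{x \<in> carrier G. inv x \<otimes> g \<otimes> x \<in> H}. \<theta> (inv x \<otimes> g \<otimes> x))
        = (\<Sum>x\<in>carrier G. \<theta> (inv x \<otimes> g \<otimes> x))"
      using fin \<theta> by (intro sum.mono_neutral_left) auto
    also have "\<dots> = (\<Sum>k<L. \<Sum>h\<in>H. \<theta> (inv (ts ! k \<otimes> h) \<otimes> g \<otimes> (ts ! k \<otimes> h)))"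
      by (rule sum_over_transversal)
    also have "\<dots> = (\<Sum>k<L. \<Sum>h\<in>H. \<theta> (inv (ts ! k) \<otimes> g \<otimes> ts ! k))"
    proof (intro sum.cong refl)
      fix k h assume k: "k \<in> {..<L}" and h: "h \<in> H"
      have "inv (ts ! k \<otimes> h) \<otimes> g \<otimes> (ts ! k \<otimes> h) = inv h \<otimes> (inv (ts ! k) \<otimes> g \<otimes> ts ! k) \<otimes> h"
        using k h g by (simp add: inv_mult_group m_assoc)
      thus "\<theta> (inv (ts ! k \<otimes> h) \<otimes> g \<otimes> (ts ! k \<otimes> h)) = \<theta> (inv (ts ! k) \<otimes> g \<otimes> ts ! k)"
        using conj[OF h] k g by simp
    qed
    also have "\<dots> = of_nat (card H) * (\<Sum>k<L. \<theta> (inv (ts ! k) \<otimes> g \<otimes> ts ! k))"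
      by (simp add: sum_distrib_left)
    finally show ?thesis using 1 cH g by (simp add: induced_char_def)
  qed (simp add: afforded_character_def induced_char_def)
qed

text \<open>Averaging over the conjugates of \<open>u\<close> cuts out single blocks of an invariant subspace.\<close>

lemma irreducible_ind:
  assumes irr: "irreducible_rep K (subgrp G H) d \<sigma>"
    and u: "u \<in> H" "\<sigma> u = 1\<^sub>m d" and N: "N > (0 :: nat)"
    and conj: "\<And>y c. y \<in> carrier G \<Longrightarrow> inv y \<otimes> u [^] (c :: nat) \<otimes> y \<in> H"
    and sum0: "\<And>y a b. y \<in> carrier G \<Longrightarrow> y \<notin> H \<Longrightarrow> a < d \<Longrightarrow> b < d \<Longrightarrow>
      (\<Sum>c<N. \<sigma> (inv y \<otimes> u [^] c \<otimes> y) $$ (a, b)) = 0"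
  shows "irreducible_rep K G (L * d) ind"
  unfolding irreducible_rep_def
proof (intro conjI allI impI)
  show "matrix_rep K G (L * d) ind" by (rule matrix_rep_ind)
  show "0 < L * d" using L_pos d_pos by simp
  fix W assume inv: "invariant_subspace K G (L * d) ind W"
  have WK: "W \<subseteq> vecs_over K (L * d)" and W0: "0\<^sub>v (L * d) \<in> W"
    and Wadd: "\<And>v w. v \<in> W \<Longrightarrow> w \<in> W \<Longrightarrow> v + w \<in> W"
    and Wsm: "\<And>c v. c \<in> K \<Longrightarrow> v \<in> W \<Longrightarrow> c \<cdot>\<^sub>v v \<in> W"
    and Wg: "\<And>g v. g \<in> carrier G \<Longrightarrow> v \<in> W \<Longrightarrow> ind g *\<^sub>v v \<in> W"
    using inv by (auto simp: invariant_subspace_def)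
  have Wc: "w \<in> carrier_vec (L * d)" if "w \<in> W" for w using WK that by (auto dest: vecs_overD)
  have uG: "u \<in> carrier G" using u by simp
  have uc: "u [^] c \<in> H \<and> \<sigma> (u [^] c) = 1\<^sub>m d" for c :: nat
  proof (induction c)
    case (Suc c)
    have "\<sigma> (u [^] c \<otimes> u) = \<sigma> (u [^] c) * \<sigma> u" using Suc u matrix_repD(4)[OF rep] by auto
    thus ?case using Suc u subgroup.m_closed[OF H] by simp
  qed (use subgroup.one_closed[OF H] rep_H(3) in auto)
  have cut: "blk L d l (block d l w) \<in> W" if w: "w \<in> W" and l: "l < L" for w l
  proof -
    \<comment> \<open>On block \<open>r\<close> these elements act as the conjugates of
      \<open>u ^ c\<close> by \<open>inv (ts ! l) \<otimes> ts ! r\<close>: for \<open>r = l\<close>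
      this is the identity, for other \<open>r\<close> the conjugator lies outside \<open>H\<close>
      and the sum over \<open>c\<close> vanishes.\<close>
    define f where "f c = ind (ts ! l \<otimes> u [^] c \<otimes> inv (ts ! l)) *\<^sub>v w" for c :: nat
    define E where "E = vsum (L * d) {..<N} f"
    have gG: "ts ! l \<otimes> u [^] c \<otimes> inv (ts ! l) \<in> carrier G" for c :: nat using l uG by simp
    have EW: "E \<in> W" unfolding E_def using Wg[OF gG w] by (intro vsum_in_invariant[OF inv]) (auto simp: f_def)
    have fr: "block d r (f c) = \<sigma> (inv (inv (ts ! l) \<otimes> ts ! r) \<otimes> u [^] c \<otimes> (inv (ts ! l) \<otimes> ts ! r)) *\<^sub>v block d r w"
      if r: "r < L" for r c
    proof -
      have e: "inv (ts ! r) \<otimes> (ts ! l \<otimes> u [^] c \<otimes> inv (ts ! l)) \<otimes> ts ! r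
          = inv (inv (ts ! l) \<otimes> ts ! r) \<otimes> u [^] c \<otimes> (inv (ts ! l) \<otimes> ts ! r)"
        using r l uG by (simp add: inv_mult_group m_assoc)
      have "inv (ts ! r) \<otimes> (ts ! l \<otimes> u [^] c \<otimes> inv (ts ! l)) \<otimes> ts ! r \<in> H"
        unfolding e using r l by (intro conj) simp
      from comp_ind[OF gG r r this Wc[OF w]] show ?thesis unfolding e f_def .
    qed
    have El: "block d r E = (if r = l then of_nat N \<cdot>\<^sub>v block d l w else 0\<^sub>v d)" if r: "r < L" for r
    proof (cases "r = l")
      case True
      have "block d r E = vsum d {..<N} (\<lambda>c. block d l w)"
        unfolding E_def comp_vsum[OF r] using fr[OF r] True l uc by simp
      also have "\<dots> = of_nat N \<cdot>\<^sub>v block d l w" by (rule eq_vecI) (auto simp: block_def)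
      finally show ?thesis using True by simp
    next
      case False
      let ?y = "inv (ts ! l) \<otimes> ts ! r"
      have y: "?y \<in> carrier G" "?y \<notin> H" using r l False same_coset by auto
      have "block d r E = vsum d {..<N} (\<lambda>c. \<sigma> (inv ?y \<otimes> u [^] c \<otimes> ?y) *\<^sub>v block d r w)"
        unfolding E_def comp_vsum[OF r] using fr[OF r] by simp
      also have "\<dots> = 0\<^sub>v d"
        using sum0[OF y] rep_H(2)[OF conj[OF y(1)]] by (intro sum_entries_zero_vsum) auto
      finally show ?thesis using False by simp
    qed
    have "E = of_nat N \<cdot>\<^sub>v blk L d l (block d l w)"
    proof (rule vec_eq_by_comp)
      fix r assume r: "r < L"
      show "block d r E = block d r (of_nat N \<cdot>\<^sub>v blk L d l (block d l w))"
        unfolding El[OF r] comp_smult[OF r blk_carrier] comp_blk[OF comp_carrier r]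
        by (auto intro!: eq_vecI)
    qed (auto simp: E_def)
    hence "inverse (of_nat N) \<cdot>\<^sub>v E = blk L d l (block d l w)"
      using N by (auto intro!: eq_vecI)
    moreover have "of_nat N \<in> K" using subfield_Rats[OF K] by auto
    ultimately show ?thesis using Wsm[OF _ EW] subfield_closed(6)[OF K] by metis
  qed
  show "W = {0\<^sub>v (L * d)} \<or> W = vecs_over K (L * d)"
  proof (cases "W = {0\<^sub>v (L * d)}")
    case False
    then obtain w where w: "w \<in> W" "w \<noteq> 0\<^sub>v (L * d)" using W0 by blast
    obtain l where l: "l < L" "block d l w \<noteq> 0\<^sub>v d"
      using w vec_eq_by_comp[OF Wc[OF w(1)] zero_carrier_vec] comp_zero by metis
    \<comment> \<open>The vectors whose copy in block \<open>l\<close> belongs to \<open>W\<close>: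
      an \<open>H\<close>-invariant subspace, nonzero after the cut and therefore
      everything.\<close>
    define U where "U = {x \<in> vecs_over K d. blk L d l x \<in> W}"
    \<comment> \<open>The element that carries block \<open>l\<close> to block \<open>r\<close>
      while applying \<open>h\<close>: with \<open>r = l\<close> it shows that \<open>U\<close> is
      invariant, with \<open>h\<close> trivial it spreads block \<open>l\<close> over all
      blocks.\<close>
    have shift: "ind (ts ! r \<otimes> h \<otimes> inv (ts ! l)) *\<^sub>v blk L d l x = blk L d r (\<sigma> h *\<^sub>v x)"
      if x: "x \<in> carrier_vec d" and h: "h \<in> H" and r: "r < L" for x h r
    proof (rule vec_eq_by_comp)
      fix k assume k: "k < L"
      let ?g = "ts ! r \<otimes> h \<otimes> inv (ts ! l)"
      have g: "?g \<in> carrier G" using r h l by simp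
      obtain j where j: "j < L" "inv (ts ! k) \<otimes> ?g \<otimes> ts ! j \<in> H" using ex_row[OF g k] by blast
      have e: "inv (ts ! r) \<otimes> ?g \<otimes> ts ! l = h"
        using r h l by (simp add: m_assoc)
      have kj: "k = r \<longleftrightarrow> j = l"
      proof
        assume "k = r"
        thus "j = l" using row_unique[OF g k j(1) l(1) j(2)] e h by simp
      next
        assume "j = l"
        hence *: "inv (ts ! k) \<otimes> ?g \<otimes> ts ! l \<in> H" using j by simp
        have "inv (ts ! k) \<otimes> ?g \<otimes> ts ! l \<otimes> inv h \<in> H"
          by (rule subgroup.m_closed[OF H * subgroup.m_inv_closed[OF H h]])
        also have "inv (ts ! k) \<otimes> ?g \<otimes> ts ! l \<otimes> inv h = inv (ts ! k) \<otimes> ts ! r"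
          using r h l k by (simp add: m_assoc)
        finally show "k = r" using same_coset k r by blast
      qed
      have "block d k (ind ?g *\<^sub>v blk L d l x) = \<sigma> (inv (ts ! k) \<otimes> ?g \<otimes> ts ! j) *\<^sub>v block d j (blk L d l x)"
        by (rule comp_ind[OF g k j blk_carrier])
      also have "\<dots> = (if k = r then \<sigma> h *\<^sub>v x else 0\<^sub>v d)"
      proof (cases "k = r")
        case True
        thus ?thesis using kj e comp_blk[OF x j(1), of l] by simp
      next
        case False
        thus ?thesis using kj comp_blk[OF x j(1), of l] mult_mat_zero_vec[OF rep_H(2)[OF j(2)]] by simp
      qed
      also have "\<dots> = block d k (blk L d r (\<sigma> h *\<^sub>v x))"
        using comp_blk[OF _ k, of "\<sigma> h *\<^sub>v x" d r] mult_mat_vec_carrier[OF rep_H(2)[OF h] x] by simp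
      finally show "block d k (ind ?g *\<^sub>v blk L d l x) = block d k (blk L d r (\<sigma> h *\<^sub>v x))" .
    qed (simp_all add: mult_mat_vec_carrier[OF ind_carrier blk_carrier])
    have invU: "invariant_subspace K (subgrp G H) d \<sigma> U"
      unfolding invariant_subspace_def
    proof (intro conjI ballI)
      show "U \<subseteq> vecs_over K d" by (auto simp: U_def)
      have "blk L d l (0\<^sub>v d) = 0\<^sub>v (L * d)" using d_pos by (auto intro!: eq_vecI simp: blk_def)
      thus "0\<^sub>v d \<in> U" using W0 vecs_over_zero[OF K] by (simp add: U_def)
    next
      fix x y assume xy: "x \<in> U" "y \<in> U"
      hence "dim_vec y = d" by (auto simp: U_def vecs_over_def)
      hence "blk L d l (x + y) = blk L d l x + blk L d l y"
        using d_pos by (auto intro!: eq_vecI simp: blk_def)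
      thus "x + y \<in> U" using xy Wadd vecs_over_add[OF K] by (simp add: U_def)
    next
      fix c x assume cx: "c \<in> K" "x \<in> U"
      hence "dim_vec x = d" by (auto simp: U_def vecs_over_def)
      hence "blk L d l (c \<cdot>\<^sub>v x) = c \<cdot>\<^sub>v blk L d l x"
        using d_pos by (auto intro!: eq_vecI simp: blk_def)
      thus "c \<cdot>\<^sub>v x \<in> U" using cx Wsm vecs_over_smult[OF K] by (simp add: U_def)
    next
      fix h x assume h: "h \<in> carrier (subgrp G H)" and x: "x \<in> U"
      have "blk L d l (\<sigma> h *\<^sub>v x) \<in> W"
      proof -
        have hH: "h \<in> H" using h by simp
        have xc: "x \<in> carrier_vec d" and xW: "blk L d l x \<in> W" using x by (auto simp: U_def vecs_over_def)
        have "ind (ts ! l \<otimes> h \<otimes> inv (ts ! l)) *\<^sub>v blk L d l x \<in> W"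
          using hH l by (intro Wg xW) simp
        thus ?thesis using shift[OF xc hH l(1)] by simp
      qed
      thus "\<sigma> h *\<^sub>v x \<in> U" using mats_over_mult_vec[OF K rep_H(1)] h x by (simp add: U_def)
    qed
    have "block d l w \<in> U" using cut[OF w(1) l(1)] comp_over[OF l(1)] w WK by (auto simp: U_def)
    from irreducible_repD(3)[OF irr invU this l(2)] have U: "U = vecs_over K d" .
    have blkW: "blk L d r x \<in> W" if r: "r < L" and x: "x \<in> vecs_over K d" for r x
    proof -
      have "blk L d l x \<in> W" using U x by (auto simp: U_def)
      hence "ind (ts ! r \<otimes> \<one> \<otimes> inv (ts ! l)) *\<^sub>v blk L d l x \<in> W" using r l by (intro Wg) auto
      thus ?thesis using shift[OF _ subgroup.one_closed[OF H] r, of x] x rep_H(3)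
        by (simp add: vecs_overD)
    qed
    have "v \<in> W" if v: "v \<in> vecs_over K (L * d)" for v
    proof -
      have "v = vsum (L * d) {..<L} (\<lambda>r. blk L d r (block d r v))"
      proof (rule vec_eq_by_comp)
        fix k assume k: "k < L"
        have "block d k (vsum (L * d) {..<L} (\<lambda>r. blk L d r (block d r v)))
            = vsum d {..<L} (\<lambda>r. if k = r then block d r v else 0\<^sub>v d)"
          unfolding comp_vsum[OF k] comp_blk[OF comp_carrier k] ..
        also have "\<dots> = block d k v"
        proof (rule eq_vecI)
          fix i assume "i < dim_vec (block d k v)"
          hence i: "i < d" by (simp add: block_def)
          have "(\<Sum>r<L. (if k = r then block d r v else 0\<^sub>v d) $ i) = (\<Sum>r<L. if k = r then block d r v $ i else 0)"
            using i by (intro sum.cong) auto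
          thus "vsum d {..<L} (\<lambda>r. if k = r then block d r v else 0\<^sub>v d) $ i = block d k v $ i"
            using i k by simp
        qed (simp add: block_def)
        finally show "block d k v = block d k (vsum (L * d) {..<L} (\<lambda>r. blk L d r (block d r v)))" by simp
      qed (use v in \<open>auto dest: vecs_overD\<close>)
      moreover have "vsum (L * d) {..<L} (\<lambda>r. blk L d r (block d r v)) \<in> W"
        using blkW comp_over[OF _ v] by (intro vsum_in_invariant[OF inv]) auto
      ultimately show ?thesis by simp
    qed
    thus ?thesis using WK by blast
  qed simp
qed

end

section \<open>Linear characters\<close>

text \<open>The field is a parameter because the same one-dimensional representation is used over
  the complex numbers, for irreducibility, and over the cyclotomic field, for the Schur
  index.\<close>

lemma lin_rep:
  assumes K: "complex_subfield K" and \<psi>: "\<And>g. g \<in> carrier G \<Longrightarrow> \<psi> g \<in> K" "\<psi> \<one>\<^bsub>G\<^esub> = 1"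
    and mult: "\<And>g h. g \<in> carrier G \<Longrightarrow> h \<in> carrier G \<Longrightarrow> \<psi> (g \<otimes>\<^bsub>G\<^esub> h) = \<psi> g * \<psi> h"
    and ext: "\<And>g. g \<notin> carrier G \<Longrightarrow> \<psi> g = 0"
  shows "irreducible_rep K G 1 (\<lambda>g. mat 1 1 (\<lambda>_. \<psi> g))" "affords G 1 (\<lambda>g. mat 1 1 (\<lambda>_. \<psi> g)) \<psi>"
proof -
  let ?\<rho> = "\<lambda>g. mat 1 1 (\<lambda>_. \<psi> g)"
  show "affords G 1 ?\<rho> \<psi>"
    using ext by (auto simp: affords_def afforded_character_def fun_eq_iff)
  have r: "matrix_rep K G 1 ?\<rho>"
    unfolding matrix_rep_def
    by (auto simp: mats_over_def \<psi> mult mult_mat_index[of _ 1 1 _ 1] intro!: eq_matI)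
  show "irreducible_rep K G 1 ?\<rho>"
    unfolding irreducible_rep_def
  proof (intro conjI allI impI)
    fix W assume W: "invariant_subspace K G 1 ?\<rho> W"
    show "W = {0\<^sub>v 1} \<or> W = vecs_over K 1"
    proof (cases "W = {0\<^sub>v 1}")
      case False
      then obtain w where w: "w \<in> W" "w \<noteq> 0\<^sub>v 1" using W by (auto simp: invariant_subspace_def)
      have wv: "w \<in> vecs_over K 1" using w W by (auto simp: invariant_subspace_def)
      have w0: "w $ 0 \<noteq> 0"
      proof
        assume "w $ 0 = 0"
        hence "w = 0\<^sub>v 1" using wv by (intro eq_vecI) (auto simp: vecs_over_def)
        thus False using w by simp
      qed
      have "v \<in> W" if v: "v \<in> vecs_over K 1" for v
      proof -
        have "v = (v $ 0 * inverse (w $ 0)) \<cdot>\<^sub>v w"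
          using v wv w0 by (intro eq_vecI) (auto simp: vecs_over_def)
        moreover have "v $ 0 * inverse (w $ 0) \<in> K"
          using v wv subfield_closed[OF K] by (auto simp: vecs_over_def)
        ultimately show ?thesis using W w by (metis invariant_subspace_def)
      qed
      thus ?thesis using W by (auto simp: invariant_subspace_def)
    qed simp
  qed (use r in auto)
qed

lemma lin_iff:
  "\<psi> \<in> lin G \<longleftrightarrow> (\<forall>g. g \<notin> carrier G \<longrightarrow> \<psi> g = 0) \<and> \<psi> \<one>\<^bsub>G\<^esub> = 1 \<and>
     (\<forall>g\<in>carrier G. \<forall>h\<in>carrier G. \<psi> (g \<otimes>\<^bsub>G\<^esub> h) = \<psi> g * \<psi> h)" if G: "group G"
proof
  interpret group G by fact
  assume "\<psi> \<in> lin G"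
  then obtain n \<rho> where irr: "irreducible_rep UNIV G n \<rho>" and aff: "afforded_character G n \<rho> = \<psi>"
    and one: "\<psi> \<one>\<^bsub>G\<^esub> = 1" by (auto simp: lin_def Irr_def affords_def)
  note R = matrix_repD[OF irreducible_repD(1)[OF irr]]
  have "\<psi> \<one>\<^bsub>G\<^esub> = of_nat n" using aff R(3) by (auto simp: afforded_character_def)
  hence n: "n = 1" using one by simp
  have val: "\<psi> g = \<rho> g $$ (0, 0)" if "g \<in> carrier G" for g
    using aff n that by (auto simp: afforded_character_def)
  have "\<psi> (g \<otimes>\<^bsub>G\<^esub> h) = \<psi> g * \<psi> h" if "g \<in> carrier G" "h \<in> carrier G" for g h
    using that R(4)[OF that] R(2)[OF that(1)] R(2)[OF that(2)]
    by (simp add: val n mult_mat_index[of _ 1 1 _ 1])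
  thus "(\<forall>g. g \<notin> carrier G \<longrightarrow> \<psi> g = 0) \<and> \<psi> \<one>\<^bsub>G\<^esub> = 1 \<and>
     (\<forall>g\<in>carrier G. \<forall>h\<in>carrier G. \<psi> (g \<otimes>\<^bsub>G\<^esub> h) = \<psi> g * \<psi> h)"
    using aff one by (auto simp: afforded_character_def)
next
  assume *: "(\<forall>g. g \<notin> carrier G \<longrightarrow> \<psi> g = 0) \<and> \<psi> \<one>\<^bsub>G\<^esub> = 1 \<and>
     (\<forall>g\<in>carrier G. \<forall>h\<in>carrier G. \<psi> (g \<otimes>\<^bsub>G\<^esub> h) = \<psi> g * \<psi> h)"
  show "\<psi> \<in> lin G"
    using lin_rep[OF complex_subfield_UNIV, of G \<psi>] * by (auto simp: lin_def Irr_def)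
qed

text \<open>Every eigenspace of a \<open>\<rho> x\<close> is invariant because all operators
  commute, so by irreducibility each \<open>\<rho> x\<close> is scalar.\<close>

lemma abelian_Irr_lin:
  assumes G: "group G" and comm: "\<And>x y. x \<in> carrier G \<Longrightarrow> y \<in> carrier G \<Longrightarrow> x \<otimes>\<^bsub>G\<^esub> y = y \<otimes>\<^bsub>G\<^esub> x"
  shows "Irr G = lin G"
proof
  interpret group G by fact
  show "Irr G \<subseteq> lin G"
  proof
    fix \<chi> assume c: "\<chi> \<in> Irr G"
    then obtain n \<rho> where irr: "irreducible_rep UNIV G n \<rho>" and aff: "afforded_character G n \<rho> = \<chi>"
      by (auto simp: Irr_def affords_def)
    note R = matrix_repD[OF irreducible_repD(1)[OF irr]]
    have n: "n > 0" by (rule irreducible_repD(2)[OF irr])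
    have scal: "\<exists>k. \<forall>v\<in>carrier_vec n. \<rho> x *\<^sub>v v = k \<cdot>\<^sub>v v" if x: "x \<in> carrier G" for x
    proof -
      obtain k where "eigenvalue (\<rho> x) k"
        using spectrum_non_empty[OF R(2)[OF x] n] by (auto simp: spectrum_def)
      then obtain v where v: "v \<in> carrier_vec n" "v \<noteq> 0\<^sub>v n" "\<rho> x *\<^sub>v v = k \<cdot>\<^sub>v v"
        using R(2)[OF x] by (auto simp: eigenvalue_def eigenvector_def)
      define W where "W = {v \<in> carrier_vec n. \<rho> x *\<^sub>v v = k \<cdot>\<^sub>v v}"
      have "invariant_subspace UNIV G n \<rho> W"
        unfolding invariant_subspace_def
      proof (intro conjI ballI)
        show "W \<subseteq> vecs_over UNIV n" by (auto simp: W_def vecs_over_def)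
        show "0\<^sub>v n \<in> W" using mult_mat_zero_vec[OF R(2)[OF x]] by (auto simp: W_def)
      next
        fix v w assume "v \<in> W" "w \<in> W"
        thus "v + w \<in> W" using mult_add_distrib_mat_vec[OF R(2)[OF x]]
          by (auto simp: W_def smult_add_distrib_vec)
      next
        fix c v assume "v \<in> W"
        thus "c \<cdot>\<^sub>v v \<in> W" using mult_mat_vec[OF R(2)[OF x]]
          by (auto simp: W_def smult_smult_assoc mult.commute)
      next
        fix g v assume g: "g \<in> carrier G" and v: "v \<in> W"
        hence vc: "v \<in> carrier_vec n" and kv: "\<rho> x *\<^sub>v v = k \<cdot>\<^sub>v v" by (auto simp: W_def)
        have "\<rho> x *\<^sub>v (\<rho> g *\<^sub>v v) = \<rho> g *\<^sub>v (\<rho> x *\<^sub>v v)"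
          using R(5)[OF x g vc] R(5)[OF g x vc] comm[OF x g] by metis
        also have "\<dots> = k \<cdot>\<^sub>v (\<rho> g *\<^sub>v v)" using mult_mat_vec[OF R(2)[OF g] vc] kv by simp
        finally show "\<rho> g *\<^sub>v v \<in> W" using mult_mat_vec_carrier[OF R(2)[OF g] vc] by (simp add: W_def)
      qed
      hence "W = vecs_over UNIV n"
        by (rule irreducible_repD(3)[OF irr, of _ v]) (use v in \<open>auto simp: W_def\<close>)
      thus ?thesis by (auto simp: W_def vecs_over_def)
    qed
    \<comment> \<open>Under scalar operators every line is invariant, so the first coordinate axis
      must be the whole space.\<close>
    define W where "W = {v :: complex vec. v \<in> carrier_vec n \<and> (\<forall>i<n. i \<noteq> 0 \<longrightarrow> v $ i = 0)}"
    have "invariant_subspace UNIV G n \<rho> W"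
      unfolding invariant_subspace_def
    proof (intro conjI ballI)
      fix g v assume g: "g \<in> carrier G" and v: "v \<in> W"
      obtain k where "\<forall>v\<in>carrier_vec n. \<rho> g *\<^sub>v v = k \<cdot>\<^sub>v v" using scal[OF g] by blast
      thus "\<rho> g *\<^sub>v v \<in> W" using v by (auto simp: W_def)
    qed (auto simp: W_def vecs_over_def)
    moreover have "unit_vec n 0 \<in> W" "unit_vec n 0 \<noteq> 0\<^sub>v n"
      using n by (auto simp: W_def)
    ultimately have W: "W = vecs_over UNIV n" by (rule irreducible_repD(3)[OF irr])
    have "n = 1"
    proof (rule ccontr)
      assume "n \<noteq> 1"
      hence n1: "1 < n" using n by simp
      have "unit_vec n 1 \<in> W" unfolding W by (simp add: vecs_over_def)
      thus False using n1 by (auto simp: W_def)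
    qed
    hence "\<chi> \<one>\<^bsub>G\<^esub> = 1" using aff R(3) by (auto simp: afforded_character_def)
    thus "\<chi> \<in> lin G" using c by (simp add: lin_def)
  qed
qed (auto simp: lin_def)

section \<open>Groups whose commutator subgroup is central of prime order\<close>

context group
begin

lemma cancel_inv [simp]:
  assumes "x \<in> carrier G" "y \<in> carrier G"
  shows "inv x \<otimes> (x \<otimes> y) = y" "x \<otimes> (inv x \<otimes> y) = y"
  using assms by (simp_all add: m_assoc[symmetric])

lemma commutator_closed [simp]:
  "x \<in> carrier G \<Longrightarrow> y \<in> carrier G \<Longrightarrow> commutator G x y \<in> carrier G"
  by (simp add: commutator_def)

lemma commutator_in_derived:
  assumes "x \<in> carrier G" "y \<in> carrier G"
  shows "commutator G x y \<in> commutator_subgroup G"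
proof -
  \<comment> \<open>\<open>derived_set\<close> consists of the products h k inv(h) inv(k), so the
    commutator convention used here is met at the inverses of \<open>x\<close> and
    \<open>y\<close>.\<close>
  have "commutator G x y \<in> derived_set G (carrier G)"
    by (intro UN_I[of "inv x"] UN_I[of "inv y"]) (use assms in \<open>simp_all add: commutator_def\<close>)
  thus ?thesis unfolding derived_def by (rule generate.incl)
qed

lemma conj_eq_commutator:
  "x \<in> carrier G \<Longrightarrow> y \<in> carrier G \<Longrightarrow> inv y \<otimes> x \<otimes> y = x \<otimes> commutator G x y"
  by (simp add: commutator_def m_assoc)

lemma mult_commute_commutator:
  "x \<in> carrier G \<Longrightarrow> y \<in> carrier G \<Longrightarrow> x \<otimes> y = y \<otimes> x \<otimes> commutator G x y"
  by (simp add: commutator_def m_assoc)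

lemma commutator_eq_one_iff:
  assumes "x \<in> carrier G" "y \<in> carrier G"
  shows "commutator G x y = \<one> \<longleftrightarrow> x \<otimes> y = y \<otimes> x"
proof
  assume "commutator G x y = \<one>"
  thus "x \<otimes> y = y \<otimes> x" using mult_commute_commutator[OF assms] assms by simp
next
  assume "x \<otimes> y = y \<otimes> x"
  hence "y \<otimes> x \<otimes> commutator G x y = y \<otimes> x \<otimes> \<one>"
    using mult_commute_commutator[OF assms] assms by simp
  thus "commutator G x y = \<one>" using assms by (simp del: r_one)
qed

lemma center_subgroup: "subgroup (center_of G) G"
proof (rule subgroupI)
  show "center_of G \<noteq> {}" by (auto simp: center_of_def intro!: exI[of _ "\<one>"])
next
  fix z assume z: "z \<in> center_of G"
  have "inv z \<otimes> g = g \<otimes> inv z" if g: "g \<in> carrier G" for g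
  proof -
    have zG: "z \<in> carrier G" and e: "inv g \<otimes> z = z \<otimes> inv g" using z g by (auto simp: center_of_def)
    show ?thesis using arg_cong[OF e, of "m_inv G"] zG g by (simp add: inv_mult_group)
  qed
  thus "inv z \<in> center_of G" using z by (simp add: center_of_def)
next
  fix z w assume zw: "z \<in> center_of G" "w \<in> center_of G"
  hence c: "z \<in> carrier G" "w \<in> carrier G" by (auto simp: center_of_def)
  have "z \<otimes> w \<otimes> g = g \<otimes> (z \<otimes> w)" if g: "g \<in> carrier G" for g
  proof -
    have wg: "w \<otimes> g = g \<otimes> w" and zg: "z \<otimes> g = g \<otimes> z" using zw g by (auto simp: center_of_def)
    have "z \<otimes> w \<otimes> g = z \<otimes> (g \<otimes> w)" using m_assoc[OF c g] wg by simp
    also have "\<dots> = z \<otimes> g \<otimes> w" using m_assoc[OF c(1) g c(2)] by simp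
    also have "\<dots> = g \<otimes> z \<otimes> w" by (simp only: zg)
    finally show ?thesis using c g by (simp add: m_assoc)
  qed
  thus "z \<otimes> w \<in> center_of G" using c by (simp add: center_of_def)
qed (auto simp: center_of_def)

lemma subgroup_nat_pow: "subgroup H G \<Longrightarrow> x \<in> H \<Longrightarrow> x [^] (n :: nat) \<in> H"
  by (induction n) (auto simp: subgroup.one_closed subgroup.m_closed)

lemma pow_cancel:
  assumes x: "x \<in> carrier G" and e: "x [^] i = x [^] j" and ij: "(i :: nat) \<le> j"
  shows "x [^] (j - i) = \<one>"
proof -
  have "x [^] i \<otimes> x [^] (j - i) = x [^] (i + (j - i))" by (rule nat_pow_mult[OF x])
  also have "i + (j - i) = j" using ij by simp
  finally have "x [^] i \<otimes> x [^] (j - i) = x [^] i \<otimes> \<one>" using x e by simp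
  thus ?thesis using x by (simp del: r_one)
qed

lemma conj_pow:
  assumes "x \<in> carrier G" "y \<in> carrier G"
  shows "(inv y \<otimes> x \<otimes> y) [^] (n :: nat) = inv y \<otimes> x [^] n \<otimes> y"
proof (induction n)
  case (Suc n)
  thus ?case using assms by (simp add: m_assoc)
qed (use assms in simp)

end

text \<open>The abstract properties that carry the representation theory. The index of the centre
  enters as an upper bound, which is what reducing exponents in a normal form provides.\<close>

locale phi2_group = group G for G (structure) +
  fixes p N :: nat
  assumes prime_p: "prime p" and ord: "Coset.order G = p ^ N"
    and D_central: "commutator_subgroup G \<subseteq> center_of G"
    and card_D: "card (commutator_subgroup G) = p"
    and ord_le: "Coset.order G \<le> p ^ 2 * card (center_of G)"
begin

abbreviation "Z \<equiv> center_of G"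
abbreviation "D \<equiv> commutator_subgroup G"
abbreviation "com \<equiv> commutator G"

lemma p_gt1: "p > 1" using prime_p prime_gt_1_nat by blast

lemma fin: "finite (carrier G)"
proof -
  have "card (carrier G) > 0" using ord p_gt1 by (simp add: Coset.order_def)
  thus ?thesis by (rule card_ge_0_finite)
qed

lemma Z_carrier [simp]: "z \<in> Z \<Longrightarrow> z \<in> carrier G" by (simp add: center_of_def)
lemma Z_comm: "z \<in> Z \<Longrightarrow> g \<in> carrier G \<Longrightarrow> z \<otimes> g = g \<otimes> z" unfolding center_of_def by blast
lemma com_Z [simp]: "x \<in> carrier G \<Longrightarrow> y \<in> carrier G \<Longrightarrow> com x y \<in> Z"
  using commutator_in_derived D_central by blast
lemma D_Z [simp]: "c \<in> D \<Longrightarrow> c \<in> Z" using D_central by blast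

lemma Z_closed [simp]:
  "\<one> \<in> Z" "x \<in> Z \<Longrightarrow> y \<in> Z \<Longrightarrow> x \<otimes> y \<in> Z" "x \<in> Z \<Longrightarrow> inv x \<in> Z" "x \<in> Z \<Longrightarrow> x [^] (n :: nat) \<in> Z"
  by (rule subgroup.one_closed[OF center_subgroup], rule subgroup.m_closed[OF center_subgroup],
      assumption+, rule subgroup.m_inv_closed[OF center_subgroup], assumption,
      rule subgroup_nat_pow[OF center_subgroup], assumption)

lemma D_subgroup: "subgroup D G" by (rule derived_is_subgroup) simp

text \<open>Central commutators make the commutator multiplicative in each argument: conjugating by
  \<open>y\<close> and then by \<open>z\<close> multiplies \<open>x\<close> by both commutators in
  turn.\<close>

lemma com_mult_right:
  assumes "x \<in> carrier G" "y \<in> carrier G" "z \<in> carrier G"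
  shows "com x (y \<otimes> z) = com x y \<otimes> com x z"
proof -
  have "x \<otimes> com x (y \<otimes> z) = inv z \<otimes> (inv y \<otimes> x \<otimes> y) \<otimes> z"
    using assms by (simp add: conj_eq_commutator[symmetric] inv_mult_group m_assoc)
  also have "\<dots> = inv z \<otimes> (x \<otimes> com x y) \<otimes> z" using assms by (simp add: conj_eq_commutator)
  also have "\<dots> = inv z \<otimes> x \<otimes> z \<otimes> com x y"
    using assms Z_comm[of "com x y" z] by (simp add: m_assoc)
  also have "\<dots> = x \<otimes> com x z \<otimes> com x y" using assms by (simp add: conj_eq_commutator)
  also have "\<dots> = x \<otimes> (com x y \<otimes> com x z)"
    using assms Z_comm[of "com x z" "com x y"] by (simp add: m_assoc)
  finally show ?thesis using assms by simp
qed

lemma com_mult_left: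
  assumes "x \<in> carrier G" "y \<in> carrier G" "z \<in> carrier G"
  shows "com (x \<otimes> y) z = com x z \<otimes> com y z"
proof -
  have "x \<otimes> y \<otimes> com (x \<otimes> y) z = (inv z \<otimes> x \<otimes> z) \<otimes> (inv z \<otimes> y \<otimes> z)"
    using assms by (simp add: conj_eq_commutator[symmetric] m_assoc)
  also have "\<dots> = (x \<otimes> com x z) \<otimes> (y \<otimes> com y z)" using assms by (simp add: conj_eq_commutator)
  also have "\<dots> = x \<otimes> (com x z \<otimes> y) \<otimes> com y z" using assms by (simp add: m_assoc)
  also have "\<dots> = x \<otimes> y \<otimes> (com x z \<otimes> com y z)"
    using assms by (simp add: Z_comm[of "com x z" y] m_assoc)
  finally show ?thesis using assms by simp
qed

lemma com_central [simp]:
  "z \<in> Z \<Longrightarrow> x \<in> carrier G \<Longrightarrow> com x z = \<one>" "z \<in> Z \<Longrightarrow> x \<in> carrier G \<Longrightarrow> com z x = \<one>"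
  by (auto simp: commutator_eq_one_iff Z_comm)

lemma com_pow_right:
  assumes "x \<in> carrier G" "y \<in> carrier G"
  shows "com x (y [^] (n :: nat)) = com x y [^] n"
  by (induction n) (use assms in \<open>simp_all add: com_mult_right\<close>)

lemma com_pow_left:
  assumes "x \<in> carrier G" "y \<in> carrier G"
  shows "com (x [^] (n :: nat)) y = com x y [^] n"
  by (induction n) (use assms in \<open>simp_all add: com_mult_left\<close>)

lemma pow_order [simp]: "x \<in> carrier G \<Longrightarrow> x [^] (p ^ N) = \<one>"
  using pow_order_eq_1[of x] ord by simp

lemma D_pow: assumes c: "c \<in> D" shows "c [^] p = \<one>"
proof -
  interpret D: group "subgrp G D" by (rule subgroup_imp_group[OF D_subgroup])
  have "Coset.order (subgrp G D) = p" using card_D by (simp add: Coset.order_def)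
  hence "c [^]\<^bsub>subgrp G D\<^esub> p = \<one>" using D.pow_order_eq_1[of c] c by simp
  thus ?thesis by (simp add: nat_pow_consistent[symmetric])
qed

lemma com_pow_p: "x \<in> carrier G \<Longrightarrow> y \<in> carrier G \<Longrightarrow> com x y [^] p = \<one>"
  by (rule D_pow[OF commutator_in_derived])

text \<open>The commutator of \<open>x ^ p\<close> with \<open>g\<close> is the p-th power of that
  of \<open>x\<close> with \<open>g\<close>, an element of a group of order
  \<open>p\<close>.\<close>

lemma pow_p_central: assumes "x \<in> carrier G" shows "x [^] p \<in> Z"
proof -
  have "x [^] p \<otimes> g = g \<otimes> x [^] p" if "g \<in> carrier G" for g
    using assms that com_pow_left[of x g p] com_pow_p[of x g]
    by (simp add: commutator_eq_one_iff[symmetric])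
  moreover have "x [^] p \<in> carrier G" using assms by simp
  ultimately show ?thesis unfolding center_of_def by blast
qed

lemma pow_eq_one_dvd:
  assumes c: "c \<in> carrier G" and cp: "c [^] p = \<one>" and "c \<noteq> \<one>"
  shows "c [^] (n :: nat) = \<one> \<longleftrightarrow> p dvd n"
proof
  assume n: "c [^] n = \<one>"
  show "p dvd n"
  proof (rule ccontr)
    assume "\<not> p dvd n"
    hence "gcd p n = 1" by (intro coprime_imp_gcd_eq_1 prime_imp_coprime[OF prime_p])
    hence "gcd n p = 1" by (simp add: gcd.commute)
    moreover have "n \<noteq> 0" using \<open>\<not> p dvd n\<close> by (metis dvd_0_right)
    ultimately obtain a b where ab: "n * a = p * b + 1" using bezout_nat[of n p] by auto
    have "c [^] (n * a) = \<one>" using c n by (simp add: nat_pow_pow[symmetric])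
    moreover have "c [^] (p * b + 1) = c" using c cp by (simp add: nat_pow_mult[symmetric] nat_pow_pow[symmetric])
    ultimately show False using ab \<open>c \<noteq> \<one>\<close> by simp
  qed
next
  assume "p dvd n"
  thus "c [^] n = \<one>" using c cp by (auto simp: nat_pow_pow[symmetric] elim!: dvdE)
qed

text \<open>The first \<open>p\<close> powers of a nontrivial element are distinct and so exhaust a
  group of order \<open>p\<close>.\<close>

lemma D_generated:
  assumes c: "c \<in> D" "c \<noteq> \<one>" and e: "e \<in> D"
  shows "\<exists>i<p. e = c [^] i"
proof -
  have cG: "c \<in> carrier G" using c by simp
  have "inj_on (\<lambda>i. c [^] i) {..<p}"
  proof (rule inj_onI)
    have *: "i = j" if "i < p" "j < p" "c [^] i = c [^] j" "i \<le> j" for i j :: nat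
    proof -
      have "c [^] (j - i) = \<one>" using pow_cancel[OF cG that(3,4)] .
      hence "p dvd j - i" using pow_eq_one_dvd[OF cG D_pow[OF c(1)] c(2)] by simp
      thus ?thesis using that by (auto dest: dvd_imp_le)
    qed
    fix i j assume "i \<in> {..<p}" "j \<in> {..<p}" "c [^] i = c [^] j"
    thus "i = j" using *[of i j] *[of j i] by (cases "i \<le> j") auto
  qed
  hence "card ((\<lambda>i. c [^] i) ` {..<p}) = card D" by (simp add: card_image card_D)
  moreover have "(\<lambda>i. c [^] i) ` {..<p} \<subseteq> D" using subgroup_nat_pow[OF D_subgroup c(1)] by auto
  moreover have "finite D" using card_D p_gt1 by (intro card_ge_0_finite) simp
  ultimately have "(\<lambda>i. c [^] i) ` {..<p} = D" by (intro card_subset_eq) auto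
  thus ?thesis using e by auto
qed

definition Cen :: "'a \<Rightarrow> 'a set" where
  "Cen h = {x \<in> carrier G. x \<otimes> h = h \<otimes> x}"

lemma Cen_iff: "h \<in> carrier G \<Longrightarrow> x \<in> Cen h \<longleftrightarrow> x \<in> carrier G \<and> com h x = \<one>"
  by (auto simp: Cen_def commutator_eq_one_iff)

lemma Cen_carrier: "x \<in> Cen h \<Longrightarrow> x \<in> carrier G" by (simp add: Cen_def)

lemma Cen_subgroup: assumes h: "h \<in> carrier G" shows "subgroup (Cen h) G"
proof (rule subgroupI)
  show "Cen h \<subseteq> carrier G" by (auto simp: Cen_def)
  show "Cen h \<noteq> {}" using h by (auto simp: Cen_def intro!: exI[of _ "\<one>"])
next
  fix x assume x: "x \<in> Cen h"
  hence xG: "x \<in> carrier G" by (simp add: Cen_def)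
  have "com h x \<otimes> com h (inv x) = com h (x \<otimes> inv x)" using com_mult_right[OF h xG, of "inv x"] xG by simp
  hence "com h (inv x) = \<one>" using x xG h by (simp add: Cen_iff)
  thus "inv x \<in> Cen h" using xG h by (simp add: Cen_iff)
next
  fix x y assume "x \<in> Cen h" "y \<in> Cen h"
  thus "x \<otimes> y \<in> Cen h" using h by (simp add: Cen_iff com_mult_right)
qed

end

section \<open>The centralizer of a non-central element\<close>

locale phi2_pair = phi2_group G p N for G (structure) and p N +
  fixes u :: 'a
  assumes uG [simp]: "u \<in> carrier G" and uZ: "u \<notin> center_of G"
begin

abbreviation "H \<equiv> Cen u"

lemma H_subgroup: "subgroup H G" by (rule Cen_subgroup) simp

lemma ex_t: obtains t where "t \<in> carrier G" "com u t \<noteq> \<one>"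
proof -
  obtain t where t: "t \<in> carrier G" "u \<otimes> t \<noteq> t \<otimes> u"
    using uZ uG unfolding center_of_def by blast
  hence "com u t \<noteq> \<one>" using commutator_eq_one_iff[OF uG t(1)] by blast
  thus thesis using that t by blast
qed

lemma notin_H: "y \<in> carrier G \<Longrightarrow> y \<notin> H \<longleftrightarrow> com u y \<noteq> \<one>"
  by (simp add: Cen_iff)

lemma Z_H [simp]: "z \<in> Z \<Longrightarrow> z \<in> H" by (simp add: Cen_iff)

lemma u_H [simp]: "u \<in> H" by (simp add: Cen_def)

text \<open>The map x |-> [u, x] is a homomorphism onto the commutator subgroup with kernel
  \<open>H\<close>. Concretely, the powers \<open>t ^ i\<close> with \<open>i < p\<close> of an
  element not commuting with \<open>u\<close> represent the cosets of \<open>H\<close>.\<close>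

lemma order_H: "Coset.order G = p * card H"
proof -
  obtain t where t: "t \<in> carrier G" "com u t \<noteq> \<one>" by (rule ex_t)
  have c: "com u t \<in> D" using t by (intro commutator_in_derived) auto
  have val: "com u (x \<otimes> t [^] i) = com u t [^] i" if "x \<in> H" for x and i :: nat
    using that t by (simp add: Cen_iff com_mult_right com_pow_right)
  have inj: "inj_on (\<lambda>(x, i). x \<otimes> t [^] (i :: nat)) (H \<times> {..<p})"
  proof (rule inj_onI)
    fix a b assume ab: "a \<in> H \<times> {..<p}" "b \<in> H \<times> {..<p}"
      "(case a of (x, i) \<Rightarrow> x \<otimes> t [^] i) = (case b of (x, i) \<Rightarrow> x \<otimes> t [^] i)"
    obtain x i y j where e: "a = (x, i)" "b = (y, j)" by (cases a, cases b)
    have x: "x \<in> H" "i < p" "y \<in> H" "j < p" and eq: "x \<otimes> t [^] i = y \<otimes> t [^] j"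
      using ab by (auto simp: e)
    have cij: "com u t [^] i = com u t [^] j" using val[OF x(1), of i] val[OF x(3), of j] eq by simp
    have *: "i = j" if "i < p" "j < p" "com u t [^] i = com u t [^] j" "i \<le> j" for i j :: nat
    proof -
      have "com u t [^] (j - i) = \<one>" using pow_cancel[OF _ that(3,4)] t by simp
      hence "p dvd j - i" using pow_eq_one_dvd[OF _ D_pow[OF c] t(2)] t by simp
      thus ?thesis using that by (auto dest: dvd_imp_le)
    qed
    have "i = j" using *[OF x(2,4) cij] *[OF x(4,2) cij[symmetric]] by (cases "i \<le> j") auto
    thus "a = b" using eq x t by (simp add: e Cen_carrier)
  qed
  have "(\<lambda>(x, i). x \<otimes> t [^] (i :: nat)) ` (H \<times> {..<p}) = carrier G"
  proof (intro subset_antisym subsetI)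
    fix g assume g: "g \<in> carrier G"
    have "com u g \<in> D" using g by (intro commutator_in_derived) auto
    then obtain i where i: "i < p" "com u g = com u t [^] i" using D_generated[OF c t(2)] by blast
    define x where "x = g \<otimes> inv (t [^] i)"
    have xG: "x \<in> carrier G" using g t by (simp add: x_def)
    have gx: "g = x \<otimes> t [^] i" using g t by (simp add: x_def m_assoc)
    have "com u x \<otimes> com u t [^] i = \<one> \<otimes> com u t [^] i"
      using xG t i(2)[symmetric] unfolding gx by (simp add: com_mult_right com_pow_right)
    hence "com u x = \<one>" using xG t by (simp del: l_one)
    hence "x \<in> H" using xG by (simp add: Cen_iff)
    thus "g \<in> (\<lambda>(x, i). x \<otimes> t [^] (i :: nat)) ` (H \<times> {..<p})" using gx i by (auto intro!: rev_image_eqI)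
  qed (use t in \<open>auto dest: Cen_carrier\<close>)
  hence "card (carrier G) = card (H \<times> {..<p})" using card_image[OF inj] by simp
  thus ?thesis by (simp add: Coset.order_def card_cartesian_product)
qed

lemma pow_in_Z_iff: "u [^] (n :: nat) \<in> Z \<longleftrightarrow> p dvd n"
proof
  obtain t where t: "t \<in> carrier G" "com u t \<noteq> \<one>" by (rule ex_t)
  assume "u [^] n \<in> Z"
  hence "com u t [^] n = \<one>" using t com_pow_left[of u t n] by simp
  thus "p dvd n" using pow_eq_one_dvd[of "com u t" n] t com_pow_p[of u t] by simp
next
  assume "p dvd n"
  thus "u [^] n \<in> Z" using pow_p_central[of u] by (auto simp: nat_pow_pow[symmetric] elim!: dvdE)
qed

text \<open>Counting: the \<open>p\<close> times \<open>card Z\<close> products lie in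
  \<open>H\<close>, are distinct by \<open>pow_in_Z_iff\<close>, and \<open>H\<close> has no more
  elements because of the bound on the index of the centre. Commutativity of \<open>H\<close>
  follows from this form.\<close>

lemma H_elements:
  assumes "x \<in> H"
  obtains i z where "i < p" "z \<in> Z" "x = u [^] (i :: nat) \<otimes> z"
proof -
  define S where "S = (\<lambda>(i, z). u [^] (i :: nat) \<otimes> z) ` ({..<p} \<times> Z)"
  have "inj_on (\<lambda>(i, z). u [^] (i :: nat) \<otimes> z) ({..<p} \<times> Z)"
  proof (rule inj_onI)
    fix a b assume ab: "a \<in> {..<p} \<times> Z" "b \<in> {..<p} \<times> Z"
      "(case a of (i, z) \<Rightarrow> u [^] i \<otimes> z) = (case b of (i, z) \<Rightarrow> u [^] i \<otimes> z)"
    obtain i z j w where e: "a = (i, z)" "b = (j, w)" by (cases a, cases b)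
    have x: "i < p" "z \<in> Z" "j < p" "w \<in> Z" and eq: "u [^] i \<otimes> z = u [^] j \<otimes> w"
      using ab by (auto simp: e)
    have *: "i = j" if "i < p" "j < p" "z \<in> Z" "w \<in> Z" "u [^] i \<otimes> z = u [^] j \<otimes> w" "i \<le> j"
      for i j :: nat and z w
    proof -
      have "u [^] i \<otimes> u [^] (j - i) = u [^] j"
        using nat_pow_mult[OF uG, of i "j - i"] that(6) by simp
      hence "u [^] i \<otimes> z = u [^] i \<otimes> (u [^] (j - i) \<otimes> w)"
        using that by (simp add: m_assoc[symmetric])
      hence "z = u [^] (j - i) \<otimes> w" using that by simp
      hence "u [^] (j - i) = z \<otimes> inv w" using that by (simp add: m_assoc)
      hence "p dvd j - i" using that pow_in_Z_iff[of "j - i"] by simp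
      thus ?thesis using that by (auto dest: dvd_imp_le)
    qed
    have "i = j" using *[OF x(1,3,2,4) eq] *[OF x(3,1,4,2) eq[symmetric]] by (cases "i \<le> j") auto
    thus "a = b" using eq x by (simp add: e)
  qed
  hence "card S = p * card Z" by (simp add: S_def card_image card_cartesian_product)
  moreover have "p * card H \<le> p * (p * card Z)"
    using ord_le unfolding order_H by (simp add: power2_eq_square mult.assoc)
  moreover have "finite H" using fin by (rule rev_finite_subset) (auto simp: Cen_def)
  moreover have "S \<subseteq> H"
    using subgroup.m_closed[OF H_subgroup subgroup_nat_pow[OF H_subgroup u_H] Z_H]
    by (auto simp: S_def)
  ultimately have "S = H" using p_gt1 by (intro card_seteq) auto
  hence "x \<in> S" using assms by simp
  thus ?thesis using that unfolding S_def by auto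
qed

lemma H_comm: assumes "x \<in> H" "y \<in> H" shows "x \<otimes> y = y \<otimes> x"
proof -
  obtain i z where x: "z \<in> Z" "x = u [^] (i :: nat) \<otimes> z" using H_elements[OF assms(1)] by metis
  have yG: "y \<in> carrier G" using assms by (auto dest: Cen_carrier)
  have "com (u [^] i \<otimes> z) y = \<one>"
    using x yG assms by (simp add: com_mult_left com_pow_left Cen_iff)
  thus ?thesis using x yG by (simp add: commutator_eq_one_iff)
qed

lemma conj_H: assumes "x \<in> H" "y \<in> carrier G" shows "inv y \<otimes> x \<otimes> y \<in> H"
  using assms Cen_carrier[OF assms(1)]
  by (simp add: conj_eq_commutator subgroup.m_closed[OF H_subgroup])

lemma conj_notin_H: assumes "x \<in> carrier G" "x \<notin> H" "y \<in> carrier G" shows "inv y \<otimes> x \<otimes> y \<notin> H"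
proof
  assume *: "inv y \<otimes> x \<otimes> y \<in> H"
  have "inv (inv y) \<otimes> (inv y \<otimes> x \<otimes> y) \<otimes> inv y \<in> H" by (rule conj_H[OF *]) (use assms in simp)
  moreover have "inv (inv y) \<otimes> (inv y \<otimes> x \<otimes> y) \<otimes> inv y = x" using assms by (simp add: m_assoc)
  ultimately show False using assms by simp
qed

text \<open>A listed pair contains a generator \<open>h\<close> that differs from \<open>u\<close>
  by a central factor; \<open>u\<close> is recovered once the centre is generated.\<close>

lemma generate_eq_H:
  assumes A: "A \<subseteq> H" and Z: "Z \<subseteq> generate G A" and u: "h \<in> A" "z \<in> Z" "u = h \<otimes> z"
  shows "generate G A = H"
proof
  show "generate G A \<subseteq> H" by (rule generate_subgroup_incl[OF A H_subgroup])
  have S: "subgroup (generate G A) G" using A by (intro generate_is_subgroup) (auto dest: Cen_carrier)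
  have "h \<in> generate G A" using u(1) by (rule generate.incl)
  hence uS: "u \<in> generate G A" unfolding u(3) using subgroup.m_closed[OF S] Z u(2) by blast
  show "H \<subseteq> generate G A"
  proof
    fix x assume "x \<in> H"
    then obtain i z where "z \<in> Z" "x = u [^] (i :: nat) \<otimes> z" using H_elements by metis
    thus "x \<in> generate G A" using subgroup.m_closed[OF S subgroup_nat_pow[OF S uS]] Z by blast
  qed
qed

end

section \<open>The rational representation of a cyclic group of prime power order\<close>

context prime_power
begin

definition expo :: "complex \<Rightarrow> complex \<Rightarrow> nat" where
  "expo x y = (SOME j. y = x ^ j)"

lemma expo: assumes "proot x" "y ^ m = 1" shows "x ^ expo x y = y"
proof -
  have "\<exists>j. y = x ^ j" using root_is_power[OF assms] by blast
  thus ?thesis unfolding expo_def by (metis (mono_tags) someI_ex)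
qed

text \<open>Multiplication by \<open>y\<close> on the cyclotomic field in the basis of powers of
  \<open>x\<close>: column \<open>b\<close> holds the coordinates of
  \<open>y * x ^ b\<close>.\<close>

definition cyc_mat :: "complex \<Rightarrow> complex \<Rightarrow> complex mat" where
  "cyc_mat x y = mat d d (\<lambda>(a, b). cf a (expo x y + b))"

text \<open>Turns coordinates back into a field element. It is injective on rational vectors, so
  identities between the matrices reduce to identities between complex numbers.\<close>

definition ev :: "complex \<Rightarrow> complex vec \<Rightarrow> complex" where
  "ev x v = (\<Sum>b<d. v $ b * x ^ b)"

lemma cyc_mat_carrier [simp]: "cyc_mat x y \<in> carrier_mat d d"
  by (simp add: cyc_mat_def)

lemma cyc_mat_over: "cyc_mat x y \<in> mats_over \<rat> d"
  by (auto simp: mats_over_def cyc_mat_def cf_Rats)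

lemma ev_inj:
  assumes x: "proot x" and v: "v \<in> vecs_over \<rat> d" "w \<in> vecs_over \<rat> d" and e: "ev x v = ev x w"
  shows "v = w"
proof (rule eq_vecI)
  fix i assume "i < dim_vec w"
  hence i: "i < d" using v by (auto simp: vecs_over_def)
  have "(\<Sum>b<d. (v $ b - w $ b) * x ^ b) = 0"
    using e by (simp add: ev_def left_diff_distrib sum_subtractf)
  hence "v $ i - w $ i = 0"
    using v i by (intro proot_independent[OF x, of "\<lambda>b. v $ b - w $ b" i]) (auto simp: vecs_over_def)
  thus "v $ i = w $ i" by simp
qed (use v in \<open>auto simp: vecs_over_def\<close>)

lemma ev_cyc_mat:
  assumes x: "proot x" and y: "y ^ m = 1" and v: "v \<in> carrier_vec d"
  shows "ev x (cyc_mat x y *\<^sub>v v) = y * ev x v"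
proof -
  have "ev x (cyc_mat x y *\<^sub>v v) = (\<Sum>a<d. (\<Sum>b<d. cf a (expo x y + b) * v $ b) * x ^ a)"
    unfolding ev_def
    by (intro sum.cong refl) (simp add: mult_mat_vec_index[OF cyc_mat_carrier v], simp add: cyc_mat_def)
  also have "\<dots> = (\<Sum>b<d. v $ b * (\<Sum>a<d. cf a (expo x y + b) * x ^ a))"
    by (simp add: sum_distrib_right sum_distrib_left, subst sum.swap) (simp add: ac_simps)
  also have "\<dots> = (\<Sum>b<d. v $ b * (y * x ^ b))"
    by (simp add: cf_proot[OF x, symmetric] power_add expo[OF x y] del: One_nat_def)
  also have "\<dots> = y * ev x v" by (simp add: ev_def sum_distrib_left ac_simps)
  finally show ?thesis .
qed

lemma cyc_mat_mult:
  assumes x: "proot x" and y: "y ^ m = 1" and z: "z ^ m = 1"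
  shows "cyc_mat x (y * z) = cyc_mat x y * cyc_mat x z"
proof (rule mat_eq_by_action[OF cyc_mat_carrier mult_carrier_mat[OF cyc_mat_carrier cyc_mat_carrier]
      complex_subfield_Rats])
  fix v assume v: "v \<in> vecs_over \<rat> d"
  hence c: "v \<in> carrier_vec d" by (rule vecs_overD)
  have zc: "cyc_mat x z *\<^sub>v v \<in> carrier_vec d" by (rule mult_mat_vec_carrier[OF cyc_mat_carrier c])
  have yz: "(y * z) ^ m = 1" using y z by (simp add: power_mult_distrib)
  note o = mats_over_mult_vec[OF complex_subfield_Rats cyc_mat_over]
  have "cyc_mat x (y * z) *\<^sub>v v = cyc_mat x y *\<^sub>v (cyc_mat x z *\<^sub>v v)"
    by (rule ev_inj[OF x o[OF v] o[OF o[OF v]]])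
      (simp add: ev_cyc_mat[OF x yz c] ev_cyc_mat[OF x y zc] ev_cyc_mat[OF x z c])
  thus "cyc_mat x (y * z) *\<^sub>v v = (cyc_mat x y * cyc_mat x z) *\<^sub>v v"
    using assoc_mult_mat_vec[OF cyc_mat_carrier cyc_mat_carrier c] by simp
qed

lemma cyc_mat_one:
  assumes x: "proot x" shows "cyc_mat x 1 = 1\<^sub>m d"
proof (rule mat_eq_by_action[OF cyc_mat_carrier one_carrier_mat complex_subfield_Rats])
  fix v assume v: "v \<in> vecs_over \<rat> d"
  hence c: "v \<in> carrier_vec d" by (rule vecs_overD)
  have "cyc_mat x 1 *\<^sub>v v = v"
    by (rule ev_inj[OF x mats_over_mult_vec[OF complex_subfield_Rats cyc_mat_over v] v])
      (simp add: ev_cyc_mat[OF x _ c])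
  thus "cyc_mat x 1 *\<^sub>v v = 1\<^sub>m d *\<^sub>v v" using c by simp
qed

lemma cyc_mat_trace:
  assumes x: "proot x" and y: "y ^ m = 1"
  shows "(\<Sum>i<d. cyc_mat x y $$ (i, i)) = trace_val y"
  using cf_trace[OF x, of "expo x y"] expo[OF x y] by (simp add: cyc_mat_def)

text \<open>For nonzero \<open>w\<close> every vector \<open>v\<close> corresponds to f(x) times
  \<open>w\<close> for some rational polynomial \<open>f\<close>, because the quotient lies in the
  field generated by \<open>x\<close>. Since \<open>x\<close> is itself a value of \<psi>, such a
  multiple is a combination of translates of \<open>w\<close>.\<close>

lemma cyc_rep:
  assumes x: "proot x" and G: "group G"
    and one: "\<psi> \<one>\<^bsub>G\<^esub> = 1" and mult: "\<And>g h. g \<in> carrier G \<Longrightarrow> h \<in> carrier G \<Longrightarrow> \<psi> (g \<otimes>\<^bsub>G\<^esub> h) = \<psi> g * \<psi> h"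
    and val: "\<And>g. g \<in> carrier G \<Longrightarrow> \<psi> g ^ m = 1" and g0: "g0 \<in> carrier G" "\<psi> g0 = x"
  shows "irreducible_rep \<rat> G d (\<lambda>g. cyc_mat x (\<psi> g))"
    and "afforded_character G d (\<lambda>g. cyc_mat x (\<psi> g)) = (\<lambda>g. if g \<in> carrier G then trace_val (\<psi> g) else 0)"
proof -
  interpret group G by fact
  let ?\<sigma> = "\<lambda>g. cyc_mat x (\<psi> g)"
  show "afforded_character G d ?\<sigma> = (\<lambda>g. if g \<in> carrier G then trace_val (\<psi> g) else 0)"
    by (auto simp: afforded_character_def cyc_mat_trace[OF x val] simp del: One_nat_def)
  have rep: "matrix_rep \<rat> G d ?\<sigma>"
    unfolding matrix_rep_def
    by (auto simp: cyc_mat_over one cyc_mat_one[OF x] mult cyc_mat_mult[OF x val val] simp del: One_nat_def)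
  show "irreducible_rep \<rat> G d ?\<sigma>"
    unfolding irreducible_rep_def
  proof (intro conjI allI impI rep d_pos)
    fix W assume W: "invariant_subspace \<rat> G d ?\<sigma> W"
    have WK: "W \<subseteq> vecs_over \<rat> d" using W by (simp add: invariant_subspace_def)
    show "W = {0\<^sub>v d} \<or> W = vecs_over \<rat> d"
    proof (cases "W = {0\<^sub>v d}")
      case False
      then obtain w where w: "w \<in> W" "w \<noteq> 0\<^sub>v d" using W by (auto simp: invariant_subspace_def)
      have wK: "w \<in> vecs_over \<rat> d" using w WK by blast
      hence wc: "w \<in> carrier_vec d" by (rule vecs_overD)
      have evQ: "ev x v \<in> Qx x" if "v \<in> vecs_over \<rat> d" for v
      proof -
        have "v $ b \<in> Qx x" if "b < d" for b
          using subfield_Rats[OF Qx_subfield[OF x]] \<open>v \<in> vecs_over \<rat> d\<close> that by (auto simp: vecs_over_def)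
        thus ?thesis unfolding ev_def
          by (intro subfield_closed(8)[OF Qx_subfield[OF x]] subfield_closed(4)[OF Qx_subfield[OF x]] Qx_power) auto
      qed
      have "ev x w \<noteq> ev x (0\<^sub>v d)"
        using ev_inj[OF x wK vecs_over_zero[OF complex_subfield_Rats]] w by blast
      hence w0: "ev x w \<noteq> 0" by (simp add: ev_def)
      have "v \<in> W" if v: "v \<in> vecs_over \<rat> d" for v
      proof -
        have "ev x v * inverse (ev x w) \<in> Qx x"
          using evQ[OF v] evQ[OF wK] subfield_closed(4,6)[OF Qx_subfield[OF x]] by blast
        then obtain f where f: "ev x v * inverse (ev x w) = evq f x" by (auto simp: Qx_def)
        \<comment> \<open>The summands of f(x) w, with powers of \<open>x\<close> realised by powers
          of the element \<open>g0\<close>.\<close>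
        define F where "F i = of_rat (coeff f i) \<cdot>\<^sub>v (cyc_mat x (\<psi> (g0 [^]\<^bsub>G\<^esub> i)) *\<^sub>v w)" for i :: nat
        define y where "y = vsum d {..degree f} F"
        have FW: "F i \<in> W" for i
          using W w g0 by (simp add: F_def invariant_subspace_def)
        have yW: "y \<in> W" unfolding y_def by (rule vsum_in_invariant[OF W FW])
        have pw: "\<psi> (g0 [^]\<^bsub>G\<^esub> i) = x ^ i" for i :: nat
          by (induction i) (use g0 in \<open>simp_all add: one mult\<close>)
        have xi: "(x ^ i) ^ m = 1" for i using x by (metis proot_def mult.commute power_mult power_one)
        have evF: "ev x (F i) = of_rat (coeff f i) * x ^ i * ev x w" for i
        proof -
          have "ev x (F i) = of_rat (coeff f i) * ev x (cyc_mat x (x ^ i) *\<^sub>v w)"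
            unfolding F_def pw ev_def sum_distrib_left by (intro sum.cong refl) (simp add: mult.assoc cyc_mat_def)
          thus ?thesis by (simp add: ev_cyc_mat[OF x xi wc])
        qed
        have "ev x y = (\<Sum>i\<le>degree f. ev x (F i))"
          unfolding ev_def y_def by (simp add: sum_distrib_right, subst sum.swap, simp)
        also have "\<dots> = evq f x * ev x w" by (simp add: evF evq_as_sum sum_distrib_right)
        also have "\<dots> = ev x v" using w0 by (simp add: f[symmetric])
        finally have "y = v" using ev_inj[OF x _ v] yW WK by blast
        thus ?thesis using yW by simp
      qed
      thus ?thesis using WK by blast
    qed simp
  qed
qed

end

section \<open>Rational representations and central characters\<close>

text \<open>A central element on whose powers the character is a nonzero constant acts trivially:
  otherwise its powers would sum to zero.\<close>

lemma central_acts_trivially: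
  assumes G: "group G" and K: "complex_subfield K" and irr: "irreducible_rep K G n \<rho>"
    and x: "x \<in> carrier G" and comm: "\<And>g. g \<in> carrier G \<Longrightarrow> x \<otimes>\<^bsub>G\<^esub> g = g \<otimes>\<^bsub>G\<^esub> x"
    and M: "x [^]\<^bsub>G\<^esub> (M :: nat) = \<one>\<^bsub>G\<^esub>" "M > 0"
    and tr: "\<And>j :: nat. afforded_character G n \<rho> (x [^]\<^bsub>G\<^esub> j) = c" and c: "c \<noteq> 0"
  shows "\<rho> x = 1\<^sub>m n"
proof (rule ccontr)
  interpret group G by fact
  assume nt: "\<rho> x \<noteq> 1\<^sub>m n"
  have one: "\<rho> (x [^]\<^bsub>G\<^esub> M) = 1\<^sub>m n" using M matrix_repD(3)[OF irreducible_repD(1)[OF irr]] by simp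
  have "of_nat M * c = (\<Sum>j<M. \<Sum>i<n. \<rho> (x [^]\<^bsub>G\<^esub> j) $$ (i, i))"
    using tr x by (simp add: afforded_character_def)
  also have "\<dots> = (\<Sum>i<n. \<Sum>j<M. \<rho> (x [^]\<^bsub>G\<^esub> j) $$ (i, i))" by (rule sum.swap)
  also have "\<dots> = 0"
    using central_sum_dichotomy[OF G K irr x comm one nt] by (intro sum.neutral) auto
  finally show False using c M by simp
qed

lemma subgrp_nat_pow: "x [^]\<^bsub>subgrp G H\<^esub> (n :: nat) = x [^]\<^bsub>G\<^esub> n"
  by (simp add: nat_pow_def)

text \<open>No centrality is assumed, since this is applied to the conjugates of
  \<open>u\<close>.\<close>

lemma (in group) power_average_fixed:
  assumes R: "matrix_rep K G n \<rho>" and x: "x \<in> carrier G" and N: "\<rho> (x [^] (N :: nat)) = 1\<^sub>m n"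
    and v: "v \<in> carrier_vec n"
  shows "\<rho> x *\<^sub>v vsum n {..<N} (\<lambda>j. \<rho> (x [^] j) *\<^sub>v v) = vsum n {..<N} (\<lambda>j. \<rho> (x [^] j) *\<^sub>v v)"
proof -
  note R = matrix_repD[OF R]
  have xp: "x [^] j \<in> carrier G" for j :: nat using x by simp
  define F where "F j = \<rho> (x [^] j) *\<^sub>v v" for j :: nat
  have Fc: "F j \<in> carrier_vec n" for j
    unfolding F_def by (rule mult_mat_vec_carrier[OF R(2)[OF xp] v])
  have s: "\<rho> x *\<^sub>v F j = F (Suc j)" for j
  proof -
    have "x [^] Suc j = x \<otimes> x [^] j" using x by (rule nat_pow_Suc2)
    thus ?thesis unfolding F_def using R(5)[OF x xp v, of j] by simp
  qed
  have F0: "F N = F 0" using v by (simp add: F_def N R)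
  have "\<rho> x *\<^sub>v vsum n {..<N} F = vsum n {..<N} (\<lambda>j. F (Suc j))"
    using mult_mat_vsum[OF R(2)[OF x] Fc, of "{..<N}"] s by simp
  also have "\<dots> = vsum n {..<N} F"
  proof (rule eq_vecI)
    fix i assume "i < dim_vec (vsum n {..<N} F)"
    moreover have "(\<Sum>j<N. F (Suc j) $ i) + F 0 $ i = (\<Sum>j<N. F j $ i) + F N $ i"
      using sum.lessThan_Suc_shift[of "\<lambda>j. F j $ i" N] by (simp add: add.commute)
    ultimately show "vsum n {..<N} (\<lambda>j. F (Suc j)) $ i = vsum n {..<N} F $ i"
      using F0 by simp
  qed simp
  finally show ?thesis by (simp add: F_def[abs_def])
qed

section \<open>Characters induced from maximal abelian subgroups\<close>

lemma (in group) ex_left_transversal: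
  assumes H: "subgroup H G" and fin: "finite (carrier G)"
  shows "\<exists>ts. left_transversal G H ts"
proof -
  \<comment> \<open>\<open>R g\<close> is the left coset of \<open>g\<close>. Choosing the
    representative from the set \<open>R g\<close> makes equal cosets have equal
    representatives.\<close>
  define R where "R g = {x \<in> carrier G. inv x \<otimes> g \<in> H}" for g
  define rep where "rep g = (SOME x. x \<in> R g)" for g
  have self: "g \<in> R g" if "g \<in> carrier G" for g
    using that subgroup.one_closed[OF H] by (simp add: R_def)
  have rep: "rep g \<in> R g" if "g \<in> carrier G" for g
    unfolding rep_def using self[OF that] by (rule someI)
  have sub: "R g \<subseteq> R g'" if g: "g \<in> carrier G" "g' \<in> carrier G" and t: "t \<in> R g" "t \<in> R g'" for g g' t
  proof
    fix x assume x: "x \<in> R g"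
    have c: "x \<in> carrier G" "t \<in> carrier G" using x t by (auto simp: R_def)
    have "(inv x \<otimes> g) \<otimes> inv (inv t \<otimes> g) \<otimes> (inv t \<otimes> g') \<in> H"
      by (rule subgroup.m_closed[OF H subgroup.m_closed[OF H _ subgroup.m_inv_closed[OF H]]])
        (use x t in \<open>auto simp: R_def\<close>)
    also have "(inv x \<otimes> g) \<otimes> inv (inv t \<otimes> g) \<otimes> (inv t \<otimes> g') = inv x \<otimes> g'"
      using c g by (simp add: inv_mult_group m_assoc)
    finally show "x \<in> R g'" using c by (simp add: R_def)
  qed
  have "finite (rep ` carrier G)" using fin by simp
  then obtain ts where ts: "set ts = rep ` carrier G" "distinct ts"
    using finite_distinct_list by blast
  have "left_transversal G H ts"
    unfolding left_transversal_def
  proof (intro conjI ballI ts)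
    show "set ts \<subseteq> carrier G" using rep ts by (auto simp: R_def)
    fix g assume g: "g \<in> carrier G"
    show "\<exists>!t. t \<in> set ts \<and> inv t \<otimes> g \<in> H"
    proof (rule ex1I[of _ "rep g"])
      show "rep g \<in> set ts \<and> inv rep g \<otimes> g \<in> H" using rep[OF g] g ts by (auto simp: R_def)
      fix t assume t: "t \<in> set ts \<and> inv t \<otimes> g \<in> H"
      then obtain g' where g': "g' \<in> carrier G" "t = rep g'" using ts by auto
      have t1: "t \<in> R g'" using rep[OF g'(1)] g' by simp
      moreover have t2: "t \<in> R g" using t t1 by (auto simp: R_def)
      ultimately have "R g = R g'" using sub[OF g g'(1) t2 t1] sub[OF g'(1) g t1 t2] by blast
      thus "t = rep g" using g' by (simp add: rep_def)
    qed
  qed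
  thus ?thesis ..
qed

context prime_power
begin

lemma trace_val_eq_d: assumes "trace_val y = of_nat d" shows "y = 1"
proof (rule ccontr)
  assume "y \<noteq> 1"
  hence "of_nat q + of_nat d = (0 :: complex) \<or> of_nat d = (0 :: complex)"
    using assms by (auto simp: trace_val_def split: if_splits) (metis add.right_inverse)
  hence "q + d = 0 \<or> d = 0" by (metis of_nat_add of_nat_eq_0_iff)
  thus False using d_pos by linarith
qed

text \<open>Reads off the kernel of a representation known only by its character. If
  \<open>y = 1\<close> the character is a nonzero constant on the powers of \<open>x\<close>;
  conversely a trivially acting \<open>x\<close> has the full degree as trace, and only 1 has trace
  \<open>d\<close>.\<close>

lemma kernel_by_trace:
  assumes A: "group A" and irr: "irreducible_rep \<rat> A n \<rho>" and x: "x \<in> carrier A"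
    and comm: "\<And>g. g \<in> carrier A \<Longrightarrow> x \<otimes>\<^bsub>A\<^esub> g = g \<otimes>\<^bsub>A\<^esub> x"
    and M: "x [^]\<^bsub>A\<^esub> (M :: nat) = \<one>\<^bsub>A\<^esub>" "M > 0" and C: "C \<noteq> 0"
    and tr: "\<And>j :: nat. afforded_character A n \<rho> (x [^]\<^bsub>A\<^esub> j) = C * trace_val (y ^ j)"
  shows "\<rho> x = 1\<^sub>m n \<longleftrightarrow> y = 1"
proof
  interpret A: group A by fact
  assume "y = 1"
  hence "afforded_character A n \<rho> (x [^]\<^bsub>A\<^esub> j) = C * of_nat d" for j :: nat
    using tr[of j] by (simp add: trace_val_def)
  moreover have "C * of_nat d \<noteq> 0" using C d_pos by simp
  ultimately show "\<rho> x = 1\<^sub>m n"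
    using central_acts_trivially[OF A complex_subfield_Rats irr x comm M, of "C * of_nat d"] by blast
next
  interpret A: group A by fact
  assume *: "\<rho> x = 1\<^sub>m n"
  have "\<rho> \<one>\<^bsub>A\<^esub> = 1\<^sub>m n" by (rule matrix_repD(3)[OF irreducible_repD(1)[OF irr]])
  hence "afforded_character A n \<rho> x = afforded_character A n \<rho> \<one>\<^bsub>A\<^esub>"
    using * x by (simp add: afforded_character_def)
  hence "C * trace_val y = C * trace_val 1" using tr[of 1] tr[of 0] x by simp
  hence "trace_val y = of_nat d" using C by (simp add: trace_val_def)
  thus "y = 1" by (rule trace_val_eq_d)
qed

lemma gal_scaled:
  assumes "proot x" "\<not> p dvd a"
  shows "gal x a (of_nat n * x ^ j) = of_nat n * (x ^ j) ^ a"
  using gal_evq[OF assms, of "monom (of_nat n) j"] by (simp add: power_mult[symmetric] mult.commute)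

lemma gal_zero: assumes "proot x" "\<not> p dvd a" shows "gal x a 0 = 0"
  using gal_evq[OF assms, of 0] by simp

end

lemma schur_index_one:
  assumes "matrix_rep (char_field G \<chi>) G n \<rho>" "affords G n \<rho> \<chi>"
  shows "schur_index_Q G \<chi> = 1"
  unfolding schur_index_Q_def using assms by (intro Least_equality) auto

context phi2_group
begin

lemma central_chars_iff:
  "\<mu> \<in> central_chars G \<longleftrightarrow> (\<forall>g. g \<notin> Z \<longrightarrow> \<mu> g = 0) \<and> \<mu> \<one> = 1 \<and>
     (\<forall>x\<in>Z. \<forall>y\<in>Z. \<mu> (x \<otimes> y) = \<mu> x * \<mu> y) \<and> (\<exists>c\<in>D. \<mu> c \<noteq> 1)"
proof -
  have g: "group (subgrp G Z)" by (rule subgroup_imp_group[OF center_subgroup])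
  have "Irr (subgrp G Z) = lin (subgrp G Z)"
    by (rule abelian_Irr_lin[OF g]) (simp add: Z_comm)
  thus ?thesis
    unfolding central_chars_def Irr_over_def by (auto simp: lin_iff[OF g] char_kernel_def)
qed

end

section \<open>Central characters that are nontrivial on the commutator subgroup\<close>

locale phi2_char = phi2_group G p N for G (structure) and p N +
  fixes \<mu> :: "'a \<Rightarrow> complex"
  assumes mu: "\<mu> \<in> central_chars G"
begin

lemma mu_one [simp]: "\<mu> \<one> = 1" using mu by (simp add: central_chars_iff)
lemma mu_mult: "x \<in> Z \<Longrightarrow> y \<in> Z \<Longrightarrow> \<mu> (x \<otimes> y) = \<mu> x * \<mu> y" using mu by (simp add: central_chars_iff)

lemma mu_pow: "x \<in> Z \<Longrightarrow> \<mu> (x [^] (n :: nat)) = \<mu> x ^ n"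
  by (induction n) (simp_all add: mu_mult)

lemma mu_nonzero: "x \<in> Z \<Longrightarrow> \<mu> x \<noteq> 0"
  using mu_mult[of x "inv x"] by auto

lemma mu_inv: "x \<in> Z \<Longrightarrow> \<mu> (inv x) = inverse (\<mu> x)"
  using mu_mult[of x "inv x"] by (auto intro!: inverse_unique[symmetric])

text \<open>Any nontrivial element generates the commutator subgroup, so nontriviality there is the
  same as faithfulness there.\<close>

lemma mu_D: assumes c: "c \<in> D" "c \<noteq> \<one>" shows "\<mu> c \<noteq> 1"
proof
  assume 1: "\<mu> c = 1"
  obtain e where e: "e \<in> D" "\<mu> e \<noteq> 1" using mu by (auto simp: central_chars_iff)
  obtain i where "e = c [^] (i :: nat)" using D_generated[OF c e(1)] by blast
  hence "\<mu> e = 1" using 1 c by (simp add: mu_pow)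
  thus False using e by simp
qed

text \<open>\<open>k + 1\<close> is the least exponent \<open>e\<close> such that p^e kills all
  values; it is positive because \<mu> is nontrivial. At \<open>z0\<close> the value has maximal
  order, so its powers are all the values of \<mu>.\<close>

lemma level:
  obtains k z0 where "z0 \<in> Z" "\<And>z. z \<in> Z \<Longrightarrow> \<mu> z ^ (p * p ^ k) = 1" "\<mu> z0 ^ (p ^ k) \<noteq> 1"
proof -
  define P where "P e \<longleftrightarrow> (\<forall>z\<in>Z. \<mu> z ^ (p ^ e) = 1)" for e
  have PN: "P N" unfolding P_def by (auto simp: mu_pow[symmetric])
  define e where "e = (LEAST e. P e)"
  have Pe: "P e" unfolding e_def using PN by (rule LeastI)
  obtain c where c: "c \<in> D" "\<mu> c \<noteq> 1" using mu by (auto simp: central_chars_iff)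
  have "\<not> P 0" using c by (auto simp: P_def)
  hence "e \<noteq> 0" using Pe by metis
  then obtain k where k: "e = Suc k" by (cases e) auto
  have "\<not> P k" using not_less_Least[of k P] k by (simp add: e_def)
  then obtain z0 where "z0 \<in> Z" "\<mu> z0 ^ (p ^ k) \<noteq> 1" by (auto simp: P_def)
  thus ?thesis using that Pe by (auto simp: P_def k)
qed

text \<open>For non-central \<open>g\<close> the summand is a nontrivial linear character of the
  whole group in \<open>x\<close>; translating by a \<open>t\<close> that does not commute with
  \<open>g\<close> multiplies the sum by a number other than 1. The exponent \<open>a\<close> covers
  the Galois conjugates.\<close>

lemma com_sum:
  assumes g: "g \<in> carrier G" "g \<notin> Z" and a: "\<not> p dvd a"
  shows "(\<Sum>x\<in>carrier G. \<mu> (com g x) ^ a) = 0"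
proof -
  interpret P: phi2_pair G p N g using g by unfold_locales
  obtain t where t: "t \<in> carrier G" "com g t \<noteq> \<one>" by (rule P.ex_t)
  have cD: "com g t \<in> D" using g t by (intro commutator_in_derived)
  have "com g t [^] a \<noteq> \<one>" using pow_eq_one_dvd[OF _ D_pow[OF cD] t(2), of a] g t a by simp
  moreover have "com g t [^] a \<in> D" by (rule subgroup_nat_pow[OF D_subgroup cD])
  ultimately have "\<mu> (com g t [^] a) \<noteq> 1" by (rule mu_D[rotated])
  hence n1: "\<mu> (com g t) ^ a \<noteq> 1" using g t by (simp add: mu_pow)
  have "bij_betw (\<lambda>x. x \<otimes> t) (carrier G) (carrier G)"
    by (rule bij_betwI[of _ _ _ "\<lambda>x. x \<otimes> inv t"]) (use t in \<open>auto simp: m_assoc\<close>)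
  hence "(\<Sum>x\<in>carrier G. \<mu> (com g x) ^ a) = (\<Sum>x\<in>carrier G. \<mu> (com g (x \<otimes> t)) ^ a)"
    by (rule sum.reindex_bij_betw[symmetric])
  also have "\<dots> = (\<Sum>x\<in>carrier G. \<mu> (com g x) ^ a * \<mu> (com g t) ^ a)"
    by (rule sum.cong) (use g t in \<open>auto simp: com_mult_right mu_mult power_mult_distrib\<close>)
  also have "\<dots> = (\<Sum>x\<in>carrier G. \<mu> (com g x) ^ a) * \<mu> (com g t) ^ a"
    by (rule sum_distrib_right[symmetric])
  finally show ?thesis using n1 by (metis mult_cancel_left2 mult.commute)
qed

text \<open>Sends \<open>u ^ i \<otimes> z\<close> to \<mu>(z). The choice of \<open>z\<close> is
  immaterial once \<mu> is trivial on \<open>u ^ p\<close>.\<close>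

definition psi :: "'a \<Rightarrow> 'a \<Rightarrow> complex" where
  "psi u x = (if x \<in> Cen u then \<mu> (SOME z. z \<in> Z \<and> (\<exists>i :: nat. x = u [^] i \<otimes> z)) else 0)"

end

locale phi2_level = phi2_char G p N \<mu> + prime_power p q k
  for G (structure) and p N \<mu> q k +
  fixes z0 :: 'a
  assumes z0 [simp]: "z0 \<in> center_of G" and mu_m: "\<And>z. z \<in> center_of G \<Longrightarrow> \<mu> z ^ (p * q) = 1"
    and mu_q: "\<mu> z0 ^ q \<noteq> 1"
begin

abbreviation "\<zeta> \<equiv> \<mu> z0"
abbreviation "\<chi> \<equiv> chi_mu p G \<mu>"

lemma proot_zeta: "proot \<zeta>" using mu_m[OF z0] mu_q by (simp add: proot_def)

lemma mu_root: assumes "z \<in> Z" obtains j where "j < m" "\<mu> z = \<zeta> ^ j"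
  using root_is_power[OF proot_zeta mu_m[OF assms]] by blast

lemma char_field_chi: "char_field G \<chi> = Qx \<zeta>"
  unfolding char_field_def
proof (rule hull_eq_Qx[OF proot_zeta])
  note F = subfield_closed[OF Qx_subfield[OF proot_zeta]]
  have "of_nat p \<in> Qx \<zeta>" using subfield_Rats[OF Qx_subfield[OF proot_zeta]] by auto
  moreover have "\<mu> z \<in> Qx \<zeta>" if "z \<in> Z" for z using mu_root[OF that] Qx_power by metis
  ultimately show "\<chi> ` carrier G \<subseteq> Qx \<zeta>" using F by (auto simp: chi_mu_def)
next
  fix Q assume Q: "complex_subfield Q" "\<chi> ` carrier G \<subseteq> Q"
  have "\<chi> z0 \<in> Q" using Q(2) by auto
  moreover have "inverse (of_nat p) \<in> Q"
    using subfield_closed(6)[OF Q(1)] subfield_Rats[OF Q(1)] by auto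
  ultimately have "\<chi> z0 * inverse (of_nat p) \<in> Q" by (rule subfield_closed(4)[OF Q(1)])
  moreover have "\<chi> z0 * inverse (of_nat p) = \<zeta>" using p_gt1 by (simp add: chi_mu_def field_simps)
  ultimately show "\<zeta> \<in> Q" by simp
qed

text \<open>Modulo the common kernel the centre is generated by \<open>z0\<close>, so the second
  character is the \<open>a\<close>-th power of the first, where \<open>a\<close> is read off at
  \<open>z0\<close>; equal kernels make \<open>a\<close> prime to \<open>p\<close>.\<close>

lemma galois_if_same_kernel:
  assumes \<nu>: "\<nu> \<in> central_chars G" and ker: "\<And>z. z \<in> Z \<Longrightarrow> \<mu> z = 1 \<longleftrightarrow> \<nu> z = 1"
  shows "\<exists>\<sigma>\<in>Gal_Q (char_field G \<chi>). chi_mu p G \<nu> = (\<lambda>g. \<sigma> (\<chi> g))"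
proof -
  interpret \<nu>: phi2_char G p N \<nu> using \<nu> by unfold_locales
  have num: "\<nu> z0 ^ m = 1"
    using ker[of "z0 [^] m"] mu_m[OF z0] by (simp add: mu_pow \<nu>.mu_pow)
  then obtain a where a: "\<nu> z0 = \<zeta> ^ a" using root_is_power[OF proot_zeta] by blast
  have "\<nu> z0 ^ q \<noteq> 1" using ker[of "z0 [^] q"] mu_q by (simp add: mu_pow \<nu>.mu_pow)
  hence "proot (\<zeta> ^ a)" using num by (simp add: proot_def a)
  hence pa: "\<not> p dvd a" using proot_power_iff[OF proot_zeta] by simp
  have val: "\<nu> z = \<mu> z ^ a" if z: "z \<in> Z" for z
  proof -
    obtain j where j: "\<mu> z = \<zeta> ^ j" using mu_root[OF z] by blast
    have "\<mu> (z \<otimes> inv (z0 [^] j)) = 1"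
      using z j proot_nonzero[OF proot_zeta] by (simp add: mu_mult mu_inv mu_pow)
    hence "\<nu> (z \<otimes> inv (z0 [^] j)) = 1" using ker z by simp
    hence "\<nu> z * inverse (\<nu> z0 ^ j) = 1" using z by (simp add: \<nu>.mu_mult \<nu>.mu_inv \<nu>.mu_pow)
    hence "\<nu> z = \<nu> z0 ^ j" using \<nu>.mu_nonzero[OF z0] by (simp add: field_simps)
    thus ?thesis by (simp add: a j power_mult[symmetric] mult.commute)
  qed
  have "chi_mu p G \<nu> = (\<lambda>g. gal \<zeta> a (\<chi> g))"
  proof
    fix g
    show "chi_mu p G \<nu> g = gal \<zeta> a (\<chi> g)"
    proof (cases "g \<in> Z")
      case True
      then obtain j where j: "\<mu> g = \<zeta> ^ j" using mu_root by blast
      show ?thesis using True val[OF True] gal_scaled[OF proot_zeta pa, of p j] by (simp add: chi_mu_def j)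
    next
      case False
      thus ?thesis using gal_zero[OF proot_zeta pa] by (simp add: chi_mu_def)
    qed
  qed
  thus ?thesis using gal_in_Gal[OF proot_zeta pa] by (auto simp: char_field_chi)
qed

lemma same_kernel_if_galois:
  assumes s: "\<sigma> \<in> Gal_Q (char_field G \<chi>)" and e: "chi_mu p G \<nu> = (\<lambda>g. \<sigma> (\<chi> g))" and z: "z \<in> Z"
  shows "\<mu> z = 1 \<longleftrightarrow> \<nu> z = 1"
proof -
  obtain a where a: "\<not> p dvd a" "\<sigma> = gal \<zeta> a"
    using Gal_is_gal[OF proot_zeta] s by (auto simp: char_field_chi)
  obtain j where j: "\<mu> z = \<zeta> ^ j" using mu_root[OF z] by blast
  have "of_nat p * \<nu> z = gal \<zeta> a (of_nat p * \<zeta> ^ j)"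
    using fun_cong[OF e, of z] z by (simp add: chi_mu_def a j)
  hence \<nu>: "\<nu> z = (\<zeta> ^ j) ^ a" using p_gt1 by (simp add: gal_scaled[OF proot_zeta a(1)])
  have "proot (\<zeta> ^ a)" using proot_power[OF proot_zeta a(1)] .
  hence "(\<zeta> ^ a) ^ j = 1 \<longleftrightarrow> \<zeta> ^ j = 1"
    using proot_power_eq_1 proot_zeta by metis
  thus ?thesis unfolding \<nu> j by (simp add: power_mult[symmetric] mult.commute)
qed

end

section \<open>The extension of the central character to the centralizer, and the character it
  induces\<close>

locale phi2_full = phi2_level G p N \<mu> q k z0 + phi2_pair G p N u
  for G (structure) and p N \<mu> q k z0 u +
  assumes mu_u: "\<mu> (u [^] p) = 1"
begin

abbreviation "\<psi> \<equiv> psi u"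

text \<open>Two expressions of the same element differ by a central power of \<open>u\<close>, whose
  exponent is a multiple of \<open>p\<close>; there \<mu> is 1 by the assumption on
  \<open>u ^ p\<close>.\<close>

lemma psi_val:
  assumes z: "z \<in> Z" shows "\<psi> (u [^] (i :: nat) \<otimes> z) = \<mu> z"
proof -
  have *: "\<mu> z = \<mu> w" if "z \<in> Z" "w \<in> Z" "u [^] i \<otimes> z = u [^] j \<otimes> w" "i \<le> j" for i j :: nat and z w
  proof -
    have "u [^] i \<otimes> u [^] (j - i) = u [^] j"
      using nat_pow_mult[OF uG, of i "j - i"] that(4) by simp
    hence "u [^] i \<otimes> z = u [^] i \<otimes> (u [^] (j - i) \<otimes> w)"
      using that by (simp add: m_assoc[symmetric])
    hence zw: "z = u [^] (j - i) \<otimes> w" using that by simp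
    hence "u [^] (j - i) = z \<otimes> inv w" using that by (simp add: m_assoc)
    hence uZ': "u [^] (j - i) \<in> Z" using that by simp
    then obtain c where c: "j - i = p * c" using pow_in_Z_iff by (auto elim: dvdE)
    have "u [^] (j - i) = (u [^] p) [^] c" using c by (simp add: nat_pow_pow)
    hence "\<mu> (u [^] (j - i)) = 1" using mu_u pow_p_central[of u] by (simp add: mu_pow)
    hence "\<mu> (u [^] (j - i) \<otimes> w) = \<mu> w" using mu_mult[OF uZ' that(2)] by simp
    thus ?thesis using zw by metis
  qed
  define x where "x = u [^] i \<otimes> z"
  have xH: "x \<in> H"
    unfolding x_def using z by (intro subgroup.m_closed[OF H_subgroup] subgroup_nat_pow[OF H_subgroup]) auto
  define w where "w = (SOME z. z \<in> Z \<and> (\<exists>i :: nat. x = u [^] i \<otimes> z))"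
  have "w \<in> Z \<and> (\<exists>i :: nat. x = u [^] i \<otimes> w)"
    unfolding w_def by (rule someI[of _ z]) (use z in \<open>auto simp: x_def\<close>)
  then obtain j where j: "w \<in> Z" "u [^] i \<otimes> z = u [^] (j :: nat) \<otimes> w" by (auto simp: x_def)
  have "\<mu> z = \<mu> w" using *[OF z j] *[OF j(1) z j(2)[symmetric]] by (cases "i \<le> j") auto
  thus ?thesis using xH by (simp add: psi_def w_def x_def)
qed

lemma psi_Z [simp]: "z \<in> Z \<Longrightarrow> \<psi> z = \<mu> z"
  using psi_val[of z 0] by simp

lemma psi_u [simp]: "\<psi> u = 1"
  using psi_val[of \<one> 1] by simp

lemma psi_out: "x \<notin> H \<Longrightarrow> \<psi> x = 0" by (simp add: psi_def)

lemma psi_mult: assumes "x \<in> H" "y \<in> H" shows "\<psi> (x \<otimes> y) = \<psi> x * \<psi> y"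
proof -
  obtain i z where x: "z \<in> Z" "x = u [^] (i :: nat) \<otimes> z" using H_elements[OF assms(1)] by metis
  obtain j w where y: "w \<in> Z" "y = u [^] (j :: nat) \<otimes> w" using H_elements[OF assms(2)] by metis
  have "x \<otimes> y = u [^] i \<otimes> (z \<otimes> u [^] j) \<otimes> w" using x y by (simp add: m_assoc)
  also have "z \<otimes> u [^] j = u [^] j \<otimes> z" using x by (intro Z_comm) auto
  also have "u [^] i \<otimes> (u [^] j \<otimes> z) \<otimes> w = u [^] (i + j) \<otimes> (z \<otimes> w)"
    using x y by (simp add: m_assoc nat_pow_mult[symmetric])
  finally have "\<psi> (x \<otimes> y) = \<mu> (z \<otimes> w)" using psi_val[of "z \<otimes> w"] x y by simp
  thus ?thesis using x y psi_val by (simp add: mu_mult)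
qed

lemma H_group: "group (subgrp G H)" by (rule subgroup_imp_group[OF H_subgroup])

lemma psi_lin: "\<psi> \<in> lin (subgrp G H)"
  by (simp add: lin_iff[OF H_group] psi_out psi_mult)

lemma psi_root: assumes "x \<in> H" obtains j where "j < m" "\<psi> x = \<zeta> ^ j"
proof -
  obtain i z where x: "z \<in> Z" "x = u [^] (i :: nat) \<otimes> z" using H_elements[OF assms] by metis
  show ?thesis using mu_root[OF x(1)] that psi_val[OF x(1)] x by metis
qed

lemma psi_m: assumes "x \<in> H" shows "\<psi> x ^ m = 1"
proof -
  obtain j where j: "\<psi> x = \<zeta> ^ j" using psi_root[OF assms] by blast
  have "\<zeta> ^ m = 1" using mu_m[OF z0] .
  thus ?thesis unfolding j by (metis mult.commute power_mult power_one)
qed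

lemma psi_pow: "x \<in> H \<Longrightarrow> \<psi> (x [^] (n :: nat)) = \<psi> x ^ n"
  by (induction n) (simp_all add: psi_mult subgroup_nat_pow[OF H_subgroup])

lemma char_field_psi: "char_field (subgrp G H) \<psi> = Qx \<zeta>"
  unfolding char_field_def
proof (rule hull_eq_Qx[OF proot_zeta])
  show "\<psi> ` carrier (subgrp G H) \<subseteq> Qx \<zeta>"
  proof
    fix y assume "y \<in> \<psi> ` carrier (subgrp G H)"
    then obtain x where x: "x \<in> H" "y = \<psi> x" by auto
    obtain j where "\<psi> x = \<zeta> ^ j" using psi_root[OF x(1)] by blast
    thus "y \<in> Qx \<zeta>" using Qx_power x by simp
  qed
  fix Q assume "complex_subfield Q" "\<psi> ` carrier (subgrp G H) \<subseteq> Q"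
  moreover have "\<psi> z0 \<in> \<psi> ` carrier (subgrp G H)" by (rule imageI) simp
  ultimately show "\<zeta> \<in> Q" by auto
qed

lemma psi_unique:
  assumes f: "f \<in> lin (subgrp G H)" and S: "S \<subseteq> H" "generate G S = H" and e: "\<And>x. x \<in> S \<Longrightarrow> f x = \<psi> x"
  shows "f = \<psi>"
proof
  fix x
  have fo: "f x = 0" if "x \<notin> H" for x using f that by (simp add: lin_iff[OF H_group])
  have f1: "f \<one> = 1" using f by (simp add: lin_iff[OF H_group])
  have fm: "f (x \<otimes> y) = f x * f y" if "x \<in> H" "y \<in> H" for x y
    using f that by (simp add: lin_iff[OF H_group])
  have Hc: "x \<in> carrier G" if "x \<in> H" for x using that by (rule Cen_carrier)
  have "subgroup {x \<in> H. f x = \<psi> x} G"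
  proof (rule subgroupI)
    show "{x \<in> H. f x = \<psi> x} \<noteq> {}" using f1 psi_Z[of \<one>] by (auto intro!: exI[of _ \<one>])
  next
    fix x assume x: "x \<in> {x \<in> H. f x = \<psi> x}"
    have i: "inv x \<in> H" using x by (intro subgroup.m_inv_closed[OF H_subgroup]) simp
    have "f x * f (inv x) = 1" "\<psi> x * \<psi> (inv x) = 1"
      using fm[OF _ i, of x] psi_mult[OF _ i, of x] x Hc[of x] f1 by auto
    hence "f (inv x) = \<psi> (inv x)" using x by (metis (mono_tags, lifting) inverse_unique mem_Collect_eq)
    thus "inv x \<in> {x \<in> H. f x = \<psi> x}" using i by simp
  qed (use Hc fm psi_mult subgroup.m_closed[OF H_subgroup] in auto)
  hence "generate G S \<subseteq> {x \<in> H. f x = \<psi> x}" using S e by (intro generate_subgroup_incl) auto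
  thus "f x = \<psi> x" using S fo psi_out by (cases "x \<in> H") auto
qed

text \<open>Conjugating \<open>g\<close> by \<open>x\<close> multiplies \<psi>(g) by \<mu>([g, x]),
  and these factors sum to zero unless \<open>g\<close> is central. Outside the normal subgroup
  \<open>H\<close> nothing contributes. All exponents prime to \<open>p\<close> are treated so that
  \<Omega> can be induced term by term.\<close>

lemma induced_psi_power:
  assumes a: "\<not> p dvd a"
  shows "induced_char G H (\<lambda>x. \<psi> x ^ a) = (\<lambda>g. if g \<in> Z then of_nat p * \<mu> g ^ a else 0)"
proof
  fix g
  have cH: "card H > 0" using order_H ord p_gt1 by (metis gr0I mult_0_right not_one_less_zero power_eq_0_iff)
  show "induced_char G H (\<lambda>x. \<psi> x ^ a) g = (if g \<in> Z then of_nat p * \<mu> g ^ a else 0)"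
  proof (cases "g \<in> H")
    case True
    note g = this
    have gG: "g \<in> carrier G" using g by (rule Cen_carrier)
    have cj: "inv x \<otimes> g \<otimes> x \<in> H" "\<psi> (inv x \<otimes> g \<otimes> x) = \<psi> g * \<mu> (com g x)" if x: "x \<in> carrier G" for x
      using conj_H[OF g x] psi_mult[OF g, of "com g x"] x gG by (simp_all add: conj_eq_commutator)
    hence S: "{x \<in> carrier G. inv x \<otimes> g \<otimes> x \<in> H} = carrier G" by auto
    have "(\<Sum>x\<in>carrier G. \<psi> (inv x \<otimes> g \<otimes> x) ^ a) = (\<Sum>x\<in>carrier G. \<psi> g ^ a * \<mu> (com g x) ^ a)"
      by (rule sum.cong) (simp_all add: cj power_mult_distrib)
    also have "\<dots> = \<psi> g ^ a * (\<Sum>x\<in>carrier G. \<mu> (com g x) ^ a)" by (simp add: sum_distrib_left)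
    finally have s: "(\<Sum>x\<in>carrier G. \<psi> (inv x \<otimes> g \<otimes> x) ^ a) = \<psi> g ^ a * (\<Sum>x\<in>carrier G. \<mu> (com g x) ^ a)" .
    show ?thesis
    proof (cases "g \<in> Z")
      case True
      hence "(\<Sum>x\<in>carrier G. \<mu> (com g x) ^ a) = of_nat (card (carrier G))" by simp
      also have "card (carrier G) = p * card H" using order_H by (simp add: Coset.order_def)
      finally show ?thesis using s S True gG cH by (simp add: induced_char_def)
    next
      case False
      hence "(\<Sum>x\<in>carrier G. \<mu> (com g x) ^ a) = 0" using com_sum[OF gG _ a] by simp
      thus ?thesis using s S False gG by (simp add: induced_char_def)
    qed
  next
    case False
    hence gZ: "g \<notin> Z" by auto
    show ?thesis
    proof (cases "g \<in> carrier G")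
      case True
      hence "{x \<in> carrier G. inv x \<otimes> g \<otimes> x \<in> H} = {}" using conj_notin_H[OF True False] by auto
      thus ?thesis using gZ by (simp add: induced_char_def del: Collect_empty_eq)
    qed (use gZ in \<open>simp add: induced_char_def\<close>)
  qed
qed

lemma induced_psi: "induced_char G H \<psi> = \<chi>"
  using induced_psi_power[of 1, unfolded power_one_right] p_gt1 by (simp add: chi_mu_def)

text \<open>A conjugate of \<open>u\<close> by an element outside \<open>H\<close> is
  \<open>u\<close> times a nontrivial commutator, hence does not act trivially under
  \<open>\<sigma>\<close>, and its powers sum to zero in the abelian group \<open>H\<close>. Used
  over the complex numbers for the induced character and over the rationals for \<Omega>.\<close>

lemma ind_irreducible:
  assumes K: "complex_subfield K" and irr: "irreducible_rep K (subgrp G H) e \<sigma>"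
    and su: "\<sigma> u = 1\<^sub>m e" and sD: "\<And>c. c \<in> D \<Longrightarrow> c \<noteq> \<one> \<Longrightarrow> \<sigma> c \<noteq> 1\<^sub>m e"
    and ts: "left_transversal G H ts"
  shows "irreducible_rep K G (length ts * e) (induced_rep G H ts e \<sigma>)"
proof -
  interpret I: induction G H ts K e \<sigma>
    by (intro induction.intro transversal.intro transversal_axioms.intro induction_axioms.intro
        is_group H_subgroup ts K irreducible_repD(1,2)[OF irr])
  note R = matrix_repD[OF irreducible_repD(1)[OF irr], simplified]
  have HH: "u [^] (c :: nat) \<in> H" for c by (rule subgroup_nat_pow[OF H_subgroup u_H])
  have spow: "\<sigma> (u [^] (c :: nat)) = 1\<^sub>m e" for c
    by (induction c) (use su R HH in simp_all)
  show ?thesis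
  proof (rule I.irreducible_ind[OF irr u_H su, of p])
    show "p > 0" using p_gt1 by simp
    show "\<And>y c. y \<in> carrier G \<Longrightarrow> inv y \<otimes> u [^] (c :: nat) \<otimes> y \<in> H" by (rule conj_H[OF HH])
    fix y a b assume y: "y \<in> carrier G" "y \<notin> H" and ab: "a < e" "b < e"
    define x where "x = inv y \<otimes> u \<otimes> y"
    have xH: "x \<in> H" unfolding x_def by (rule conj_H[OF u_H y(1)])
    have xe: "x = u \<otimes> com u y" using y by (simp add: x_def conj_eq_commutator)
    have cD: "com u y \<in> D" using y by (intro commutator_in_derived) auto
    have "\<sigma> x = \<sigma> u * \<sigma> (com u y)" unfolding xe using y by (intro R(4)) auto
    hence "\<sigma> x = \<sigma> (com u y)" using su R(2)[of "com u y"] y by simp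
    moreover have "com u y \<noteq> \<one>" using notin_H y by simp
    ultimately have nt: "\<sigma> x \<noteq> 1\<^sub>m e" using sD[OF cD] by simp
    have xp: "x [^] (c :: nat) = inv y \<otimes> u [^] c \<otimes> y" for c
      unfolding x_def using y by (intro conj_pow) auto
    have "inv y \<otimes> u [^] p \<otimes> y = u [^] p \<otimes> com (u [^] p) y" using y by (simp add: conj_eq_commutator)
    \<comment> \<open>The p-th power is central and so unchanged by conjugation; therefore averaging
      over \<open>p\<close> powers suffices.\<close>
    hence "x [^] p = u [^] p" unfolding xp using y pow_p_central[of u] by simp
    hence "\<sigma> (x [^]\<^bsub>subgrp G H\<^esub> p) = 1\<^sub>m e" by (simp add: subgrp_nat_pow spow)
    from central_sum_dichotomy[OF H_group K irr _ _ this nt ab]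
    have "(\<Sum>j<p. \<sigma> (x [^]\<^bsub>subgrp G H\<^esub> j) $$ (a, b)) = 0" using xH H_comm by simp
    thus "(\<Sum>c<p. \<sigma> (inv y \<otimes> u [^] c \<otimes> y) $$ (a, b)) = 0" by (simp add: subgrp_nat_pow xp)
  qed
qed

lemma affords_induced:
  assumes K: "complex_subfield K" and rep: "matrix_rep K (subgrp G H) e \<sigma>" and e: "e > 0"
    and aff: "affords (subgrp G H) e \<sigma> \<theta>" and ts: "left_transversal G H ts"
  shows "matrix_rep K G (length ts * e) (induced_rep G H ts e \<sigma>)"
    and "affords G (length ts * e) (induced_rep G H ts e \<sigma>) (induced_char G H \<theta>)"
proof -
  interpret I: induction G H ts K e \<sigma>
    by (intro induction.intro transversal.intro transversal_axioms.intro induction_axioms.intro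
        is_group H_subgroup ts K rep e)
  show "matrix_rep K G (length ts * e) (induced_rep G H ts e \<sigma>)" by (rule I.matrix_rep_ind)
  show "affords G (length ts * e) (induced_rep G H ts e \<sigma>) (induced_char G H \<theta>)"
    by (rule I.afforded_ind[OF fin H_comm aff])
qed

lemma psi_rep:
  assumes "complex_subfield K" "Qx \<zeta> \<subseteq> K"
  shows "irreducible_rep K (subgrp G H) 1 (\<lambda>g. mat 1 1 (\<lambda>_. \<psi> g))"
    "affords (subgrp G H) 1 (\<lambda>g. mat 1 1 (\<lambda>_. \<psi> g)) \<psi>"
proof -
  have "\<psi> g \<in> K" if "g \<in> H" for g using psi_root[OF that] Qx_power assms(2) by (metis subsetD)
  thus "irreducible_rep K (subgrp G H) 1 (\<lambda>g. mat 1 1 (\<lambda>_. \<psi> g))"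
    "affords (subgrp G H) 1 (\<lambda>g. mat 1 1 (\<lambda>_. \<psi> g)) \<psi>"
    using lin_rep[OF assms(1), of "subgrp G H" \<psi>] by (simp_all add: psi_mult psi_out)
qed

lemma chi_nl: "\<chi> \<in> nl G"
proof -
  obtain ts where ts: "left_transversal G H ts" using ex_left_transversal[OF H_subgroup fin] by blast
  note P = psi_rep[OF complex_subfield_UNIV subset_UNIV]
  have "irreducible_rep UNIV G (length ts * 1) (induced_rep G H ts 1 (\<lambda>g. mat 1 1 (\<lambda>_. \<psi> g)))"
  proof (rule ind_irreducible[OF complex_subfield_UNIV P(1) _ _ ts])
    show "mat 1 1 (\<lambda>_. \<psi> u) = 1\<^sub>m 1" by (auto intro!: eq_matI)
    fix c assume c: "c \<in> D" "c \<noteq> \<one>"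
    have "mat 1 1 (\<lambda>_. \<psi> c) $$ (0, 0) \<noteq> 1\<^sub>m 1 $$ (0, 0)" using mu_D[OF c] c by simp
    thus "mat 1 1 (\<lambda>_. \<psi> c) \<noteq> 1\<^sub>m 1" by metis
  qed
  moreover have "affords G (length ts * 1) (induced_rep G H ts 1 (\<lambda>g. mat 1 1 (\<lambda>_. \<psi> g))) \<chi>"
    using affords_induced(2)[OF complex_subfield_UNIV irreducible_repD(1)[OF P(1)] _ P(2) ts]
    by (simp add: induced_psi)
  ultimately have "\<chi> \<in> Irr G" by (auto simp: Irr_def)
  thus ?thesis using p_gt1 by (simp add: nl_def chi_mu_def)
qed

lemma required: "required_pair G \<chi> H \<psi>"
  using chi_nl psi_lin H_subgroup
  by (simp add: required_pair_def nl_def induced_psi char_field_psi char_field_chi)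

lemma schur_psi: "schur_index_Q (subgrp G H) \<psi> = 1"
  using psi_rep[OF Qx_subfield[OF proot_zeta] subset_refl]
  by (intro schur_index_one) (auto simp: char_field_psi dest: irreducible_repD)

text \<open>\<psi> is one-dimensional with values in the character field, so inducing it realises
  the induced character over that field.\<close>

lemma schur_chi: "schur_index_Q G \<chi> = 1"
proof -
  obtain ts where ts: "left_transversal G H ts" using ex_left_transversal[OF H_subgroup fin] by blast
  note P = psi_rep[OF Qx_subfield[OF proot_zeta] subset_refl]
  show ?thesis
    using affords_induced[OF Qx_subfield[OF proot_zeta] irreducible_repD(1)[OF P(1)] _ P(2) ts]
    by (intro schur_index_one) (auto simp: char_field_chi induced_psi)
qed

lemma Omega_psi: "Omega (subgrp G H) \<psi> = (\<lambda>g. if g \<in> H then trace_val (\<psi> g) else 0)"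
proof
  fix g
  have e: "Omega (subgrp G H) \<psi> g = (\<Sum>a\<in>units. gal \<zeta> a (\<psi> g))"
    by (simp add: Omega_def schur_psi char_field_psi sum_Gal[OF proot_zeta])
  show "Omega (subgrp G H) \<psi> g = (if g \<in> H then trace_val (\<psi> g) else 0)"
  proof (cases "g \<in> H")
    case True
    then obtain j where j: "\<psi> g = \<zeta> ^ j" using psi_root by blast
    have "(\<Sum>a\<in>units. gal \<zeta> a (\<psi> g)) = (\<Sum>a\<in>units. \<psi> g ^ a)"
      unfolding j by (rule sum.cong) (auto simp: gal_power[OF proot_zeta])
    thus ?thesis using e True sum_units_power[OF psi_m[OF True]] by simp
  next
    case False
    have "(\<Sum>a\<in>units. gal \<zeta> a (\<psi> g)) = 0"
      unfolding psi_out[OF False] by (rule sum.neutral) (auto simp: gal_zero[OF proot_zeta])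
    thus ?thesis using e False by simp
  qed
qed

lemma Omega_chi: "Omega G \<chi> = (\<lambda>g. if g \<in> Z then of_nat p * trace_val (\<mu> g) else 0)"
proof
  fix g
  have e: "Omega G \<chi> g = (\<Sum>a\<in>units. gal \<zeta> a (\<chi> g))"
    by (simp add: Omega_def schur_chi char_field_chi sum_Gal[OF proot_zeta])
  show "Omega G \<chi> g = (if g \<in> Z then of_nat p * trace_val (\<mu> g) else 0)"
  proof (cases "g \<in> Z")
    case True
    then obtain j where j: "\<mu> g = \<zeta> ^ j" using mu_root by blast
    have "(\<Sum>a\<in>units. gal \<zeta> a (\<chi> g)) = (\<Sum>a\<in>units. of_nat p * \<mu> g ^ a)"
      by (rule sum.cong) (auto simp: chi_mu_def True j gal_scaled[OF proot_zeta])
    also have "\<dots> = of_nat p * trace_val (\<mu> g)"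
      using sum_units_power[OF mu_m[OF True]] by (simp add: sum_distrib_left[symmetric])
    finally show ?thesis using e True by simp
  next
    case False
    have "(\<Sum>a\<in>units. gal \<zeta> a (\<chi> g)) = 0"
      by (rule sum.neutral) (auto simp: chi_mu_def False gal_zero[OF proot_zeta])
    thus ?thesis using e False by simp
  qed
qed

text \<open>On \<open>H\<close> the character \<Omega>(\<psi>) is the sum of the powers of \<psi>
  with exponents prime to \<open>p\<close>, and induction is additive.\<close>

lemma induced_Omega: "induced_char G H (Omega (subgrp G H) \<psi>) = Omega G \<chi>"
proof
  fix g
  have O: "Omega (subgrp G H) \<psi> x = (\<Sum>a\<in>units. \<psi> x ^ a)" if "x \<in> H" for x
    using that sum_units_power[OF psi_m[OF that]] by (simp add: Omega_psi)
  have "induced_char G H (Omega (subgrp G H) \<psi>) g = (\<Sum>a\<in>units. induced_char G H (\<lambda>x. \<psi> x ^ a) g)"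
  proof (cases "g \<in> carrier G")
    case True
    let ?S = "{x \<in> carrier G. inv x \<otimes> g \<otimes> x \<in> H}"
    have "(\<Sum>x\<in>?S. Omega (subgrp G H) \<psi> (inv x \<otimes> g \<otimes> x)) = (\<Sum>x\<in>?S. \<Sum>a\<in>units. \<psi> (inv x \<otimes> g \<otimes> x) ^ a)"
      by (rule sum.cong) (auto simp: O)
    also have "\<dots> = (\<Sum>a\<in>units. \<Sum>x\<in>?S. \<psi> (inv x \<otimes> g \<otimes> x) ^ a)" by (rule sum.swap)
    finally show ?thesis using True by (simp add: induced_char_def sum_divide_distrib)
  qed (simp add: induced_char_def)
  also have "\<dots> = (\<Sum>a\<in>units. if g \<in> Z then of_nat p * \<mu> g ^ a else 0)"
    by (rule sum.cong) (auto simp: induced_psi_power)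
  also have "\<dots> = Omega G \<chi> g"
    using sum_units_power[OF mu_m, of g] by (simp add: Omega_chi sum_distrib_left[symmetric])
  finally show "induced_char G H (Omega (subgrp G H) \<psi>) g = Omega G \<chi> g" .
qed

text \<open>\<open>\<sigma>\<close> is an arbitrary representation with the given character. Its
  kernel is found from traces, which supplies the two conditions needed for irreducibility:
  \<open>u\<close> acts trivially and nontrivial commutators do not.\<close>

lemma induced_from_Omega:
  assumes irr: "irreducible_rep \<rat> (subgrp G H) e \<sigma>"
    and aff: "affords (subgrp G H) e \<sigma> (Omega (subgrp G H) \<psi>)" and ts: "left_transversal G H ts"
  shows "irreducible_rep \<rat> G (length ts * e) (induced_rep G H ts e \<sigma>)"
    and "affords G (length ts * e) (induced_rep G H ts e \<sigma>) (Omega G \<chi>)"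
proof -
  have ker: "\<sigma> x = 1\<^sub>m e \<longleftrightarrow> \<psi> x = 1" if x: "x \<in> H" for x
  proof (rule kernel_by_trace[OF H_group irr, of _ "p ^ N" 1])
    show "x [^]\<^bsub>subgrp G H\<^esub> (p ^ N) = \<one>\<^bsub>subgrp G H\<^esub>"
      using Cen_carrier[OF x] by (simp add: subgrp_nat_pow)
    fix j :: nat
    have "x [^] j \<in> H" by (rule subgroup_nat_pow[OF H_subgroup x])
    thus "afforded_character (subgrp G H) e \<sigma> (x [^]\<^bsub>subgrp G H\<^esub> j) = 1 * trace_val (\<psi> x ^ j)"
      using aff x by (simp add: affords_def Omega_psi subgrp_nat_pow psi_pow)
  qed (use x H_comm p_gt1 in auto)
  show "irreducible_rep \<rat> G (length ts * e) (induced_rep G H ts e \<sigma>)"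
    by (rule ind_irreducible[OF complex_subfield_Rats irr _ _ ts]) (use ker mu_D in auto)
  show "affords G (length ts * e) (induced_rep G H ts e \<sigma>) (Omega G \<chi>)"
    using affords_induced(2)[OF complex_subfield_Rats irreducible_repD(1,2)[OF irr] aff ts]
    by (simp add: induced_Omega)
qed

lemma Omega_kernel:
  assumes irr: "irreducible_rep \<rat> G n \<rho>" and aff: "affords G n \<rho> (Omega G \<chi>)" and z: "z \<in> Z"
  shows "\<rho> z = 1\<^sub>m n \<longleftrightarrow> \<mu> z = 1"
proof (rule kernel_by_trace[OF is_group irr, of _ "p ^ N" "of_nat p"])
  show "z [^] (p ^ N) = \<one>" using z by simp
  fix j :: nat
  show "afforded_character G n \<rho> (z [^] j) = of_nat p * trace_val (\<mu> z ^ j)"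
    using aff z by (simp add: affords_def Omega_chi mu_pow)
qed (use z Z_comm p_gt1 in auto)

lemma cyc_rep_H:
  "irreducible_rep \<rat> (subgrp G H) d (\<lambda>h. cyc_mat \<zeta> (\<psi> h))"
  "affords (subgrp G H) d (\<lambda>h. cyc_mat \<zeta> (\<psi> h)) (Omega (subgrp G H) \<psi>)"
  using cyc_rep[OF proot_zeta H_group, of \<psi> z0]
  by (simp_all add: psi_mult psi_m affords_def Omega_psi)

end

section \<open>Rational representations whose central kernel is that of the given character\<close>

context phi2_full
begin

text \<open>If \<open>u\<close> fixed no nonzero vector, neither would its conjugates
  \<open>u c ^ j\<close>, so the averages \<open>E j\<close> of a vector \<open>v\<close> over their
  powers would vanish. Summing over \<open>j\<close>, the terms with exponent
  \<open>0 < i < p\<close> cancel because the powers of the central element \<open>c ^ i\<close> sum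
  to zero. What remains is \<open>p\<close> times \<open>v\<close>.\<close>

lemma fixed_vector:
  assumes irr: "irreducible_rep \<rat> G n \<rho>" and ker: "\<And>z. z \<in> Z \<Longrightarrow> \<rho> z = 1\<^sub>m n \<longleftrightarrow> \<mu> z = 1"
  obtains w where "w \<in> vecs_over \<rat> n" "w \<noteq> 0\<^sub>v n" "\<rho> u *\<^sub>v w = w"
proof (rule ccontr)
  note main = that
  assume no: "\<not> thesis"
  note Q = complex_subfield_Rats
  note R0 = irreducible_repD(1)[OF irr]
  note R = matrix_repD[OF R0]
  have n: "n > 0" by (rule irreducible_repD(2)[OF irr])
  have zero: "w = 0\<^sub>v n" if "w \<in> vecs_over \<rat> n" "\<rho> u *\<^sub>v w = w" for w
    using no main that by blast
  obtain t where t: "t \<in> carrier G" "com u t \<noteq> \<one>" by (rule ex_t)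
  define c where "c = com u t"
  have c: "c \<in> D" "c \<in> Z" "c \<noteq> \<one>" "c [^] p = \<one>"
    using t com_pow_p[of u t] by (auto simp: c_def intro: commutator_in_derived)
  have cp: "c [^] (j :: nat) \<in> carrier G" for j using c by simp
  define v :: "complex vec" where "v = unit_vec n 0"
  have vQ: "v \<in> vecs_over \<rat> n" unfolding v_def by (rule vecs_over_unit[OF Q])
  hence vc: "v \<in> carrier_vec n" by (rule vecs_overD)
  define E where "E j = vsum n {..<p} (\<lambda>i. \<rho> ((u \<otimes> c [^] j) [^] i) *\<^sub>v v)" for j :: nat
  have ucG: "u \<otimes> c [^] j \<in> carrier G" for j :: nat using cp by simp
  have ucpow: "(u \<otimes> c [^] j) [^] i = u [^] i \<otimes> c [^] (j * i)" for i j :: nat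
    using pow_mult_distrib[of u "c [^] j" i] Z_comm[of "c [^] j" u] c by (simp add: nat_pow_pow)
  have EQ: "E j \<in> vecs_over \<rat> n" for j :: nat
  proof -
    have "\<rho> ((u \<otimes> c [^] j) [^] i) *\<^sub>v v \<in> vecs_over \<rat> n" for i :: nat
      using mats_over_mult_vec[OF Q R(1) vQ] ucG by simp
    thus ?thesis by (auto simp: E_def vecs_over_def intro!: subfield_closed(8)[OF Q])
  qed
  have Ec: "E j \<in> carrier_vec n" for j using EQ by (rule vecs_overD)
  have E0: "E j = 0\<^sub>v n" for j :: nat
  proof -
    have up: "\<rho> (u [^] p) = 1\<^sub>m n" using ker[OF pow_p_central[OF uG]] mu_u by simp
    have "c [^] (j * p) = \<one>" using pow_eq_one_dvd[OF _ c(4,3), of "j * p"] c by simp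
    hence "\<rho> ((u \<otimes> c [^] j) [^] p) = 1\<^sub>m n" using up by (simp add: ucpow)
    from power_average_fixed[OF R0 ucG this vc]
    have fx: "\<rho> (u \<otimes> c [^] j) *\<^sub>v E j = E j" by (simp add: E_def)
    \<comment> \<open>Conjugation by \<open>t ^ j\<close> turns \<open>u\<close> into
      \<open>u c ^ j\<close>, so \<open>\<rho> y\<close> carries fixed vectors of the latter to
      fixed vectors of the former.\<close>
    define y where "y = t [^] j"
    have y: "y \<in> carrier G" using t by (simp add: y_def)
    have "com u y = c [^] j" using t by (simp add: y_def c_def com_pow_right)
    hence "u \<otimes> y = y \<otimes> (u \<otimes> c [^] j)"
      using mult_commute_commutator[OF uG y] y cp by (simp add: m_assoc)
    hence "\<rho> u *\<^sub>v (\<rho> y *\<^sub>v E j) = \<rho> y *\<^sub>v E j"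
      using R(5)[OF uG y Ec] R(5)[OF y ucG Ec] fx by metis
    hence z: "\<rho> y *\<^sub>v E j = 0\<^sub>v n"
      using zero mats_over_mult_vec[OF Q R(1)[OF y] EQ] by blast
    have "E j = \<rho> (inv y) *\<^sub>v (\<rho> y *\<^sub>v E j)"
      using R(5)[OF _ y Ec, of "inv y" j] y R(3) Ec[of j] by simp
    thus ?thesis using z mult_mat_zero_vec[OF R(2)[of "inv y"]] y by simp
  qed
  have nz: "\<rho> (c [^] i) \<noteq> 1\<^sub>m n" if i: "0 < i" "i < p" for i
  proof -
    have "\<not> p dvd i" using i by (auto dest: dvd_imp_le)
    hence "c [^] i \<noteq> \<one>" using pow_eq_one_dvd[OF _ c(4,3), of i] c by simp
    moreover have "c [^] i \<in> D" by (rule subgroup_nat_pow[OF D_subgroup c(1)])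
    ultimately show ?thesis using ker[of "c [^] i"] mu_D c by simp
  qed
  have sum0: "vsum n {..<p} (\<lambda>j. \<rho> (c [^] (j * i)) *\<^sub>v v) = 0\<^sub>v n" if i: "0 < i" "i < p" for i :: nat
  proof (rule sum_entries_zero_vsum)
    fix a b assume ab: "a < n" "b < n"
    have "(c [^] i) [^] p = \<one>" using pow_eq_one_dvd[OF _ c(4,3), of "i * p"] c by (simp add: nat_pow_pow)
    hence 1: "\<rho> ((c [^] i) [^] p) = 1\<^sub>m n" using R(3) by simp
    have "(\<Sum>j<p. \<rho> ((c [^] i) [^] j) $$ (a, b)) = 0"
      by (rule central_sum_dichotomy[OF is_group Q irr cp _ 1 nz[OF i] ab]) (use c Z_comm in auto)
    thus "(\<Sum>j<p. \<rho> (c [^] (j * i)) $$ (a, b)) = 0" using c by (simp add: nat_pow_pow mult.commute)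
  qed (use vc R(2)[OF cp] in auto)
  \<comment> \<open>One double sum in two orders: grouped by the exponent \<open>i\<close> only
    \<open>i = 0\<close> survives, grouped by \<open>j\<close> it consists of the vanishing
    averages.\<close>
  have "of_nat p * v $ 0 = (\<Sum>i<p. vsum n {..<p} (\<lambda>j. \<rho> (u [^] i) *\<^sub>v (\<rho> (c [^] (j * i)) *\<^sub>v v)) $ 0)"
  proof -
    have "vsum n {..<p} (\<lambda>j. \<rho> (u [^] i) *\<^sub>v (\<rho> (c [^] (j * i)) *\<^sub>v v)) = 0\<^sub>v n" if i: "0 < i" "i < p" for i
    proof -
      have ui: "u [^] i \<in> carrier G" by simp
      have "vsum n {..<p} (\<lambda>j. \<rho> (u [^] i) *\<^sub>v (\<rho> (c [^] (j * i)) *\<^sub>v v))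
          = \<rho> (u [^] i) *\<^sub>v vsum n {..<p} (\<lambda>j. \<rho> (c [^] (j * i)) *\<^sub>v v)"
        by (rule mult_mat_vsum[OF R(2)[OF ui], symmetric]) (rule mult_mat_vec_carrier[OF R(2)[OF cp] vc])
      thus ?thesis using sum0[OF i] mult_mat_zero_vec[OF R(2)[OF ui]] by simp
    qed
    hence "(\<Sum>i<p. vsum n {..<p} (\<lambda>j. \<rho> (u [^] i) *\<^sub>v (\<rho> (c [^] (j * i)) *\<^sub>v v)) $ 0)
      = (\<Sum>i<p. if i = 0 then of_nat p * v $ 0 else 0)"
      using n vc by (intro sum.cong) (auto simp: R(3) simp del: vsum_index, simp add: vsum_def)
    thus ?thesis using p_gt1 by simp
  qed
  also have "\<dots> = (\<Sum>i<p. \<Sum>j<p. (\<rho> ((u \<otimes> c [^] j) [^] i) *\<^sub>v v) $ 0)"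
    using n R(5)[OF _ cp vc] by (simp add: ucpow)
  also have "\<dots> = (\<Sum>j<p. \<Sum>i<p. (\<rho> ((u \<otimes> c [^] j) [^] i) *\<^sub>v v) $ 0)" by (rule sum.swap)
  also have "\<dots> = (\<Sum>j<p. E j $ 0)" using n by (simp add: E_def)
  also have "\<dots> = 0" using n by (simp add: E0)
  finally show False using n p_gt1 by (simp add: v_def)
qed

lemma block_div_mod:
  assumes "b < (e :: nat)"
  shows "(a * e + b) div e = a" "(a * e + b) mod e = b"
  using assms by simp_all

declare One_nat_def [simp del]

text \<open>Frobenius reciprocity written out: \<open>H\<close> acts on the span of the central
  translates of a vector fixed by \<open>u\<close> through \<psi>, as on the cyclotomic field, and
  this extends to an intertwiner from the induced representation.\<close>

lemma equivalent_to_induced: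
  assumes irr: "irreducible_rep \<rat> G n \<rho>" and ker: "\<And>z. z \<in> Z \<Longrightarrow> \<rho> z = 1\<^sub>m n \<longleftrightarrow> \<mu> z = 1"
    and ts: "left_transversal G H ts"
  shows "equivalent_reps \<rat> G n \<rho> (length ts * d) (induced_rep G H ts d (\<lambda>h. cyc_mat \<zeta> (\<psi> h)))"
proof -
  note Q = complex_subfield_Rats
  note R0 = irreducible_repD(1)[OF irr]
  note R = matrix_repD[OF R0]
  let ?\<sigma> = "\<lambda>h. cyc_mat \<zeta> (\<psi> h)"
  interpret I: induction G H ts "\<rat>" d ?\<sigma>
  proof (rule induction.intro)
    show "transversal G H ts" by (intro transversal.intro transversal_axioms.intro is_group H_subgroup ts)
    show "induction_axioms G H \<rat> d ?\<sigma>"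
      by (rule induction_axioms.intro[OF Q irreducible_repD(1,2)[OF cyc_rep_H(1)]])
  qed
  obtain w where w: "w \<in> vecs_over \<rat> n" "w \<noteq> 0\<^sub>v n" "\<rho> u *\<^sub>v w = w"
    using fixed_vector[OF irr ker] by blast
  have wc: "w \<in> carrier_vec n" using w(1) by (rule vecs_overD)
  have z0p: "z0 [^] (j :: nat) \<in> carrier G" for j by simp
  define L where "L = length ts"
  \<comment> \<open>Basis vector \<open>b\<close> of block \<open>k\<close> goes to the translate of
    \<open>w\<close> by \<open>ts ! k \<otimes> z0 [^] b\<close>.\<close>
  define T where "T = mat n (L * d) (\<lambda>(r, i). (\<rho> (ts ! (i div d) \<otimes> z0 [^] (i mod d)) *\<^sub>v w) $ r)"
  have Tc: "T \<in> carrier_mat n (L * d)" by (simp add: T_def)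
  have d0: "d > 0" by (rule d_pos)
  have tsc: "ts ! k \<in> carrier G" if "k < L" for k using that by (simp add: L_def)
  have Ti: "T $$ (r, k * d + b) = (\<rho> (ts ! k \<otimes> z0 [^] b) *\<^sub>v w) $ r" if "r < n" "k < L" "b < d" for r k b
  proof -
    have "T $$ (r, k * d + b) = (\<rho> (ts ! ((k * d + b) div d) \<otimes> z0 [^] ((k * d + b) mod d)) *\<^sub>v w) $ r"
      using that block_bound[of k L b d] by (simp add: T_def)
    thus ?thesis by (simp only: block_div_mod[OF that(3)])
  qed
  have over: "\<rho> g *\<^sub>v w \<in> vecs_over \<rat> n" if "g \<in> carrier G" for g
    by (rule mats_over_mult_vec[OF Q R(1)[OF that] w(1)])
  have TQ: "T $$ (r, i) \<in> \<rat>" if "r < n" "i < L * d" for r i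
  proof -
    have "i div d < L" using that d0 by (simp add: div_less_iff_less_mult)
    hence "ts ! (i div d) \<otimes> z0 [^] (i mod d) \<in> carrier G" using tsc by simp
    thus ?thesis using over that by (simp add: T_def vecs_over_def)
  qed
  \<comment> \<open>On the centre \<open>\<rho>\<close> depends on the value of \<mu> only, so any
    central element may be replaced by a power of \<open>z0\<close>.\<close>
  have same: "\<rho> z = \<rho> z'" if zz: "z \<in> Z" "z' \<in> Z" "\<mu> z = \<mu> z'" for z z'
  proof -
    have "\<mu> (z \<otimes> inv z') = 1" using zz mu_nonzero[OF zz(2)] by (simp add: mu_mult mu_inv)
    hence 1: "\<rho> (z \<otimes> inv z') = 1\<^sub>m n" using ker[of "z \<otimes> inv z'"] zz by simp
    have "\<rho> (z \<otimes> inv z' \<otimes> z') = \<rho> (z \<otimes> inv z') * \<rho> z'" using zz by (intro R(4)) auto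
    moreover have "z \<otimes> inv z' \<otimes> z' = z" using zz by (simp add: m_assoc)
    ultimately show ?thesis using 1 R(2)[of z'] zz by simp
  qed
  have hw: "\<rho> h *\<^sub>v (\<rho> (z0 [^] b) *\<^sub>v w) = \<rho> (z0 [^] (expo \<zeta> (\<psi> h) + b)) *\<^sub>v w" if h: "h \<in> H" for h and b :: nat
  proof -
    obtain i z where x: "z \<in> Z" "h = u [^] (i :: nat) \<otimes> z" using H_elements[OF h] by metis
    have ui: "\<rho> (u [^] i) *\<^sub>v w = w" for i :: nat
    proof (induction i)
      case (Suc i)
      thus ?case using R(5)[OF nat_pow_closed[OF uG] uG wc, of i] w(3) by simp
    qed (use wc R(3) in simp)
    have ez: "\<zeta> ^ expo \<zeta> (\<psi> h) = \<mu> z"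
      using expo[OF proot_zeta psi_m[OF h]] x psi_val by simp
    have hG: "h \<in> carrier G" using h by (rule Cen_carrier)
    have zz: "z \<otimes> z0 [^] b \<in> Z" using x by simp
    have zzG: "z \<otimes> z0 [^] b \<in> carrier G" using zz by (rule Z_carrier)
    have "h \<otimes> z0 [^] b = u [^] i \<otimes> (z \<otimes> z0 [^] b)" using x by (simp add: m_assoc)
    also have "\<dots> = (z \<otimes> z0 [^] b) \<otimes> u [^] i" using Z_comm[OF zz, of "u [^] i"] by simp
    finally have "\<rho> h *\<^sub>v (\<rho> (z0 [^] b) *\<^sub>v w) = \<rho> (z \<otimes> z0 [^] b) *\<^sub>v (\<rho> (u [^] i) *\<^sub>v w)"
      using R(5)[OF hG z0p wc, of b] R(5)[OF zzG nat_pow_closed[OF uG] wc, of i] by simp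
    also have "\<dots> = \<rho> (z \<otimes> z0 [^] b) *\<^sub>v w" by (simp add: ui)
    also have "\<rho> (z \<otimes> z0 [^] b) = \<rho> (z0 [^] (expo \<zeta> (\<psi> h) + b))"
      by (rule same) (use x(1) zz in \<open>simp_all add: mu_mult mu_pow power_add ez\<close>)
    finally show ?thesis .
  qed
  have z0m: "\<rho> (z0 [^] (j mod m)) = \<rho> (z0 [^] j)" for j
    by (rule same) (simp_all add: mu_pow proot_power_mod[OF proot_zeta])
  \<comment> \<open>The translates satisfy the same relations as powers of the root:
    \<open>z0 ^ q\<close> acts nontrivially with period \<open>p\<close>, so its \<open>p\<close>
    powers sum to zero.\<close>
  have expand: "(\<rho> (g \<otimes> z0 [^] j) *\<^sub>v w) $ r = (\<Sum>a<d. cf a j * (\<rho> (g \<otimes> z0 [^] a) *\<^sub>v w) $ r)"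
    if g: "g \<in> carrier G" and r: "r < n" for g r j
  proof (rule cf_expand)
    fix j
    show "(\<rho> (g \<otimes> z0 [^] (j mod m)) *\<^sub>v w) $ r = (\<rho> (g \<otimes> z0 [^] j) *\<^sub>v w) $ r"
      using R(4)[OF g z0p] z0m by simp
  next
    fix s :: nat
    define y where "y = \<rho> (g \<otimes> z0 [^] s) *\<^sub>v w"
    have gs: "g \<otimes> z0 [^] s \<in> carrier G" using g by simp
    have yc: "y \<in> carrier_vec n" unfolding y_def by (rule mult_mat_vec_carrier[OF R(2)[OF gs] wc])
    have x: "z0 [^] q \<in> carrier G" by simp
    have nt: "\<rho> (z0 [^] q) \<noteq> 1\<^sub>m n" using ker[of "z0 [^] q"] mu_q by (simp add: mu_pow)
    have "\<mu> ((z0 [^] q) [^] p) = 1" using mu_m[OF z0] by (simp add: mu_pow power_mult[symmetric] mult.commute)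
    hence one: "\<rho> ((z0 [^] q) [^] p) = 1\<^sub>m n" using ker[of "(z0 [^] q) [^] p"] by simp
    have xp: "(z0 [^] q) [^] (l :: nat) \<in> carrier G" for l by simp
    have v0: "vsum n {..<p} (\<lambda>l. \<rho> ((z0 [^] q) [^] l) *\<^sub>v y) = 0\<^sub>v n"
      by (rule sum_entries_zero_vsum[OF R(2)[OF xp] _ yc],
          rule central_sum_dichotomy[OF is_group Q irr x _ one nt]) (simp_all add: Z_comm)
    have "g \<otimes> z0 [^] (q * l + s) = (z0 [^] q) [^] l \<otimes> (g \<otimes> z0 [^] s)" for l :: nat
    proof -
      have "g \<otimes> z0 [^] (q * l + s) = g \<otimes> (z0 [^] q) [^] l \<otimes> z0 [^] s"
        using g by (simp add: nat_pow_mult[symmetric] nat_pow_pow m_assoc)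
      also have "g \<otimes> (z0 [^] q) [^] l = (z0 [^] q) [^] l \<otimes> g" using Z_comm[of "(z0 [^] q) [^] l" g] g by simp
      finally show ?thesis using g by (simp add: m_assoc)
    qed
    hence "(\<Sum>l<p. (\<rho> (g \<otimes> z0 [^] (q * l + s)) *\<^sub>v w) $ r) = (\<Sum>l<p. (\<rho> ((z0 [^] q) [^] l) *\<^sub>v y) $ r)"
      using R(5)[OF xp gs wc] by (simp add: y_def)
    also have "\<dots> = vsum n {..<p} (\<lambda>l. \<rho> ((z0 [^] q) [^] l) *\<^sub>v y) $ r" using r by simp
    also have "\<dots> = 0" unfolding v0 using r by simp
    finally show "(\<Sum>l<p. (\<rho> (g \<otimes> z0 [^] (q * l + s)) *\<^sub>v w) $ r) = 0" .
  qed
  have int: "\<rho> g * T = T * I.ind g" if g: "g \<in> carrier G" for g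
  proof (rule eq_matI)
    have ic: "I.ind g \<in> carrier_mat (L * d) (L * d)" by (simp add: L_def)
    fix r i assume "r < dim_row (T * I.ind g)" "i < dim_col (T * I.ind g)"
    hence r: "r < n" and i: "i < L * d" using Tc ic by auto
    define l b where "l = i div d" and "b = i mod d"
    have l: "l < L" using i d0 by (simp add: l_def div_less_iff_less_mult)
    have b: "b < d" using d0 by (simp add: b_def)
    have ie: "i = l * d + b" unfolding l_def b_def by (rule div_mult_mod_eq[symmetric])
    have tl: "ts ! l \<in> carrier G" using tsc[OF l] .
    have tlb: "ts ! l \<otimes> z0 [^] b \<in> carrier G" using tl by simp
    obtain k where k: "k < L" "inv (ts ! k) \<otimes> (g \<otimes> ts ! l) \<in> H"
      using I.ex_index[of "g \<otimes> ts ! l"] g tl unfolding L_def by auto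
    define h where "h = inv (ts ! k) \<otimes> g \<otimes> ts ! l"
    have tk: "ts ! k \<in> carrier G" using tsc[OF k(1)] .
    have hk: "h \<in> H" using k tk tl g by (simp add: h_def m_assoc)
    have hG: "h \<in> carrier G" using hk by (rule Cen_carrier)
    have gt: "g \<otimes> ts ! l = ts ! k \<otimes> h" using tk tl g by (simp add: h_def m_assoc)
    have "(\<rho> g * T) $$ (r, i) = (\<rho> g *\<^sub>v (\<rho> (ts ! l \<otimes> z0 [^] b) *\<^sub>v w)) $ r"
      unfolding mult_mat_index[OF R(2)[OF g] Tc r i]
        mult_mat_vec_index[OF R(2)[OF g] mult_mat_vec_carrier[OF R(2)[OF tlb] wc] r]
      by (rule sum.cong) (auto simp: ie Ti[OF _ l b])
    also have "\<dots> = (\<rho> (ts ! k) *\<^sub>v (\<rho> h *\<^sub>v (\<rho> (z0 [^] b) *\<^sub>v w))) $ r"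
    proof -
      have zb: "\<rho> (z0 [^] b) *\<^sub>v w \<in> carrier_vec n" by (rule mult_mat_vec_carrier[OF R(2)[OF z0p] wc])
      have "\<rho> g *\<^sub>v (\<rho> (ts ! l \<otimes> z0 [^] b) *\<^sub>v w) = \<rho> (g \<otimes> ts ! l) *\<^sub>v (\<rho> (z0 [^] b) *\<^sub>v w)"
        using R(5)[OF tl z0p wc, of b] R(5)[OF g tl zb] by simp
      thus ?thesis unfolding gt using R(5)[OF tk hG zb] by simp
    qed
    also have "\<dots> = (\<rho> (ts ! k \<otimes> z0 [^] (expo \<zeta> (\<psi> h) + b)) *\<^sub>v w) $ r"
      unfolding hw[OF hk] using R(5)[OF tk z0p wc, of "expo \<zeta> (\<psi> h) + b"] by simp
    also have "\<dots> = (\<Sum>a<d. cf a (expo \<zeta> (\<psi> h) + b) * (\<rho> (ts ! k \<otimes> z0 [^] a) *\<^sub>v w) $ r)"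
      by (rule expand[OF tk r])
    also have "\<dots> = (\<Sum>a<d. T $$ (r, k * d + a) * I.ind g $$ (k * d + a, l * d + b))"
    proof (rule sum.cong[OF refl])
      fix a assume "a \<in> {..<d}"
      hence a: "a < d" by simp
      have "I.ind g $$ (k * d + a, l * d + b) = cf a (expo \<zeta> (\<psi> h) + b)"
        using I.ind_index[of k l a b g] k l a b hk by (simp add: L_def h_def[symmetric] cyc_mat_def)
      thus "cf a (expo \<zeta> (\<psi> h) + b) * (\<rho> (ts ! k \<otimes> z0 [^] a) *\<^sub>v w) $ r
          = T $$ (r, k * d + a) * I.ind g $$ (k * d + a, l * d + b)"
        using Ti[OF r k(1) a] by simp
    qed
    \<comment> \<open>Adding the zero blocks completes the single nonzero block to the full column
      of the induced matrix.\<close>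
    also have "\<dots> = (\<Sum>k'<L. if k' = k then \<Sum>a<d. T $$ (r, k * d + a) * I.ind g $$ (k * d + a, l * d + b) else 0)"
      using k by simp
    also have "\<dots> = (\<Sum>k'<L. \<Sum>a<d. T $$ (r, k' * d + a) * I.ind g $$ (k' * d + a, l * d + b))"
    proof (rule sum.cong[OF refl])
      fix k' assume "k' \<in> {..<L}"
      hence k': "k' < L" by simp
      show "(if k' = k then \<Sum>a<d. T $$ (r, k * d + a) * I.ind g $$ (k * d + a, l * d + b) else 0)
        = (\<Sum>a<d. T $$ (r, k' * d + a) * I.ind g $$ (k' * d + a, l * d + b))"
      proof (cases "k' = k")
        case False
        have "inv (ts ! k') \<otimes> (g \<otimes> ts ! l) \<notin> H"
        proof
          assume "inv (ts ! k') \<otimes> (g \<otimes> ts ! l) \<in> H"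
          hence "k' = k" using I.index_unique[of "g \<otimes> ts ! l" k' k] k k' g tl by (simp add: L_def)
          thus False using False by simp
        qed
        hence "inv (ts ! k') \<otimes> g \<otimes> ts ! l \<notin> H" using tsc[OF k'] g tl by (simp add: m_assoc)
        hence "I.ind g $$ (k' * d + a, l * d + b) = 0" if "a < d" for a
          using I.ind_index[of k' l a b g] k' l that b by (simp add: L_def)
        hence "(\<Sum>a<d. T $$ (r, k' * d + a) * I.ind g $$ (k' * d + a, l * d + b)) = 0"
          by (intro sum.neutral) simp
        thus ?thesis using False by (simp only: if_False)
      next
        case True
        show ?thesis unfolding True by simp
      qed
    qed
    also have "\<dots> = (\<Sum>j<L * d. T $$ (r, j) * I.ind g $$ (j, l * d + b))"
      by (rule sum_blocks[OF d0, symmetric])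
    also have "\<dots> = (T * I.ind g) $$ (r, i)"
      using mult_mat_index[OF Tc ic r i] by (simp add: ie)
    finally show "(\<rho> g * T) $$ (r, i) = (T * I.ind g) $$ (r, i)" .
  qed (use R(2)[OF g] Tc in \<open>auto simp: L_def carrier_matD[OF I.ind_carrier]\<close>)
  have T0: "T \<noteq> 0\<^sub>m n (L * d)"
  proof
    assume z: "T = 0\<^sub>m n (L * d)"
    have L0: "0 < L" using I.L_pos by (simp add: L_def)
    have t0: "ts ! 0 \<in> carrier G" using tsc[OF L0] .
    have "\<rho> (ts ! 0) *\<^sub>v w = 0\<^sub>v n"
    proof (rule eq_vecI)
      fix r assume "r < dim_vec (0\<^sub>v n)"
      thus "(\<rho> (ts ! 0) *\<^sub>v w) $ r = 0\<^sub>v n $ r"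
        using Ti[OF _ L0 d0, of r] z L0 d0 t0 by simp
    qed (use R(2)[OF t0] in auto)
    hence "\<rho> (inv (ts ! 0)) *\<^sub>v (\<rho> (ts ! 0) *\<^sub>v w) = 0\<^sub>v n"
      using mult_mat_zero_vec[OF R(2)[of "inv (ts ! 0)"]] t0 by simp
    moreover have "\<rho> (inv (ts ! 0)) *\<^sub>v (\<rho> (ts ! 0) *\<^sub>v w) = w"
      using R(5)[of "inv (ts ! 0)" "ts ! 0" w] t0 wc R(3) by simp
    ultimately show False using w by simp
  qed
  have irr': "irreducible_rep \<rat> G (L * d) I.ind"
    using induced_from_Omega(1)[OF cyc_rep_H ts] by (simp add: L_def)
  show ?thesis
    using schur_equivalent[OF Q is_group irr irr' Tc TQ T0 int] by (simp add: L_def)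
qed

declare One_nat_def [simp]

end

section \<open>The central character of a rational representation\<close>

context phi2_group
begin

text \<open>Let \<open>T\<close> be the central kernel of \<open>\<rho>\<close> and
  \<open>z0\<close> an element of maximal order modulo \<open>T\<close>. Once \<open>z0\<close> is
  shown to generate the centre modulo \<open>T\<close>, sending it to a root of unity of the same
  order gives a character with kernel \<open>T\<close>.\<close>

lemma central_char_of_rep:
  assumes irr: "irreducible_rep \<rat> G n \<rho>" and nt: "\<not> D \<subseteq> rep_kernel G n \<rho>"
  shows "\<exists>\<mu>\<in>central_chars G. \<forall>z\<in>Z. \<rho> z = 1\<^sub>m n \<longleftrightarrow> \<mu> z = 1"
proof -
  note Q = complex_subfield_Rats
  note R0 = irreducible_repD(1)[OF irr]
  note R = matrix_repD[OF R0]
  have n: "n > 0" by (rule irreducible_repD(2)[OF irr])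
  define T where "T = {z \<in> Z. \<rho> z = 1\<^sub>m n}"
  have Tm: "z \<otimes> z' \<in> T" if "z \<in> T" "z' \<in> T" for z z'
    using that R(4)[of z z'] by (simp add: T_def)
  have Tc: "z' \<in> T" if "z \<in> T" "z \<otimes> z' \<in> T" "z' \<in> Z" for z z'
    using that R(4)[of z z'] R(2)[of z'] by (simp add: T_def)
  have T1: "\<one> \<in> T" using R(3) by (simp add: T_def)
  have Tp: "z [^] (j :: nat) \<in> T" if "z \<in> T" for z j
    using that by (induction j) (simp_all add: T1 Tm)
  obtain c where c: "c \<in> D" "c \<notin> T" using nt by (auto simp: rep_kernel_def T_def)
  define P where "P e \<longleftrightarrow> (\<forall>z\<in>Z. z [^] (p ^ e) \<in> T)" for e :: nat
  have PN: "P N" using T1 by (simp add: P_def)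
  define e where "e = (LEAST e. P e)"
  have Pe: "P e" unfolding e_def using PN by (rule LeastI)
  have "\<not> P 0" using c by (auto simp: P_def)
  hence "e \<noteq> 0" using Pe by metis
  then obtain k where k: "e = Suc k" by (cases e) auto
  define q where "q = p ^ k"
  interpret X: prime_power p q k using prime_p by unfold_locales (simp_all add: q_def)
  have m: "\<And>z. z \<in> Z \<Longrightarrow> z [^] (p * q) \<in> T" using Pe by (simp add: P_def k q_def)
  have "\<not> P k" using not_less_Least[of k P] k by (simp add: e_def)
  then obtain z0 where z0: "z0 \<in> Z" "z0 [^] q \<notin> T" by (auto simp: P_def q_def)
  have m0: "p * q > 0" by (rule X.m_pos)
  have ord: "z0 [^] j \<in> T \<longleftrightarrow> p * q dvd j" for j :: nat
  proof
    assume j: "z0 [^] j \<in> T"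
    obtain a b where ab: "p * q * a = j * b + gcd (p * q) j" using bezout_nat[of "p * q" j] m0 by auto
    have "(z0 [^] j) [^] b \<otimes> z0 [^] gcd (p * q) j = (z0 [^] (p * q)) [^] a"
      using z0 ab by (simp add: nat_pow_pow nat_pow_mult)
    hence "(z0 [^] j) [^] b \<otimes> z0 [^] gcd (p * q) j \<in> T" using Tp[OF m[OF z0(1)], of a] by simp
    hence g: "z0 [^] gcd (p * q) j \<in> T" using Tc[OF Tp[OF j]] z0 by simp
    have "gcd (p * q) j dvd p ^ Suc k" by (simp add: q_def)
    then obtain i where i: "i \<le> Suc k" "gcd (p * q) j = p ^ i"
      using prime_p divides_primepow_nat by blast
    have "i = Suc k"
    proof (rule ccontr)
      assume "i \<noteq> Suc k"
      hence "p ^ i dvd q" using i by (simp add: q_def le_imp_power_dvd)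
      then obtain c where "q = p ^ i * c" by (elim dvdE)
      hence "z0 [^] q \<in> T" using Tp[OF g, of c] z0 i by (simp add: nat_pow_pow)
      thus False using z0 by simp
    qed
    hence "gcd (p * q) j = p * q" using i by (simp add: q_def)
    thus "p * q dvd j" by (metis gcd_dvd2)
  next
    assume "p * q dvd j"
    thus "z0 [^] j \<in> T" using Tp[OF m[OF z0(1)]] z0 by (auto simp: nat_pow_pow[symmetric] elim!: dvdE)
  qed
  have pw: "\<exists>j. z0 [^] (j :: nat) \<otimes> z \<in> T" if z: "z \<in> Z" for z
  proof (rule ccontr)
    assume no: "\<not> ?thesis"
    \<comment> \<open>Double counting: if no \<open>z0 ^ c z\<close> acted trivially, every sum over
      \<open>j\<close> would vanish. Every sum over \<open>c\<close> with \<open>j > 0\<close>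
      vanishes as well, since \<open>z0 ^ j\<close> acts nontrivially. But the terms with
      \<open>j = 0\<close> are all 1, so the total would be both 0 and \<open>p * q\<close>.\<close>
    define f where "f c j = \<rho> ((z0 [^] c \<otimes> z) [^] j) $$ (0, 0)" for c j :: nat
    have f1: "(\<Sum>j<p * q. f c j) = 0" for c
      unfolding f_def
    proof (rule central_sum_dichotomy[OF is_group Q irr _ _ _ _ n n])
      have zz: "z0 [^] c \<otimes> z \<in> Z" using z z0 by simp
      show "z0 [^] c \<otimes> z \<in> carrier G" using zz by (rule Z_carrier)
      show "z0 [^] c \<otimes> z \<otimes> g = g \<otimes> (z0 [^] c \<otimes> z)" if "g \<in> carrier G" for g
        by (rule Z_comm[OF zz that])
      show "\<rho> ((z0 [^] c \<otimes> z) [^] (p * q)) = 1\<^sub>m n" using m[of "z0 [^] c \<otimes> z"] z z0 by (simp add: T_def)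
      show "\<rho> (z0 [^] c \<otimes> z) \<noteq> 1\<^sub>m n" using no z z0 by (auto simp: T_def)
    qed
    have f2: "(\<Sum>c<p * q. f c j) = 0" if j: "0 < j" "j < p * q" for j
    proof -
      have zj: "z [^] j \<in> carrier G" using z by simp
      have "\<not> p * q dvd j" using j by (auto dest: dvd_imp_le)
      hence nt: "\<rho> (z0 [^] j) \<noteq> 1\<^sub>m n" using ord[of j] z0 by (simp add: T_def)
      have x: "z0 [^] j \<in> carrier G" using z0 by simp
      have xc: "(z0 [^] j) [^] (c :: nat) \<in> carrier G" for c using z0 by simp
      have one: "\<rho> ((z0 [^] j) [^] (p * q)) = 1\<^sub>m n"
        using m[of "z0 [^] j"] z0 by (simp add: T_def)
      have ee: "(z0 [^] c \<otimes> z) [^] j = (z0 [^] j) [^] c \<otimes> z [^] j" for c :: nat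
        using pow_mult_distrib[of "z0 [^] c" z j] Z_comm[of z "z0 [^] c"] z z0 by (simp add: nat_pow_pow mult.commute)
      have "(\<Sum>c<p * q. f c j) = (\<Sum>c<p * q. \<Sum>a<n. \<rho> ((z0 [^] j) [^] c) $$ (0, a) * \<rho> (z [^] j) $$ (a, 0))"
        unfolding f_def ee R(4)[OF xc zj] mult_mat_index[OF R(2)[OF xc] R(2)[OF zj] n n] ..
      also have "\<dots> = (\<Sum>a<n. (\<Sum>c<p * q. \<rho> ((z0 [^] j) [^] c) $$ (0, a)) * \<rho> (z [^] j) $$ (a, 0))"
        by (subst sum.swap) (simp add: sum_distrib_right)
      also have "\<dots> = 0"
        using central_sum_dichotomy[OF is_group Q irr x _ one nt n] Z_comm z0
        by (intro sum.neutral) auto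
      finally show ?thesis .
    qed
    have "of_nat (p * q) = (\<Sum>j<p * q. if j = 0 then of_nat (p * q) else (0 :: complex))" using m0 by simp
    also have "\<dots> = (\<Sum>j<p * q. \<Sum>c<p * q. f c j)"
    proof (rule sum.cong[OF refl])
      fix j assume "j \<in> {..<p * q}"
      thus "(if j = 0 then of_nat (p * q) else (0 :: complex)) = (\<Sum>c<p * q. f c j)"
        using f2[of j] n by (cases "j = 0") (auto simp: f_def R(3))
    qed
    also have "\<dots> = (\<Sum>c<p * q. \<Sum>j<p * q. f c j)" by (rule sum.swap)
    finally show False using m0 by (simp add: f1)
  qed
  define \<zeta> where "\<zeta> = cis (2 * pi / of_nat (p * q))"
  have prim: "\<zeta> ^ j = 1 \<longleftrightarrow> p * q dvd j" for j :: nat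
  proof -
    have e: "\<zeta> ^ i = cis (2 * pi * real i / real (p * q))" for i
      by (simp add: \<zeta>_def DeMoivre mult.commute)
    have "\<zeta> ^ q \<noteq> 1"
    proof
      assume "\<zeta> ^ q = 1"
      hence "cis (2 * pi * real q / real (p * q)) = cis (2 * pi * real 0 / real (p * q))"
        using e[of q] by simp
      moreover have "q < p * q" using X.q_pos p_gt1 by simp
      moreover have "inj_on (\<lambda>k. cis (2 * pi * real k / real (p * q))) {..<p * q}"
        using bij_betw_roots_unity[OF m0] by (rule bij_betw_imp_inj_on)
      ultimately have "q = 0" using m0 by (auto dest: inj_onD[where x = q and y = 0])
      thus False using X.q_pos by simp
    qed
    moreover have "\<zeta> ^ (p * q) = 1" using m0 by (simp add: e)
    ultimately show ?thesis using X.proot_power_eq_1[of \<zeta> j] by (simp add: X.proot_def)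
  qed
  have ex: "\<exists>j :: nat. \<exists>t\<in>T. z = z0 [^] j \<otimes> t" if z: "z \<in> Z" for z
  proof -
    obtain j where j: "z0 [^] (j :: nat) \<otimes> z \<in> T" using pw[OF z] by blast
    \<comment> \<open>A natural number that serves as \<open>-j\<close> modulo
      \<open>p * q\<close>.\<close>
    define i where "i = (p * q - 1) * j"
    have ij: "i + j = p * q * j" using m0 by (simp add: i_def algebra_simps)
    have "z = z0 [^] i \<otimes> (inv (z0 [^] (i + j)) \<otimes> (z0 [^] j \<otimes> z))"
    proof -
      have "z0 [^] i \<otimes> (inv (z0 [^] (i + j)) \<otimes> (z0 [^] j \<otimes> z)) = inv (z0 [^] (i + j)) \<otimes> (z0 [^] i \<otimes> (z0 [^] j \<otimes> z))"
        using Z_comm[of "z0 [^] i" "inv (z0 [^] (i + j))"] z z0 by (simp add: m_assoc[symmetric])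
      also have "z0 [^] i \<otimes> (z0 [^] j \<otimes> z) = z0 [^] (i + j) \<otimes> z"
        using z z0 by (simp add: m_assoc[symmetric] nat_pow_mult)
      finally show ?thesis using z z0 by simp
    qed
    moreover have "inv (z0 [^] (i + j)) \<in> T"
      using Tc[of "z0 [^] (i + j)" "inv (z0 [^] (i + j))"] ord[of "i + j"] z0 T1 by (simp add: ij)
    ultimately show ?thesis using Tm j by blast
  qed
  define \<mu> where "\<mu> z = (if z \<in> Z then \<zeta> ^ (SOME j. \<exists>t\<in>T. z = z0 [^] j \<otimes> t) else 0)" for z
  have val: "\<mu> z = \<zeta> ^ j" if z: "t \<in> T" "z = z0 [^] j \<otimes> t" for z j t
  proof -
    have zZ: "z \<in> Z" using z z0 by (simp add: T_def)
    define i where "i = (SOME j :: nat. \<exists>t\<in>T. z = z0 [^] j \<otimes> t)"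
    have "\<exists>j :: nat. \<exists>t\<in>T. z = z0 [^] j \<otimes> t" using z by blast
    hence "\<exists>t\<in>T. z = z0 [^] i \<otimes> t" unfolding i_def by (rule someI_ex)
    then obtain s where s: "s \<in> T" "z = z0 [^] i \<otimes> s" by blast
    have *: "\<zeta> ^ i = \<zeta> ^ j" if st: "s \<in> T" "t \<in> T" "z0 [^] i \<otimes> s = z0 [^] j \<otimes> t" "i \<le> j"
      for i j :: nat and s t
    proof -
      have c: "s \<in> carrier G" "t \<in> carrier G" "z0 \<in> carrier G" using st z0 by (auto simp: T_def)
      have "z0 [^] i \<otimes> z0 [^] (j - i) = z0 [^] j" using nat_pow_mult[OF c(3), of i "j - i"] st(4) by simp
      hence "z0 [^] i \<otimes> s = z0 [^] i \<otimes> (z0 [^] (j - i) \<otimes> t)" using st c by (simp add: m_assoc[symmetric])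
      hence "s = t \<otimes> z0 [^] (j - i)" using c st Z_comm[of t "z0 [^] (j - i)"] by (simp add: T_def)
      hence "z0 [^] (j - i) \<in> T" using Tc[of t "z0 [^] (j - i)"] st z0 by simp
      hence 1: "\<zeta> ^ (j - i) = 1" using ord prim by simp
      have "\<zeta> ^ j = \<zeta> ^ i * \<zeta> ^ (j - i)" using st(4) by (simp flip: power_add)
      thus ?thesis using 1 by simp
    qed
    have st: "z0 [^] i \<otimes> s = z0 [^] j \<otimes> t" using s(2) z(2) by (rule trans[OF sym])
    have "\<zeta> ^ i = \<zeta> ^ j"
    proof (cases "i \<le> j")
      case True thus ?thesis by (rule *[OF s(1) z(1) st])
    next
      case False
      hence "j \<le> i" by simp
      thus ?thesis by (rule *[OF z(1) s(1) st[symmetric], symmetric])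
    qed
    moreover have "\<mu> z = \<zeta> ^ i" using zZ unfolding \<mu>_def i_def by (rule if_P)
    ultimately show ?thesis by simp
  qed
  have muT: "\<rho> z = 1\<^sub>m n \<longleftrightarrow> \<mu> z = 1" if z: "z \<in> Z" for z
  proof -
    obtain j t where jt: "t \<in> T" "z = z0 [^] (j :: nat) \<otimes> t" using ex[OF z] by blast
    have tc: "t \<in> Z" using jt by (simp add: T_def)
    have "\<rho> z = 1\<^sub>m n \<longleftrightarrow> z \<in> T" using z by (simp add: T_def)
    also have "\<dots> \<longleftrightarrow> z0 [^] j \<in> T"
    proof
      assume "z \<in> T"
      moreover have "z = t \<otimes> z0 [^] j" using jt tc z0 Z_comm[of t "z0 [^] j"] by simp
      ultimately show "z0 [^] j \<in> T" using Tc[of t "z0 [^] j"] jt z0 by simp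
    next
      assume "z0 [^] j \<in> T"
      thus "z \<in> T" using Tm jt by simp
    qed
    also have "\<dots> \<longleftrightarrow> \<mu> z = 1" using ord prim val[OF jt] by simp
    finally show ?thesis .
  qed
  have "\<mu> (x \<otimes> y) = \<mu> x * \<mu> y" if xy: "x \<in> Z" "y \<in> Z" for x y
  proof -
    obtain i s where s: "s \<in> T" "x = z0 [^] (i :: nat) \<otimes> s" using ex[OF xy(1)] by blast
    obtain j t where t: "t \<in> T" "y = z0 [^] (j :: nat) \<otimes> t" using ex[OF xy(2)] by blast
    have c: "s \<in> Z" "t \<in> Z" "z0 \<in> carrier G" using s t z0 by (auto simp: T_def)
    have "x \<otimes> y = z0 [^] i \<otimes> (s \<otimes> z0 [^] j) \<otimes> t" using s t c by (simp add: m_assoc)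
    also have "s \<otimes> z0 [^] j = z0 [^] j \<otimes> s" using c by (intro Z_comm) auto
    also have "z0 [^] i \<otimes> (z0 [^] j \<otimes> s) \<otimes> t = z0 [^] (i + j) \<otimes> (s \<otimes> t)"
      using c by (simp add: m_assoc nat_pow_mult[symmetric])
    finally have "\<mu> (x \<otimes> y) = \<zeta> ^ (i + j)" by (rule val[OF Tm[OF s(1) t(1)]])
    thus ?thesis using val[OF s] val[OF t] by (simp add: power_add)
  qed
  moreover have "\<mu> \<one> = 1" using muT[of \<one>] R(3) by simp
  moreover have "\<mu> g = 0" if "g \<notin> Z" for g using that by (simp add: \<mu>_def)
  moreover have "\<exists>c\<in>D. \<mu> c \<noteq> 1" using muT[of c] c by (auto simp: T_def)
  ultimately have "\<mu> \<in> central_chars G"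
    unfolding central_chars_iff by blast
  thus ?thesis using muT by blast
qed

end

section \<open>Required pairs\<close>

context phi2_group
begin

text \<open>The value prescribed at \<open>h\<close> is a value \<open>\<mu> z\<close> of the central character, so that \<open>u = h z\<inverse>\<close>
  lies in the kernel of \<open>\<psi>\<^sub>\<mu>\<close> and \<open>\<mu>(u\<^sup>p) = 1\<close>.\<close>

definition good_pair :: "('a \<Rightarrow> complex) \<Rightarrow> ('a \<times> complex) list \<Rightarrow> bool" where
  "good_pair \<mu> v \<longleftrightarrow> (\<exists>h z. (h, \<mu> z) \<in> set v \<and> h \<in> carrier G \<and> h \<notin> Z \<and> z \<in> Z \<and>
     \<mu> (h [^] p) = \<mu> z ^ p \<and> (\<forall>(x, c)\<in>set v. (x, c) = (h, \<mu> z) \<or> x \<in> Z \<and> c = \<mu> x) \<and>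
     Z \<subseteq> generate G (fst ` set v))"

text \<open>Everything is expressed through the set of central elements on which \<mu> is 1: it is
  the central kernel of each constructed representation, it determines the representation up to
  equivalence, and it determines \<mu> up to Galois conjugacy.\<close>

lemma good_pair_facts:
  assumes mu: "\<mu> \<in> central_chars G" and good: "good_pair \<mu> v"
  shows "gives_required_pair p G \<mu> v"
    and "\<exists>n0 \<rho>0. constructed_rep G v n0 \<rho>0 \<and> (\<forall>n \<rho>. irreducible_rep \<rat> G n \<rho> \<longrightarrow>
       (\<forall>z\<in>Z. \<rho> z = 1\<^sub>m n \<longleftrightarrow> \<mu> z = 1) \<longrightarrow> equivalent_reps \<rat> G n \<rho> n0 \<rho>0)"
    and "\<And>n \<rho>. constructed_rep G v n \<rho> \<Longrightarrow> irreducible_rep \<rat> G n \<rho> \<and>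
       affords G n \<rho> (Omega G (chi_mu p G \<mu>)) \<and> (\<forall>z\<in>Z. \<rho> z = 1\<^sub>m n \<longleftrightarrow> \<mu> z = 1)"
    and "\<And>\<nu>. \<nu> \<in> central_chars G \<Longrightarrow> (\<forall>z\<in>Z. \<mu> z = 1 \<longleftrightarrow> \<nu> z = 1) \<longleftrightarrow>
       (\<exists>\<sigma>\<in>Gal_Q (char_field G (chi_mu p G \<mu>)). chi_mu p G \<nu> = (\<lambda>g. \<sigma> (chi_mu p G \<mu> g)))"
proof -
  interpret C: phi2_char G p N \<mu> using mu by unfold_locales
  obtain k z0 where kz: "z0 \<in> Z" "\<And>z. z \<in> Z \<Longrightarrow> \<mu> z ^ (p * p ^ k) = 1" "\<mu> z0 ^ (p ^ k) \<noteq> 1"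
    using C.level by metis
  obtain h z where h: "(h, \<mu> z) \<in> set v" "h \<in> carrier G" "h \<notin> Z" and z: "z \<in> Z"
    and hp: "\<mu> (h [^] p) = \<mu> z ^ p" and all: "\<And>x c. (x, c) \<in> set v \<Longrightarrow> (x, c) = (h, \<mu> z) \<or> x \<in> Z \<and> c = \<mu> x"
    and gen: "Z \<subseteq> generate G (fst ` set v)"
    using good unfolding good_pair_def by blast
  define u where "u = h \<otimes> inv z"
  have uG: "u \<in> carrier G" using h z by (simp add: u_def)
  have hu: "h = u \<otimes> z" using h z by (simp add: u_def m_assoc)
  have uZ: "u \<notin> Z"
  proof
    assume "u \<in> Z"
    hence "h \<in> Z" unfolding hu using z by simp
    thus False using h by simp
  qed
  have "u [^] p = h [^] p \<otimes> inv z [^] p"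
    unfolding u_def using h z Z_comm[of "inv z" h] by (intro pow_mult_distrib) auto
  hence mu_u: "\<mu> (u [^] p) = 1"
    using hp z h pow_p_central[OF h(2)] C.mu_nonzero[OF z]
    by (simp add: C.mu_mult C.mu_pow C.mu_inv power_inverse)
  interpret P: phi2_full G p N \<mu> "p ^ k" k z0 u
    using kz uG uZ mu_u prime_p by unfold_locales auto
  have fH: "fst ` set v \<subseteq> P.H"
  proof
    fix x assume "x \<in> fst ` set v"
    then obtain c where "(x, c) \<in> set v" by auto
    hence "x = h \<or> x \<in> Z" using all by blast
    moreover have "h \<in> P.H" unfolding hu using z subgroup.m_closed[OF P.H_subgroup P.u_H P.Z_H] by blast
    ultimately show "x \<in> P.H" by auto
  qed
  have "h \<in> fst ` set v" using h(1) by force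
  hence genH: "generate G (fst ` set v) = P.H"
    using P.generate_eq_H[OF fH gen _ _ u_def] z by simp
  hence gH: "gen_subgroup G v = P.H" by (simp add: gen_subgroup_def)
  have val: "P.\<psi> x = c" if "(x, c) \<in> set v" for x c
  proof -
    have "P.\<psi> h = \<mu> z" using P.psi_val[OF z, of 1] uG by (simp add: hu)
    thus ?thesis using all[OF that] by auto
  qed
  \<comment> \<open>The listed values determine the linear character, so the quantifiers over it in
    the definitions collapse to the single extension already studied.\<close>
  have lwv: "lin_with_values G v f \<longleftrightarrow> f = P.\<psi>" for f
  proof
    assume f: "lin_with_values G v f"
    show "f = P.\<psi>"
    proof (rule P.psi_unique[OF _ fH genH])
      show "f \<in> lin (subgrp G P.H)" using f by (simp add: lin_with_values_def gH)
      fix x assume "x \<in> fst ` set v"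
      then obtain c where "(x, c) \<in> set v" by auto
      thus "f x = P.\<psi> x" using f val by (auto simp: lin_with_values_def)
    qed
  next
    assume "f = P.\<psi>"
    thus "lin_with_values G v f" using P.psi_lin val by (auto simp: lin_with_values_def gH)
  qed
  show "gives_required_pair p G \<mu> v"
    using P.chi_nl P.required by (simp add: gives_required_pair_def lwv gH)
  have con: "constructed_rep G v n \<rho> \<longleftrightarrow> (\<exists>e \<sigma> ts. irreducible_rep \<rat> (subgrp G P.H) e \<sigma> \<and>
      affords (subgrp G P.H) e \<sigma> (Omega (subgrp G P.H) P.\<psi>) \<and> left_transversal G P.H ts \<and>
      n = length ts * e \<and> \<rho> = induced_rep G P.H ts e \<sigma>)" for n \<rho>
    unfolding constructed_rep_def lwv gH by blast
  show "irreducible_rep \<rat> G n \<rho> \<and> affords G n \<rho> (Omega G (chi_mu p G \<mu>)) \<and> (\<forall>z\<in>Z. \<rho> z = 1\<^sub>m n \<longleftrightarrow> \<mu> z = 1)"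
    if c: "constructed_rep G v n \<rho>" for n \<rho>
  proof -
    obtain e \<sigma> ts where s: "irreducible_rep \<rat> (subgrp G P.H) e \<sigma>"
      "affords (subgrp G P.H) e \<sigma> (Omega (subgrp G P.H) P.\<psi>)" "left_transversal G P.H ts"
      "n = length ts * e" "\<rho> = induced_rep G P.H ts e \<sigma>" using c unfolding con by blast
    note I = P.induced_from_Omega[OF s(1-3), folded s(4,5)]
    show ?thesis using I P.Omega_kernel[OF I] by blast
  qed
  obtain ts where ts: "left_transversal G P.H ts"
    using ex_left_transversal[OF P.H_subgroup fin] by blast
  show "\<exists>n0 \<rho>0. constructed_rep G v n0 \<rho>0 \<and> (\<forall>n \<rho>. irreducible_rep \<rat> G n \<rho> \<longrightarrow>
       (\<forall>z\<in>Z. \<rho> z = 1\<^sub>m n \<longleftrightarrow> \<mu> z = 1) \<longrightarrow> equivalent_reps \<rat> G n \<rho> n0 \<rho>0)"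
    using P.equivalent_to_induced[OF _ _ ts] P.cyc_rep_H ts unfolding con by blast
  show "(\<forall>z\<in>Z. \<mu> z = 1 \<longleftrightarrow> \<nu> z = 1) \<longleftrightarrow>
       (\<exists>\<sigma>\<in>Gal_Q (char_field G (chi_mu p G \<mu>)). chi_mu p G \<nu> = (\<lambda>g. \<sigma> (chi_mu p G \<mu> g)))"
    if "\<nu> \<in> central_chars G" for \<nu>
    using P.galois_if_same_kernel[OF that] P.same_kernel_if_galois by blast
qed

text \<open>Exhaustion and the coincidences both follow from comparing central kernels, whichever
  pairs are listed.\<close>

lemma determines_rational_repsI:
  assumes ne: "\<And>\<mu>. \<mu> \<in> central_chars G \<Longrightarrow> A \<mu> \<noteq> {}"
    and good: "\<And>\<mu> v. \<mu> \<in> central_chars G \<Longrightarrow> v \<in> A \<mu> \<Longrightarrow> good_pair \<mu> v"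
  shows "determines_rational_reps p G A"
  unfolding determines_rational_reps_def
proof (intro conjI ballI allI impI)
  fix \<mu> assume mu: "\<mu> \<in> central_chars G"
  show "A \<mu> \<noteq> {}" by (rule ne[OF mu])
  fix v assume v: "v \<in> A \<mu>"
  note F = good_pair_facts[OF mu good[OF mu v]]
  show "gives_required_pair p G \<mu> v" by (rule F(1))
  show "\<exists>n \<rho>. constructed_rep G v n \<rho>" using F(2) by blast
  fix n \<rho> assume c: "constructed_rep G v n \<rho>"
  show "irreducible_rep \<rat> G n \<rho>" "affords G n \<rho> (Omega G (chi_mu p G \<mu>))" using F(3)[OF c] by auto
  obtain c where "c \<in> D" "\<mu> c \<noteq> 1" using mu by (auto simp: central_chars_iff)
  thus "\<not> D \<subseteq> rep_kernel G n \<rho>" using F(3)[OF c] by (auto simp: rep_kernel_def)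
next
  fix n \<rho> assume *: "irreducible_rep \<rat> G n \<rho> \<and> \<not> D \<subseteq> rep_kernel G n \<rho>"
  then obtain \<mu> where mu: "\<mu> \<in> central_chars G" and ker: "\<forall>z\<in>Z. \<rho> z = 1\<^sub>m n \<longleftrightarrow> \<mu> z = 1"
    using central_char_of_rep by blast
  obtain v where v: "v \<in> A \<mu>" using ne[OF mu] by blast
  show "\<exists>\<mu>\<in>central_chars G. \<exists>v\<in>A \<mu>. \<exists>n' \<rho>'. constructed_rep G v n' \<rho>' \<and> equivalent_reps \<rat> G n \<rho> n' \<rho>'"
    using good_pair_facts(2)[OF mu good[OF mu v]] * ker mu v by blast
next
  fix \<mu> \<nu> v v' n \<rho> n' \<rho>'
  assume mu: "\<mu> \<in> central_chars G" and nu: "\<nu> \<in> central_chars G" and v: "v \<in> A \<mu>" and v': "v' \<in> A \<nu>"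
    and c: "constructed_rep G v n \<rho> \<and> constructed_rep G v' n' \<rho>'"
  note F = good_pair_facts[OF mu good[OF mu v]]
  note F' = good_pair_facts[OF nu good[OF nu v']]
  have i: "irreducible_rep \<rat> G n \<rho>" "\<And>z. z \<in> Z \<Longrightarrow> \<rho> z = 1\<^sub>m n \<longleftrightarrow> \<mu> z = 1" using F(3) c by blast+
  have i': "irreducible_rep \<rat> G n' \<rho>'" "\<And>z. z \<in> Z \<Longrightarrow> \<rho>' z = 1\<^sub>m n' \<longleftrightarrow> \<nu> z = 1" using F'(3) c by blast+
  have car: "\<And>g. g \<in> carrier G \<Longrightarrow> \<rho> g \<in> carrier_mat n n" "\<And>g. g \<in> carrier G \<Longrightarrow> \<rho>' g \<in> carrier_mat n' n'"
    using matrix_repD(2)[OF irreducible_repD(1)[OF i(1)]] matrix_repD(2)[OF irreducible_repD(1)[OF i'(1)]] by auto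
  have "equivalent_reps \<rat> G n \<rho> n' \<rho>' \<longleftrightarrow> (\<forall>z\<in>Z. \<mu> z = 1 \<longleftrightarrow> \<nu> z = 1)"
  proof
    assume e: "equivalent_reps \<rat> G n \<rho> n' \<rho>'"
    have "rep_kernel G n \<rho> = rep_kernel G n' \<rho>'"
      using equivalent_reps_kernel[OF car(1) e] equivalent_reps_kernel[OF car(2) equivalent_reps_sym[OF car(1) e]] by blast
    moreover have "z \<in> rep_kernel G n \<rho> \<longleftrightarrow> \<rho> z = 1\<^sub>m n" "z \<in> rep_kernel G n' \<rho>' \<longleftrightarrow> \<rho>' z = 1\<^sub>m n'"
      if "z \<in> Z" for z using that by (simp_all add: rep_kernel_def)
    ultimately have "\<rho> z = 1\<^sub>m n \<longleftrightarrow> \<rho>' z = 1\<^sub>m n'" if "z \<in> Z" for z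
      using that by metis
    thus "\<forall>z\<in>Z. \<mu> z = 1 \<longleftrightarrow> \<nu> z = 1" using i(2) i'(2) by blast
  next
    assume k: "\<forall>z\<in>Z. \<mu> z = 1 \<longleftrightarrow> \<nu> z = 1"
    \<comment> \<open>Both given representations are equivalent to one reference representation
      constructed for \<mu>.\<close>
    obtain n0 \<rho>0 where r0: "constructed_rep G v n0 \<rho>0" "\<And>n \<rho>. irreducible_rep \<rat> G n \<rho> \<Longrightarrow>
       (\<forall>z\<in>Z. \<rho> z = 1\<^sub>m n \<longleftrightarrow> \<mu> z = 1) \<Longrightarrow> equivalent_reps \<rat> G n \<rho> n0 \<rho>0" using F(2) by blast
    have "equivalent_reps \<rat> G n \<rho> n0 \<rho>0" using r0(2)[OF i(1)] i(2) by blast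
    moreover have "equivalent_reps \<rat> G n0 \<rho>0 n' \<rho>'"
      using equivalent_reps_sym[OF car(2) r0(2)[OF i'(1)]] i'(2) k by blast
    ultimately show "equivalent_reps \<rat> G n \<rho> n' \<rho>'"
      using equivalent_reps_trans[OF complex_subfield_Rats, of G \<rho> n n0 \<rho>0 n' \<rho>'] car(1) by blast
  qed
  thus "equivalent_reps \<rat> G n \<rho> n' \<rho>' \<longleftrightarrow>
      (\<exists>\<sigma>\<in>Gal_Q (char_field G (chi_mu p G \<mu>)). chi_mu p G \<nu> = (\<lambda>g. \<sigma> (chi_mu p G \<mu> g)))"
    using F(4)[OF nu] by simp
qed

end

section \<open>Groups given by presentations\<close>

text \<open>The lowest level of the cyclotomic setting, with \<open>q = 1\<close>.\<close>

lemma root_is_power_prime: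
  assumes "prime p" "x ^ p = 1" "x \<noteq> 1" "y ^ p = 1"
  shows "\<exists>i<p. y = (x :: complex) ^ i"
proof -
  interpret prime_power p 1 0 using assms(1) by unfold_locales simp_all
  have "proot x" unfolding proot_def using assms by simp
  from root_is_power[OF this, of y] show ?thesis using assms by simp
qed

lemma root_is_power_prime_square:
  assumes "prime p" "x ^ (p ^ 2) = 1" "x ^ p \<noteq> 1" "y ^ (p ^ 2) = 1"
  shows "\<exists>i. y = (x :: complex) ^ i"
proof -
  interpret prime_power p p 1 using assms(1) by unfold_locales simp_all
  show ?thesis using root_is_power[of x y] assms by (auto simp: proot_def power2_eq_square)
qed

lemma primitive_root_prime_square:
  assumes "prime p" "x ^ (p ^ 2) = 1" "x ^ p \<noteq> 1"
  shows "primitive_root_of_unity (p ^ 2) x"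
proof -
  interpret prime_power p p 1 using assms(1) by unfold_locales simp_all
  have "proot x" using assms by (simp add: proot_def power2_eq_square)
  from proot_power_eq_1[OF this] show ?thesis
    using p_gt1 unfolding primitive_root_of_unity_def
    by (auto simp: power2_eq_square dest: dvd_imp_le)
qed

context group
begin

text \<open>An abelian group has trivial commutator subgroup, which isoclinism would pass on to the
  non-abelian group of order p^3. This is the source of \<open>c \<noteq> \<one>\<close> for the
  presented groups.\<close>

lemma not_commutative_if_in_Phi2:
  assumes "in_Phi2 p G"
  obtains x y where "x \<in> carrier G" "y \<in> carrier G" "x \<otimes> y \<noteq> y \<otimes> x"
proof (rule ccontr)
  note main = that
  assume no: "\<not> thesis"
  interpret A: comm_group G by (rule group_comm_groupI) (use no main in blast)
  obtain E \<phi> where E: "group (E :: nat monoid)" "\<not> comm_group E"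
    and \<phi>: "\<phi> \<in> iso (subgrp G (commutator_subgroup G)) (subgrp E (commutator_subgroup E))"
    using assms unfolding in_Phi2_def isoclinic_def by blast
  interpret E: group E by fact
  have "commutator_subgroup G = {\<one>}" by (rule A.derived_eq_singleton) simp
  hence "commutator_subgroup E = {\<phi> \<one>}" using \<phi> by (auto simp: iso_def bij_betw_def)
  moreover have "\<one>\<^bsub>E\<^esub> \<in> commutator_subgroup E"
    by (rule subgroup.one_closed[OF E.derived_is_subgroup]) simp
  ultimately have D: "commutator_subgroup E = {\<one>\<^bsub>E\<^esub>}" by auto
  have "comm_group E"
  proof (rule E.group_comm_groupI)
    fix x y assume xy: "x \<in> carrier E" "y \<in> carrier E"
    have "commutator E x y = \<one>\<^bsub>E\<^esub>" using E.commutator_in_derived[OF xy] D by simp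
    thus "x \<otimes>\<^bsub>E\<^esub> y = y \<otimes>\<^bsub>E\<^esub> x" by (simp only: E.commutator_eq_one_iff[OF xy])
  qed
  thus False using E by simp
qed

lemma centralizer_subgroup:
  assumes x: "x \<in> carrier G" shows "subgroup {g \<in> carrier G. g \<otimes> x = x \<otimes> g} G"
proof (rule subgroupI)
  show "{g \<in> carrier G. g \<otimes> x = x \<otimes> g} \<noteq> {}" using x by auto
next
  fix g assume "g \<in> {g \<in> carrier G. g \<otimes> x = x \<otimes> g}"
  hence g: "g \<in> carrier G" "g \<otimes> x = x \<otimes> g" by auto
  have "inv g \<otimes> x = inv g \<otimes> (x \<otimes> g) \<otimes> inv g" using g(1) x by (simp add: m_assoc)
  also have "\<dots> = inv g \<otimes> (g \<otimes> x) \<otimes> inv g" by (simp only: g(2))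
  also have "\<dots> = x \<otimes> inv g" using g(1) x by (simp add: m_assoc)
  finally show "inv g \<in> {g \<in> carrier G. g \<otimes> x = x \<otimes> g}" using g by simp
next
  fix g h assume "g \<in> {g \<in> carrier G. g \<otimes> x = x \<otimes> g}" "h \<in> {g \<in> carrier G. g \<otimes> x = x \<otimes> g}"
  hence g: "g \<in> carrier G" "g \<otimes> x = x \<otimes> g" and h: "h \<in> carrier G" "h \<otimes> x = x \<otimes> h" by auto
  have "g \<otimes> h \<otimes> x = g \<otimes> (x \<otimes> h)" using m_assoc[OF g(1) h(1) x] h(2) by simp
  also have "\<dots> = x \<otimes> g \<otimes> h" using m_assoc[OF g(1) x h(1)] g(2) by simp
  also have "\<dots> = x \<otimes> (g \<otimes> h)" using x g h by (intro m_assoc)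
  finally show "g \<otimes> h \<in> {g \<in> carrier G. g \<otimes> x = x \<otimes> g}" using g h by simp
qed auto

lemma central_if_commutes_generators:
  assumes gen: "generate G A = carrier G" and A: "A \<subseteq> carrier G" and x: "x \<in> carrier G"
    and comm: "\<And>y. y \<in> A \<Longrightarrow> y \<otimes> x = x \<otimes> y"
  shows "x \<in> center_of G"
proof -
  have "generate G A \<subseteq> {g \<in> carrier G. g \<otimes> x = x \<otimes> g}"
    by (rule generate_subgroup_incl[OF _ centralizer_subgroup[OF x]]) (use A comm in blast)
  hence "x \<otimes> g = g \<otimes> x" if "g \<in> carrier G" for g using that unfolding gen by (blast intro: sym)
  thus ?thesis using x unfolding center_of_def by blast
qed

text \<open>The collection formula in class two: moving one \<open>b\<close> past one
  \<open>a\<close> costs one central factor \<open>c\<close>, hence \<open>j * k\<close> factors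
  altogether.\<close>

lemma pow_mult_pow_commutator:
  assumes a: "a \<in> carrier G" and b: "b \<in> carrier G" and c: "c \<in> carrier G"
    and ca: "c \<otimes> a = a \<otimes> c" and cb: "c \<otimes> b = b \<otimes> c" and ba: "b \<otimes> a = a \<otimes> b \<otimes> c"
  shows "b [^] (j :: nat) \<otimes> a [^] (k :: nat) = a [^] k \<otimes> b [^] j \<otimes> c [^] (j * k)"
proof -
  have cka: "c [^] k \<otimes> a = a \<otimes> c [^] k" and ckb: "c [^] k \<otimes> b = b \<otimes> c [^] k" for k :: nat
    using group_commutes_pow[OF ca c a] group_commutes_pow[OF cb c b] by auto
  have cc: "c \<otimes> c [^] k = c [^] k \<otimes> c" for k :: nat
    using group_commutes_pow[OF refl c c, of k] by simp
  have 1: "b \<otimes> a [^] k = a [^] k \<otimes> b \<otimes> c [^] k" for k :: nat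
  proof (induction k)
    case (Suc k)
    have "b \<otimes> a [^] Suc k = b \<otimes> a [^] k \<otimes> a" using a b by (simp add: m_assoc)
    also have "\<dots> = a [^] k \<otimes> b \<otimes> (c [^] k \<otimes> a)" unfolding Suc using a b c by (simp add: m_assoc)
    also have "\<dots> = a [^] k \<otimes> (b \<otimes> a) \<otimes> c [^] k" unfolding cka using a b c by (simp add: m_assoc)
    also have "\<dots> = a [^] Suc k \<otimes> b \<otimes> c [^] Suc k" unfolding ba using a b c by (simp add: m_assoc cc)
    finally show ?case .
  qed (use a b c in simp)
  show ?thesis
  proof (induction j)
    case (Suc j)
    have "b [^] Suc j \<otimes> a [^] k = b [^] j \<otimes> (b \<otimes> a [^] k)" using a b by (simp add: m_assoc)
    also have "\<dots> = b [^] j \<otimes> a [^] k \<otimes> b \<otimes> c [^] k" unfolding 1 using a b c by (simp add: m_assoc)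
    also have "\<dots> = a [^] k \<otimes> b [^] j \<otimes> (c [^] (j * k) \<otimes> b) \<otimes> c [^] k"
      unfolding Suc using a b c by (simp add: m_assoc)
    also have "\<dots> = a [^] k \<otimes> b [^] Suc j \<otimes> (c [^] (j * k) \<otimes> c [^] k)"
      unfolding ckb using a b c by (simp add: m_assoc)
    also have "c [^] (j * k) \<otimes> c [^] k = c [^] (Suc j * k)" using c by (simp add: nat_pow_mult add.commute)
    finally show ?case .
  qed (use a b c in simp)
qed

lemma generate_pow: "x \<in> A \<Longrightarrow> A \<subseteq> carrier G \<Longrightarrow> x [^] (n :: nat) \<in> generate G A"
  by (rule subgroup_nat_pow[OF generate_is_subgroup generate.incl])

lemma generate_eqI:
  assumes "A \<subseteq> generate G B" "B \<subseteq> A" "B \<subseteq> carrier G"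
  shows "generate G A = generate G B"
  using generate_subgroup_incl[OF assms(1) generate_is_subgroup[OF assms(3)]] mono_generate[OF assms(2)]
  by (rule subset_antisym)

end

context phi2_group
begin

text \<open>Collecting \<open>n\<close> factors costs the commutator to the power n(n - 1)/2. For
  odd \<open>p\<close> this exponent is a multiple of \<open>p\<close> at \<open>n = p\<close>, so
  taking p-th powers is a homomorphism.\<close>

lemma pow_p_mult:
  assumes odd: "odd p" and x: "x \<in> carrier G" and y: "y \<in> carrier G"
  shows "(x \<otimes> y) [^] p = x [^] p \<otimes> y [^] p"
proof -
  define e where "e = com y x"
  have e: "e \<in> Z" "e [^] p = \<one>" using x y com_pow_p[of y x] by (auto simp: e_def)
  have eG: "e \<in> carrier G" using e by simp
  have yx: "y [^] (n :: nat) \<otimes> x = x \<otimes> y [^] n \<otimes> e [^] n" for n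
    using pow_mult_pow_commutator[OF x y eG Z_comm[OF e(1) x] Z_comm[OF e(1) y]
        mult_commute_commutator[OF y x, folded e_def], of n 1] x by simp
  have "(x \<otimes> y) [^] n = x [^] n \<otimes> y [^] n \<otimes> e [^] (\<Sum>i<n. i)" for n :: nat
  proof (induction n)
    case (Suc n)
    have "(x \<otimes> y) [^] Suc n = x [^] n \<otimes> y [^] n \<otimes> (e [^] (\<Sum>i<n. i) \<otimes> (x \<otimes> y))"
      using Suc x y eG by (simp add: m_assoc)
    also have "e [^] (\<Sum>i<n. i) \<otimes> (x \<otimes> y) = x \<otimes> y \<otimes> e [^] (\<Sum>i<n. i)"
      using e x y by (intro Z_comm) auto
    also have "x [^] n \<otimes> y [^] n \<otimes> (x \<otimes> y \<otimes> e [^] (\<Sum>i<n. i)) = x [^] n \<otimes> (y [^] n \<otimes> x) \<otimes> y \<otimes> e [^] (\<Sum>i<n. i)"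
      using x y eG by (simp add: m_assoc)
    also have "\<dots> = x [^] n \<otimes> x \<otimes> y [^] n \<otimes> (e [^] n \<otimes> y) \<otimes> e [^] (\<Sum>i<n. i)"
      unfolding yx using x y eG by (simp add: m_assoc)
    also have "e [^] n \<otimes> y = y \<otimes> e [^] n" using e y by (intro Z_comm) auto
    also have "x [^] n \<otimes> x \<otimes> y [^] n \<otimes> (y \<otimes> e [^] n) \<otimes> e [^] (\<Sum>i<n. i)
        = x [^] Suc n \<otimes> y [^] Suc n \<otimes> (e [^] n \<otimes> e [^] (\<Sum>i<n. i))"
      using x y eG by (simp add: m_assoc)
    also have "e [^] n \<otimes> e [^] (\<Sum>i<n. i) = e [^] (\<Sum>i<Suc n. i)"
      using eG by (simp add: nat_pow_mult add.commute)
    finally show ?case .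
  qed (use x y eG in simp)
  moreover have "e [^] (\<Sum>i<p. i) = \<one>"
  proof -
    obtain r where r: "p = 2 * r + 1" using odd by (elim oddE)
    have "(\<Sum>i<2 * l + 1. i) = l * (2 * l + 1)" for l :: nat
      by (induction l) (simp_all add: algebra_simps)
    hence "(\<Sum>i<p. i) = p * r" unfolding r by simp
    thus ?thesis using e(2) eG by (simp add: nat_pow_pow[symmetric])
  qed
  ultimately show ?thesis using x y by simp
qed

lemma good_pair_simple:
  assumes mu: "\<mu> \<in> central_chars G" and h: "h \<in> carrier G" "h \<notin> Z" "\<mu> (h [^] p) = 1" "(h, 1) \<in> set v"
    and v: "\<And>x c. (x, c) \<in> set v \<Longrightarrow> (x, c) = (h, 1) \<or> x \<in> Z \<and> c = \<mu> x"
    and gen: "Z \<subseteq> generate G (fst ` set v)"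
  shows "good_pair \<mu> v"
proof -
  have "\<mu> \<one> = 1" using mu by (simp add: central_chars_iff)
  thus ?thesis unfolding good_pair_def
    by (intro exI[of _ h] exI[of _ \<one>]) (use h v gen in auto)
qed

lemma determines_rational_reps_simple:
  assumes h: "h \<in> carrier G" "h \<notin> Z" "h [^] p = \<one>" and v: "\<And>\<mu>. (h, 1) \<in> set (v \<mu>)"
    "\<And>\<mu> x c. (x, c) \<in> set (v \<mu>) \<Longrightarrow> (x, c) = (h, 1) \<or> x \<in> Z \<and> c = \<mu> x"
    and gen: "Z = generate G B" "\<And>\<mu>. B \<subseteq> fst ` set (v \<mu>)"
  shows "determines_rational_reps p G (\<lambda>\<mu>. {v \<mu>})"
proof (rule determines_rational_repsI)
  fix \<mu> w assume mu: "\<mu> \<in> central_chars G" and "w \<in> {v \<mu>}"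
  hence w: "w = v \<mu>" by simp
  show "good_pair \<mu> w" unfolding w
  proof (rule good_pair_simple[OF mu h(1,2) _ v(1)])
    show "(x, c) = (h, 1) \<or> x \<in> Z \<and> c = \<mu> x" if "(x, c) \<in> set (v \<mu>)" for x c by (rule v(2)[OF that])
    have "\<mu> \<one> = 1" using mu by (simp add: central_chars_iff)
    thus "\<mu> (h [^] p) = 1" using h(3) by simp
    show "Z \<subseteq> generate G (fst ` set (v \<mu>))" unfolding gen(1) by (rule mono_generate[OF gen(2)])
  qed
qed simp

end

section \<open>Groups on two non-central generators: centre and commutator subgroup\<close>

locale phi2_gens = phi2_group G p N for G (structure) and p N +
  fixes a b c :: 'a and S :: "'a set"
  assumes aG [simp]: "a \<in> carrier G" and bG [simp]: "b \<in> carrier G"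
    and com_ba: "commutator G b a = c" and c_S: "c \<in> S" and S_Z: "S \<subseteq> center_of G"
    and c_neq_one: "c \<noteq> \<one>"
    and center_gen: "center_of G = generate G ({a [^] p, b [^] p} \<union> S)"
    and derived_gen: "commutator_subgroup G = generate G {c}"
begin

lemma c_D: "c \<in> D" unfolding derived_gen by (rule generate.incl) simp

lemma b_notin_Z: "b \<notin> Z"
  using com_central(2)[of b a] com_ba c_neq_one by auto

lemma a_notin_Z: "a \<notin> Z"
  using com_central(1)[of a b] com_ba c_neq_one by auto

lemma inv_pow_a_mult_b_notin_Z: "inv (a [^] (i :: nat)) \<otimes> b \<notin> Z"
proof
  have "inv (a [^] i) \<otimes> a = a \<otimes> inv (a [^] i)"
  proof -
    have "inv (a [^] i) \<otimes> a = inv (a [^] i) \<otimes> (a \<otimes> a [^] i) \<otimes> inv (a [^] i)" by (simp add: m_assoc)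
    also have "a \<otimes> a [^] i = a [^] i \<otimes> a" using nat_pow_Suc2[OF aG, of i] by simp
    finally show ?thesis by (simp add: m_assoc)
  qed
  hence "com (inv (a [^] i) \<otimes> b) a = c"
    by (simp add: com_mult_left com_ba commutator_eq_one_iff[symmetric] c_D)
  moreover assume "inv (a [^] i) \<otimes> b \<in> Z"
  ultimately show False using com_central(2)[of "inv (a [^] i) \<otimes> b" a] c_neq_one by simp
qed

lemma a_mult_inv_pow_b_notin_Z: "a \<otimes> inv (b [^] (i :: nat)) \<notin> Z"
proof
  have "b \<otimes> inv (b [^] i) = inv (b [^] i) \<otimes> b"
  proof -
    have "b \<otimes> inv (b [^] i) = inv (b [^] i) \<otimes> (b [^] i \<otimes> b) \<otimes> inv (b [^] i)" by (simp add: m_assoc)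
    also have "b [^] i \<otimes> b = b \<otimes> b [^] i" using nat_pow_Suc2[OF bG, of i] by simp
    finally show ?thesis by (simp add: m_assoc)
  qed
  hence "com b (a \<otimes> inv (b [^] i)) = c"
    by (simp add: com_mult_right com_ba commutator_eq_one_iff[symmetric] c_D)
  moreover assume "a \<otimes> inv (b [^] i) \<in> Z"
  ultimately show False using com_central(1)[of "a \<otimes> inv (b [^] i)" b] c_neq_one by simp
qed

text \<open>The p-th power of \<open>h\<close> is a^p times the inverse of b^(pi), on which \<mu> is
  1 by the choice of \<open>i\<close>. The element \<open>a ^ p\<close> may be absent from the list;
  it is recovered from \<open>h ^ p\<close> and \<open>b ^ p\<close>.\<close>

lemma good_pair_a_mult_inv_pow_b:
  fixes i :: nat
  defines "h \<equiv> a \<otimes> b [^] (- int i)"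
  assumes odd: "odd p" and mu: "\<mu> \<in> central_chars G" and i: "\<mu> (a [^] p) = \<mu> (b [^] p) ^ i"
    and Z: "Z = generate G B" and h: "(h, 1) \<in> set v"
    and v: "\<And>x c. (x, c) \<in> set v \<Longrightarrow> (x, c) = (h, 1) \<or> x \<in> Z \<and> c = \<mu> x"
    and B: "b [^] p \<in> fst ` set v" "B \<subseteq> insert (a [^] p) (fst ` set v)"
  shows "good_pair \<mu> v"
proof -
  interpret C: phi2_char G p N \<mu> using mu by unfold_locales
  note pZ = pow_p_central[OF aG] pow_p_central[OF bG]
  have he: "h = a \<otimes> inv (b [^] i)" by (simp add: h_def int_pow_neg_int)
  have hG: "h \<in> carrier G" by (simp add: he)
  have "(inv (b [^] i)) [^] p = inv ((b [^] p) [^] i)"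
    by (simp add: nat_pow_inv nat_pow_pow mult.commute)
  hence hp: "h [^] p = a [^] p \<otimes> inv ((b [^] p) [^] i)"
    unfolding he by (subst pow_p_mult[OF odd]) simp_all
  have "\<mu> (h [^] p) = 1"
    unfolding hp using pZ C.mu_nonzero[OF pZ(2)] by (simp add: C.mu_mult C.mu_inv C.mu_pow i)
  moreover have "Z \<subseteq> generate G (fst ` set v)"
  proof -
    have sub: "fst ` set v \<subseteq> carrier G"
    proof
      fix x assume "x \<in> fst ` set v"
      then obtain c where "(x, c) \<in> set v" by auto
      thus "x \<in> carrier G" using v[of x c] hG by auto
    qed
    note S = generate_is_subgroup[OF sub]
    have hv: "h \<in> fst ` set v" using h by force
    have "a [^] p = h [^] p \<otimes> (b [^] p) [^] i" unfolding hp by (simp add: m_assoc)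
    also have "\<dots> \<in> generate G (fst ` set v)"
      by (intro subgroup.m_closed[OF S] generate_pow[OF hv sub] subgroup_nat_pow[OF S] generate.incl[OF B(1)])
    finally have "a [^] p \<in> generate G (fst ` set v)" .
    hence "B \<subseteq> generate G (fst ` set v)" using B(2) by (auto intro: generate.incl)
    thus ?thesis unfolding Z by (rule generate_subgroup_incl[OF _ S])
  qed
  ultimately show ?thesis
    using a_mult_inv_pow_b_notin_Z[of i] hG h v by (intro good_pair_simple[OF mu, of h]) (auto simp: he)
qed

end

text \<open>Every element has the form a^i b^j z with \<open>z\<close> in the subgroup generated by
  \<open>a ^ p\<close>, \<open>b ^ p\<close> and \<open>S\<close>. The multiplication rule for such
  forms yields the commutator subgroup, the bound on the order and the centre; the given order
  \<open>p ^ N\<close> supplies finiteness.\<close>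

lemma (in group) phi2_gensI:
  assumes p: "prime p" and ord: "Coset.order G = p ^ N" and ab: "a \<in> carrier G" "b \<in> carrier G"
    and S: "S \<subseteq> carrier G" and gen: "generate G (insert a (insert b S)) = carrier G"
    and cent: "\<And>s t. s \<in> S \<Longrightarrow> t \<in> insert a (insert b S) \<Longrightarrow> s \<otimes> t = t \<otimes> s"
    and c: "commutator G b a = c" "c \<in> S" "c [^] p = \<one>"
    and na: "x0 \<in> carrier G" "y0 \<in> carrier G" "x0 \<otimes> y0 \<noteq> y0 \<otimes> x0"
  shows "phi2_gens G p N a b c S"
proof -
  let ?A = "insert a (insert b S)"
  note [simp] = ab
  have p1: "p > 1" using p prime_gt_1_nat by blast
  have A: "?A \<subseteq> carrier G" using ab S by auto
  have SZ: "S \<subseteq> center_of G"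
  proof
    fix s assume s: "s \<in> S"
    show "s \<in> center_of G"
      by (rule central_if_commutes_generators[OF gen A]) (use s S cent[OF s] in \<open>auto intro: sym\<close>)
  qed
  have cZ: "c \<in> center_of G" using c(2) SZ by blast
  have cG [simp]: "c \<in> carrier G" using c(2) S by blast
  have cc: "c \<otimes> g = g \<otimes> c" if "g \<in> carrier G" for g using cZ that unfolding center_of_def by blast
  have ba: "b \<otimes> a = a \<otimes> b \<otimes> c" using mult_commute_commutator[OF ab(2,1)] c by simp
  note comm = pow_mult_pow_commutator[OF ab(1,2) cG cc[OF ab(1)] cc[OF ab(2)] ba]
  \<comment> \<open>Moving \<open>b\<close> past \<open>a ^ p\<close> costs \<open>c ^ p\<close>,
    which is trivial.\<close>
  have pa: "a [^] p \<in> center_of G"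
  proof (rule central_if_commutes_generators[OF gen A])
    fix t assume "t \<in> ?A"
    then consider "t = a" | "t = b" | "t \<in> S" by auto
    thus "t \<otimes> a [^] p = a [^] p \<otimes> t"
    proof cases
      case 1 thus ?thesis using nat_pow_Suc2[OF ab(1), of p] by simp
    next
      case 2 thus ?thesis using comm[of 1 p] c(3) by simp
    next
      case 3
      have "a \<otimes> t = t \<otimes> a" using cent[OF 3, of a] by simp
      thus ?thesis using group_commutes_pow[OF _ ab(1), of t p] 3 S by auto
    qed
  qed simp
  have pb: "b [^] p \<in> center_of G"
  proof (rule central_if_commutes_generators[OF gen A])
    fix t assume "t \<in> ?A"
    then consider "t = a" | "t = b" | "t \<in> S" by auto
    thus "t \<otimes> b [^] p = b [^] p \<otimes> t"
    proof cases
      case 1 thus ?thesis using comm[of p 1] c(3) by simp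
    next
      case 2 thus ?thesis using nat_pow_Suc2[OF ab(2), of p] by simp
    next
      case 3
      have "b \<otimes> t = t \<otimes> b" using cent[OF 3, of b] by simp
      thus ?thesis using group_commutes_pow[OF _ ab(2), of t p] 3 S by auto
    qed
  qed simp
  define Z' where "Z' = generate G ({a [^] p, b [^] p} \<union> S)"
  have gZ: "{a [^] p, b [^] p} \<union> S \<subseteq> carrier G" using S by simp
  have Z'Z: "Z' \<subseteq> center_of G"
    unfolding Z'_def by (rule generate_subgroup_incl[OF _ center_subgroup]) (use pa pb SZ in simp)
  have Z's: "subgroup Z' G" unfolding Z'_def by (rule generate_is_subgroup[OF gZ])
  note Zm = subgroup.m_closed[OF Z's]
  have Z'G [simp]: "z \<in> Z' \<Longrightarrow> z \<in> carrier G" for z using Z'Z by (auto simp: center_of_def)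
  have Zc: "z \<otimes> g = g \<otimes> z" if "z \<in> Z'" "g \<in> carrier G" for z g
    using Z'Z that unfolding center_of_def by blast
  have gen_Z: "g \<in> Z'" if "g \<in> {a [^] p, b [^] p} \<union> S" for g unfolding Z'_def by (rule generate.incl[OF that])
  have cpZ: "c [^] (j :: nat) \<in> Z'" for j by (rule subgroup_nat_pow[OF Z's gen_Z]) (use c in simp)
  have mult: "(a [^] i \<otimes> b [^] j \<otimes> z) \<otimes> (a [^] k \<otimes> b [^] l \<otimes> w)
      = a [^] (i + k) \<otimes> b [^] (j + l) \<otimes> (c [^] (j * k) \<otimes> (z \<otimes> w))"
    if zw: "z \<in> Z'" "w \<in> Z'" for i j k l :: nat and z w
  proof -
    have "(a [^] i \<otimes> b [^] j \<otimes> z) \<otimes> (a [^] k \<otimes> b [^] l \<otimes> w)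
        = a [^] i \<otimes> b [^] j \<otimes> (z \<otimes> (a [^] k \<otimes> b [^] l)) \<otimes> w" using zw by (simp add: m_assoc)
    also have "z \<otimes> (a [^] k \<otimes> b [^] l) = a [^] k \<otimes> b [^] l \<otimes> z" using zw by (intro Zc) auto
    also have "a [^] i \<otimes> b [^] j \<otimes> (a [^] k \<otimes> b [^] l \<otimes> z) \<otimes> w
        = a [^] i \<otimes> (b [^] j \<otimes> a [^] k) \<otimes> b [^] l \<otimes> (z \<otimes> w)" using zw by (simp add: m_assoc)
    also have "\<dots> = a [^] i \<otimes> a [^] k \<otimes> b [^] j \<otimes> (c [^] (j * k) \<otimes> b [^] l) \<otimes> (z \<otimes> w)"
      unfolding comm using zw by (simp add: m_assoc)
    also have "c [^] (j * k) \<otimes> b [^] l = b [^] l \<otimes> c [^] (j * k)" by (intro Zc cpZ) simp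
    also have "a [^] i \<otimes> a [^] k \<otimes> b [^] j \<otimes> (b [^] l \<otimes> c [^] (j * k)) \<otimes> (z \<otimes> w)
        = (a [^] i \<otimes> a [^] k) \<otimes> (b [^] j \<otimes> b [^] l) \<otimes> (c [^] (j * k) \<otimes> (z \<otimes> w))"
      using zw by (simp add: m_assoc)
    finally show ?thesis by (simp add: nat_pow_mult)
  qed
  define W where "W = {a [^] i \<otimes> b [^] j \<otimes> z | (i :: nat) (j :: nat) z. z \<in> Z'}"
  have WG: "W \<subseteq> carrier G" by (auto simp: W_def)
  have WI: "a [^] (i :: nat) \<otimes> b [^] (j :: nat) \<otimes> z \<in> W" if "z \<in> Z'" for i j z using that by (auto simp: W_def)
  have Wm: "x \<otimes> y \<in> W" if xy: "x \<in> W" "y \<in> W" for x y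
  proof -
    obtain i j z where x: "x = a [^] (i :: nat) \<otimes> b [^] (j :: nat) \<otimes> z" "z \<in> Z'" using xy by (auto simp: W_def)
    obtain k l w where y: "y = a [^] (k :: nat) \<otimes> b [^] (l :: nat) \<otimes> w" "w \<in> Z'" using xy by (auto simp: W_def)
    show ?thesis unfolding x(1) y(1) mult[OF x(2) y(2)] by (intro WI Zm cpZ x y)
  qed
  have W1: "\<one> \<in> W" using WI[OF subgroup.one_closed[OF Z's], of 0 0] by simp
  have Wsub: "subgroup W G"
  proof (rule subgroupI[OF WG _ _ Wm])
    show "W \<noteq> {}" using W1 by blast
    fix x assume x: "x \<in> W"
    have xG: "x \<in> carrier G" using x WG by blast
    have "x [^] (n :: nat) \<in> W" for n by (induction n) (use x W1 Wm in auto)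
    \<comment> \<open>In a finite group inverses are powers, so closure under products is
      enough.\<close>
    moreover have "inv x = x [^] (p ^ N - 1)"
    proof (rule inv_equality)
      have "x [^] (p ^ N - 1) \<otimes> x = x [^] Suc (p ^ N - 1)" by simp
      also have "Suc (p ^ N - 1) = p ^ N" using p1 by simp
      finally show "x [^] (p ^ N - 1) \<otimes> x = \<one>" using pow_order_eq_1[OF xG] ord by simp
    qed (use xG in simp_all)
    ultimately show "inv x \<in> W" by simp
  qed
  have "s \<in> W" if s: "s \<in> S" for s
    using WI[OF gen_Z, of s 0 0] s S by auto
  hence AW: "?A \<subseteq> W"
    using WI[OF subgroup.one_closed[OF Z's], of 1 0] WI[OF subgroup.one_closed[OF Z's], of 0 1] by auto
  have W: "carrier G = W" using generate_subgroup_incl[OF AW Wsub] gen WG by simp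
  have Ksub: "subgroup (generate G {c}) G" by (rule generate_is_subgroup) simp
  have cK: "c [^] (j :: nat) \<in> generate G {c}" for j by (rule generate_pow) simp_all
  have D: "commutator_subgroup G = generate G {c}"
  proof
    show "generate G {c} \<subseteq> commutator_subgroup G"
      by (rule generate_subgroup_incl[OF _ derived_is_subgroup])
        (use commutator_in_derived[OF ab(2,1)] c in auto)
    show "commutator_subgroup G \<subseteq> generate G {c}"
      unfolding derived_def
    proof (rule generate_subgroup_incl[OF _ Ksub], intro subsetI)
      fix g assume "g \<in> derived_set G (carrier G)"
      then obtain x y where xy: "x \<in> carrier G" "y \<in> carrier G" "g = x \<otimes> y \<otimes> inv x \<otimes> inv y" by auto
      obtain i j z where x: "x = a [^] (i :: nat) \<otimes> b [^] (j :: nat) \<otimes> z" "z \<in> Z'"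
        using xy(1) unfolding W by (auto simp: W_def)
      obtain k l w where y: "y = a [^] (k :: nat) \<otimes> b [^] (l :: nat) \<otimes> w" "w \<in> Z'"
        using xy(2) unfolding W by (auto simp: W_def)
      \<comment> \<open>The common part of \<open>x \<otimes> y\<close> and
        \<open>y \<otimes> x\<close>: the two differ only in their powers of \<open>c\<close>, so
        every commutator is a power of \<open>c\<close> up to inverses.\<close>
      define e where "e = a [^] (i + k) \<otimes> b [^] (j + l) \<otimes> (z \<otimes> w)"
      have eG: "e \<in> carrier G" using x y by (simp add: e_def)
      have e1: "x \<otimes> y = e \<otimes> c [^] (j * k)"
        unfolding x(1) y(1) mult[OF x(2) y(2)] e_def
        using x(2) y(2) Zc[OF cpZ, of "z \<otimes> w" "j * k"] by (simp add: m_assoc)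
      have e2: "y \<otimes> x = e \<otimes> c [^] (l * i)"
        unfolding x(1) y(1) mult[OF y(2) x(2)] e_def
        using x(2) y(2) Zc[OF cpZ, of "z \<otimes> w" "l * i"] Zc[OF y(2), of z]
        by (simp add: m_assoc add.commute)
      define r where "r = inv (c [^] (l * i)) \<otimes> c [^] (j * k)"
      have rK: "r \<in> generate G {c}"
        unfolding r_def by (intro subgroup.m_closed[OF Ksub] subgroup.m_inv_closed[OF Ksub] cK)
      have rZ: "r \<in> Z'" unfolding r_def by (intro Zm subgroup.m_inv_closed[OF Z's] cpZ)
      have "x \<otimes> y = y \<otimes> x \<otimes> r" unfolding e1 e2 r_def using eG by (simp add: m_assoc)
      also have "\<dots> = r \<otimes> (y \<otimes> x)" using rZ xy by (intro Zc[symmetric]) auto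
      finally have "g = r" using xy rZ by (simp add: m_assoc)
      thus "g \<in> generate G {c}" using rK by simp
    qed
  qed
  \<comment> \<open>A trivial \<open>c\<close> would trivialise all commutators, against the given
    pair that does not commute.\<close>
  have c1: "c \<noteq> \<one>"
  proof
    assume "c = \<one>"
    hence "commutator_subgroup G = {\<one>}" using D generate_one by simp
    hence "commutator G x0 y0 = \<one>" using commutator_in_derived[OF na(1,2)] by simp
    thus False using na(3) by (simp only: commutator_eq_one_iff[OF na(1,2)])
  qed
  have fin: "finite (carrier G)"
    using ord p1 by (intro card_ge_0_finite) (simp add: Coset.order_def)
  have cardD: "card (commutator_subgroup G) = p"
  proof -
    have "card (generate G {c}) = group.ord G c" using generate_pow_card[OF cG] by simp
    moreover have "group.ord G c dvd p" using pow_eq_id[OF cG, of p] c(3) by simp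
    moreover have "group.ord G c \<noteq> 1" using ord_eq_1[OF cG] c1 by blast
    ultimately show ?thesis using p D by (auto simp: prime_nat_iff)
  qed
  have bound: "Coset.order G \<le> p ^ 2 * card Z'"
  proof -
    have finZ: "finite Z'" using fin by (rule rev_finite_subset) auto
    \<comment> \<open>Multiples of \<open>p\<close> in the exponents move into the central factor,
      so exponents below \<open>p\<close> suffice.\<close>
    have red: "g [^] (i :: nat) = g [^] (i mod p) \<otimes> (g [^] p) [^] (i div p)" if "g \<in> carrier G" for g i
      using that by (simp add: nat_pow_pow nat_pow_mult)
    have "carrier G \<subseteq> (\<lambda>(i, j, z). a [^] i \<otimes> b [^] j \<otimes> z) ` ({..<p} \<times> {..<p} \<times> Z')"
    proof
      fix g assume "g \<in> carrier G"
      then obtain i j z where g: "g = a [^] (i :: nat) \<otimes> b [^] (j :: nat) \<otimes> z" "z \<in> Z'"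
        unfolding W by (auto simp: W_def)
      let ?u = "(a [^] p) [^] (i div p)" and ?v = "(b [^] p) [^] (j div p)"
      have uv: "?u \<in> Z'" "?v \<in> Z'" by (rule subgroup_nat_pow[OF Z's gen_Z]; simp)+
      have "g = a [^] (i mod p) \<otimes> (?u \<otimes> b [^] (j mod p)) \<otimes> ?v \<otimes> z"
        unfolding g(1) red[OF ab(1), of i] red[OF ab(2), of j] using g(2) by (simp add: m_assoc)
      also have "?u \<otimes> b [^] (j mod p) = b [^] (j mod p) \<otimes> ?u" using uv by (intro Zc) auto
      also have "a [^] (i mod p) \<otimes> (b [^] (j mod p) \<otimes> ?u) \<otimes> ?v \<otimes> z
          = a [^] (i mod p) \<otimes> b [^] (j mod p) \<otimes> (?u \<otimes> ?v \<otimes> z)" using g(2) by (simp add: m_assoc)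
      finally have "g = a [^] (i mod p) \<otimes> b [^] (j mod p) \<otimes> (?u \<otimes> ?v \<otimes> z)" .
      moreover have "?u \<otimes> ?v \<otimes> z \<in> Z'" by (intro Zm uv g)
      ultimately show "g \<in> (\<lambda>(i, j, z). a [^] i \<otimes> b [^] j \<otimes> z) ` ({..<p} \<times> {..<p} \<times> Z')"
        using p1 by (intro rev_image_eqI[of "(i mod p, j mod p, ?u \<otimes> ?v \<otimes> z)"]) auto
    qed
    hence "card (carrier G) \<le> card ({..<p} \<times> {..<p} \<times> Z')" using finZ by (intro surj_card_le) auto
    thus ?thesis by (simp add: Coset.order_def card_cartesian_product power2_eq_square mult.assoc)
  qed
  have finC: "finite (center_of G)" using fin by (rule rev_finite_subset) (auto simp: center_of_def)
  interpret P: phi2_group G p N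
  proof (unfold_locales)
    show "commutator_subgroup G \<subseteq> center_of G"
      unfolding D by (rule generate_subgroup_incl[OF _ center_subgroup]) (use cZ in simp)
    show "Coset.order G \<le> p ^ 2 * card (center_of G)"
      using bound card_mono[OF finC Z'Z] by (meson le_trans mult_le_mono2)
  qed (use p ord cardD in auto)
  \<comment> \<open>Commuting a normal form with \<open>b\<close> tests the exponent of
    \<open>a\<close>, and with \<open>a\<close> that of \<open>b\<close>; for a central element both
    are multiples of \<open>p\<close>.\<close>
  have "center_of G \<subseteq> Z'"
  proof
    fix x assume x: "x \<in> center_of G"
    hence "x \<in> W" unfolding W[symmetric] by simp
    then obtain i j z where e: "x = a [^] (i :: nat) \<otimes> b [^] (j :: nat) \<otimes> z" "z \<in> Z'" by (auto simp: W_def)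
    have zZ: "z \<in> center_of G" using e Z'Z by blast
    have self: "commutator G g g = \<one>" if "g \<in> carrier G" for g
      using commutator_eq_one_iff[OF that that] by simp
    have pw: "g [^] (n :: nat) \<in> Z'" if g: "g [^] p \<in> Z'" "p dvd n" "g \<in> carrier G" for g n
    proof -
      obtain k where "n = p * k" using g(2) by (elim dvdE)
      thus ?thesis using subgroup_nat_pow[OF Z's g(1), of k] g(3) by (simp add: nat_pow_pow)
    qed
    have "c [^] i = \<one>"
      using P.com_central(1)[OF x ab(2)] zZ self[OF ab(2)] c(1)
      unfolding e(1) by (simp add: P.com_mult_right P.com_pow_right)
    hence i: "p dvd i" using P.pow_eq_one_dvd[OF cG c(3) c1] by simp
    have ne: "commutator G a b \<noteq> \<one>"
      using c1 c(1) commutator_eq_one_iff[OF ab(2,1)] commutator_eq_one_iff[OF ab] by metis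
    have "commutator G a b [^] j = \<one>"
      using P.com_central(1)[OF x ab(1)] zZ self[OF ab(1)]
      unfolding e(1) by (simp add: P.com_mult_right P.com_pow_right)
    hence j: "p dvd j" using P.pow_eq_one_dvd[OF _ P.com_pow_p[OF ab] ne] by simp
    have "a [^] p \<in> Z'" "b [^] p \<in> Z'" by (simp_all add: gen_Z)
    thus "x \<in> Z'" unfolding e(1) using pw i j by (intro Zm e(2)) auto
  qed
  hence "center_of G = Z'" using Z'Z by blast
  thus ?thesis using ab c c1 SZ D by unfold_locales (simp_all add: Z'_def)
qed

text \<open>Comparing each word of a chain with the last one gives equations that simplify well,
  because the last word is the name of the commutator or the identity.\<close>

lemma Phi2_pres_rels:
  assumes "Phi2_pres G xs R"
  shows "\<forall>cs\<in>set R. \<forall>u\<in>set (butlast cs). word_val G xs u = word_val G xs (last cs)"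
proof (intro ballI)
  fix cs u assume cs: "cs \<in> set R" "u \<in> set (butlast cs)"
  hence "u \<in> set cs" "last cs \<in> set cs" by (auto dest: in_set_butlastD intro: last_in_set)
  moreover have "satisfies_rels G xs (set R \<union> omitted_rels (length xs))"
    using assms by (simp add: Phi2_pres_def presented_by_def)
  ultimately show "word_val G xs u = word_val G xs (last cs)"
    using cs(1) unfolding satisfies_rels_def by (metis UnI1)
qed

lemma Phi2_pres_carrier: "Phi2_pres G xs R \<Longrightarrow> set xs \<subseteq> carrier G"
  by (simp add: Phi2_pres_def presented_by_def)

text \<open>The omitted relations leave only the first two generators not commuting, so the
  remaining ones, listed in \<open>ss\<close>, are central.\<close>

lemma (in group) phi2_gens_of_pres:
  assumes p: "prime p" "Coset.order G = p ^ N" "in_Phi2 p G" and P: "Phi2_pres G (a # b # ss) R"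
    and c: "commutator G b a = c" "c \<in> set ss" "c [^] p = \<one>"
  shows "phi2_gens G p N a b c (set ss)"
proof -
  define xs where "xs = a # b # ss"
  have carr: "set xs \<subseteq> carrier G" and gen: "generate G (set xs) = carrier G"
    and rels: "satisfies_rels G xs (set R \<union> omitted_rels (length xs))"
    using P by (simp_all add: Phi2_pres_def presented_by_def xs_def)
  have comm: "xs ! i \<otimes> xs ! j = xs ! j \<otimes> xs ! i" if "i < j" "j < length xs" "(i, j) \<noteq> (0, 1)" for i j
  proof -
    have "[Comm (Gen i) (Gen j), One] \<in> omitted_rels (length xs)" using that by (auto simp: omitted_rels_def)
    hence "word_val G xs (Comm (Gen i) (Gen j)) = word_val G xs One"
      using rels unfolding satisfies_rels_def by (metis UnI2 list.set_intros)
    hence "commutator G (xs ! i) (xs ! j) = \<one>" by simp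
    moreover have "xs ! i \<in> carrier G" "xs ! j \<in> carrier G" using carr that by (auto dest: nth_mem)
    ultimately show ?thesis using commutator_eq_one_iff by blast
  qed
  obtain x0 y0 where na: "x0 \<in> carrier G" "y0 \<in> carrier G" "x0 \<otimes> y0 \<noteq> y0 \<otimes> x0"
    by (rule not_commutative_if_in_Phi2[OF p(3)])
  show ?thesis
  proof (rule phi2_gensI[OF p(1,2) _ _ _ _ _ c na])
    fix s t assume s: "s \<in> set ss" and t: "t \<in> insert a (insert b (set ss))"
    obtain i where i: "i < length ss" "s = xs ! (i + 2)" using s by (auto simp: in_set_conv_nth xs_def)
    obtain j where j: "j < length xs" "t = xs ! j" using t by (metis in_set_conv_nth list.simps(15) xs_def)
    have il: "i + 2 < length xs" using i by (simp add: xs_def)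
    consider "i + 2 < j" | "i + 2 = j" | "j < i + 2" by linarith
    thus "s \<otimes> t = t \<otimes> s"
    proof cases
      case 1 thus ?thesis using comm[OF 1 j(1)] i j by simp
    next
      case 2 thus ?thesis using i j by simp
    next
      case 3 thus ?thesis using comm[OF 3 il] i j by simp
    qed
  qed (use carr gen in \<open>auto simp: xs_def\<close>)
qed

section \<open>The fifteen groups\<close>

locale phi2_family = group G for G (structure) +
  fixes p :: nat
  assumes p: "prime p" "odd p" and ord: "Coset.order G = p ^ 5" and fam: "in_Phi2 p G"
begin

text \<open>For groups in which one of the first two generators has order \<open>p\<close>, which
  allows the value 1 there. \<open>B\<close> is a shortened generating set of the centre: what it
  omits is trivial or equal to \<open>c\<close>, and \<open>c\<close> is a power of a member.
  \<open>d\<close> is the name under which \<open>c\<close> occurs in the result.\<close>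

lemma determines_simple:
  assumes P: "Phi2_pres G (a # b # ss) R" and c: "commutator G b a = c" "c \<in> set ss" "c [^] p = \<one>"
    and h: "h = a \<or> h = b" "h [^] p = \<one>"
    and B: "insert (a [^] p) (insert (b [^] p) (set ss)) \<subseteq> insert \<one> (insert c B)"
      "B \<subseteq> insert (a [^] p) (set ss)" "c \<in> B \<or> (\<exists>x\<in>B. \<exists>n :: nat. c = x [^] n)"
    and v: "\<And>\<mu>. (h, 1) \<in> set (v \<mu>)"
      "\<And>\<mu> x y. (x, y) \<in> set (v \<mu>) \<Longrightarrow> (x, y) = (h, 1) \<or> x \<in> B \<and> y = \<mu> x" "\<And>\<mu>. B \<subseteq> fst ` set (v \<mu>)"
    and d: "c = d"
  shows "center_of G = generate G B \<and> commutator_subgroup G = generate G {d} \<and>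
    determines_rational_reps p G (\<lambda>\<mu>. {v \<mu>})"
proof -
  interpret X: phi2_gens G p 5 a b c "set ss" by (rule phi2_gens_of_pres[OF p(1) ord fam P c])
  have BZ: "B \<subseteq> center_of G" using B(2) X.S_Z X.pow_p_central[OF X.aG] by auto
  hence Bc: "B \<subseteq> carrier G" by (auto dest: X.Z_carrier)
  have "c \<in> generate G B" using B(3) generate_pow[OF _ Bc] by (auto intro: generate.incl)
  hence "{a [^] p, b [^] p} \<union> set ss \<subseteq> generate G B"
    using B(1) by (auto intro: generate.incl generate.one)
  hence Z: "center_of G = generate G B"
    unfolding X.center_gen by (rule generate_eqI) (use B(2) Bc in auto)
  have hG: "h \<in> carrier G" "h \<notin> center_of G"
    using h(1) X.aG X.bG X.a_notin_Z X.b_notin_Z by auto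
  have "determines_rational_reps p G (\<lambda>\<mu>. {v \<mu>})"
    by (rule X.determines_rational_reps_simple[OF hG h(2) v(1) _ Z v(3)]) (use v(2) BZ in blast)
  thus ?thesis using Z X.derived_gen d by simp
qed

lemmas determines_simple_left = determines_simple[OF _ _ _ _ disjI1[OF refl]]
lemmas determines_simple_right = determines_simple[OF _ _ _ _ disjI2[OF refl]]

lemma Phi2_311a:
  assumes P: "Phi2_pres G [\<alpha>, \<alpha>\<^sub>1, \<alpha>\<^sub>2, \<gamma>] (rels_311a p)"
  shows "center_of G = generate G {\<alpha> [^] p, \<gamma>} \<and> commutator_subgroup G = generate G {\<alpha> [^] (p^2)} \<and>
    determines_rational_reps p G (\<lambda>\<mu>. {[(\<alpha> [^] p, \<mu> (\<alpha> [^] p)), (\<alpha>\<^sub>1, 1), (\<gamma>, \<mu> \<gamma>)]})"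
proof -
  have r: "commutator G \<alpha>\<^sub>1 \<alpha> = \<alpha>\<^sub>2" "\<alpha> [^] (p ^ 2) = \<alpha>\<^sub>2" "\<alpha>\<^sub>1 [^] p = \<one>" "\<alpha>\<^sub>2 [^] p = \<one>" "\<gamma> [^] p = \<one>"
    using Phi2_pres_rels[OF P] by (simp_all add: rels_311a_def)
  have c: "\<alpha>\<^sub>2 = (\<alpha> [^] p) [^] p" using r Phi2_pres_carrier[OF P] by (simp add: nat_pow_pow power2_eq_square[symmetric])
  hence cB: "\<alpha>\<^sub>2 \<in> {\<alpha> [^] p, \<gamma>} \<or> (\<exists>x\<in>{\<alpha> [^] p, \<gamma>}. \<exists>n :: nat. \<alpha>\<^sub>2 = x [^] n)" by blast
  show ?thesis
    by (rule determines_simple_right[OF P r(1) _ r(4) r(3) _ _ cB]) (use r in auto)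
qed

lemma Phi2_221b:
  assumes P: "Phi2_pres G [\<alpha>, \<alpha>\<^sub>1, \<alpha>\<^sub>2, \<gamma>] (rels_221b p)"
  shows "center_of G = generate G {\<alpha> [^] p, \<gamma>} \<and> commutator_subgroup G = generate G {\<alpha> [^] p} \<and>
    determines_rational_reps p G (\<lambda>\<mu>. {[(\<alpha> [^] p, \<mu> (\<alpha> [^] p)), (\<alpha>\<^sub>1, 1), (\<gamma>, \<mu> \<gamma>)]})"
proof -
  have r: "commutator G \<alpha>\<^sub>1 \<alpha> = \<alpha>\<^sub>2" "\<alpha> [^] p = \<alpha>\<^sub>2" "\<alpha>\<^sub>1 [^] p = \<one>" "\<alpha>\<^sub>2 [^] p = \<one>"
    using Phi2_pres_rels[OF P] by (simp_all add: rels_221b_def)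
  show ?thesis
    by (rule determines_simple_right[OF P r(1) _ r(4) r(3), of "{\<alpha> [^] p, \<gamma>}"]) (use r in auto)
qed

lemma Phi2_2111a:
  assumes P: "Phi2_pres G [\<alpha>, \<alpha>\<^sub>1, \<alpha>\<^sub>2, \<gamma>, \<delta>] (rels_2111a p)"
  shows "center_of G = generate G {\<alpha> [^] p, \<gamma>, \<delta>} \<and> commutator_subgroup G = generate G {\<alpha> [^] p} \<and>
    determines_rational_reps p G (\<lambda>\<mu>. {[(\<alpha> [^] p, \<mu> (\<alpha> [^] p)), (\<alpha>\<^sub>1, 1), (\<gamma>, \<mu> \<gamma>), (\<delta>, \<mu> \<delta>)]})"
proof -
  have r: "commutator G \<alpha>\<^sub>1 \<alpha> = \<alpha>\<^sub>2" "\<alpha> [^] p = \<alpha>\<^sub>2" "\<alpha>\<^sub>1 [^] p = \<one>" "\<alpha>\<^sub>2 [^] p = \<one>"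
    using Phi2_pres_rels[OF P] by (simp_all add: rels_2111a_def)
  show ?thesis
    by (rule determines_simple_right[OF P r(1) _ r(4) r(3), of "{\<alpha> [^] p, \<gamma>, \<delta>}"]) (use r in auto)
qed

lemma Phi2_2111b:
  assumes P: "Phi2_pres G [\<alpha>, \<alpha>\<^sub>1, \<alpha>\<^sub>2, \<gamma>, \<delta>] (rels_2111b p)"
  shows "center_of G = generate G {\<gamma>, \<delta>} \<and> commutator_subgroup G = generate G {\<gamma> [^] p} \<and>
    determines_rational_reps p G (\<lambda>\<mu>. {[(\<alpha>, 1), (\<gamma>, \<mu> \<gamma>), (\<delta>, \<mu> \<delta>)]})"
proof -
  have r: "commutator G \<alpha>\<^sub>1 \<alpha> = \<alpha>\<^sub>2" "\<gamma> [^] p = \<alpha>\<^sub>2" "\<alpha> [^] p = \<one>" "\<alpha>\<^sub>1 [^] p = \<one>" "\<alpha>\<^sub>2 [^] p = \<one>"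
    using Phi2_pres_rels[OF P] by (simp_all add: rels_2111b_def)
  have c: "\<alpha>\<^sub>2 = \<gamma> [^] p" using r by simp
  hence cB: "\<alpha>\<^sub>2 \<in> {\<gamma>, \<delta>} \<or> (\<exists>x\<in>{\<gamma>, \<delta>}. \<exists>n :: nat. \<alpha>\<^sub>2 = x [^] n)" by blast
  show ?thesis
    by (rule determines_simple_left[OF P r(1) _ r(5) r(3) _ _ cB]) (use r in auto)
qed

lemma Phi2_2111c:
  assumes P: "Phi2_pres G [\<alpha>, \<alpha>\<^sub>1, \<alpha>\<^sub>2, \<gamma>] (rels_2111c p)"
  shows "center_of G = generate G {\<alpha> [^] p, \<alpha>\<^sub>2, \<gamma>} \<and> commutator_subgroup G = generate G {\<alpha>\<^sub>2} \<and>
    determines_rational_reps p G (\<lambda>\<mu>. {[(\<alpha> [^] p, \<mu> (\<alpha> [^] p)), (\<alpha>\<^sub>1, 1), (\<alpha>\<^sub>2, \<mu> \<alpha>\<^sub>2), (\<gamma>, \<mu> \<gamma>)]})"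
proof -
  have r: "commutator G \<alpha>\<^sub>1 \<alpha> = \<alpha>\<^sub>2" "\<alpha>\<^sub>1 [^] p = \<one>" "\<alpha>\<^sub>2 [^] p = \<one>"
    using Phi2_pres_rels[OF P] by (simp_all add: rels_2111c_def)
  show ?thesis
    by (rule determines_simple_right[OF P r(1) _ r(3) r(2), of "{\<alpha> [^] p, \<alpha>\<^sub>2, \<gamma>}"]) (use r in auto)
qed

lemma Phi2_2111d:
  assumes P: "Phi2_pres G [\<alpha>, \<alpha>\<^sub>1, \<alpha>\<^sub>2, \<gamma>] (rels_2111d p)"
  shows "center_of G = generate G {\<alpha>\<^sub>2, \<gamma>} \<and> commutator_subgroup G = generate G {\<alpha>\<^sub>2} \<and>
    determines_rational_reps p G (\<lambda>\<mu>. {[(\<alpha>\<^sub>1, 1), (\<alpha>\<^sub>2, \<mu> \<alpha>\<^sub>2), (\<gamma>, \<mu> \<gamma>)]})"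
proof -
  have r: "commutator G \<alpha>\<^sub>1 \<alpha> = \<alpha>\<^sub>2" "\<alpha> [^] p = \<one>" "\<alpha>\<^sub>1 [^] p = \<one>" "\<alpha>\<^sub>2 [^] p = \<one>"
    using Phi2_pres_rels[OF P] by (simp_all add: rels_2111d_def)
  show ?thesis
    by (rule determines_simple_right[OF P r(1) _ r(4) r(3), of "{\<alpha>\<^sub>2, \<gamma>}"]) (use r in auto)
qed

lemma Phi2_11111:
  assumes P: "Phi2_pres G [\<alpha>, \<alpha>\<^sub>1, \<alpha>\<^sub>2, \<gamma>, \<delta>] (rels_11111 p)"
  shows "center_of G = generate G {\<alpha>\<^sub>2, \<gamma>, \<delta>} \<and> commutator_subgroup G = generate G {\<alpha>\<^sub>2} \<and>
    determines_rational_reps p G (\<lambda>\<mu>. {[(\<alpha>\<^sub>1, 1), (\<alpha>\<^sub>2, \<mu> \<alpha>\<^sub>2), (\<gamma>, \<mu> \<gamma>), (\<delta>, \<mu> \<delta>)]})"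
proof -
  have r: "commutator G \<alpha>\<^sub>1 \<alpha> = \<alpha>\<^sub>2" "\<alpha> [^] p = \<one>" "\<alpha>\<^sub>1 [^] p = \<one>" "\<alpha>\<^sub>2 [^] p = \<one>"
    using Phi2_pres_rels[OF P] by (simp_all add: rels_11111_def)
  show ?thesis
    by (rule determines_simple_right[OF P r(1) _ r(4) r(3), of "{\<alpha>\<^sub>2, \<gamma>, \<delta>}"]) (use r in auto)
qed

lemma Phi2_41:
  assumes P: "Phi2_pres G [\<alpha>, \<alpha>\<^sub>1, \<alpha>\<^sub>2] (rels_41 p)"
  shows "center_of G = generate G {\<alpha> [^] p} \<and> commutator_subgroup G = generate G {\<alpha> [^] (p^3)} \<and>
    determines_rational_reps p G (\<lambda>\<mu>. {[(\<alpha> [^] p, \<mu> (\<alpha> [^] p)), (\<alpha>\<^sub>1, 1)]})"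
proof -
  have r: "commutator G \<alpha>\<^sub>1 \<alpha> = \<alpha>\<^sub>2" "\<alpha> [^] (p ^ 3) = \<alpha>\<^sub>2" "\<alpha>\<^sub>1 [^] p = \<one>" "\<alpha>\<^sub>2 [^] p = \<one>"
    using Phi2_pres_rels[OF P] by (simp_all add: rels_41_def)
  have c: "\<alpha>\<^sub>2 = (\<alpha> [^] p) [^] (p ^ 2)" using r Phi2_pres_carrier[OF P] by (simp add: nat_pow_pow power3_eq_cube power2_eq_square mult.assoc)
  hence cB: "\<alpha>\<^sub>2 \<in> {\<alpha> [^] p} \<or> (\<exists>x\<in>{\<alpha> [^] p}. \<exists>n :: nat. \<alpha>\<^sub>2 = x [^] n)" by blast
  show ?thesis
    by (rule determines_simple_right[OF P r(1) _ r(4) r(3) _ _ cB]) (use r in auto)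
qed

lemma Phi2_311b:
  assumes P: "Phi2_pres G [\<alpha>, \<alpha>\<^sub>1, \<alpha>\<^sub>2, \<gamma>] (rels_311b p)"
  shows "center_of G = generate G {\<gamma>} \<and> commutator_subgroup G = generate G {\<gamma> [^] (p^2)} \<and>
    determines_rational_reps p G (\<lambda>\<mu>. {[(\<alpha>, 1), (\<gamma>, \<mu> \<gamma>)]})"
proof -
  have r: "commutator G \<alpha>\<^sub>1 \<alpha> = \<alpha>\<^sub>2" "\<gamma> [^] (p ^ 2) = \<alpha>\<^sub>2" "\<alpha> [^] p = \<one>" "\<alpha>\<^sub>1 [^] p = \<one>" "\<alpha>\<^sub>2 [^] p = \<one>"
    using Phi2_pres_rels[OF P] by (simp_all add: rels_311b_def)
  have c: "\<alpha>\<^sub>2 = \<gamma> [^] (p ^ 2)" using r by simp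
  hence cB: "\<alpha>\<^sub>2 \<in> {\<gamma>} \<or> (\<exists>x\<in>{\<gamma>}. \<exists>n :: nat. \<alpha>\<^sub>2 = x [^] n)" by blast
  show ?thesis
    by (rule determines_simple_left[OF P r(1) _ r(5) r(3) _ _ cB]) (use r in auto)
qed

lemma Phi2_311c:
  assumes P: "Phi2_pres G [\<alpha>, \<alpha>\<^sub>1, \<alpha>\<^sub>2] (rels_311c p)"
  shows "center_of G = generate G {\<alpha> [^] p, \<alpha>\<^sub>2} \<and> commutator_subgroup G = generate G {\<alpha>\<^sub>2} \<and>
    determines_rational_reps p G (\<lambda>\<mu>. {[(\<alpha> [^] p, \<mu> (\<alpha> [^] p)), (\<alpha>\<^sub>1, 1), (\<alpha>\<^sub>2, \<mu> \<alpha>\<^sub>2)]})"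
proof -
  have r: "commutator G \<alpha>\<^sub>1 \<alpha> = \<alpha>\<^sub>2" "\<alpha>\<^sub>1 [^] p = \<one>" "\<alpha>\<^sub>2 [^] p = \<one>"
    using Phi2_pres_rels[OF P] by (simp_all add: rels_311c_def)
  show ?thesis
    by (rule determines_simple_right[OF P r(1) _ r(3) r(2), of "{\<alpha> [^] p, \<alpha>\<^sub>2}"]) (use r in auto)
qed

lemma Phi2_221c:
  assumes P: "Phi2_pres G [\<alpha>, \<alpha>\<^sub>1, \<alpha>\<^sub>2, \<gamma>] (rels_221c p)"
  shows "center_of G = generate G {\<alpha> [^] p, \<gamma>} \<and> commutator_subgroup G = generate G {\<gamma> [^] p} \<and>
    determines_rational_reps p G (\<lambda>\<mu>. {[(\<alpha> [^] p, \<mu> (\<alpha> [^] p)), (\<alpha>\<^sub>1, 1), (\<gamma>, \<mu> \<gamma>)]})"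
proof -
  have r: "commutator G \<alpha>\<^sub>1 \<alpha> = \<alpha>\<^sub>2" "\<gamma> [^] p = \<alpha>\<^sub>2" "\<alpha>\<^sub>1 [^] p = \<one>" "\<alpha>\<^sub>2 [^] p = \<one>"
    using Phi2_pres_rels[OF P] by (simp_all add: rels_221c_def)
  have c: "\<alpha>\<^sub>2 = \<gamma> [^] p" using r by simp
  hence cB: "\<alpha>\<^sub>2 \<in> {\<alpha> [^] p, \<gamma>} \<or> (\<exists>x\<in>{\<alpha> [^] p, \<gamma>}. \<exists>n :: nat. \<alpha>\<^sub>2 = x [^] n)" by blast
  show ?thesis
    by (rule determines_simple_right[OF P r(1) _ r(4) r(3) _ _ cB]) (use r in auto)
qed

text \<open>Here \<alpha>^p generates \<open>G'\<close>, so its value under \<mu> is a primitive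
  p-th root of unity and the value at \<open>\<alpha>\<^sub>1 ^ p\<close> is a power of it. The
  exponent \<open>i\<close> tells which power of \<alpha> corrects
  \<open>\<alpha>\<^sub>1\<close>.\<close>

lemma Phi2_221a:
  assumes P: "Phi2_pres G [\<alpha>, \<alpha>\<^sub>1, \<alpha>\<^sub>2, \<gamma>] (rels_221a p)"
  shows "center_of G = generate G {\<alpha> [^] p, \<alpha>\<^sub>1 [^] p, \<gamma>} \<and> commutator_subgroup G = generate G {\<alpha> [^] p} \<and>
    determines_rational_reps p G (\<lambda>\<mu>. {[(\<alpha> [^] (- int i) \<otimes> \<alpha>\<^sub>1, 1), (\<alpha> [^] p, \<mu> (\<alpha> [^] p)), (\<gamma>, \<mu> \<gamma>)]
      | i. i < p \<and> \<mu> (\<alpha>\<^sub>1 [^] p) = (\<mu> (\<alpha> [^] p)) ^ i})"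
proof -
  have r: "commutator G \<alpha>\<^sub>1 \<alpha> = \<alpha>\<^sub>2" "\<alpha> [^] p = \<alpha>\<^sub>2" "\<alpha>\<^sub>1 [^] (p ^ 2) = \<one>" "\<alpha>\<^sub>2 [^] p = \<one>"
    using Phi2_pres_rels[OF P] by (simp_all add: rels_221a_def)
  interpret X: phi2_gens G p 5 \<alpha> "\<alpha>\<^sub>1" "\<alpha>\<^sub>2" "{\<alpha>\<^sub>2, \<gamma>}"
    using phi2_gens_of_pres[OF p(1) ord fam P, of "\<alpha>\<^sub>2"] r by simp
  have Sc: "{\<alpha>\<^sub>2, \<gamma>} \<subseteq> carrier G" using X.S_Z by (auto dest: X.Z_carrier)
  have Z: "center_of G = generate G {\<alpha> [^] p, \<alpha>\<^sub>1 [^] p, \<gamma>}"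
    unfolding X.center_gen using r(2) by (simp add: insert_commute)
  note pZ = X.pow_p_central[OF X.aG] X.pow_p_central[OF X.bG]
  have "determines_rational_reps p G (\<lambda>\<mu>. {[(\<alpha> [^] (- int i) \<otimes> \<alpha>\<^sub>1, 1), (\<alpha> [^] p, \<mu> (\<alpha> [^] p)), (\<gamma>, \<mu> \<gamma>)]
      | i. i < p \<and> \<mu> (\<alpha>\<^sub>1 [^] p) = (\<mu> (\<alpha> [^] p)) ^ i})" (is "determines_rational_reps p G ?A")
  proof (rule X.determines_rational_repsI)
    fix \<mu> assume mu: "\<mu> \<in> central_chars G"
    interpret C: phi2_char G p 5 \<mu> using mu by unfold_locales
    have "\<mu> (\<alpha> [^] p) ^ p = 1" using C.mu_pow[OF pZ(1), of p] r by simp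
    moreover have "\<mu> (\<alpha> [^] p) \<noteq> 1" using C.mu_D[OF X.c_D X.c_neq_one] r(2) by simp
    moreover have "\<mu> (\<alpha>\<^sub>1 [^] p) ^ p = 1"
      using C.mu_pow[OF pZ(2), of p] r by (simp add: nat_pow_pow power2_eq_square)
    ultimately obtain i where "i < p" "\<mu> (\<alpha>\<^sub>1 [^] p) = \<mu> (\<alpha> [^] p) ^ i"
      using root_is_power_prime[OF p(1)] by metis
    thus "?A \<mu> \<noteq> {}" by blast
  next
    fix \<mu> v assume mu: "\<mu> \<in> central_chars G" and "v \<in> ?A \<mu>"
    then obtain i where i: "\<mu> (\<alpha>\<^sub>1 [^] p) = \<mu> (\<alpha> [^] p) ^ i"
      and v: "v = [(\<alpha> [^] (- int i) \<otimes> \<alpha>\<^sub>1, 1), (\<alpha> [^] p, \<mu> (\<alpha> [^] p)), (\<gamma>, \<mu> \<gamma>)]" by blast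
    interpret C: phi2_char G p 5 \<mu> using mu by unfold_locales
    define h where "h = inv (\<alpha> [^] i) \<otimes> \<alpha>\<^sub>1"
    have v: "v = [(h, 1), (\<alpha> [^] p, \<mu> (\<alpha> [^] p)), (\<gamma>, \<mu> \<gamma>)]"
      unfolding v h_def by (simp add: int_pow_neg_int)
    have hG: "h \<in> carrier G" by (simp add: h_def)
    have "(inv (\<alpha> [^] i)) [^] p = inv ((\<alpha> [^] p) [^] i)"
      by (simp add: nat_pow_inv nat_pow_pow mult.commute)
    hence hp: "h [^] p = inv ((\<alpha> [^] p) [^] i) \<otimes> \<alpha>\<^sub>1 [^] p"
      unfolding h_def by (subst X.pow_p_mult[OF p(2)]) simp_all
    have "\<mu> (h [^] p) = 1"
      unfolding hp using pZ C.mu_nonzero[OF pZ(1)] by (simp add: C.mu_mult C.mu_inv C.mu_pow i)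
    moreover have "center_of G \<subseteq> generate G (fst ` set v)"
    proof -
      have sub: "fst ` set v \<subseteq> carrier G" using hG Sc by (simp add: v)
      note S = generate_is_subgroup[OF sub]
      have "\<alpha>\<^sub>1 [^] p = (\<alpha> [^] p) [^] i \<otimes> h [^] p" unfolding hp by simp
      also have "\<dots> \<in> generate G (fst ` set v)"
        by (intro subgroup.m_closed[OF S] generate_pow[OF _ sub]) (simp_all add: v)
      finally have "{\<alpha> [^] p, \<alpha>\<^sub>1 [^] p, \<gamma>} \<subseteq> generate G (fst ` set v)"
        by (auto simp: v intro: generate.incl)
      thus ?thesis unfolding Z by (rule generate_subgroup_incl[OF _ S])
    qed
    ultimately show "X.good_pair \<mu> v"
      using hG X.inv_pow_a_mult_b_notin_Z[of i] pZ X.S_Z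
      by (intro X.good_pair_simple[OF mu, of h]) (auto simp: v h_def)
  qed
  thus ?thesis using Z X.derived_gen r by simp
qed

text \<open>The p-th power of \<alpha>^p generates \<open>G'\<close>, so \<mu>(\<alpha>^p) is always
  a primitive root of order p^2. Any p-th root \<omega> of \<mu> at
  \<open>\<alpha>\<^sub>1 ^ p\<close> is a root of unity of order dividing p^2, hence already a
  value of \<mu>.\<close>

lemma Phi2_32a1:
  assumes P: "Phi2_pres G [\<alpha>, \<alpha>\<^sub>1, \<alpha>\<^sub>2] (rels_32a1 p)"
  shows "center_of G = generate G {\<alpha> [^] p, \<alpha>\<^sub>1 [^] p} \<and> commutator_subgroup G = generate G {\<alpha> [^] (p^2)} \<and>
    determines_rational_reps p G (\<lambda>\<mu>. {[(\<alpha> [^] p, \<mu> (\<alpha> [^] p)), (\<alpha>\<^sub>1, \<omega>)] | \<omega>. \<omega> ^ p = \<mu> (\<alpha>\<^sub>1 [^] p)})"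
proof -
  have r: "commutator G \<alpha>\<^sub>1 \<alpha> = \<alpha>\<^sub>2" "\<alpha> [^] (p ^ 2) = \<alpha>\<^sub>2" "\<alpha>\<^sub>1 [^] (p ^ 2) = \<one>" "\<alpha>\<^sub>2 [^] p = \<one>"
    using Phi2_pres_rels[OF P] by (simp_all add: rels_32a1_def)
  interpret X: phi2_gens G p 5 \<alpha> "\<alpha>\<^sub>1" "\<alpha>\<^sub>2" "{\<alpha>\<^sub>2}"
    using phi2_gens_of_pres[OF p(1) ord fam P, of "\<alpha>\<^sub>2"] r by simp
  have Bc: "{\<alpha> [^] p, \<alpha>\<^sub>1 [^] p} \<subseteq> carrier G" by simp
  have c: "\<alpha>\<^sub>2 = (\<alpha> [^] p) [^] p" using r(2) by (simp add: nat_pow_pow power2_eq_square)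
  hence "\<alpha>\<^sub>2 \<in> generate G {\<alpha> [^] p, \<alpha>\<^sub>1 [^] p}" using generate_pow[OF _ Bc, of "\<alpha> [^] p" p] by simp
  hence Z: "center_of G = generate G {\<alpha> [^] p, \<alpha>\<^sub>1 [^] p}"
    unfolding X.center_gen by (intro generate_eqI) (auto intro: generate.incl)
  note pZ = X.pow_p_central[OF X.aG] X.pow_p_central[OF X.bG]
  have "determines_rational_reps p G (\<lambda>\<mu>. {[(\<alpha> [^] p, \<mu> (\<alpha> [^] p)), (\<alpha>\<^sub>1, \<omega>)] | \<omega>. \<omega> ^ p = \<mu> (\<alpha>\<^sub>1 [^] p)})"
    (is "determines_rational_reps p G ?A")
  proof (rule X.determines_rational_repsI)
    fix \<mu> assume mu: "\<mu> \<in> central_chars G"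
    interpret C: phi2_char G p 5 \<mu> using mu by unfold_locales
    \<comment> \<open>A nonzero complex number has \<open>p\<close> distinct p-th roots, so the
      listed choice is not empty.\<close>
    have "card {\<omega>. \<omega> ^ p = \<mu> (\<alpha>\<^sub>1 [^] p)} = p"
      using C.mu_nonzero[OF pZ(2)] X.p_gt1 by (intro card_nth_roots) auto
    hence "{\<omega>. \<omega> ^ p = \<mu> (\<alpha>\<^sub>1 [^] p)} \<noteq> {}" using X.p_gt1 by (metis card.empty not_less_zero)
    thus "?A \<mu> \<noteq> {}" by blast
  next
    fix \<mu> v assume mu: "\<mu> \<in> central_chars G" and "v \<in> ?A \<mu>"
    then obtain \<omega> where w: "\<omega> ^ p = \<mu> (\<alpha>\<^sub>1 [^] p)" and v: "v = [(\<alpha> [^] p, \<mu> (\<alpha> [^] p)), (\<alpha>\<^sub>1, \<omega>)]" by blast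
    interpret C: phi2_char G p 5 \<mu> using mu by unfold_locales
    have "\<mu> (\<alpha> [^] p) ^ p \<noteq> 1" using C.mu_D[OF X.c_D X.c_neq_one] c C.mu_pow[OF pZ(1), of p] by simp
    moreover have "\<mu> (\<alpha> [^] p) ^ (p ^ 2) = 1"
      using C.mu_pow[OF pZ(1), of "p ^ 2"] c r(4) by (simp add: nat_pow_pow power2_eq_square mult.assoc)
    moreover have "\<omega> ^ (p ^ 2) = 1"
      using C.mu_pow[OF pZ(2), of p] r(3) by (simp add: w[symmetric] power2_eq_square power_mult nat_pow_pow)
    ultimately obtain j where "\<omega> = \<mu> (\<alpha> [^] p) ^ j" using root_is_power_prime_square[OF p(1)] by metis
    hence wj: "\<omega> = \<mu> ((\<alpha> [^] p) [^] j)" using pZ by (simp add: C.mu_pow)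
    show "X.good_pair \<mu> v"
      unfolding X.good_pair_def v
    proof (intro exI conjI)
      show "(\<alpha>\<^sub>1, \<mu> ((\<alpha> [^] p) [^] j)) \<in> set [(\<alpha> [^] p, \<mu> (\<alpha> [^] p)), (\<alpha>\<^sub>1, \<omega>)]" using wj by simp
      have "{\<alpha> [^] p, \<alpha>\<^sub>1 [^] p} \<subseteq> generate G {\<alpha> [^] p, \<alpha>\<^sub>1}"
        using generate_pow[of "\<alpha>\<^sub>1" "{\<alpha> [^] p, \<alpha>\<^sub>1}" p] by (auto intro: generate.incl)
      thus "center_of G \<subseteq> generate G (fst ` set [(\<alpha> [^] p, \<mu> (\<alpha> [^] p)), (\<alpha>\<^sub>1, \<omega>)])"
        unfolding Z by (simp add: generate_subgroup_incl generate_is_subgroup)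
    qed (use X.b_notin_Z pZ w wj in auto)
  qed
  thus ?thesis using Z X.derived_gen r by simp
qed

text \<open>A p-th root \<omega> of \<mu> at \<open>\<alpha>\<^sub>1 ^ p\<close> has order p^2. It
  is a value of \<mu> if \<mu>(\<alpha>^p) has that order; otherwise \<omega> would enlarge the
  character field, and the generator is replaced by \<alpha> times a power of the inverse of
  \<open>\<alpha>\<^sub>1\<close>.\<close>

lemma Phi2_32a2:
  assumes P: "Phi2_pres G [\<alpha>, \<alpha>\<^sub>1, \<alpha>\<^sub>2] (rels_32a2 p)"
  shows "center_of G = generate G {\<alpha> [^] p, \<alpha>\<^sub>1 [^] p}" "commutator_subgroup G = generate G {\<alpha>\<^sub>1 [^] p}"
    and "\<And>\<mu> \<omega>. \<mu> \<in> central_chars G \<Longrightarrow> primitive_root_of_unity (p^2) (\<mu> (\<alpha> [^] p)) \<Longrightarrow>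
      \<omega> ^ p = \<mu> (\<alpha>\<^sub>1 [^] p) \<Longrightarrow> gives_required_pair p G \<mu> [(\<alpha> [^] p, \<mu> (\<alpha> [^] p)), (\<alpha>\<^sub>1, \<omega>)]"
    and "\<And>\<mu>. \<mu> \<in> central_chars G \<Longrightarrow> \<not> primitive_root_of_unity (p^2) (\<mu> (\<alpha> [^] p)) \<Longrightarrow>
      \<exists>i<p. \<mu> (\<alpha> [^] p) = \<mu> (\<alpha>\<^sub>1 [^] p) ^ i"
    and "\<And>\<mu> i. \<mu> \<in> central_chars G \<Longrightarrow> \<mu> (\<alpha> [^] p) = \<mu> (\<alpha>\<^sub>1 [^] p) ^ i \<Longrightarrow>
      gives_required_pair p G \<mu> [(\<alpha> \<otimes> \<alpha>\<^sub>1 [^] (- int i), 1), (\<alpha>\<^sub>1 [^] p, \<mu> (\<alpha>\<^sub>1 [^] p))]"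
proof -
  have r: "commutator G \<alpha>\<^sub>1 \<alpha> = \<alpha>\<^sub>2" "\<alpha>\<^sub>1 [^] p = \<alpha>\<^sub>2" "\<alpha> [^] (p ^ 3) = \<one>" "\<alpha>\<^sub>2 [^] p = \<one>"
    using Phi2_pres_rels[OF P] by (simp_all add: rels_32a2_def)
  interpret X: phi2_gens G p 5 \<alpha> "\<alpha>\<^sub>1" "\<alpha>\<^sub>2" "{\<alpha>\<^sub>2}"
    using phi2_gens_of_pres[OF p(1) ord fam P, of "\<alpha>\<^sub>2"] r by simp
  note pZ = X.pow_p_central[OF X.aG] X.pow_p_central[OF X.bG]
  show Z: "center_of G = generate G {\<alpha> [^] p, \<alpha>\<^sub>1 [^] p}" unfolding X.center_gen using r(2) by (simp add: insert_commute)
  show "commutator_subgroup G = generate G {\<alpha>\<^sub>1 [^] p}" using X.derived_gen r by simp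
  have root: "\<mu> (\<alpha>\<^sub>1 [^] p) ^ p = 1 \<and> \<mu> (\<alpha>\<^sub>1 [^] p) \<noteq> 1 \<and> \<mu> (\<alpha> [^] p) ^ (p ^ 2) = 1"
    if mu: "\<mu> \<in> central_chars G" for \<mu>
  proof -
    interpret C: phi2_char G p 5 \<mu> using mu by unfold_locales
    show ?thesis
      using C.mu_D[OF X.c_D X.c_neq_one] C.mu_pow[OF pZ(2), of p] C.mu_pow[OF pZ(1), of "p ^ 2"] r
      by (simp add: nat_pow_pow power2_eq_square power3_eq_cube mult.assoc)
  qed
  fix \<mu> assume mu: "\<mu> \<in> central_chars G"
  interpret C: phi2_char G p 5 \<mu> using mu by unfold_locales
  show "gives_required_pair p G \<mu> [(\<alpha> [^] p, \<mu> (\<alpha> [^] p)), (\<alpha>\<^sub>1, \<omega>)]"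
    if prim: "primitive_root_of_unity (p^2) (\<mu> (\<alpha> [^] p))" and w: "\<omega> ^ p = \<mu> (\<alpha>\<^sub>1 [^] p)" for \<omega>
  proof (rule X.good_pair_facts(1)[OF mu])
    have "\<mu> (\<alpha> [^] p) ^ p \<noteq> 1"
      using prim X.p_gt1 by (simp add: primitive_root_of_unity_def power2_eq_square)
    moreover have "\<omega> ^ (p ^ 2) = 1" using root[OF mu] by (simp add: w[symmetric] power2_eq_square power_mult)
    ultimately obtain j where "\<omega> = \<mu> (\<alpha> [^] p) ^ j" using root_is_power_prime_square[OF p(1)] root[OF mu] by metis
    hence wj: "\<omega> = \<mu> ((\<alpha> [^] p) [^] j)" using pZ by (simp add: C.mu_pow)
    show "X.good_pair \<mu> [(\<alpha> [^] p, \<mu> (\<alpha> [^] p)), (\<alpha>\<^sub>1, \<omega>)]"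
      unfolding X.good_pair_def
    proof (intro exI conjI)
      show "(\<alpha>\<^sub>1, \<mu> ((\<alpha> [^] p) [^] j)) \<in> set [(\<alpha> [^] p, \<mu> (\<alpha> [^] p)), (\<alpha>\<^sub>1, \<omega>)]" using wj by simp
      have "{\<alpha> [^] p, \<alpha>\<^sub>1 [^] p} \<subseteq> generate G {\<alpha> [^] p, \<alpha>\<^sub>1}"
        using generate_pow[of "\<alpha>\<^sub>1" "{\<alpha> [^] p, \<alpha>\<^sub>1}" p] by (auto intro: generate.incl)
      thus "center_of G \<subseteq> generate G (fst ` set [(\<alpha> [^] p, \<mu> (\<alpha> [^] p)), (\<alpha>\<^sub>1, \<omega>)])"
        unfolding Z by (simp add: generate_subgroup_incl generate_is_subgroup)
    qed (use X.b_notin_Z pZ w wj in auto)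
  qed
  show "\<exists>i<p. \<mu> (\<alpha> [^] p) = \<mu> (\<alpha>\<^sub>1 [^] p) ^ i" if "\<not> primitive_root_of_unity (p^2) (\<mu> (\<alpha> [^] p))"
    using primitive_root_prime_square[OF p(1), of "\<mu> (\<alpha> [^] p)"] that root[OF mu] root_is_power_prime[OF p(1)] by metis
  show "gives_required_pair p G \<mu> [(\<alpha> \<otimes> \<alpha>\<^sub>1 [^] (- int i), 1), (\<alpha>\<^sub>1 [^] p, \<mu> (\<alpha>\<^sub>1 [^] p))]"
    if i: "\<mu> (\<alpha> [^] p) = \<mu> (\<alpha>\<^sub>1 [^] p) ^ i" for i
    by (rule X.good_pair_facts(1)[OF mu], rule X.good_pair_a_mult_inv_pow_b[OF p(2) mu i Z]) (use pZ in auto)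
qed

text \<open>Both \<alpha>^p and \<open>\<alpha>\<^sub>1 ^ p\<close> take p-th roots of unity as
  values. If the second value is 1, \<open>\<alpha>\<^sub>1\<close> itself serves; if not, it is a
  primitive root, the first value is a power of it, and a mixed generator serves.\<close>

lemma Phi2_221d:
  assumes P: "Phi2_pres G [\<alpha>, \<alpha>\<^sub>1, \<alpha>\<^sub>2] (rels_221d p)"
  shows "center_of G = generate G {\<alpha> [^] p, \<alpha>\<^sub>1 [^] p, \<alpha>\<^sub>2}" "commutator_subgroup G = generate G {\<alpha>\<^sub>2}"
    and "\<And>\<mu>. \<mu> \<in> central_chars G \<Longrightarrow> \<mu> (\<alpha>\<^sub>1 [^] p) = 1 \<Longrightarrow>
      gives_required_pair p G \<mu> [(\<alpha> [^] p, \<mu> (\<alpha> [^] p)), (\<alpha>\<^sub>1, 1), (\<alpha>\<^sub>2, \<mu> \<alpha>\<^sub>2)]"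
    and "\<And>\<mu>. \<mu> \<in> central_chars G \<Longrightarrow> \<mu> (\<alpha>\<^sub>1 [^] p) \<noteq> 1 \<Longrightarrow> \<exists>i<p. \<mu> (\<alpha> [^] p) = \<mu> (\<alpha>\<^sub>1 [^] p) ^ i"
    and "\<And>\<mu> i. \<mu> \<in> central_chars G \<Longrightarrow> \<mu> (\<alpha> [^] p) = \<mu> (\<alpha>\<^sub>1 [^] p) ^ i \<Longrightarrow>
      gives_required_pair p G \<mu> [(\<alpha> \<otimes> \<alpha>\<^sub>1 [^] (- int i), 1), (\<alpha>\<^sub>1 [^] p, \<mu> (\<alpha>\<^sub>1 [^] p)), (\<alpha>\<^sub>2, \<mu> \<alpha>\<^sub>2)]"
proof -
  have r: "commutator G \<alpha>\<^sub>1 \<alpha> = \<alpha>\<^sub>2" "\<alpha> [^] (p ^ 2) = \<one>" "\<alpha>\<^sub>1 [^] (p ^ 2) = \<one>" "\<alpha>\<^sub>2 [^] p = \<one>"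
    using Phi2_pres_rels[OF P] by (simp_all add: rels_221d_def)
  interpret X: phi2_gens G p 5 \<alpha> "\<alpha>\<^sub>1" "\<alpha>\<^sub>2" "{\<alpha>\<^sub>2}"
    using phi2_gens_of_pres[OF p(1) ord fam P, of "\<alpha>\<^sub>2"] r by simp
  note pZ = X.pow_p_central[OF X.aG] X.pow_p_central[OF X.bG]
  have cZ: "\<alpha>\<^sub>2 \<in> center_of G" using X.S_Z by simp
  show Z: "center_of G = generate G {\<alpha> [^] p, \<alpha>\<^sub>1 [^] p, \<alpha>\<^sub>2}" unfolding X.center_gen by (simp add: insert_commute)
  show "commutator_subgroup G = generate G {\<alpha>\<^sub>2}" by (rule X.derived_gen)
  fix \<mu> assume mu: "\<mu> \<in> central_chars G"
  interpret C: phi2_char G p 5 \<mu> using mu by unfold_locales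
  show "gives_required_pair p G \<mu> [(\<alpha> [^] p, \<mu> (\<alpha> [^] p)), (\<alpha>\<^sub>1, 1), (\<alpha>\<^sub>2, \<mu> \<alpha>\<^sub>2)]"
    if w: "\<mu> (\<alpha>\<^sub>1 [^] p) = 1"
  proof (rule X.good_pair_facts(1)[OF mu], rule X.good_pair_simple[OF mu X.bG X.b_notin_Z w])
    let ?B = "{\<alpha> [^] p, \<alpha>\<^sub>1, \<alpha>\<^sub>2}"
    have B: "?B \<subseteq> carrier G" using cZ by simp
    have "{\<alpha> [^] p, \<alpha>\<^sub>1 [^] p, \<alpha>\<^sub>2} \<subseteq> generate G ?B"
      using generate_pow[OF _ B, of "\<alpha>\<^sub>1" p] by (auto intro: generate.incl)
    thus "center_of G \<subseteq> generate G (fst ` set [(\<alpha> [^] p, \<mu> (\<alpha> [^] p)), (\<alpha>\<^sub>1, 1), (\<alpha>\<^sub>2, \<mu> \<alpha>\<^sub>2)])"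
      unfolding Z using generate_subgroup_incl[OF _ generate_is_subgroup[OF B]] by simp
  qed (use pZ cZ in auto)
  have root: "\<mu> (\<alpha>\<^sub>1 [^] p) ^ p = 1" "\<mu> (\<alpha> [^] p) ^ p = 1"
    using C.mu_pow[OF pZ(2), of p] C.mu_pow[OF pZ(1), of p] r by (simp_all add: nat_pow_pow power2_eq_square)
  show "\<exists>i<p. \<mu> (\<alpha> [^] p) = \<mu> (\<alpha>\<^sub>1 [^] p) ^ i" if "\<mu> (\<alpha>\<^sub>1 [^] p) \<noteq> 1"
    by (rule root_is_power_prime[OF p(1) root(1) that root(2)])
  show "gives_required_pair p G \<mu> [(\<alpha> \<otimes> \<alpha>\<^sub>1 [^] (- int i), 1), (\<alpha>\<^sub>1 [^] p, \<mu> (\<alpha>\<^sub>1 [^] p)), (\<alpha>\<^sub>2, \<mu> \<alpha>\<^sub>2)]"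
    if i: "\<mu> (\<alpha> [^] p) = \<mu> (\<alpha>\<^sub>1 [^] p) ^ i" for i
    by (rule X.good_pair_facts(1)[OF mu], rule X.good_pair_a_mult_inv_pow_b[OF p(2) mu i Z]) (use pZ cZ in auto)
qed

end

theorem theorem7:
  fixes p :: nat and G :: "('a, 'b) monoid_scheme"
  assumes "prime p" and "odd p"
    and "group G" and "order G = p ^ 5" and "in_Phi2 p G"
  shows
    "(\<forall>\<alpha> \<alpha>\<^sub>1 \<alpha>\<^sub>2 \<gamma>. Phi2_pres G [\<alpha>, \<alpha>\<^sub>1, \<alpha>\<^sub>2, \<gamma>] (rels_311a p) \<longrightarrow>
       center_of G = generate G {\<alpha> [^]\<^bsub>G\<^esub> p, \<gamma>} \<and> commutator_subgroup G = generate G {\<alpha> [^]\<^bsub>G\<^esub> (p^2)} \<and>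
       determines_rational_reps p G (\<lambda>\<mu>. {[(\<alpha> [^]\<^bsub>G\<^esub> p, \<mu> (\<alpha> [^]\<^bsub>G\<^esub> p)), (\<alpha>\<^sub>1, 1), (\<gamma>, \<mu> \<gamma>)]})) \<and>
     (\<forall>\<alpha> \<alpha>\<^sub>1 \<alpha>\<^sub>2 \<gamma>. Phi2_pres G [\<alpha>, \<alpha>\<^sub>1, \<alpha>\<^sub>2, \<gamma>] (rels_221a p) \<longrightarrow>
       center_of G = generate G {\<alpha> [^]\<^bsub>G\<^esub> p, \<alpha>\<^sub>1 [^]\<^bsub>G\<^esub> p, \<gamma>} \<and> commutator_subgroup G = generate G {\<alpha> [^]\<^bsub>G\<^esub> p} \<and>
       determines_rational_reps p G (\<lambda>\<mu>. {[(\<alpha> [^]\<^bsub>G\<^esub> (- int i) \<otimes>\<^bsub>G\<^esub> \<alpha>\<^sub>1, 1), (\<alpha> [^]\<^bsub>G\<^esub> p, \<mu> (\<alpha> [^]\<^bsub>G\<^esub> p)), (\<gamma>, \<mu> \<gamma>)]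
         | i. i < p \<and> \<mu> (\<alpha>\<^sub>1 [^]\<^bsub>G\<^esub> p) = (\<mu> (\<alpha> [^]\<^bsub>G\<^esub> p)) ^ i})) \<and>
     (\<forall>\<alpha> \<alpha>\<^sub>1 \<alpha>\<^sub>2 \<gamma>. Phi2_pres G [\<alpha>, \<alpha>\<^sub>1, \<alpha>\<^sub>2, \<gamma>] (rels_221b p) \<longrightarrow>
       center_of G = generate G {\<alpha> [^]\<^bsub>G\<^esub> p, \<gamma>} \<and> commutator_subgroup G = generate G {\<alpha> [^]\<^bsub>G\<^esub> p} \<and>
       determines_rational_reps p G (\<lambda>\<mu>. {[(\<alpha> [^]\<^bsub>G\<^esub> p, \<mu> (\<alpha> [^]\<^bsub>G\<^esub> p)), (\<alpha>\<^sub>1, 1), (\<gamma>, \<mu> \<gamma>)]})) \<and>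
     (\<forall>\<alpha> \<alpha>\<^sub>1 \<alpha>\<^sub>2 \<gamma> \<delta>. Phi2_pres G [\<alpha>, \<alpha>\<^sub>1, \<alpha>\<^sub>2, \<gamma>, \<delta>] (rels_2111a p) \<longrightarrow>
       center_of G = generate G {\<alpha> [^]\<^bsub>G\<^esub> p, \<gamma>, \<delta>} \<and> commutator_subgroup G = generate G {\<alpha> [^]\<^bsub>G\<^esub> p} \<and>
       determines_rational_reps p G (\<lambda>\<mu>. {[(\<alpha> [^]\<^bsub>G\<^esub> p, \<mu> (\<alpha> [^]\<^bsub>G\<^esub> p)), (\<alpha>\<^sub>1, 1), (\<gamma>, \<mu> \<gamma>), (\<delta>, \<mu> \<delta>)]})) \<and>
     (\<forall>\<alpha> \<alpha>\<^sub>1 \<alpha>\<^sub>2 \<gamma> \<delta>. Phi2_pres G [\<alpha>, \<alpha>\<^sub>1, \<alpha>\<^sub>2, \<gamma>, \<delta>] (rels_2111b p) \<longrightarrow>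
       center_of G = generate G {\<gamma>, \<delta>} \<and> commutator_subgroup G = generate G {\<gamma> [^]\<^bsub>G\<^esub> p} \<and>
       determines_rational_reps p G (\<lambda>\<mu>. {[(\<alpha>, 1), (\<gamma>, \<mu> \<gamma>), (\<delta>, \<mu> \<delta>)]})) \<and>
     (\<forall>\<alpha> \<alpha>\<^sub>1 \<alpha>\<^sub>2 \<gamma>. Phi2_pres G [\<alpha>, \<alpha>\<^sub>1, \<alpha>\<^sub>2, \<gamma>] (rels_2111c p) \<longrightarrow>
       center_of G = generate G {\<alpha> [^]\<^bsub>G\<^esub> p, \<alpha>\<^sub>2, \<gamma>} \<and> commutator_subgroup G = generate G {\<alpha>\<^sub>2} \<and>
       determines_rational_reps p G (\<lambda>\<mu>. {[(\<alpha> [^]\<^bsub>G\<^esub> p, \<mu> (\<alpha> [^]\<^bsub>G\<^esub> p)), (\<alpha>\<^sub>1, 1), (\<alpha>\<^sub>2, \<mu> \<alpha>\<^sub>2), (\<gamma>, \<mu> \<gamma>)]})) \<and>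
     (\<forall>\<alpha> \<alpha>\<^sub>1 \<alpha>\<^sub>2 \<gamma>. Phi2_pres G [\<alpha>, \<alpha>\<^sub>1, \<alpha>\<^sub>2, \<gamma>] (rels_2111d p) \<longrightarrow>
       center_of G = generate G {\<alpha>\<^sub>2, \<gamma>} \<and> commutator_subgroup G = generate G {\<alpha>\<^sub>2} \<and>
       determines_rational_reps p G (\<lambda>\<mu>. {[(\<alpha>\<^sub>1, 1), (\<alpha>\<^sub>2, \<mu> \<alpha>\<^sub>2), (\<gamma>, \<mu> \<gamma>)]})) \<and>
     (\<forall>\<alpha> \<alpha>\<^sub>1 \<alpha>\<^sub>2 \<gamma> \<delta>. Phi2_pres G [\<alpha>, \<alpha>\<^sub>1, \<alpha>\<^sub>2, \<gamma>, \<delta>] (rels_11111 p) \<longrightarrow>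
       center_of G = generate G {\<alpha>\<^sub>2, \<gamma>, \<delta>} \<and> commutator_subgroup G = generate G {\<alpha>\<^sub>2} \<and>
       determines_rational_reps p G (\<lambda>\<mu>. {[(\<alpha>\<^sub>1, 1), (\<alpha>\<^sub>2, \<mu> \<alpha>\<^sub>2), (\<gamma>, \<mu> \<gamma>), (\<delta>, \<mu> \<delta>)]})) \<and>
     (\<forall>\<alpha> \<alpha>\<^sub>1 \<alpha>\<^sub>2. Phi2_pres G [\<alpha>, \<alpha>\<^sub>1, \<alpha>\<^sub>2] (rels_41 p) \<longrightarrow>
       center_of G = generate G {\<alpha> [^]\<^bsub>G\<^esub> p} \<and> commutator_subgroup G = generate G {\<alpha> [^]\<^bsub>G\<^esub> (p^3)} \<and>
       determines_rational_reps p G (\<lambda>\<mu>. {[(\<alpha> [^]\<^bsub>G\<^esub> p, \<mu> (\<alpha> [^]\<^bsub>G\<^esub> p)), (\<alpha>\<^sub>1, 1)]})) \<and>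
     (\<forall>\<alpha> \<alpha>\<^sub>1 \<alpha>\<^sub>2. Phi2_pres G [\<alpha>, \<alpha>\<^sub>1, \<alpha>\<^sub>2] (rels_32a1 p) \<longrightarrow>
       center_of G = generate G {\<alpha> [^]\<^bsub>G\<^esub> p, \<alpha>\<^sub>1 [^]\<^bsub>G\<^esub> p} \<and> commutator_subgroup G = generate G {\<alpha> [^]\<^bsub>G\<^esub> (p^2)} \<and>
       determines_rational_reps p G (\<lambda>\<mu>. {[(\<alpha> [^]\<^bsub>G\<^esub> p, \<mu> (\<alpha> [^]\<^bsub>G\<^esub> p)), (\<alpha>\<^sub>1, \<omega>)] | \<omega>. \<omega> ^ p = \<mu> (\<alpha>\<^sub>1 [^]\<^bsub>G\<^esub> p)})) \<and>
     (\<forall>\<alpha> \<alpha>\<^sub>1 \<alpha>\<^sub>2 \<gamma>. Phi2_pres G [\<alpha>, \<alpha>\<^sub>1, \<alpha>\<^sub>2, \<gamma>] (rels_311b p) \<longrightarrow>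
       center_of G = generate G {\<gamma>} \<and> commutator_subgroup G = generate G {\<gamma> [^]\<^bsub>G\<^esub> (p^2)} \<and>
       determines_rational_reps p G (\<lambda>\<mu>. {[(\<alpha>, 1), (\<gamma>, \<mu> \<gamma>)]})) \<and>
     (\<forall>\<alpha> \<alpha>\<^sub>1 \<alpha>\<^sub>2. Phi2_pres G [\<alpha>, \<alpha>\<^sub>1, \<alpha>\<^sub>2] (rels_311c p) \<longrightarrow>
       center_of G = generate G {\<alpha> [^]\<^bsub>G\<^esub> p, \<alpha>\<^sub>2} \<and> commutator_subgroup G = generate G {\<alpha>\<^sub>2} \<and>
       determines_rational_reps p G (\<lambda>\<mu>. {[(\<alpha> [^]\<^bsub>G\<^esub> p, \<mu> (\<alpha> [^]\<^bsub>G\<^esub> p)), (\<alpha>\<^sub>1, 1), (\<alpha>\<^sub>2, \<mu> \<alpha>\<^sub>2)]})) \<and>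
     (\<forall>\<alpha> \<alpha>\<^sub>1 \<alpha>\<^sub>2 \<gamma>. Phi2_pres G [\<alpha>, \<alpha>\<^sub>1, \<alpha>\<^sub>2, \<gamma>] (rels_221c p) \<longrightarrow>
       center_of G = generate G {\<alpha> [^]\<^bsub>G\<^esub> p, \<gamma>} \<and> commutator_subgroup G = generate G {\<gamma> [^]\<^bsub>G\<^esub> p} \<and>
       determines_rational_reps p G (\<lambda>\<mu>. {[(\<alpha> [^]\<^bsub>G\<^esub> p, \<mu> (\<alpha> [^]\<^bsub>G\<^esub> p)), (\<alpha>\<^sub>1, 1), (\<gamma>, \<mu> \<gamma>)]})) \<and>
     (\<forall>\<alpha> \<alpha>\<^sub>1 \<alpha>\<^sub>2. Phi2_pres G [\<alpha>, \<alpha>\<^sub>1, \<alpha>\<^sub>2] (rels_32a2 p) \<longrightarrow>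
       center_of G = generate G {\<alpha> [^]\<^bsub>G\<^esub> p, \<alpha>\<^sub>1 [^]\<^bsub>G\<^esub> p} \<and> commutator_subgroup G = generate G {\<alpha>\<^sub>1 [^]\<^bsub>G\<^esub> p} \<and>
       (\<forall>\<mu> \<in> central_chars G. \<forall>\<zeta> \<zeta>' k.
          primitive_root_of_unity p \<zeta> \<and> primitive_root_of_unity (p^2) \<zeta>' \<and> k < p^2 \<and>
          \<mu> (\<alpha>\<^sub>1 [^]\<^bsub>G\<^esub> p) = \<zeta> \<and> \<mu> (\<alpha> [^]\<^bsub>G\<^esub> p) = \<zeta>' ^ k \<longrightarrow>
          (primitive_root_of_unity (p^2) (\<mu> (\<alpha> [^]\<^bsub>G\<^esub> p)) \<longrightarrow>
             (\<forall>\<omega>. \<omega> ^ p = \<mu> (\<alpha>\<^sub>1 [^]\<^bsub>G\<^esub> p) \<longrightarrow>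
                gives_required_pair p G \<mu> [(\<alpha> [^]\<^bsub>G\<^esub> p, \<mu> (\<alpha> [^]\<^bsub>G\<^esub> p)), (\<alpha>\<^sub>1, \<omega>)])) \<and>
          (\<not> primitive_root_of_unity (p^2) (\<mu> (\<alpha> [^]\<^bsub>G\<^esub> p)) \<longrightarrow>
             (\<exists>i < p. \<mu> (\<alpha> [^]\<^bsub>G\<^esub> p) = \<zeta> ^ i) \<and>
             (\<forall>i < p. \<mu> (\<alpha> [^]\<^bsub>G\<^esub> p) = \<zeta> ^ i \<longrightarrow>
                gives_required_pair p G \<mu> [(\<alpha> \<otimes>\<^bsub>G\<^esub> \<alpha>\<^sub>1 [^]\<^bsub>G\<^esub> (- int i), 1), (\<alpha>\<^sub>1 [^]\<^bsub>G\<^esub> p, \<mu> (\<alpha>\<^sub>1 [^]\<^bsub>G\<^esub> p))])))) \<and>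
     (\<forall>\<alpha> \<alpha>\<^sub>1 \<alpha>\<^sub>2. Phi2_pres G [\<alpha>, \<alpha>\<^sub>1, \<alpha>\<^sub>2] (rels_221d p) \<longrightarrow>
       center_of G = generate G {\<alpha> [^]\<^bsub>G\<^esub> p, \<alpha>\<^sub>1 [^]\<^bsub>G\<^esub> p, \<alpha>\<^sub>2} \<and> commutator_subgroup G = generate G {\<alpha>\<^sub>2} \<and>
       (\<forall>\<mu> \<in> central_chars G.
          (\<mu> (\<alpha>\<^sub>1 [^]\<^bsub>G\<^esub> p) = 1 \<longrightarrow>
             gives_required_pair p G \<mu> [(\<alpha> [^]\<^bsub>G\<^esub> p, \<mu> (\<alpha> [^]\<^bsub>G\<^esub> p)), (\<alpha>\<^sub>1, 1), (\<alpha>\<^sub>2, \<mu> \<alpha>\<^sub>2)]) \<and>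
          (\<mu> (\<alpha>\<^sub>1 [^]\<^bsub>G\<^esub> p) \<noteq> 1 \<longrightarrow>
             (\<exists>i < p. \<mu> (\<alpha> [^]\<^bsub>G\<^esub> p) = \<mu> (\<alpha>\<^sub>1 [^]\<^bsub>G\<^esub> p) ^ i) \<and>
             (\<forall>i < p. \<mu> (\<alpha> [^]\<^bsub>G\<^esub> p) = \<mu> (\<alpha>\<^sub>1 [^]\<^bsub>G\<^esub> p) ^ i \<longrightarrow>
                gives_required_pair p G \<mu> [(\<alpha> \<otimes>\<^bsub>G\<^esub> \<alpha>\<^sub>1 [^]\<^bsub>G\<^esub> (- int i), 1), (\<alpha>\<^sub>1 [^]\<^bsub>G\<^esub> p, \<mu> (\<alpha>\<^sub>1 [^]\<^bsub>G\<^esub> p)), (\<alpha>\<^sub>2, \<mu> \<alpha>\<^sub>2)]))))"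
proof -
  interpret F: phi2_family G p by (intro phi2_family.intro phi2_family_axioms.intro assms)
  show ?thesis
    by (rule conjI, intro allI impI, erule F.Phi2_311a,
        rule conjI, intro allI impI, erule F.Phi2_221a,
        rule conjI, intro allI impI, erule F.Phi2_221b,
        rule conjI, intro allI impI, erule F.Phi2_2111a,
        rule conjI, intro allI impI, erule F.Phi2_2111b,
        rule conjI, intro allI impI, erule F.Phi2_2111c,
        rule conjI, intro allI impI, erule F.Phi2_2111d,
        rule conjI, intro allI impI, erule F.Phi2_11111,
        rule conjI, intro allI impI, erule F.Phi2_41,
        rule conjI, intro allI impI, erule F.Phi2_32a1,
        rule conjI, intro allI impI, erule F.Phi2_311b,
        rule conjI, intro allI impI, erule F.Phi2_311c,
        rule conjI, intro allI impI, erule F.Phi2_221c,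
        rule conjI,
        \<comment> \<open>The substitution replaces the named p-th root of unity by the value of
          \<mu> at \<open>\<alpha>\<^sub>1 ^ p\<close>, the form used in the lemma.\<close>
        (intro allI impI conjI ballI; (elim conjE, hypsubst)?; rule F.Phi2_32a2; assumption),
        intro allI impI conjI ballI; rule F.Phi2_221d; assumption)
qed

end
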